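(* Let $n\ge3$ and $1\le k\le n-2$. Then $$e_k^\perp\left(\langle\mathcal{E}_{n,n}, e_n\rangle|_{\mathrm{hooks}}\right)=\sum_{\gamma \in T_{n,0}}\Big( s_{\mathrm{hook}(\underline{e_{k+}^\perp}(\gamma))}+s_{\mathrm{hook}(\underline{e_{k-}^\perp}(\gamma))}\Big).$$ In addition, $$\sum_{\tau\in \mathrm{SYT}(k+1,1^{n-k-1})}\ \sum_{\gamma \in T_{n,\mathrm{des}(\tau')}} s_{\mathrm{hook}(\gamma)}\;-\;e_k^\perp\left(\langle\mathcal{E}_{n,n}, s_{1^{n}}\rangle|_{\mathrm{hooks}}\right)$$ has a Schur positive expansion (nonnegative integer coefficients in the Schur basis).
   Context: **Symmetric functions.** $\Lambda_Q$ and $\Lambda$ are the rings of symmetric functions in $Q=\{q_1,q_2,\dots\}$ and in $X=\{x_1,x_2,\dots\}$; $s_\lambda\otimes s_\mu$ means $s_\lambda(Q)s_\mu(X)$. For $F=\sum c_{\lambda,\mu}\,s_\lambda\otimes s_\mu$, $\langle F,s_\mu\rangle=\sum_\lambda c_{\lambda,\mu}s_\lambda\in\Lambda_Q$; $e_n=s_{1^n}$. For $f=\sum_\lambda c_\lambda s_\lambda$, $f|_{\mathrm{hooks}}$ is the sum of those $c_\lambda s_\lambda$ with $\lambda$ of the form $(a,1^m)$. $e_k^\perp$ is the adjoint of multiplication by $e_k$ for the Hall scalar product: $e_k^\perp s_\lambda$ is the sum of $s_\nu$ over partitions $\nu$ obtained from $\lambda$ by deleting $k$ boxes lying in distinct rows.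 **The character $\mathcal{E}_{n,n}$.** Let $X=(x_{i,j})_{1\le i\le k,1\le j\le n}$, with $GL_k\times\mathbb{S}_n$ acting on $\mathbb{Q}[X]$ by $(\tau,\sigma).F(X)=F(\tau X\sigma)$. $\mathcal{E}_{n,n}^{\langle k\rangle}$ is the smallest $GL_k\times\mathbb{S}_n$-submodule of $\mathbb{Q}[X]$ containing the Vandermonde determinant $\prod_{i<j}(x_{1,i}-x_{1,j})$ and closed under all partial derivatives $\partial_{x_{s,j}}$ and all higher polarization operators $\sum_{j=1}^n x_{r,j}\partial_{x_{s,j}}^d$ ($1\le r,s\le k$, $d\ge1$). Its character $\sum_{d\in\mathbb{N}^k} q_1^{d_1}\cdots q_k^{d_k}\,\mathrm{Frob}(\mathcal{E}_{n,n;d}^{\langle k\rangle})(X)$ ($d$ the multidegree, $d_i$ = degree in row $i$; Frob the Frobenius characteristic) expands as $\sum c_{\lambda,\mu}s_\lambda(q_1,\dots,q_k)s_\mu(X)$ with $c_{\lambda,\mu}\in\mathbb{N}$ independent of $k$ for $\ell(\lambda)\le k$; one sets $\mathcal{E}_{n,n}=\sum c_{\lambda,\mu}\,s_\lambda\otimes s_\mu$. **Tableaux.** $\mathrm{SYT}(\mu)$ is the set of standard Young tableaux of shape $\mu$ in French notation (row 2 lies above row 1, entries increase along rows and up columns). $\mathrm{Des}(\tau)$ is the set of $i$ such that $i+1$ lies in a row strictly above that of $i$; $\mathrm{des}(\tau)=|\mathrm{Des}(\tau)|$, $\mathrm{maj}(\tau)=\sum_{i\in\mathrm{Des}(\tau)}i$;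 $\tau'$ is the transpose of $\tau$. A hook-shaped standard tableau is determined by its descent set; for $\tau\in\mathrm{SYT}(k+1,1^{n-k-1})$, $\mathrm{des}(\tau')=k$. **Paths.** Consider the staircase of unit boxes with bottom-left corner $(i,j)\in\mathbb{N}^2$, $i+j\le n-3$. For $0\le s\le n-2$, $T_{n,s}$ is the set of lattice paths with steps $N=(0,1)$, $E=(1,0)$ from $(0,s)$ to some point of $\{(x,y): x+y=n-2,\ x\ge0,\ y\ge s\}$. $\mathrm{ht}(\gamma)$ is the $y$-coordinate of the end point; $\mathrm{area}(\gamma)$ is the number of staircase boxes south-east of $\gamma$ (including all boxes in rows below height $s$): $\mathrm{area}(\gamma)=\sum_{j=0}^{s-1}(n-2-j)+\sum(n-2-y-x)$, the last sum over the north steps $(x,y)\to(x,y+1)$. Paths in unions or sums over $\tau$ carry the tableau $\tau$ along; for $\gamma\in T_{n,\mathrm{des}(\tau')}$ associated to $\tau$, $\mathrm{hook}(\gamma)=(\mathrm{area}(\gamma)+\mathrm{ht}(\gamma)-\mathrm{maj}(\tau')+1,1^{n-2-\mathrm{ht}(\gamma)})$. **The maps.** Let $T_n^m=\{\gamma\in T_{n,0}: n-2-\mathrm{ht}(\gamma)\ge m\}$ (paths with at least $m$ east steps). For $\gamma\in T_{n,0}$ let $p_i$ be the number of north steps before the $i$-th east step. - For $\gamma\in T_n^k$: $\underline{e_{k+}^\perp}(\gamma)$ is the path in $T_{n,k}$ obtained by deleting the first $k$ east steps of $\gamma$, with associated tableau $\tau\in\mathrm{SYT}(k+1,1^{n-k-1})$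 determined by $\mathrm{Des}(\tau')=\{n-i-p_i:1\le i\le k\}$. - For $\gamma\in T_n^{k-1}\setminus\{E^{n-2}\}$: let $h$ be the number of east steps before the first north step. $\underline{e_{k-}^\perp}(\gamma)$ is the path in $T_{n,k}$ obtained by deleting the first $k-1$ east steps and the first north step of $\gamma$, with associated tableau $\tau\in\mathrm{SYT}(k+1,1^{n-k-1})$ determined by $\mathrm{Des}(\tau')=\{n-i-p_i:1\le i\le k-1\}\cup\{\max(1,h-k+2)\}$. - Elsewhere on $T_{n,0}$ the maps take the value $\emptyset$, and $s_{\mathrm{hook}(\emptyset)}=0$. *)

theory Defs
  imports
    Complex_Main
    "HOL-Library.Poly_Mapping"
    "HOL-Library.Function_Algebras"
    "HOL-Library.Multiset"
    "HOL-Combinatorics.Permutations"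
    "HOL-Combinatorics.Orbits"
    "Jordan_Normal_Form.Matrix"
begin

section \<open>Partitions, diagrams and tableaux\<close>

text \<open>Cells are pairs (row, column), counted from 0; row 0 is the bottom row (French notation).
  A tableau is a function on all cells that vanishes outside its diagram.\<close>

type_synonym tableau = "nat \<times> nat \<Rightarrow> nat"

definition is_partition :: "nat list \<Rightarrow> bool" where
  "is_partition \<nu> \<longleftrightarrow> sorted_wrt (\<ge>) \<nu> \<and> 0 \<notin> set \<nu>"

definition is_hook :: "nat list \<Rightarrow> bool" where
  "is_hook \<nu> \<longleftrightarrow> (\<exists>a m. a \<ge> 1 \<and> \<nu> = a # replicate m 1)"

definition diagram :: "nat list \<Rightarrow> (nat \<times> nat) set" where
  "diagram \<nu> = {(r, c). r < length \<nu> \<and> c < \<nu> ! r}"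

definition SSYT :: "nat list \<Rightarrow> tableau set" where
  "SSYT \<nu> = {T.
     (\<forall>x. x \<notin> diagram \<nu> \<longrightarrow> T x = 0) \<and>
     (\<forall>r c c'. c < c' \<and> (r, c') \<in> diagram \<nu> \<longrightarrow> T (r, c) \<le> T (r, c')) \<and>
     (\<forall>r r' c. r < r' \<and> (r', c) \<in> diagram \<nu> \<longrightarrow> T (r, c) < T (r', c))}"

definition SYT :: "nat list \<Rightarrow> tableau set" where
  "SYT \<mu> = {\<tau>.
     (\<forall>x. x \<notin> diagram \<mu> \<longrightarrow> \<tau> x = 0) \<and>
     bij_betw \<tau> (diagram \<mu>) {1..sum_list \<mu>} \<and>
     (\<forall>r c c'. c < c' \<and> (r, c') \<in> diagram \<mu> \<longrightarrow> \<tau> (r, c) < \<tau> (r, c')) \<and>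
     (\<forall>r r' c. r < r' \<and> (r', c) \<in> diagram \<mu> \<longrightarrow> \<tau> (r, c) < \<tau> (r', c))}"

definition tab_transpose :: "tableau \<Rightarrow> tableau" where
  "tab_transpose \<tau> = (\<lambda>(r, c). \<tau> (c, r))"

definition Des :: "tableau \<Rightarrow> nat set" where
  "Des \<tau> = {i. i \<ge> 1 \<and> (\<exists>r c r' c'. \<tau> (r, c) = i \<and> \<tau> (r', c') = i + 1 \<and> r < r')}"

definition des :: "tableau \<Rightarrow> nat" where
  "des \<tau> = card (Des \<tau>)"

definition maj :: "tableau \<Rightarrow> nat" where
  "maj \<tau> = \<Sum> (Des \<tau>)"


section \<open>Symmetric functions\<close>

text \<open>A formal power series in countably many variables (numbered from 0) is given by its
  coefficient function on monomials. Addition and subtraction of series are the pointwise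
  ones; multiplication is \<open>series_mult\<close> (not the pointwise product).\<close>

type_synonym monomial = "nat \<Rightarrow>\<^sub>0 nat"
type_synonym series = "monomial \<Rightarrow> rat"

definition mon_degree :: "monomial \<Rightarrow> nat" where
  "mon_degree m = (\<Sum>v\<in>Poly_Mapping.keys m. Poly_Mapping.lookup m v)"

definition series_mult :: "series \<Rightarrow> series \<Rightarrow> series" where
  "series_mult f g = (\<lambda>m. \<Sum>(a, b) | a + b = m. f a * g b)"

definition series_one :: series where
  "series_one = (\<lambda>m. if m = 0 then 1 else 0)"

definition symmetric_functions :: "series set" where
  "symmetric_functions = {f.
     (\<forall>\<pi> m. bij \<pi> \<longrightarrow> f (Poly_Mapping.map_key \<pi> m) = f m) \<and>
     (\<exists>D. \<forall>m. mon_degree m > D \<longrightarrow> f m = 0)}"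

text \<open>The coefficient of a monomial in a Schur function is the number of semistandard tableaux
  with that content. Setting all variables but the first \<open>k\<close> to 0 amounts to looking only at
  the monomials in these variables.\<close>

definition schur :: "nat list \<Rightarrow> series" where
  "schur \<nu> = (\<lambda>m. of_nat (card {T \<in> SSYT \<nu>.
     \<forall>v. card {x \<in> diagram \<nu>. T x = v} = Poly_Mapping.lookup m v}))"

definition elementary :: "nat \<Rightarrow> series" where
  "elementary k = schur (replicate k 1)"

definition schur_series :: "(nat list \<Rightarrow> rat) \<Rightarrow> series" where
  "schur_series c = (\<lambda>m. \<Sum>\<nu> | c \<nu> \<noteq> 0. c \<nu> * schur \<nu> m)"

definition is_schur_expansion :: "series \<Rightarrow> (nat list \<Rightarrow> rat) \<Rightarrow> bool" where
  "is_schur_expansion f c \<longleftrightarrow>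
     finite {\<nu>. c \<nu> \<noteq> 0} \<and> (\<forall>\<nu>. c \<nu> \<noteq> 0 \<longrightarrow> is_partition \<nu>) \<and> f = schur_series c"

definition schur_coeff :: "series \<Rightarrow> nat list \<Rightarrow> rat" where
  "schur_coeff f = (THE c. is_schur_expansion f c)"

definition schur_positive :: "series \<Rightarrow> bool" where
  "schur_positive f \<longleftrightarrow> (\<exists>c :: nat list \<Rightarrow> nat. is_schur_expansion f (\<lambda>\<nu>. of_nat (c \<nu>)))"

definition hook_part :: "series \<Rightarrow> series" where
  "hook_part f = schur_series (\<lambda>\<nu>. if is_hook \<nu> then schur_coeff f \<nu> else 0)"

text \<open>The Hall scalar product: Schur functions are orthonormal.\<close>

definition hall :: "series \<Rightarrow> series \<Rightarrow> rat" where
  "hall f g = (\<Sum>\<nu> | schur_coeff f \<nu> \<noteq> 0. schur_coeff f \<nu> * schur_coeff g \<nu>)"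

definition e_perp :: "nat \<Rightarrow> series \<Rightarrow> series" where
  "e_perp k f = (THE g. g \<in> symmetric_functions \<and>
     (\<forall>h\<in>symmetric_functions. hall g h = hall f (series_mult (elementary k) h)))"

text \<open>Series in the two alphabets \<open>Q\<close> (first argument) and \<open>X\<close> (second argument).\<close>

type_synonym series2 = "monomial \<Rightarrow> monomial \<Rightarrow> rat"

definition schur_series2 :: "(nat list \<Rightarrow> nat list \<Rightarrow> rat) \<Rightarrow> series2" where
  "schur_series2 c = (\<lambda>q x. \<Sum>(\<nu>, \<mu>) | c \<nu> \<mu> \<noteq> 0. c \<nu> \<mu> * schur \<nu> q * schur \<mu> x)"

definition partition_supported2 :: "(nat list \<Rightarrow> nat list \<Rightarrow> rat) \<Rightarrow> bool" where
  "partition_supported2 c \<longleftrightarrow> finite {(\<nu>, \<mu>). c \<nu> \<mu> \<noteq> 0} \<and>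
     (\<forall>\<nu> \<mu>. c \<nu> \<mu> \<noteq> 0 \<longrightarrow> is_partition \<nu> \<and> is_partition \<mu>)"

definition schur_coeff2 :: "series2 \<Rightarrow> nat list \<Rightarrow> nat list \<Rightarrow> rat" where
  "schur_coeff2 F = (THE c. partition_supported2 c \<and> F = schur_series2 c)"

text \<open>The linear extension in \<open>g\<close> of \<open>\<langle>F, s\<^sub>\<mu>\<rangle> = (\<Sum>\<nu>. c \<nu> \<mu> s\<^sub>\<nu>)\<close>.\<close>

definition pairing :: "series2 \<Rightarrow> series \<Rightarrow> series" where
  "pairing F g = schur_series
     (\<lambda>\<nu>. \<Sum>\<mu> | schur_coeff2 F \<nu> \<mu> \<noteq> 0. schur_coeff2 F \<nu> \<mu> * hall (schur \<mu>) g)"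


section \<open>Polynomials in the variables \<open>x\<^sub>i\<^sub>j\<close>\<close>

text \<open>The variable \<open>x\<^sub>i\<^sub>j\<close> is the pair \<open>(i, j)\<close>; rows and columns are counted from 0.\<close>

type_synonym mpoly = "(nat \<times> nat \<Rightarrow>\<^sub>0 nat) \<Rightarrow>\<^sub>0 rat"

definition Const :: "rat \<Rightarrow> mpoly" where
  "Const a = Poly_Mapping.single 0 a"

definition Var :: "nat \<times> nat \<Rightarrow> mpoly" where
  "Var v = Poly_Mapping.single (Poly_Mapping.single v 1) 1"

global_interpretation mpoly: vector_space "\<lambda>a p. Const a * p"
  by standard (simp_all add: Const_def algebra_simps mult_single single_add
      flip: mult.assoc)

definition poly_ring :: "nat \<Rightarrow> nat \<Rightarrow> mpoly set" where
  "poly_ring k n = {p. \<forall>m\<in>Poly_Mapping.keys p. Poly_Mapping.keys m \<subseteq> {..<k} \<times> {..<n}}"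

definition substitute :: "(nat \<times> nat \<Rightarrow> mpoly) \<Rightarrow> mpoly \<Rightarrow> mpoly" where
  "substitute f p = (\<Sum>m\<in>Poly_Mapping.keys p. Const (Poly_Mapping.lookup p m) *
     (\<Prod>v\<in>Poly_Mapping.keys m. f v ^ Poly_Mapping.lookup m v))"

definition partial_deriv :: "nat \<times> nat \<Rightarrow> mpoly \<Rightarrow> mpoly" where
  "partial_deriv v p = (\<Sum>m\<in>Poly_Mapping.keys p.
     Poly_Mapping.single (m - Poly_Mapping.single v 1)
       (of_nat (Poly_Mapping.lookup m v) * Poly_Mapping.lookup p m))"

definition polarization :: "nat \<Rightarrow> nat \<Rightarrow> nat \<Rightarrow> nat \<Rightarrow> mpoly \<Rightarrow> mpoly" where
  "polarization n r s d p = (\<Sum>j<n. Var (r, j) * (partial_deriv (s, j) ^^ d) p)"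

text \<open>\<open>F(X) \<mapsto> F(A X \<sigma>)\<close>, where the permutation matrix of \<open>\<sigma>\<close> has the entry 1 at the
  positions \<open>(\<sigma> j, j)\<close>.\<close>

definition gl_sym_act :: "nat \<Rightarrow> rat mat \<Rightarrow> (nat \<Rightarrow> nat) \<Rightarrow> mpoly \<Rightarrow> mpoly" where
  "gl_sym_act k A \<sigma> = substitute (\<lambda>(i, j). \<Sum>a<k. Const (A $$ (i, a)) * Var (a, \<sigma> j))"

definition vandermonde :: "nat \<Rightarrow> mpoly" where
  "vandermonde n = (\<Prod>(i, j) | i < j \<and> j < n. Var (0, i) - Var (0, j))"

definition is_polarization_module :: "nat \<Rightarrow> nat \<Rightarrow> mpoly set \<Rightarrow> bool" where
  "is_polarization_module k n W \<longleftrightarrow>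
     W \<subseteq> poly_ring k n \<and> mpoly.subspace W \<and>
     (\<forall>A \<sigma>. \<forall>p\<in>W. A \<in> carrier_mat k k \<and> invertible_mat A \<and> \<sigma> permutes {..<n}
        \<longrightarrow> gl_sym_act k A \<sigma> p \<in> W) \<and>
     vandermonde n \<in> W \<and>
     (\<forall>s<k. \<forall>j<n. \<forall>p\<in>W. partial_deriv (s, j) p \<in> W) \<and>
     (\<forall>r<k. \<forall>s<k. \<forall>d\<ge>1. \<forall>p\<in>W. polarization n r s d p \<in> W)"

definition E_module :: "nat \<Rightarrow> nat \<Rightarrow> mpoly set" where
  "E_module k n = \<Inter> {W. is_polarization_module k n W}"

definition multidegree_part :: "nat \<Rightarrow> nat \<Rightarrow> monomial \<Rightarrow> mpoly set \<Rightarrow> mpoly set" where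
  "multidegree_part k n d W = {p \<in> W. \<forall>m\<in>Poly_Mapping.keys p. \<forall>i<k.
     (\<Sum>j<n. Poly_Mapping.lookup m (i, j)) = Poly_Mapping.lookup d i}"


section \<open>Frobenius characteristic and the character\<close>

text \<open>Trace of a linear endomorphism of a finite-dimensional space \<open>V\<close>, in an arbitrary basis.\<close>

definition trace_on :: "mpoly set \<Rightarrow> (mpoly \<Rightarrow> mpoly) \<Rightarrow> rat" where
  "trace_on V f = (let B = (SOME B. mpoly.independent B \<and> mpoly.span B = V)
     in \<Sum>b\<in>B. mpoly.representation B (f b) b)"

definition cycle_type :: "nat \<Rightarrow> (nat \<Rightarrow> nat) \<Rightarrow> nat list" where
  "cycle_type n \<sigma> =
     rev (sorted_list_of_multiset (image_mset card (mset_set (orbit \<sigma> ` {..<n}))))"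

definition power_sum :: "nat \<Rightarrow> series" where
  "power_sum r = (\<lambda>m. if \<exists>v. m = Poly_Mapping.single v r then 1 else 0)"

definition power_sum_partition :: "nat list \<Rightarrow> series" where
  "power_sum_partition \<rho> = foldr (\<lambda>r f. series_mult (power_sum r) f) \<rho> series_one"

text \<open>\<open>S\<^sub>n\<close> acts through the identity of \<open>GL\<^sub>k\<close>.\<close>

definition Frob :: "nat \<Rightarrow> nat \<Rightarrow> mpoly set \<Rightarrow> series" where
  "Frob k n V = (\<lambda>x. (\<Sum>\<sigma> | \<sigma> permutes {..<n}.
     trace_on V (gl_sym_act k (1\<^sub>m k) \<sigma>) * power_sum_partition (cycle_type n \<sigma>) x) / fact n)"

text \<open>Coefficient of \<open>q\<^sup>d x\<close> in the character of the module, a series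
  in \<open>q\<close>-variables with index below \<open>k\<close>.\<close>

definition E_character :: "nat \<Rightarrow> nat \<Rightarrow> series2" where
  "E_character k n = (\<lambda>d x. if Poly_Mapping.keys d \<subseteq> {..<k}
     then Frob k n (multidegree_part k n d (E_module k n)) x else 0)"

text \<open>The coefficients common to all \<open>k\<close>. Only monomials in the first \<open>k\<close> variables of \<open>Q\<close> are
  compared, that is, \<open>s\<^sub>\<nu>\<close> is evaluated at \<open>q\<^sub>1, \<dots>, q\<^sub>k\<close>; it vanishes there if \<open>\<nu>\<close> has more than
  \<open>k\<close> parts, so that these \<open>\<nu>\<close> do not contribute.\<close>

definition E_coeff :: "nat \<Rightarrow> nat list \<Rightarrow> nat list \<Rightarrow> rat" where
  "E_coeff n = (THE c. partition_supported2 c \<and>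
     (\<forall>k\<ge>1. \<forall>d x. Poly_Mapping.keys d \<subseteq> {..<k} \<longrightarrow> E_character k n d x = schur_series2 c d x))"

definition E_function :: "nat \<Rightarrow> series2" where
  "E_function n = schur_series2 (E_coeff n)"


section \<open>Lattice paths\<close>

datatype step = North | East

type_synonym path = "step list"

text \<open>A path is the list of its steps; its starting point \<open>(0, s)\<close> is a separate parameter, and
  \<open>path_point s \<gamma> i\<close> is the point reached after \<open>i\<close> steps.\<close>

definition path_point :: "nat \<Rightarrow> path \<Rightarrow> nat \<Rightarrow> nat \<times> nat" where
  "path_point s \<gamma> i = (count_list (take i \<gamma>) East, s + count_list (take i \<gamma>) North)"

definition paths :: "nat \<Rightarrow> nat \<Rightarrow> path set" where
  "paths n s = {\<gamma>. case path_point s \<gamma> (length \<gamma>) of (x, y) \<Rightarrow> x + y = n - 2 \<and> y \<ge> s}"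

definition height :: "nat \<Rightarrow> path \<Rightarrow> nat" where
  "height s \<gamma> = snd (path_point s \<gamma> (length \<gamma>))"

definition area :: "nat \<Rightarrow> nat \<Rightarrow> path \<Rightarrow> nat" where
  "area n s \<gamma> = (\<Sum>j<s. n - 2 - j) +
     (\<Sum>i | i < length \<gamma> \<and> \<gamma> ! i = North. case path_point s \<gamma> i of (x, y) \<Rightarrow> n - 2 - y - x)"

text \<open>The path associated with \<open>\<tau>\<close> starts at height \<open>des \<tau>'\<close>. The first part is positive in
  all cases that occur, so the truncated subtraction is harmless.\<close>

definition path_hook :: "nat \<Rightarrow> tableau \<Rightarrow> path \<Rightarrow> nat list" where
  "path_hook n \<tau> \<gamma> = (let \<tau>' = tab_transpose \<tau>; s = des \<tau>' in
     (area n s \<gamma> + height s \<gamma> + 1 - maj \<tau>') # replicate (n - 2 - height s \<gamma>) 1)"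

definition hook_shape :: "nat \<Rightarrow> nat \<Rightarrow> nat list" where
  "hook_shape n k = (k + 1) # replicate (n - k - 1) 1"

definition hook_tableau :: "nat \<Rightarrow> nat \<Rightarrow> nat set \<Rightarrow> tableau" where
  "hook_tableau n k D = (THE \<tau>. \<tau> \<in> SYT (hook_shape n k) \<and> Des (tab_transpose \<tau>) = D)"

definition paths_with_east :: "nat \<Rightarrow> nat \<Rightarrow> path set" where
  "paths_with_east n m = {\<gamma> \<in> paths n 0. n - 2 - height 0 \<gamma> \<ge> m}"

text \<open>\<open>norths_before \<gamma> i\<close> is the number of north steps before the \<open>i\<close>-th east step
  (\<open>i\<close> counted from 1).\<close>

definition norths_before :: "path \<Rightarrow> nat \<Rightarrow> nat" where
  "norths_before \<gamma> i =
     count_list (take (filter (\<lambda>j. \<gamma> ! j = East) [0..<length \<gamma>] ! (i - 1)) \<gamma>) North"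

definition delete_first :: "step \<Rightarrow> nat \<Rightarrow> path \<Rightarrow> path" where
  "delete_first a m \<gamma> = (remove1 a ^^ m) \<gamma>"

text \<open>\<open>None\<close> stands for the value \<open>\<emptyset>\<close>. In the second map, \<open>h + 2 - k\<close> is \<open>max 0 (h - k + 2)\<close>,
  which has the same maximum with 1 as \<open>h - k + 2\<close>.\<close>

definition e_perp_plus :: "nat \<Rightarrow> nat \<Rightarrow> path \<Rightarrow> (tableau \<times> path) option" where
  "e_perp_plus n k \<gamma> =
     (if \<gamma> \<in> paths_with_east n k
      then Some (hook_tableau n k ((\<lambda>i. n - i - norths_before \<gamma> i) ` {1..k}),
                 delete_first East k \<gamma>)
      else None)"

definition e_perp_minus :: "nat \<Rightarrow> nat \<Rightarrow> path \<Rightarrow> (tableau \<times> path) option" where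
  "e_perp_minus n k \<gamma> =
     (if \<gamma> \<in> paths_with_east n (k - 1) - {replicate (n - 2) East}
      then let h = length (takeWhile (\<lambda>a. a = East) \<gamma>) in
        Some (hook_tableau n k
                ((\<lambda>i. n - i - norths_before \<gamma> i) ` {1..k - 1} \<union> {max 1 (h + 2 - k)}),
              delete_first North 1 (delete_first East (k - 1) \<gamma>))
      else None)"

definition hook_schur :: "nat \<Rightarrow> (tableau \<times> path) option \<Rightarrow> series" where
  "hook_schur n z = (case z of None \<Rightarrow> 0 | Some (\<tau>, \<gamma>) \<Rightarrow> schur (path_hook n \<tau> \<gamma>))"

end

theory Submission
  imports Defs "HOL-Computational_Algebra.Polynomial"
begin

text \<open>The multiplicity space of \<open>e\<^sub>n\<close> in the module consists of the alternating elements. In every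
  multidegree they are spanned by the images of the Vandermonde determinant under products of
  polarizations from row 0, because symmetrized derivatives kill the determinant. The coefficient of the
  hook \<open>(a, 1\<^sup>m)\<close> is read off from the specialization that keeps one even variable \<open>q\<close> and one odd
  variable: there a Schur function vanishes unless its shape is a hook, and the value of the
  character is the number of alternants of degree \<open>a\<close> in row 0 that are linear and antisymmetric in
  \<open>m\<close> further rows. These have a basis indexed by sets \<open>I \<subseteq> {1..<n}\<close> of derivative orders, so
  the hooks correspond to subsets of \<open>{2..<n}\<close>, that is, to lattice paths. Pieri's rule for hooks gives two
  terms for every path, which are the values of the two maps; these maps are injective with disjoint
  images, which leaves a sum of Schur functions over the remaining pairs.\<close>

text \<open>All series have commuting variables, so the odd variable is simulated: with
  \<open>N\<close> equal variables each coefficient in question is a polynomial in \<open>N\<close>,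
  and its value at -1 stands for one odd variable. The substitution respects products, so Pieri's
  rule on hooks, the extraction of e_n from a Frobenius characteristic and the extraction of hooks
  in \<open>Q\<close> come from one computation. It does not see single hooks: h_a e_m is the sum of
  the Schur functions of (a,1^m) and (a+1,1^(m-1)), and only such pair sums are measured. Induction
  on the leg separates them; for the basis the same separation is whether 1 belongs to
  \<open>I\<close>, which is why {1..<n} shrinks to {2..<n}. The hook of a subset J has leg |J| and
  first part n(n-1)/2 minus the sum of J. Injectivity of the two maps rests on the tableau: its
  descents remember where the deleted steps stood.\<close>

abbreviation "lookup \<equiv> Poly_Mapping.lookup"
abbreviation "single \<equiv> Poly_Mapping.single"
abbreviation "keys \<equiv> Poly_Mapping.keys"
abbreviation "map_key \<equiv> Poly_Mapping.map_key"
abbreviation "pd \<equiv> partial_deriv"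
abbreviation "pol \<equiv> polarization"
abbreviation "vdm \<equiv> vandermonde"
abbreviation "Sym \<equiv> symmetric_functions"
abbreviation "sbst \<equiv> substitute"

section \<open>Schur functions\<close>

definition part :: "nat list => nat => nat" where
 "part v r = (if r < length v then v ! r else 0)"

text \<open>Shapes are padded with zeros to functions, so that interlacing is a pointwise condition
  and list lengths do not have to be tracked; \<open>L\<close> is an upper bound for the number of
  nonzero rows.\<close>

definition is_shape :: "nat => (nat => nat) => bool" where
 "is_shape L la \<longleftrightarrow> (\<forall>i. la (Suc i) \<le> la i) & (\<forall>i\<ge>L. la i = 0)"

definition boxes :: "(nat => nat) => (nat \<times> nat) set" where
 "boxes la = {(r, c). c < la r}"

definition ssize :: "nat => (nat => nat) => nat" where
 "ssize L la = (\<Sum>i<L. la i)"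

text \<open>For shapes this says that \<open>la / ka\<close> is a horizontal strip: no two boxes of
  the difference lie in one column.\<close>

definition intl :: "(nat => nat) => (nat => nat) => bool" where
 "intl ka la \<longleftrightarrow> (\<forall>i. la (Suc i) \<le> ka i & ka i \<le> la i)"

text \<open>Gelfand-Tsetlin patterns with top row \<open>la\<close> and weight \<open>m\<close>;
  dropping the top row corresponds to removing all entries \<open>N\<close> from a tableau. The
  recursion can be manipulated row by row, which both the symmetry of Schur functions and their
  specialization exploit.\<close>

fun gt_patterns :: "nat => nat => (nat => nat) => (nat => nat) => nat" where
 "gt_patterns L 0 m la = (if la = (%_. 0) then 1 else 0)"
| "gt_patterns L (Suc N) m la =
   (\<Sum>ka | intl ka la & ssize L ka + m N = ssize L la. gt_patterns L N m ka)"

definition bounded_tableaux :: "nat => (nat => nat) => (nat => nat) => tableau set" where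
 "bounded_tableaux N m la = {T.
   (\<forall>x. x \<notin> boxes la --> T x = 0) &
   (\<forall>r c c'. c < c' & (r, c') \<in> boxes la --> T (r, c) \<le> T (r, c')) &
   (\<forall>r r' c. r < r' & (r', c) \<in> boxes la --> T (r, c) < T (r', c)) &
   (\<forall>x\<in>boxes la. T x < N) &
   (\<forall>v<N. card {x \<in> boxes la. T x = v} = m v)}"

lemma is_shape_antimono: "is_shape L la ==> i \<le> j ==> la j \<le> la i"
 unfolding is_shape_def by (metis lift_Suc_antimono_le)

lemma intl_is_shape: "is_shape L la ==> intl ka la ==> is_shape L ka"
 unfolding is_shape_def intl_def by (metis le_trans le_zero_eq)

lemma finite_intl:
 assumes "is_shape L la" shows "finite {ka. intl ka la}"
proof (rule finite_subset)
 show "{ka. intl ka la} \<subseteq> {f. \<forall>x. (x \<in> {..<L} --> f x \<in> {..la 0}) & (x \<notin> {..<L} --> f x = 0)}"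
 proof (intro subsetI CollectI allI conjI impI)
  fix ka x assume "ka \<in> {ka. intl ka la}"
  then have i: "intl ka la" by simp
  have "ka x \<le> la x" "la x \<le> la 0"
   using i is_shape_antimono[OF assms, of 0 x] by (auto simp: intl_def)
  then show "ka x \<in> {..la 0}" by simp
  show "ka x = 0" if "x \<notin> {..<L}"
   using intl_is_shape[OF assms i] that by (auto simp: is_shape_def)
 qed
 show "finite {f. \<forall>x. (x \<in> {..<L} --> f x \<in> {..la 0}) & (x \<notin> {..<L} --> f x = (0::nat))}"
  by (rule finite_set_of_finite_funs) auto
qed

lemma finite_boxes: "is_shape L la ==> finite (boxes la)"
proof (rule finite_subset)
 assume s: "is_shape L la"
 show "boxes la \<subseteq> {..<L} \<times> {..<la 0}"
 proof
  fix x assume "x \<in> boxes la"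
  then obtain r c where x: "x = (r, c)" "c < la r" by (auto simp: boxes_def)
  then have "r < L" using s unfolding is_shape_def by (metis linorder_not_less not_less0)
  moreover have "la r \<le> la 0" using is_shape_antimono[OF s] by simp
  ultimately show "x \<in> {..<L} \<times> {..<la 0}" using x by simp
 qed
qed auto

lemma card_boxes: assumes "is_shape L la" shows "card (boxes la) = ssize L la"
proof -
 have "boxes la = (SIGMA r:{..<L}. {..<la r})"
  using assms unfolding boxes_def is_shape_def by (auto, metis linorder_not_less not_less0)
 then show ?thesis by (simp add: ssize_def)
qed

lemma intl_boxes: "intl ka la ==> boxes ka \<subseteq> boxes la"
 unfolding intl_def boxes_def by (auto intro: less_le_trans)

lemma ssize_mono: "intl ka la ==> ssize L ka \<le> ssize L la"
 unfolding intl_def ssize_def by (auto intro: sum_mono)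

lemma down_closed_eq_lessThan:
 fixes S :: "nat set"
 assumes "finite S" "!!x y. x \<in> S ==> y < x ==> y \<in> S"
 shows "S = {..<card S}"
proof (cases "S = {}")
 case False
 have "S = {..Max S}"
  using assms Max_in[OF assms(1) False] Max_ge[OF assms(1)] by (auto, metis nat_less_le)
 then show ?thesis by (metis card_atMost lessThan_Suc_atMost)
qed simp

text \<open>The entries \<open>N\<close> fill a horizontal strip, because columns increase strictly;
  what remains is a tableau of shape \<open>kap T\<close>. \<open>F\<close> cuts the strip off and
  \<open>G\<close> fills it in again.\<close>

lemma bounded_tableaux_Suc:
 assumes s: "is_shape L la"
 shows "card (bounded_tableaux (Suc N) m la) =
  (\<Sum>ka | intl ka la & ssize L ka + m N = ssize L la. card (bounded_tableaux N m ka))"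
proof -
 define K where "K = {ka. intl ka la & ssize L ka + m N = ssize L la}"
 have finK: "finite K" unfolding K_def by (rule finite_subset[OF _ finite_intl[OF s]]) auto
 define kap where "kap T r = card {c. c < la r & T (r, c) < N}" for T :: tableau and r
 define F where "F T = (kap T, %x. if x \<in> boxes (kap T) then T x else 0)" for T :: tableau
 define G where "G p = (%x. if x \<in> boxes (fst p) then snd p x else if x \<in> boxes la then N else (0::nat))"
  for p :: "(nat => nat) \<times> tableau"
 have fb: "finite (boxes la)" by (rule finite_boxes[OF s])
 have kapD: "{c. c < la r & T (r, c) < N} = {..<kap T r}" if T: "T \<in> bounded_tableaux (Suc N) m la" for T r
  unfolding kap_def
 proof (rule down_closed_eq_lessThan)
  fix x y assume xy: "x \<in> {c. c < la r & T (r, c) < N}" "y < x"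
  then have "T (r, y) \<le> T (r, x)" using T unfolding bounded_tableaux_def boxes_def by simp
  with xy show "y \<in> {c. c < la r & T (r, c) < N}" by simp
 qed auto
 have kap_iff: "c < kap T r \<longleftrightarrow> c < la r & T (r, c) < N" if "T \<in> bounded_tableaux (Suc N) m la" for T r c
  using kapD[OF that, of r] by blast
 have F: "F T \<in> (SIGMA ka:K. bounded_tableaux N m ka)" "G (F T) = T"
  if T: "T \<in> bounded_tableaux (Suc N) m la" for T
 proof -
  note kap = kap_iff[OF T]
  have TN: "T x < Suc N" if "x \<in> boxes la" for x using T that unfolding bounded_tableaux_def by blast
  have il: "intl (kap T) la" unfolding intl_def
  proof (intro allI conjI)
   fix i
   show "kap T i \<le> la i" using kap by (metis linorder_not_less nat_less_le)
   \<comment> \<open>A box of row \<open>i + 1\<close> in column \<open>kap T i\<close> would force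
     the box below it to have an entry less than \<open>N\<close>, hence to belong to
     \<open>kap T\<close>.\<close>
   show "la (Suc i) \<le> kap T i"
   proof (rule ccontr)
    assume "\<not> la (Suc i) \<le> kap T i"
    then have lt: "kap T i < la (Suc i)" by simp
    then have "(Suc i, kap T i) \<in> boxes la" by (simp add: boxes_def)
    then have "T (i, kap T i) < T (Suc i, kap T i)" "T (Suc i, kap T i) < Suc N"
     using T unfolding bounded_tableaux_def by blast+
    then have "T (i, kap T i) < N" by simp
    moreover have "kap T i < la i" using lt s unfolding is_shape_def by (meson less_le_trans)
    ultimately show False using kap by blast
   qed
  qed
  note sk = intl_is_shape[OF s il]
  have un: "boxes la = boxes (kap T) \<union> {x \<in> boxes la. T x = N}"
   using kap TN by (auto simp: boxes_def less_Suc_eq)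
  have "card (boxes la) = card (boxes (kap T)) + card {x \<in> boxes la. T x = N}"
   by (subst un, rule card_Un_disjoint) (use fb finite_boxes[OF sk] kap in "auto simp: boxes_def")
  moreover have "card {x \<in> boxes la. T x = N} = m N" using T unfolding bounded_tableaux_def by blast
  ultimately have K: "kap T \<in> K" using il s sk by (simp add: K_def card_boxes)
  have bs: "boxes (kap T) \<subseteq> boxes la" by (rule intl_boxes[OF il])
  have "(%x. if x \<in> boxes (kap T) then T x else 0) \<in> bounded_tableaux N m (kap T)"
   unfolding bounded_tableaux_def
  proof (safe, goal_cases)
   case (2 r c c')
   then have "(r, c) \<in> boxes (kap T)" "(r, c') \<in> boxes la" using bs by (auto simp: boxes_def)
   then show ?case using 2 T unfolding bounded_tableaux_def by simp
  next
   case (3 r r' c)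
   then have "(r, c) \<in> boxes (kap T)" "(r', c) \<in> boxes la"
    using bs is_shape_antimono[OF sk, of r r'] by (auto simp: boxes_def)
   then show ?case using 3 T unfolding bounded_tableaux_def by simp
  next
   case (4 r c) then show ?case using kap by (simp add: boxes_def)
  next
   case (5 v)
   have "{x \<in> boxes (kap T). (if x \<in> boxes (kap T) then T x else 0) = v} = {x \<in> boxes la. T x = v}"
    using bs 5 kap by (auto simp: boxes_def)
   then show ?case using 5 T unfolding bounded_tableaux_def by simp
  qed simp
  with K show "F T \<in> (SIGMA ka:K. bounded_tableaux N m ka)" by (simp add: F_def)
  show "G (F T) = T"
  proof
   fix x show "G (F T) x = T x"
   proof (cases "x \<in> boxes la")
    case True then show ?thesis using un by (auto simp: G_def F_def)
   next
    case False
    moreover have "T x = 0" using T False unfolding bounded_tableaux_def by blast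
    ultimately show ?thesis using bs by (auto simp: G_def F_def)
   qed
  qed
 qed
 have G: "G p \<in> bounded_tableaux (Suc N) m la" "F (G p) = p"
  if p: "p \<in> (SIGMA ka:K. bounded_tableaux N m ka)" for p
 proof -
  obtain ka T where p': "p = (ka, T)" "ka \<in> K" "T \<in> bounded_tableaux N m ka" using p by auto
  have il: "intl ka la" using p' by (simp add: K_def)
  have sz: "ssize L ka + m N = ssize L la" using p' by (simp add: K_def)
  note sk = intl_is_shape[OF s il] and bs = intl_boxes[OF il]
  have TN: "T x < N" if "x \<in> boxes ka" for x using p' that unfolding bounded_tableaux_def by blast
  show GT: "G p \<in> bounded_tableaux (Suc N) m la"
   unfolding bounded_tableaux_def
  proof (safe, goal_cases)
   case (1 r c) then show ?case using bs by (auto simp: G_def p')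
  next
   case (2 r c c')
   have "T (r, c) \<le> T (r, c')" if "(r, c') \<in> boxes ka"
    using that 2 p' unfolding bounded_tableaux_def by blast
   then show ?case using 2 TN[of "(r,c)"] by (auto simp: G_def p' boxes_def)
  next
   case (3 r r' c)
   have lt: "T (r, c) < T (r', c)" if "(r', c) \<in> boxes ka"
    using that 3 p' unfolding bounded_tableaux_def by blast
   have "c < la (Suc r)" using 3 is_shape_antimono[OF s, of "Suc r" r'] by (auto simp: boxes_def)
   then have "c < ka r" using il unfolding intl_def by (meson less_le_trans)
   then have rc: "(r, c) \<in> boxes ka" by (simp add: boxes_def)
   then show ?case using 3 lt TN[OF rc] by (auto simp: G_def p')
  next
   case (4 r c) then show ?case using TN[of "(r,c)"] by (auto simp: G_def p')
  next
   case (5 v)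
   show ?case
   proof (cases "v = N")
    case True
    have "{x \<in> boxes la. G p x = v} = boxes la - boxes ka"
     using TN True by (auto simp: G_def p')
    then show ?thesis using True sz fb finite_boxes[OF sk] bs
     by (simp add: card_Diff_subset card_boxes[OF s] card_boxes[OF sk])
   next
    case False
    then have "{x \<in> boxes la. G p x = v} = {x \<in> boxes ka. T x = v}"
     using bs by (auto simp: G_def p')
    then show ?thesis using 5 False p' unfolding bounded_tableaux_def by simp
   qed
  qed
  have "kap (G p) r = ka r" for r
  proof -
   have "{c. c < la r & G p (r, c) < N} = {..<ka r}"
    using TN bs by (auto simp: G_def p' boxes_def split: if_splits)
   then show ?thesis by (simp add: kap_def)
  qed
  then have kk: "kap (G p) = ka" by auto
  moreover have "(%x. if x \<in> boxes ka then G p x else 0) = T"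
   using p' unfolding bounded_tableaux_def by (auto simp: G_def fun_eq_iff)
  ultimately show "F (G p) = p" unfolding F_def p'(1) by simp
 qed
 have "bij_betw F (bounded_tableaux (Suc N) m la) (SIGMA ka:K. bounded_tableaux N m ka)"
  by (intro bij_betw_byWitness[where f' = G] ballI image_subsetI F G)
 then have "card (bounded_tableaux (Suc N) m la) = card (SIGMA ka:K. bounded_tableaux N m ka)"
  by (rule bij_betw_same_card)
 moreover have "finite (bounded_tableaux N m ka)" if "ka \<in> K" for ka
 proof (rule finite_subset)
  have "is_shape L ka" using that intl_is_shape[OF s] by (simp add: K_def)
  then show "finite {f. \<forall>x. (x \<in> boxes ka --> f x \<in> {..N}) & (x \<notin> boxes ka --> f x = (0::nat))}"
   by (intro finite_set_of_finite_funs finite_boxes) auto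
 qed (force simp: bounded_tableaux_def)
 ultimately show ?thesis using finK by (simp add: K_def)
qed

lemma card_bounded_tableaux:
 "is_shape L la ==> card (bounded_tableaux N m la) = gt_patterns L N m la"
proof (induction N arbitrary: la)
 case 0
 have "bounded_tableaux 0 m la = (if la = (%_. 0) then {%_. 0} else {})"
  by (auto simp: bounded_tableaux_def boxes_def fun_eq_iff)
 then show ?case by simp
next
 case (Suc N)
 then show ?case by (auto simp: bounded_tableaux_Suc[OF Suc.prems] intl_is_shape intro!: sum.cong)
qed

lemma boxes_part: "boxes (part v) = diagram v"
 by (auto simp: boxes_def part_def diagram_def split: if_splits)

lemma is_shape_part:
 assumes "is_partition v" "length v \<le> L" shows "is_shape L (part v)"
 using assms unfolding is_shape_def is_partition_def part_def
 by (auto simp: sorted_wrt_iff_nth_less)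

lemma ssize_part: "length v \<le> L ==> ssize L (part v) = sum_list v"
proof -
 assume a: "length v \<le> L"
 have "ssize L (part v) = (\<Sum>i<length v. part v i)" unfolding ssize_def
  by (rule sum.mono_neutral_right) (use a in "auto simp: part_def")
 also have "... = sum_list v" by (simp add: part_def sum_list_sum_nth atLeast0LessThan)
 finally show ?thesis .
qed

text \<open>The alphabet of \<open>schur\<close> is infinite, but an entry outside the support of
  \<open>m\<close> would have multiplicity 0 in a finite diagram, so bounding the entries by
  \<open>N\<close> loses no tableau. \<open>N\<close> and \<open>L\<close> are arbitrary bounds, so
  that several monomials can be compared with the same pattern count.\<close>

lemma schur_eq_gt_patterns:
 assumes "is_partition g" "length g \<le> L" "keys m \<subseteq> {..<N}"
 shows "schur g m = of_nat (gt_patterns L N (lookup m) (part g))"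
proof -
 have s: "is_shape L (part g)" by (rule is_shape_part[OF assms(1,2)])
 have fd: "finite (diagram g)" using finite_boxes[OF s] by (simp add: boxes_part)
 have "{T \<in> SSYT g. \<forall>v. card {x \<in> diagram g. T x = v} = lookup m v} =
  bounded_tableaux N (lookup m) (part g)" (is "?A = ?B")
 proof (intro equalityI subsetI)
  fix T assume T: "T \<in> ?A"
  have "T x < N" if "x \<in> diagram g" for x
  proof (rule ccontr)
   assume "\<not> T x < N"
   then have "lookup m (T x) = 0" using assms(3)
    by (meson in_keys_iff lessThan_iff subsetD)
   then have "card {y \<in> diagram g. T y = T x} = 0" using T by simp
   then have "{y \<in> diagram g. T y = T x} = {}" using fd by (simp add: card_eq_0_iff)
   then show False using that by blast
  qed
  with T show "T \<in> ?B" by (simp add: bounded_tableaux_def SSYT_def boxes_part)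
 next
  fix T assume T: "T \<in> ?B"
  have "card {x \<in> diagram g. T x = v} = lookup m v" for v
  proof (cases "v < N")
   case True then show ?thesis using T by (simp add: bounded_tableaux_def boxes_part)
  next
   case False
   then have "{x \<in> diagram g. T x = v} = {}" using T by (auto simp: bounded_tableaux_def boxes_part)
   moreover have "lookup m v = 0" using False assms(3)
    by (meson in_keys_iff lessThan_iff subsetD)
   ultimately show ?thesis by (metis card.empty)
  qed
  with T show "T \<in> ?A" by (simp add: bounded_tableaux_def SSYT_def boxes_part)
 qed
 then show ?thesis using card_bounded_tableaux[OF s] by (simp add: schur_def)
qed

lemma gt_patterns_cong: "(!!i. i < N ==> m i = m' i) ==> gt_patterns L N m la = gt_patterns L N m' la"
 by (induction N arbitrary: la) (auto intro!: sum.cong)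

text \<open>Bender-Knuth: given \<open>\<kappa> \<subset> \<rho> \<subset> \<lambda>\<close>, each part of \<open>\<rho>\<close> ranges over an interval
  determined by \<open>\<kappa>\<close> and \<open>\<lambda>\<close>; reflecting it in this interval exchanges the two strip sizes.\<close>

definition upper :: "(nat => nat) => (nat => nat) => nat => nat" where
 "upper ka la i = (case i of 0 => la 0 | Suc j => min (la (Suc j)) (ka j))"

definition reflect :: "(nat => nat) => (nat => nat) => (nat => nat) => nat => nat" where
 "reflect ka la rh i = max (ka i) (la (Suc i)) + upper ka la i - rh i"

lemma intl_between:
 assumes "intl rh la" "intl ka rh"
 shows "max (ka i) (la (Suc i)) \<le> rh i" "rh i \<le> upper ka la i"
 using assms unfolding intl_def upper_def by (auto split: nat.split)

lemma between_intl:
 assumes "!!i. max (ka i) (la (Suc i)) \<le> rh i" "!!i. rh i \<le> upper ka la i"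
 shows "intl rh la" "intl ka rh"
proof -
 have *: "rh i \<le> la i" "rh (Suc i) \<le> ka i" for i
  using assms(2)[of i] assms(2)[of "Suc i"] by (auto simp: upper_def split: nat.splits)
 show "intl rh la" "intl ka rh"
  using assms(1) * unfolding intl_def by auto
qed

lemma reflect:
 assumes "intl rh la" "intl ka rh"
 shows "intl (reflect ka la rh) la" "intl ka (reflect ka la rh)"
  "reflect ka la (reflect ka la rh) = rh"
proof -
 note b = intl_between[OF assms]
 have "max (ka i) (la (Suc i)) \<le> reflect ka la rh i" "reflect ka la rh i \<le> upper ka la i" for i
  using b[of i] unfolding reflect_def by linarith+
 from between_intl[OF this] show "intl (reflect ka la rh) la" "intl ka (reflect ka la rh)" .
 show "reflect ka la (reflect ka la rh) = rh"
 proof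
  fix i show "reflect ka la (reflect ka la rh) i = rh i"
   using b[of i] unfolding reflect_def by linarith
 qed
qed

text \<open>The interval of row \<open>i\<close> begins at the maximum of \<open>ka i\<close> and
  \<open>la (i+1)\<close>, and that of row \<open>i + 1\<close> ends at their minimum. Maximum and
  minimum add up to \<open>ka i + la (i+1)\<close>, so the ends of all intervals sum to |ka| + |la|;
  a row and its reflection together give the two ends of its interval.\<close>

lemma ssize_reflect:
 assumes s: "is_shape L la" and i: "intl rh la" "intl ka rh"
 shows "ssize L rh + ssize L (reflect ka la rh) = ssize L ka + ssize L la"
proof -
 have mm: "max a b + min b a = a + b" for a b :: nat by simp
 have L0: "la L = 0" using s by (simp add: is_shape_def)
 \<comment> \<open>The additional summand vanishes since \<open>la L = 0\<close>; it makes room for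
   the shift of the index.\<close>
 have up: "(\<Sum>i<L. upper ka la i) = (\<Sum>i<Suc L. upper ka la i)"
  using L0 by (cases L) (auto simp: upper_def)
 have "rh i + reflect ka la rh i = max (ka i) (la (Suc i)) + upper ka la i" for i
  using intl_between[OF i, of i] unfolding reflect_def by linarith
 then have "ssize L rh + ssize L (reflect ka la rh)
   = (\<Sum>i<L. max (ka i) (la (Suc i))) + (\<Sum>i<L. upper ka la i)"
  unfolding ssize_def by (simp flip: sum.distrib)
 also have "... = la 0 + (\<Sum>i<L. max (ka i) (la (Suc i)) + min (la (Suc i)) (ka i))"
  unfolding up by (subst sum.lessThan_Suc_shift) (simp add: upper_def sum.distrib)
 also have "... = la 0 + (\<Sum>i<L. ka i + la (Suc i))"
  unfolding mm ..
 also have "... = (\<Sum>i<L. ka i) + (\<Sum>i<Suc L. la i)"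
  by (subst sum.lessThan_Suc_shift) (simp add: sum.distrib)
 finally show ?thesis using L0 by (simp add: ssize_def)
qed

lemma gt_patterns_swap_top:
 assumes s: "is_shape L la" and m: "m' N = m (Suc N)" "m' (Suc N) = m N" "!!i. i < N ==> m' i = m i"
 shows "gt_patterns L (Suc (Suc N)) m' la = gt_patterns L (Suc (Suc N)) m la"
proof -
 define P where "P m = (SIGMA rh:{rh. intl rh la & ssize L rh + m (Suc N) = ssize L la}.
  {ka. intl ka rh & ssize L ka + m N = ssize L rh})" for m :: "nat => nat"
 have exp: "gt_patterns L (Suc (Suc N)) m la = (\<Sum>(rh, ka)\<in>P m. gt_patterns L N m ka)" for m
 proof -
  have "finite {rh. intl rh la & ssize L rh + m (Suc N) = ssize L la}"
   by (rule finite_subset[OF _ finite_intl[OF s]]) auto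
  moreover have "finite {ka. intl ka rh & ssize L ka + m N = ssize L rh}"
   if "intl rh la" for rh
   by (rule finite_subset[OF _ finite_intl[OF intl_is_shape[OF s that]]]) auto
  ultimately show ?thesis unfolding P_def by (simp add: sum.Sigma)
 qed
 define R where "R = (%(rh, ka). (reflect ka la rh, ka))"
 have R: "R p \<in> P m2" "R (R p) = p"
  if "p \<in> P m1" "m2 N = m1 (Suc N)" "m2 (Suc N) = m1 N" for p m1 m2
 proof -
  obtain rh ka where p: "p = (rh, ka)" by force
  then have i: "intl rh la" "intl ka rh" and
   sz: "ssize L rh + m1 (Suc N) = ssize L la" "ssize L ka + m1 N = ssize L rh"
   using that(1) by (auto simp: P_def)
  show "R p \<in> P m2" using reflect[OF i] ssize_reflect[OF s i] sz that(2,3)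
   by (auto simp: P_def R_def p)
  show "R (R p) = p" using reflect(3)[OF i] by (simp add: R_def p)
 qed
 have "(\<Sum>(rh, ka)\<in>P m'. gt_patterns L N m' ka) = (\<Sum>(rh, ka)\<in>P m. gt_patterns L N m ka)"
  by (rule sum.reindex_bij_witness[where i = R and j = R])
   (use R[of _ m' m] R[of _ m m'] m in "auto simp: R_def intro!: gt_patterns_cong")
 then show ?thesis by (simp only: exp)
qed

lemma gt_patterns_swap:
 "is_shape L la ==> Suc i < N ==> gt_patterns L N (m o transpose i (Suc i)) la = gt_patterns L N m la"
proof (induction N arbitrary: la)
 case (Suc N)
 show ?case
 proof (cases "Suc i = N")
  case True
  then obtain N' where "N = Suc N'" by blast
  with True have "i = N'" by simp
  show ?thesis unfolding \<open>N = Suc N'\<close> \<open>i = N'\<close>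
   by (rule gt_patterns_swap_top[OF Suc.prems(1)]) (simp_all add: transpose_def)
 next
  case False
  then have "(m o transpose i (Suc i)) N = m N" "Suc i < N" using Suc.prems by (auto simp: transpose_def)
  then show ?thesis using Suc.IH intl_is_shape[OF Suc.prems(1)]
   by (auto intro!: sum.cong)
 qed
qed simp

section \<open>Invariance under all bijections of the variables\<close>

lemma lookup_map_key: "inj p ==> lookup (map_key p m) i = lookup m (p i)"
 by (simp add: map_key.rep_eq)

lemma map_key_comp_bij:
 "bij f ==> bij g ==> map_key (f o g) m = map_key g (map_key f m)"
 by (rule poly_mapping_eqI) (simp add: lookup_map_key bij_is_inj bij_comp)

lemma bij_betw_extends_to_perm:
 fixes f :: "'a => 'a"
 assumes b: "bij_betw f K' K" and fK: "finite K" "finite K'"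
 obtains p where "p permutes (K \<union> K')" "!!x. x \<in> K' ==> p x = f x"
proof -
 have c: "card K' = card K" by (rule bij_betw_same_card[OF b])
 have "card ((K \<union> K') - K') = card ((K \<union> K') - K)"
  using fK c by (simp add: card_Diff_subset)
 then obtain g where g: "bij_betw g ((K \<union> K') - K') ((K \<union> K') - K)"
  using fK by (metis bij_betw_iff_card finite_Diff finite_UnI)
 define p where "p i = (if i \<in> K' then f i else if i \<in> K then g i else i)" for i
 have b1: "bij_betw p K' K" using b by (rule bij_betw_cong[THEN iffD1, rotated]) (simp add: p_def)
 have b2: "bij_betw p ((K \<union> K') - K') ((K \<union> K') - K)"
  using g by (rule bij_betw_cong[THEN iffD1, rotated]) (auto simp: p_def)
 have "bij_betw p (K' \<union> ((K \<union> K') - K')) (K \<union> ((K \<union> K') - K))"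
  by (rule bij_betw_combine[OF b1 b2]) auto
 moreover have "K' \<union> ((K \<union> K') - K') = K \<union> K'" "K \<union> ((K \<union> K') - K) = K \<union> K'" by auto
 ultimately have "bij_betw p (K \<union> K') (K \<union> K')" by simp
 then have "p permutes (K \<union> K')" by (rule bij_imp_permutes) (auto simp: p_def)
 then show ?thesis by (rule that) (simp add: p_def)
qed

text \<open>\<open>symmetric_functions\<close> asks for invariance under every bijection of the
  indices, whereas transpositions generate only the finitary permutations. On a single monomial the
  difference disappears, as only the finitely many preimages of its support matter.\<close>

lemma bij_agrees_with_perm:
 fixes g :: "nat => nat"
 assumes "bij g"
 obtains p S where "finite S" "p permutes S" "map_key p m = map_key g m"
proof -
 define K where "K = keys m"
 define K' where "K' = g -` K"
 have bK: "bij_betw g K' K" unfolding K'_def using assms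
  by (metis bij_betw_def bij_is_inj inj_on_subset subset_UNIV surj_image_vimage_eq bij_is_surj)
 have fK: "finite K" by (simp add: K_def)
 have fK': "finite K'" using bij_betw_finite[OF bK] fK by simp
 obtain p where perm: "p permutes (K \<union> K')" and pf: "!!x. x \<in> K' ==> p x = g x"
  using bij_betw_extends_to_perm[OF bK fK fK'] by metis
 have pK: "p ` K' = K" using bK pf by (auto simp: bij_betw_def)
 have "lookup m (p i) = lookup m (g i)" for i
 proof (cases "i \<in> K'")
  case False
  then have "g i \<notin> K" by (simp add: K'_def)
  moreover have "p i \<notin> K" using False pK permutes_inj[OF perm] by (metis imageE inj_eq)
  ultimately show ?thesis by (simp add: K_def in_keys_iff)
 qed (simp add: pf)
 then have "map_key p m = map_key g m"
  using permutes_inj[OF perm] bij_is_inj[OF assms] by (intro poly_mapping_eqI) (simp add: lookup_map_key)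
 with perm fK fK' show ?thesis using that[of "K \<union> K'" p] by simp
qed

lemma sym_if_transpos:
 fixes f :: "monomial => 'a"
 assumes "!!a b m. f (map_key (transpose a b) m) = f m" "bij g"
 shows "f (map_key g m) = f m"
proof -
 obtain p S where S: "finite S" "p permutes S" "map_key p m = map_key g m"
  using bij_agrees_with_perm[OF assms(2)] .
 have "\<forall>m. f (map_key p m) = f m" using S(2,1)
 proof (induction rule: permutes_induct)
  case id then show ?case by (simp add: id_def map_key_id)
 next
  case (swap a b p)
  then show ?case using assms(1) by (simp add: map_key_comp_bij permutes_bij del: comp_apply o_apply)
 qed
 with S(3) show ?thesis by metis
qed

lemma transposition_if_adjacent:
 fixes f :: "monomial => 'a"
 assumes adj: "!!a m. f (map_key (transpose a (Suc a)) m) = f m"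
 shows "f (map_key (transpose a b) m) = f m"
proof -
 have *: "f (map_key (transpose a (a + d)) m) = f m" for a d m
 proof (induction d arbitrary: m)
  case 0 then show ?case by (simp add: id_def map_key_id)
 next
  case (Suc d)
  show ?case
  proof (cases "d = 0")
   case True then show ?thesis using adj by simp
  next
   case False
   \<comment> \<open>Conjugation by an adjacent transposition increases the distance by one. It
     requires \<open>a\<close> and \<open>a + d\<close> to be different, hence the separate case
     \<open>d = 0\<close>.\<close>
   have "transpose a (a + Suc d) = (transpose (a + d) (Suc (a + d)) o transpose a (a + d)) o transpose (a + d) (Suc (a + d))"
    using False by (auto simp: fun_eq_iff transpose_def)
   then show ?thesis using adj Suc by (simp add: map_key_comp_bij bij_comp del: comp_apply o_apply)
  qed
 qed
 show ?thesis
 proof (cases "a \<le> b")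
  case True then show ?thesis using *[of a "b - a"] by simp
 next
  case False then show ?thesis using *[of b "a - b"] by (simp add: transpose_commute)
 qed
qed

lemma keys_bounded: obtains N where "keys (m :: nat \<Rightarrow>\<^sub>0 'a::zero) \<subseteq> {..<N}"
proof -
 have "finite (keys m)" by simp
 then obtain N where "\<forall>i\<in>keys m. i < N" using finite_nat_set_iff_bounded by metis
 then show ?thesis by (intro that[of N]) auto
qed

lemma schur_adjacent:
 assumes "is_partition v"
 shows "schur v (map_key (transpose a (Suc a)) m) = schur v m"
proof -
 obtain N0 where N0: "keys m \<subseteq> {..<N0}" by (rule keys_bounded)
 \<comment> \<open>Beyond \<open>a + 1\<close>, so that exchanging the two variables does not lead
   out of the range.\<close>
 define N where "N = max N0 (Suc (Suc a))"
 have N: "keys m \<subseteq> {..<N}" "Suc a < N" using N0 by (auto simp: N_def)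
 let ?m = "map_key (transpose a (Suc a)) m"
 have l: "lookup ?m = lookup m o transpose a (Suc a)"
  by (simp add: map_key.rep_eq)
 have "keys ?m \<subseteq> {..<N}"
 proof
  fix i assume "i \<in> keys ?m"
  then have "transpose a (Suc a) i \<in> keys m" by (simp add: in_keys_iff l)
  then have "transpose a (Suc a) i < N" using N(1) by blast
  then show "i \<in> {..<N}" using N(2) by (auto simp: transpose_def split: if_splits)
 qed
 then show ?thesis
  using gt_patterns_swap[OF is_shape_part[OF assms order_refl] N(2)] assms N
  by (simp add: schur_eq_gt_patterns[OF assms order_refl] l)
qed

section \<open>Dominance order and the basis of Schur functions\<close>

lemma mon_degree_eq: "keys m \<subseteq> {..<N} ==> mon_degree m = (\<Sum>v<N. lookup m v)"
 unfolding mon_degree_def by (rule sum.mono_neutral_left) (auto simp: in_keys_iff)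

lemma mon_degree_add: "mon_degree (a + b) = mon_degree a + mon_degree b"
proof -
 obtain N where "keys a \<subseteq> {..<N}" by (rule keys_bounded)
 moreover obtain N' where "keys b \<subseteq> {..<N'}" by (rule keys_bounded)
 moreover have "keys (a + b) \<subseteq> keys a \<union> keys b"
  by (rule Poly_Mapping.keys_add)
 ultimately have "keys a \<subseteq> {..<max N N'}" "keys b \<subseteq> {..<max N N'}"
  "keys (a + b) \<subseteq> {..<max N N'}" by force+
 then show ?thesis by (simp add: mon_degree_eq lookup_add sum.distrib)
qed

lemma gt_patterns_SucE:
 assumes "gt_patterns L (Suc N) m la ~= 0"
 obtains ka where "intl ka la" "ssize L ka + m N = ssize L la" "gt_patterns L N m ka ~= 0"
proof -
 from assms have "(\<Sum>ka | intl ka la & ssize L ka + m N = ssize L la. gt_patterns L N m ka) ~= 0"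
  by (simp only: gt_patterns.simps not_False_eq_True)
 then obtain ka where "ka \<in> {ka. intl ka la & ssize L ka + m N = ssize L la}" "gt_patterns L N m ka ~= 0"
  by (rule sum.not_neutral_contains_not_neutral)
 with that show ?thesis by blast
qed

lemma gt_patterns_size: "gt_patterns L N m la ~= 0 ==> (\<Sum>i<N. m i) = ssize L la"
proof (induction N arbitrary: la)
 case 0 then show ?case by (auto simp: ssize_def split: if_splits)
next
 case (Suc N)
 from Suc.prems obtain ka where "ssize L ka + m N = ssize L la" "gt_patterns L N m ka ~= 0"
  by (rule gt_patterns_SucE)
 then show ?case using Suc.IH by simp
qed

lemma schur_degree:
 assumes "is_partition v" "schur v m ~= 0" shows "mon_degree m = sum_list v"
proof -
 obtain N where N: "keys m \<subseteq> {..<N}" by (rule keys_bounded)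
 then have "gt_patterns (length v) N (lookup m) (part v) ~= 0"
  using assms(2) schur_eq_gt_patterns[OF assms(1) order_refl N] by auto
 from gt_patterns_size[OF this] show ?thesis by (simp add: mon_degree_eq[OF N] ssize_part)
qed

lemma schur_sym: "is_partition v ==> bij p ==> schur v (map_key p m) = schur v m"
 by (rule sym_if_transpos[OF transposition_if_adjacent[OF schur_adjacent]])

lemma schur_in_Sym: "is_partition v ==> schur v \<in> Sym"
 unfolding symmetric_functions_def using schur_sym schur_degree by (blast dest: less_not_refl2)

lemma gt_patterns_rows: "gt_patterns L N m la ~= 0 ==> N \<le> j ==> la j = 0"
proof (induction N arbitrary: la j)
 case 0 then show ?case by (auto split: if_splits)
next
 case (Suc N)
 from Suc.prems(1) obtain ka where "intl ka la" "gt_patterns L N m ka ~= 0"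
  by (rule gt_patterns_SucE)
 moreover obtain j' where "j = Suc j'" "N \<le> j'" using Suc.prems(2) by (cases j) auto
 ultimately show ?case using Suc.IH unfolding intl_def by (metis le_zero_eq)
qed

text \<open>Entries less than \<open>i\<close> can only occupy the first \<open>i\<close> rows, as
  columns increase strictly. This is the triangularity of the Kostka numbers, stated for
  patterns.\<close>

lemma gt_patterns_dominance:
 "gt_patterns L N m la ~= 0 ==> i \<le> N ==> (\<Sum>j<i. m j) \<le> (\<Sum>j<i. la j)"
proof (induction N arbitrary: la)
 case (Suc N)
 obtain ka where ka: "intl ka la" "gt_patterns L N m ka ~= 0"
  using Suc.prems(1) by (rule gt_patterns_SucE)
 show ?case
 proof (cases "i \<le> N")
  case True
  then have "(\<Sum>j<i. m j) \<le> (\<Sum>j<i. ka j)" using Suc.IH ka by simp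
  also have "... \<le> (\<Sum>j<i. la j)" using ka(1) by (auto simp: intl_def intro: sum_mono)
  finally show ?thesis .
 next
  case False
  then have i: "i = Suc N" using Suc.prems by simp
  have "(\<Sum>j<i. m j) = (\<Sum>j<L. la j)"
   using gt_patterns_size[OF Suc.prems(1)] i by (simp add: ssize_def)
  also have "... = (\<Sum>j\<in>{..<L} \<inter> {..<i}. la j)"
  proof (rule sum.mono_neutral_right)
   show "\<forall>x\<in>{..<L} - {..<L} \<inter> {..<i}. la x = 0"
   proof
    fix x assume "x \<in> {..<L} - {..<L} \<inter> {..<i}"
    then have "Suc N \<le> x" using i by auto
    then show "la x = 0" by (rule gt_patterns_rows[OF Suc.prems(1)])
   qed
  qed auto
  also have "... \<le> (\<Sum>j<i. la j)" by (rule sum_mono2) auto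
  finally show ?thesis .
 qed
qed simp

text \<open>The tableau whose row \<open>j\<close> consists of entries \<open>j\<close> has this
  weight; in its pattern each level drops the last row of the level above, which gives
  \<open>ka\<close>.\<close>

lemma gt_patterns_diag:
 "is_shape L la ==> (!!j. N \<le> j ==> la j = 0) ==> gt_patterns L N la la ~= 0"
proof (induction N arbitrary: la)
 case 0 then show ?case by (auto simp: fun_eq_iff)
next
 case (Suc N)
 define ka where "ka j = (if j < N then la j else 0)" for j
 have dec: "la (Suc j) \<le> la j" for j using Suc.prems(1) by (simp add: is_shape_def)
 have "la (Suc j) \<le> ka j & ka j \<le> la j" for j
  using dec[of j] Suc.prems(2)[of "Suc j"] by (auto simp: ka_def)
 then have il: "intl ka la" by (simp add: intl_def)
 have sk: "is_shape L ka" by (rule intl_is_shape[OF Suc.prems(1) il])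
 have "gt_patterns L N la ka = gt_patterns L N ka ka" by (rule gt_patterns_cong) (simp add: ka_def)
 moreover have "gt_patterns L N ka ka ~= 0" by (rule Suc.IH[OF sk]) (simp add: ka_def)
 moreover have "ssize L ka + la N = ssize L la"
 proof -
  have "la j = ka j + (if j = N then la N else 0)" for j
   using Suc.prems(2)[of j] by (auto simp: ka_def)
  then have "ssize L la = (\<Sum>j<L. ka j + (if j = N then la N else 0))"
   unfolding ssize_def by (intro sum.cong) auto
  also have "... = ssize L ka + (if N < L then la N else 0)"
   by (simp add: sum.distrib ssize_def)
  finally show ?thesis using Suc.prems(1) by (auto simp: is_shape_def)
 qed
 moreover have "finite {ka. intl ka la & ssize L ka + la N = ssize L la}"
  by (rule finite_subset[OF _ finite_intl[OF Suc.prems(1)]]) auto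
 ultimately show ?case using il by auto
qed

definition part_mon :: "nat list => monomial" where
 "part_mon v = Abs_poly_mapping (part v)"

lemma lookup_part_mon [simp]: "lookup (part_mon v) = part v"
 unfolding part_mon_def
 by (rule lookup_Abs_poly_mapping, rule finite_subset[of _ "{..<length v}"]) (auto simp: part_def)

lemma keys_part_mon: "keys (part_mon v) \<subseteq> {..<length v}"
 by (auto simp: in_keys_iff part_def split: if_splits)

lemma schur_diag: assumes "is_partition v" shows "schur v (part_mon v) ~= 0"
proof -
 have "gt_patterns (length v) (length v) (part v) (part v) ~= 0"
  by (rule gt_patterns_diag[OF is_shape_part[OF assms order_refl]]) (auto simp: part_def)
 then show ?thesis by (simp add: schur_eq_gt_patterns[OF assms order_refl keys_part_mon])
qed

text \<open>A numerical refinement of dominance: a dominating partition has larger or equal partial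
  sums, so their total is monotone, and it stays the same only if no partial sum changes. Inductions
  over the partial order become inductions over natural numbers. \<open>D\<close> has to bound the
  lengths of the partitions compared.\<close>

definition dom_weight :: "nat => nat list => nat" where
 "dom_weight D v = (\<Sum>i\<le>D. \<Sum>j<i. part v j)"

lemma part_eqI:
 assumes "is_partition v" "is_partition u" "part v = part u" shows "v = u"
proof -
 have len: "length v \<le> length u" if "is_partition v" "part v = part u" for v u
 proof (rule ccontr)
  assume "\<not> length v \<le> length u"
  then have "part v (length u) ~= 0" using that(1)
   by (auto simp: part_def is_partition_def in_set_conv_nth)
  then show False using that(2) by (simp add: part_def)
 qed
 have "length v = length u" using len[OF assms(1,3)] len[OF assms(2) assms(3)[symmetric]] by simp
 moreover have "v ! i = u ! i" if "i < length v" for i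
  using that calculation fun_cong[OF assms(3), of i] by (simp add: part_def)
 ultimately show ?thesis by (rule nth_equalityI)
qed

lemma schur_dominance:
 assumes "is_partition v" "schur v (part_mon u) ~= 0"
 shows "(\<Sum>j<i. part u j) \<le> (\<Sum>j<i. part v j)"
proof -
 define N where "N = max i (length u)"
 have k: "keys (part_mon u) \<subseteq> {..<N}"
  using keys_part_mon[of u] by (auto simp: N_def)
 then have "gt_patterns (length v) N (part u) (part v) ~= 0"
  using assms(2) schur_eq_gt_patterns[OF assms(1) order_refl k] by auto
 then show ?thesis by (rule gt_patterns_dominance) (simp add: N_def)
qed

lemma schur_dom_weight:
 assumes "is_partition v" "schur v (part_mon u) ~= 0"
 shows "dom_weight D u \<le> dom_weight D v"
 unfolding dom_weight_def by (rule sum_mono) (rule schur_dominance[OF assms])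

lemma dom_weight_eq_imp_eq:
 assumes "is_partition v" "is_partition u" "length v \<le> D" "length u \<le> D"
  "schur v (part_mon u) ~= 0" "dom_weight D u = dom_weight D v"
 shows "v = u"
proof (rule part_eqI[OF assms(1,2)])
 have eq: "(\<Sum>j<i. part u j) = (\<Sum>j<i. part v j)" if "i \<le> D" for i
 proof (rule ccontr)
  assume "(\<Sum>j<i. part u j) ~= (\<Sum>j<i. part v j)"
  then have "(\<Sum>j<i. part u j) < (\<Sum>j<i. part v j)"
   using schur_dominance[OF assms(1,5), of i] by simp
  then have "dom_weight D u < dom_weight D v" unfolding dom_weight_def
   using that schur_dominance[OF assms(1,5)] by (intro sum_strict_mono_ex1) auto
  then show False using assms(6) by simp
 qed
 show "part v = part u"
 proof
  fix j show "part v j = part u j"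
  proof (cases "j < D")
   case True
   then show ?thesis using eq[of j] eq[of "Suc j"] by simp
  next
   case False then show ?thesis using assms(3,4) by (simp add: part_def)
  qed
 qed
qed

definition parts_upto :: "nat => nat list set" where
 "parts_upto D = {v. is_partition v & sum_list v \<le> D}"

lemma part_length_le: "is_partition v ==> length v \<le> sum_list v"
proof -
 have "0 \<notin> set v ==> length v \<le> sum_list v" by (induction v) auto
 then show "is_partition v ==> length v \<le> sum_list v" by (simp add: is_partition_def)
qed

lemma finite_parts_upto: "finite (parts_upto D)"
proof (rule finite_subset)
 show "parts_upto D \<subseteq> {xs. set xs \<subseteq> {..D} & length xs \<le> D}"
  using part_length_le member_le_sum_list by (fastforce simp: parts_upto_def)
qed (rule finite_lists_length_le, simp)

lemma schur_series_eq:
 assumes "finite S" "!!v. c v ~= 0 ==> v \<in> S"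
 shows "schur_series c m = (\<Sum>v\<in>S. c v * schur v m)"
 unfolding schur_series_def by (rule sum.mono_neutral_left) (use assms in auto)

text \<open>Triangularity: for \<open>u\<close> of maximal \<open>dom_weight\<close> among the
  shapes with nonzero coefficient, the monomial \<open>part_mon u\<close> occurs in
  \<open>schur u\<close> and in no other Schur function that contributes to the sum.\<close>

lemma schur_indep:
 assumes S: "finite S" "!!v. v \<in> S ==> is_partition v"
  and zero: "!!m. (\<Sum>v\<in>S. c v * schur v m) = (0::rat)" and "v \<in> S"
 shows "c v = 0"
proof (rule ccontr)
 define D where "D = Max (length ` S)"
 define S' where "S' = {u\<in>S. c u ~= 0}"
 assume "c v ~= 0"
 then have "S' ~= {}" "finite S'" using assms by (auto simp: S'_def)
 then obtain u where mu: "u \<in> S'" "!!g. g \<in> S' ==> dom_weight D g \<le> dom_weight D u"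
  using obtains_MAX[of S' "dom_weight D"] Max_ge[of "dom_weight D ` S'"] by (metis finite_imageI imageI)
 have len: "length g \<le> D" if "g \<in> S" for g using that S(1) by (simp add: D_def)
 have "c g * schur g (part_mon u) = 0" if "g \<in> S" "g ~= u" for g
 proof (rule ccontr)
  assume n: "c g * schur g (part_mon u) ~= 0"
  then have k: "g \<in> S'" using that by (simp add: S'_def)
  have "dom_weight D u \<le> dom_weight D g"
   using n S that by (intro schur_dom_weight) auto
  then have "dom_weight D u = dom_weight D g" using mu(2)[OF k] by simp
  then have "g = u" using n that S mu(1) len by (intro dom_weight_eq_imp_eq) (auto simp: S'_def)
  then show False using that by simp
 qed
 then have "(\<Sum>g\<in>S. c g * schur g (part_mon u)) = c u * schur u (part_mon u)"
  using mu(1) sum.remove[OF S(1), of u "%g. c g * schur g (part_mon u)"]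
  by (simp add: S'_def sum.neutral)
 then show False using zero mu(1) S schur_diag[of u] by (auto simp: S'_def)
qed

lemma schur_expn_unique:
 assumes "is_schur_expansion f c" "is_schur_expansion f c'" shows "c = c'"
proof
 fix v
 let ?S = "{v. c v ~= 0} \<union> {v. c' v ~= 0}"
 have S: "finite ?S" "!!v. v \<in> ?S ==> is_partition v"
  using assms unfolding is_schur_expansion_def by auto
 show "c v = c' v"
 proof (cases "v \<in> ?S")
  case True
  have "schur_series c m = schur_series c' m" for m
   using assms unfolding is_schur_expansion_def by metis
  then have "(\<Sum>v\<in>?S. (c v - c' v) * schur v m) = 0" for m
   using S(1) by (simp add: schur_series_eq[of ?S] left_diff_distrib sum_subtractf)
  from schur_indep[OF S this True] show ?thesis by simp
 qed auto
qed

lemma Sym_bij: "f \<in> Sym ==> bij p ==> f (map_key p m) = f m"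
 by (simp add: symmetric_functions_def)

lemma mon_sorted:
 fixes m :: monomial
 obtains g u where "bij g" "is_partition u" "map_key g m = part_mon u"
proof -
 define xs where "xs = rev (sort_key (lookup m) (sorted_list_of_set (keys m)))"
 have d: "distinct xs" and set: "set xs = keys m" by (auto simp: xs_def)
 define u where "u = map (lookup m) xs"
 have "sorted (rev u)" by (simp add: u_def xs_def rev_map)
 then have "sorted_wrt (\<ge>) u" by (simp add: sorted_wrt_rev)
 moreover have "0 \<notin> set u" using set by (auto simp: u_def in_keys_iff)
 ultimately have pm: "is_partition u" by (simp add: is_partition_def)
 have b: "bij_betw (nth xs) {..<length xs} (keys m)"
  using bij_betw_nth[OF d] set by simp
 obtain p where p: "p permutes (keys m \<union> {..<length xs})" "!!i. i < length xs ==> p i = xs ! i"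
  using bij_betw_extends_to_perm[OF b] by (auto simp: lessThan_def)
 have pim: "p ` {..<length xs} = keys m" using b p(2) by (auto simp: bij_betw_def)
 have "map_key p m = part_mon u"
 proof (rule poly_mapping_eqI)
  fix i
  have "lookup m (p i) = part u i"
  proof (cases "i < length xs")
   case True then show ?thesis using p(2) by (simp add: part_def u_def)
  next
   case False
   then have "p i \<notin> keys m" using pim permutes_inj[OF p(1)]
    by (metis imageE inj_eq lessThan_iff)
   then show ?thesis using False by (simp add: part_def u_def in_keys_iff)
  qed
  then show "lookup (map_key p m) i = lookup (part_mon u) i"
   using permutes_inj[OF p(1)] by (simp add: lookup_map_key)
 qed
 with pm permutes_bij[OF p(1)] show ?thesis using that by blast
qed

lemma mon_dpart_mon: "mon_degree (part_mon u) = sum_list u"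
 using ssize_part[of u "length u"]
 by (simp add: mon_degree_eq[OF keys_part_mon] ssize_def)

text \<open>Gaussian elimination along \<open>dom_weight\<close>: if \<open>f\<close> vanishes at
  all partition monomials of weight above \<open>t\<close>, then subtracting multiples of the Schur
  functions of weight exactly \<open>t\<close> makes it vanish at weight \<open>t\<close> too, since
  each of these meets only its own monomial among those of weight at least \<open>t\<close>.\<close>

lemma schur_spanning:
 assumes "!!p m. bij p ==> f (map_key p m) = f m" "!!m. mon_degree m > D ==> f m = (0::rat)"
 obtains c where "!!m. f m = (\<Sum>v\<in>parts_upto D. c v * schur v m)"
proof -
 let ?P = "parts_upto D"
 have zero: "f m = 0" if "!!p m. bij p ==> f (map_key p m) = f m" "!!m. mon_degree m > D ==> f m = (0::rat)"
  "!!u. u \<in> ?P ==> f (part_mon u) = 0" for f m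
 proof -
  obtain p u where *: "bij p" "is_partition u" "map_key p m = part_mon u"
   by (rule mon_sorted)
  then have "f m = f (part_mon u)" using that(1) by metis
  also have "... = 0"
  proof (cases "sum_list u \<le> D")
   case True then show ?thesis using that(3) *(2) by (simp add: parts_upto_def)
  next
   case False then show ?thesis using that(2) by (simp add: mon_dpart_mon)
  qed
  finally show ?thesis .
 qed
 have "\<exists>c. \<forall>m. f m = (\<Sum>v\<in>?P. c v * schur v m)"
  if "!!p m. bij p ==> f (map_key p m) = f m" "!!m. mon_degree m > D ==> f m = 0"
   "!!u. u \<in> ?P ==> t \<le> dom_weight D u ==> f (part_mon u) = 0" for f :: series and t
  using that
 proof (induction t arbitrary: f)
  case 0
  then have "f m = 0" for m using zero[of f m] by simp
  then show ?case by (intro exI[of _ "%_. 0"]) simp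
 next
  case (Suc t)
  define a where "a u = (if dom_weight D u = t then f (part_mon u) / schur u (part_mon u) else 0)" for u
  define g where "g m = f m - (\<Sum>v\<in>?P. a v * schur v m)" for m
  have pP: "is_partition v" "length v \<le> D" if "v \<in> ?P" for v
   using that part_length_le[of v] by (auto simp: parts_upto_def)
  have "g (part_mon u) = 0" if mu: "u \<in> ?P" "t \<le> dom_weight D u" for u
  proof -
   have z: "a v * schur v (part_mon u) = 0" if "v \<in> ?P" "v ~= u" for v
   proof (rule ccontr)
    assume n: "a v * schur v (part_mon u) ~= 0"
    then have "dom_weight D v = t" by (auto simp: a_def split: if_splits)
    moreover have "dom_weight D u \<le> dom_weight D v"
     using n pP that by (intro schur_dom_weight) auto
    ultimately have "dom_weight D u = dom_weight D v" using mu by simp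
    then have "v = u" using n pP that mu by (intro dom_weight_eq_imp_eq) auto
    then show False using that by simp
   qed
   have "(\<Sum>v\<in>?P. a v * schur v (part_mon u)) = a u * schur u (part_mon u)"
    using sum.remove[OF finite_parts_upto mu(1), of "%v. a v * schur v (part_mon u)"] z
    by (simp add: sum.neutral)
   also have "... = f (part_mon u)"
    using schur_diag[of u] pP mu Suc.prems(3)[of u] by (auto simp: a_def)
   finally show ?thesis by (simp add: g_def)
  qed
  moreover have "g (map_key p m) = g m" if "bij p" for p m
   using Suc.prems(1)[OF that] schur_sym[OF _ that] pP by (simp add: g_def)
  moreover have "g m = 0" if "mon_degree m > D" for m
  proof -
   have "schur v m = 0" if "v \<in> ?P" for v
    using schur_degree[of v m] that \<open>mon_degree m > D\<close> by (auto simp: parts_upto_def)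
   then show ?thesis using Suc.prems(2) that by (simp add: g_def)
  qed
  ultimately obtain c where c: "!!m. g m = (\<Sum>v\<in>?P. c v * schur v m)"
   using Suc.IH[of g] by blast
  have "f m = (\<Sum>v\<in>?P. (a v + c v) * schur v m)" for m
   using c[of m] by (simp add: g_def distrib_right sum.distrib)
  then show ?case by (intro exI[of _ "%v. a v + c v"]) simp
 qed
 note * = this
 have "dom_weight D u < Suc (Max (dom_weight D ` ?P))" if "u \<in> ?P" for u
  using that finite_parts_upto by (simp add: less_Suc_eq_le)
 then have "\<exists>c. \<forall>m. f m = (\<Sum>v\<in>?P. c v * schur v m)"
  using *[of f "Suc (Max (dom_weight D ` ?P))"] assms by force
 with that show ?thesis by blast
qed

lemma is_schur_expn_sum:
 assumes "finite S" "!!v. v \<in> S ==> is_partition v" "!!m. f m = (\<Sum>v\<in>S. c v * schur v m)"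
 shows "is_schur_expansion f (%v. if v \<in> S then c v else 0)"
proof -
 have "f m = schur_series (%v. if v \<in> S then c v else 0) m" for m
  using assms by (subst schur_series_eq[of S]) (auto split: if_splits)
 then show ?thesis unfolding is_schur_expansion_def using assms(1,2)
  by (auto intro: finite_subset[of _ S])
qed

lemma schur_coeff_eqI: "is_schur_expansion f c ==> schur_coeff f = c"
 unfolding schur_coeff_def by (rule the_equality) (auto dest: schur_expn_unique)

lemma schur_coeff_expn:
 assumes "f \<in> Sym" shows "is_schur_expansion f (schur_coeff f)"
proof -
 obtain D where D: "!!m. mon_degree m > D ==> f m = 0"
  using assms unfolding symmetric_functions_def by blast
 obtain c where "!!m. f m = (\<Sum>v\<in>parts_upto D. c v * schur v m)"
  using schur_spanning[OF Sym_bij[OF assms] D] by blast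
 then have "is_schur_expansion f (%v. if v \<in> parts_upto D then c v else 0)"
  by (intro is_schur_expn_sum finite_parts_upto) (auto simp: parts_upto_def)
 then show ?thesis by (metis schur_coeff_eqI)
qed

lemma Sym_sum:
 assumes "finite I" "!!i. i \<in> I ==> f i \<in> Sym"
 shows "(%m. \<Sum>i\<in>I. a i * f i m) \<in> Sym"
proof -
 have "\<forall>i\<in>I. \<exists>D. \<forall>m. mon_degree m > D --> f i m = 0"
  using assms(2) unfolding symmetric_functions_def by blast
 then obtain D where D: "!!i m. i \<in> I ==> mon_degree m > D i ==> f i m = 0" by metis
 have "(\<Sum>i\<in>I. a i * f i m) = 0" if "mon_degree m > Max (insert 0 (D ` I))" for m
 proof (rule sum.neutral, rule ballI)
  fix i assume i: "i \<in> I"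
  then have "D i \<le> Max (insert 0 (D ` I))" using assms(1) by simp
  then show "a i * f i m = 0" using D[OF i, of m] that by simp
 qed
 then show ?thesis using Sym_bij[OF assms(2)] unfolding symmetric_functions_def by auto
qed

lemma schur_expn_lincomb:
 assumes "finite I" "!!i. i \<in> I ==> is_schur_expansion (f i) (c i)"
 shows "is_schur_expansion (%m. \<Sum>i\<in>I. a i * f i m) (%v. \<Sum>i\<in>I. a i * c i v)"
proof -
 let ?S = "\<Union>i\<in>I. {v. c i v ~= 0}"
 have S: "finite ?S" using assms by (auto simp: is_schur_expansion_def)
 have nz: "v \<in> ?S" if "(\<Sum>i\<in>I. a i * c i v) ~= 0" for v
  using that by (metis (mono_tags, lifting) UN_iff mem_Collect_eq mult_zero_right sum.neutral)
 have "(\<Sum>i\<in>I. a i * f i m) = schur_series (%v. \<Sum>i\<in>I. a i * c i v) m" for m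
 proof -
  have "(\<Sum>i\<in>I. a i * f i m) = (\<Sum>i\<in>I. a i * (\<Sum>v\<in>?S. c i v * schur v m))"
  proof (intro sum.cong refl arg_cong2[where f = "(*)"])
   fix i assume i: "i \<in> I"
   then have "f i m = schur_series (c i) m" using assms(2) by (metis is_schur_expansion_def)
   then show "f i m = (\<Sum>v\<in>?S. c i v * schur v m)"
    using schur_series_eq[of ?S "c i" m] S i by auto
  qed
  also have "... = (\<Sum>v\<in>?S. (\<Sum>i\<in>I. a i * c i v) * schur v m)"
   by (simp add: sum_distrib_left sum_distrib_right mult.assoc sum.swap[of _ I])
  also have "... = schur_series (%v. \<Sum>i\<in>I. a i * c i v) m"
   using schur_series_eq[of ?S "%v. \<Sum>i\<in>I. a i * c i v" m] S nz by auto
  finally show ?thesis .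
 qed
 moreover have "finite {v. (\<Sum>i\<in>I. a i * c i v) ~= 0}"
  by (rule finite_subset[OF _ S]) (use nz in blast)
 moreover have "is_partition v" if "(\<Sum>i\<in>I. a i * c i v) ~= 0" for v
  using nz[OF that] assms(2) by (auto simp: is_schur_expansion_def)
 ultimately show ?thesis unfolding is_schur_expansion_def by blast
qed

lemma schur_expn_schur: "is_partition v ==> is_schur_expansion (schur v) (%u. if u = v then 1 else 0)"
 unfolding is_schur_expansion_def
 by (auto simp: fun_eq_iff schur_series_eq[of "{v}"] split: if_splits)

lemma schur_coeff_schur: "is_partition v ==> schur_coeff (schur v) = (%u. if u = v then 1 else 0)"
 by (rule schur_coeff_eqI[OF schur_expn_schur])

lemma hall_schur_right:
 assumes "f \<in> Sym" "is_partition v"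
 shows "hall f (schur v) = schur_coeff f v"
proof -
 have "finite {u. schur_coeff f u ~= 0}"
  using schur_coeff_expn[OF assms(1)] by (simp add: is_schur_expansion_def)
 then show ?thesis by (auto simp: hall_def schur_coeff_schur[OF assms(2)] if_distrib sum.delta cong: if_cong)
qed

section \<open>Products of symmetric functions\<close>

lemma finite_mon_splits: "finite {(a, b). a + b = (m :: monomial)}"
proof -
 let ?F = "{f. \<forall>x. (x \<in> keys m --> f x \<in> {..mon_degree m}) & (x \<notin> keys m --> f x = (0::nat))}"
 have le: "lookup a x \<le> lookup m x" if "a + b = m" for a b x
  using that by (auto simp: lookup_add)
 have "lookup m x \<le> mon_degree m" for x
  by (cases "x \<in> keys m") (auto simp: mon_degree_def in_keys_iff intro: member_le_sum)
 then have "lookup a \<in> ?F" if "a + b = m" for a b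
  using le[OF that] by (auto simp: in_keys_iff intro: order_trans) (metis le_zero_eq)
 then have "(lookup o fst) ` {(a, b). a + b = m} \<subseteq> ?F" by auto
 moreover have "finite ?F" by (rule finite_set_of_finite_funs) auto
 ultimately have "finite ((lookup o fst) ` {(a, b). a + b = m})" by (rule finite_subset)
 moreover have "inj_on (lookup o fst) {(a, b). a + b = m}"
  by (rule inj_onI) (auto intro: poly_mapping_eqI)
 ultimately show ?thesis by (rule finite_imageD)
qed

lemma series_mult_sym:
 assumes "f \<in> Sym" "g \<in> Sym"
 shows "series_mult f g \<in> Sym"
proof -
 obtain D1 where D1: "!!m. mon_degree m > D1 ==> f m = 0" using assms(1) unfolding symmetric_functions_def by blast
 obtain D2 where D2: "!!m. mon_degree m > D2 ==> g m = 0" using assms(2) unfolding symmetric_functions_def by blast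
 have "series_mult f g m = 0" if "mon_degree m > D1 + D2" for m
  unfolding series_mult_def
 proof (rule sum.neutral, clarify)
  fix a b assume "m = a + b"
  then have "mon_degree a > D1 \<or> mon_degree b > D2" using that by (auto simp: mon_degree_add)
  then show "f a * g b = 0" using D1 D2 by auto
 qed
 moreover have "series_mult f g (map_key s m) = series_mult f g m" if b: "bij s" for s m
 proof -
  define r where "r = inv_into UNIV s"
  have b': "bij r" unfolding r_def by (rule bij_imp_bij_inv[OF b])
  let ?M = "map_key s" and ?W = "map_key r"
  have WM: "?W (?M a) = a" "?M (?W a) = a" for a :: monomial
   using b b' by (auto intro!: poly_mapping_eqI simp: lookup_map_key bij_is_inj r_def
     surj_f_inv_f[OF bij_is_surj])
  have add: "?M (a + b) = ?M a + ?M b" "?W (a + b) = ?W a + ?W b" for a b :: monomial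
   using b b' by (simp_all add: map_key_plus bij_is_inj)
  note sym = Sym_bij[OF assms(1) b'] Sym_bij[OF assms(2) b']
  show ?thesis unfolding series_mult_def
  proof (rule sum.reindex_bij_witness[where i = "%(a, b). (?M a, ?M b)" and j = "%(a, b). (?W a, ?W b)"], goal_cases)
   case (2 p)
   then obtain a b where p: "p = (a, b)" "a + b = ?M m" by auto
   then have "?W a + ?W b = m" using WM(1)[of m] by (simp flip: add(2))
   then show ?case by (simp add: p)
  next
   case (4 p)
   then obtain a b where p: "p = (a, b)" "a + b = m" by auto
   then show ?case by (simp add: p flip: add(1))
  qed (auto simp: WM sym)
 qed
 ultimately show ?thesis unfolding symmetric_functions_def by blast
qed

section \<open>The superspecialization of symmetric functions\<close>

text \<open>\<open>spec_sum f a m N\<close> is the coefficient of \<open>q\<^sup>a u\<^sup>m\<close> in \<open>f (q, u, \<dots>, u)\<close> with \<open>N\<close> copies of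
  \<open>u\<close>. It is a polynomial in \<open>N\<close>; its value at \<open>N = -1\<close> is, up to the sign \<open>(-1)\<^sup>m\<close>, the
  Hall product of \<open>f\<close> with \<open>h\<^sub>a e\<^sub>m\<close>, which only sees the hook components of \<open>f\<close>.\<close>

definition spec_mons :: "nat => nat => nat => monomial set" where
 "spec_mons N a m =
   {x. keys x \<subseteq> {..N} & lookup x 0 = a & mon_degree x = a + m}"

definition spec_sum :: "series => nat => nat => nat => rat" where
 "spec_sum f a m N = (\<Sum>x\<in>spec_mons N a m. f x)"

text \<open>A relation instead of a function, because a value exists only where
  \<open>spec_sum\<close> is a polynomial in \<open>N\<close>. This is shown separately for power
  sums, Schur functions and dimensions of alternants, and it is inherited by linear combinations and
  products. With the sign, Schur functions get the values 0 and 1.\<close>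

definition has_sspec :: "series => nat => nat => rat => bool" where
 "has_sspec f a m v \<longleftrightarrow>
   (\<exists>P. (\<forall>N. poly P (of_nat N) = spec_sum f a m N) & v = (-1) ^ m * poly P (-1))"

lemma has_sspecI:
 "(!!N. poly P (of_nat N) = spec_sum f a m N) ==> v = (-1) ^ m * poly P (-1) ==> has_sspec f a m v"
 unfolding has_sspec_def by blast

lemma poly_eq_if_eq_on_nat:
 fixes P Q :: "rat poly" assumes "!!N :: nat. poly P (of_nat N) = poly Q (of_nat N)" shows "P = Q"
proof (rule ccontr)
 assume "P ~= Q"
 then have "finite {x. poly (P - Q) x = 0}" by (intro poly_roots_finite) simp
 moreover have "range (of_nat :: nat => rat) \<subseteq> {x. poly (P - Q) x = 0}" using assms by auto
 ultimately have "finite (range (of_nat :: nat => rat))" by (rule finite_subset[rotated])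
 moreover have "inj (of_nat :: nat => rat)" by (simp add: inj_on_def)
 ultimately show False using finite_imageD infinite_UNIV_nat by blast
qed

lemma has_sspec_unique: "has_sspec f a m v ==> has_sspec f a m w ==> v = w"
 unfolding has_sspec_def by (metis poly_eq_if_eq_on_nat)

lemma has_sspec_lincomb:
 assumes "finite I" "!!i. i \<in> I ==> has_sspec (f i) a m (v i)"
 shows "has_sspec (%x. \<Sum>i\<in>I. c i * f i x) a m (\<Sum>i\<in>I. c i * v i)"
proof -
 have "\<forall>i\<in>I. \<exists>P. (\<forall>N. poly P (of_nat N) = spec_sum (f i) a m N) & v i = (-1) ^ m * poly P (-1)"
  using assms(2) unfolding has_sspec_def by (intro ballI)
 from bchoice[OF this] obtain P where
  "\<forall>i\<in>I. (\<forall>N. poly (P i) (of_nat N) = spec_sum (f i) a m N) & v i = (-1) ^ m * poly (P i) (-1)" ..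
 then have P: "!!i N. i \<in> I ==> poly (P i) (of_nat N) = spec_sum (f i) a m N"
  "!!i. i \<in> I ==> v i = (-1) ^ m * poly (P i) (-1)" by simp_all
 show ?thesis
 proof (rule has_sspecI[where P = "\<Sum>i\<in>I. smult (c i) (P i)"])
  fix N
  have "(\<Sum>i\<in>I. c i * spec_sum (f i) a m N) = spec_sum (%x. \<Sum>i\<in>I. c i * f i x) a m N"
   by (simp add: spec_sum_def sum_distrib_left sum.swap[of _ I])
  then show "poly (\<Sum>i\<in>I. smult (c i) (P i)) (of_nat N) = spec_sum (%x. \<Sum>i\<in>I. c i * f i x) a m N"
   using P(1) by (simp add: poly_sum)
 qed (use P(2) in "simp add: poly_sum sum_distrib_left mult.left_commute")
qed

lemma finite_bounded_mons: "finite {x :: monomial. keys x \<subseteq> {..N} & mon_degree x \<le> D}"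
proof -
 let ?F = "{f. \<forall>x. (x \<in> {..N} --> f x \<in> {..D}) & (x \<notin> {..N} --> f x = (0::nat))}"
 have le: "lookup x v \<le> mon_degree x" for x :: monomial and v
  by (cases "v \<in> keys x") (auto simp: mon_degree_def in_keys_iff intro: member_le_sum)
 have mem: "lookup x \<in> ?F" if "keys x \<subseteq> {..N}" "mon_degree x \<le> D" for x
  using that order_trans[OF le that(2)] by (auto simp: in_keys_iff subset_iff) 
 then have "lookup ` {x :: monomial. keys x \<subseteq> {..N} & mon_degree x \<le> D} \<subseteq> ?F"
  by (intro image_subsetI mem) simp_all
 moreover have "finite ?F" by (rule finite_set_of_finite_funs) auto
 ultimately show ?thesis
  by (rule finite_imageD[OF finite_subset]) (auto intro!: inj_onI poly_mapping_eqI)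
qed

lemma finite_spec_mons [simp]: "finite (spec_mons N a m)"
 by (rule finite_subset[OF _ finite_bounded_mons[of N "a + m"]]) (auto simp: spec_mons_def)

lemma lookup_le_mon_degree: "lookup x v \<le> mon_degree x"
 by (cases "v \<in> keys x") (auto simp: mon_degree_def in_keys_iff intro: member_le_sum)

lemma keys_add_nat: "keys (a + b :: 'a \<Rightarrow>\<^sub>0 nat) = keys a \<union> keys b"
 by (auto simp: in_keys_iff lookup_add)

text \<open>Substituting \<open>(q, u, ..., u)\<close> is a ring homomorphism, compared here in
  degree \<open>a\<close> in \<open>q\<close> and \<open>m\<close> in \<open>u\<close>: a
  factorization of a monomial distributes both degrees over the factors.\<close>

lemma spec_sum_mult:
 "spec_sum (series_mult f g) a m N =
   (\<Sum>i\<le>a. \<Sum>j\<le>m. spec_sum f i j N * spec_sum g (a - i) (m - j) N)"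
proof -
 let ?U = "spec_mons N"
 let ?S1 = "SIGMA x:?U a m. {(p, q). p + q = x}"
 let ?S2 = "SIGMA ij:{..a} \<times> {..m}. ?U (fst ij) (snd ij) \<times> ?U (a - fst ij) (m - snd ij)"
 have "spec_sum (series_mult f g) a m N = (\<Sum>(x, p, q)\<in>?S1. f p * g q)"
  unfolding spec_sum_def series_mult_def
  by (subst sum.Sigma) (simp_all add: finite_mon_splits)
 also have "... = (\<Sum>(ij, p, q)\<in>?S2. f p * g q)"
 proof (rule sum.reindex_bij_witness[where
    i = "%(ij, p, q). (p + q, p, q)" and
    j = "%(x, p, q). ((lookup p 0, mon_degree p - lookup p 0), p, q)"], goal_cases)
  case (2 t)
  then obtain p q where t: "t = (p + q, p, q)" and pq: "p + q \<in> ?U a m" by auto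
  have "mon_degree p - lookup p 0 + (mon_degree q - lookup q 0) = m"
   using pq lookup_le_mon_degree[of p 0] lookup_le_mon_degree[of q 0]
   by (auto simp: spec_mons_def lookup_add mon_degree_add)
  then show ?case using pq lookup_le_mon_degree[of p 0] lookup_le_mon_degree[of q 0]
   by (auto simp: t spec_mons_def lookup_add mon_degree_add keys_add_nat)
 next
  case (4 t)
  then obtain i j p q where t: "t = ((i, j), p, q)" and *: "i \<le> a" "j \<le> m" "p \<in> ?U i j" "q \<in> ?U (a - i) (m - j)"
   by auto
  then show ?case by (auto simp: spec_mons_def lookup_add mon_degree_add keys_add_nat)
 qed (auto simp: spec_mons_def)
 also have "... = (\<Sum>ij\<in>{..a} \<times> {..m}. \<Sum>(p, q)\<in>?U (fst ij) (snd ij) \<times> ?U (a - fst ij) (m - snd ij). f p * g q)"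
  by (subst sum.Sigma) simp_all
 also have "... = (\<Sum>ij\<in>{..a} \<times> {..m}. spec_sum f (fst ij) (snd ij) N * spec_sum g (a - fst ij) (m - snd ij) N)"
  by (simp add: spec_sum_def sum_product sum.cartesian_product)
 also have "... = (\<Sum>i\<le>a. \<Sum>j\<le>m. spec_sum f i j N * spec_sum g (a - i) (m - j) N)"
  by (subst sum.cartesian_product) (simp add: case_prod_beta')
 finally show ?thesis .
qed

lemma has_sspec_mult:
 assumes "!!i j. i \<le> a ==> j \<le> m ==> has_sspec f i j (u i j)"
  and "!!i j. i \<le> a ==> j \<le> m ==> has_sspec g i j (w i j)"
 shows "has_sspec (series_mult f g) a m (\<Sum>i\<le>a. \<Sum>j\<le>m. u i j * w (a - i) (m - j))"
proof -
 have "\<forall>ij\<in>{..a} \<times> {..m}. \<exists>P. (\<forall>N. poly P (of_nat N) = spec_sum f (fst ij) (snd ij) N) & u (fst ij) (snd ij) = (-1) ^ snd ij * poly P (-1)"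
  using assms(1) by (simp add: has_sspec_def)
 from bchoice[OF this] obtain P' where "\<forall>ij\<in>{..a} \<times> {..m}. (\<forall>N. poly (P' ij) (of_nat N) = spec_sum f (fst ij) (snd ij) N)
   & u (fst ij) (snd ij) = (-1) ^ snd ij * poly (P' ij) (-1)" ..
 moreover define P where "P i j = P' (i, j)" for i j
 ultimately have P: "!!i j N. i \<le> a ==> j \<le> m ==> poly (P i j) (of_nat N) = spec_sum f i j N"
  "!!i j. i \<le> a ==> j \<le> m ==> u i j = (-1) ^ j * poly (P i j) (-1)" by simp_all
 have "\<forall>ij\<in>{..a} \<times> {..m}. \<exists>P. (\<forall>N. poly P (of_nat N) = spec_sum g (fst ij) (snd ij) N) & w (fst ij) (snd ij) = (-1) ^ snd ij * poly P (-1)"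
  using assms(2) by (simp add: has_sspec_def)
 from bchoice[OF this] obtain Q' where "\<forall>ij\<in>{..a} \<times> {..m}. (\<forall>N. poly (Q' ij) (of_nat N) = spec_sum g (fst ij) (snd ij) N)
   & w (fst ij) (snd ij) = (-1) ^ snd ij * poly (Q' ij) (-1)" ..
 moreover define Q where "Q i j = Q' (i, j)" for i j
 ultimately have Q: "!!i j N. i \<le> a ==> j \<le> m ==> poly (Q i j) (of_nat N) = spec_sum g i j N"
  "!!i j. i \<le> a ==> j \<le> m ==> w i j = (-1) ^ j * poly (Q i j) (-1)" by simp_all
 show ?thesis
 proof (rule has_sspecI[where P = "\<Sum>i\<le>a. \<Sum>j\<le>m. P i j * Q (a - i) (m - j)"])
  show "poly (\<Sum>i\<le>a. \<Sum>j\<le>m. P i j * Q (a - i) (m - j)) (of_nat N) = spec_sum (series_mult f g) a m N" for N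
   by (auto simp: spec_sum_mult poly_sum P(1) Q(1) intro!: sum.cong)
  have "u i j * w (a - i) (m - j) = (-1) ^ m * poly (P i j * Q (a - i) (m - j)) (-1)" if "i \<le> a" "j \<le> m" for i j
  proof -
   have "(-1 :: rat) ^ m = (-1) ^ j * (-1) ^ (m - j)" using that by (simp flip: power_add)
   then show ?thesis using that by (simp add: P(2) Q(2))
  qed
  then show "(\<Sum>i\<le>a. \<Sum>j\<le>m. u i j * w (a - i) (m - j)) = (-1) ^ m * poly (\<Sum>i\<le>a. \<Sum>j\<le>m. P i j * Q (a - i) (m - j)) (-1)"
   by (simp add: poly_sum sum_distrib_left)
 qed
qed

lemma has_sspec_one: "has_sspec series_one 0 m (if m = 0 then 1 else 0)"
proof (rule has_sspecI[where P = "if m = 0 then 1 else 0"])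
 fix N
 have "(0 :: monomial) \<in> spec_mons N 0 m \<longleftrightarrow> m = 0" by (auto simp: spec_mons_def mon_degree_def)
 then show "poly (if m = 0 then 1 else 0) (of_nat N) = spec_sum series_one 0 m N"
  by (auto simp: spec_sum_def series_one_def sum.delta)
qed auto

lemma mon_degree_single [simp]: "mon_degree (single v r) = r"
 by (simp add: mon_degree_def)

text \<open>The power sum becomes \<open>q^r + N u^r\<close>. Its part without \<open>q\<close>
  takes the value -1 at \<open>N = -1\<close>, and the factor (-1)^r turns this into (-1)^(r-1), the
  sign of an \<open>r\<close>-cycle.\<close>

lemma has_sspec_power_sum:
 assumes "r \<ge> 1"
 shows "has_sspec (power_sum r) 0 m (if m = r then (-1) ^ (r - 1) else 0)"
proof (rule has_sspecI[where P = "if m = r then [:0, 1:] else 0"])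
 fix N
 have "spec_sum (power_sum r) 0 m N = (\<Sum>x\<in>spec_mons N 0 m \<inter> range (%v. single v r). 1)"
  unfolding spec_sum_def power_sum_def by (subst sum.inter_restrict) (auto intro!: sum.cong)
 also have "spec_mons N 0 m \<inter> range (%v. single v r) =
   (if m = r then (%v. single v r) ` {1..N} else {})"
  using assms by (auto simp: spec_mons_def lookup_single when_def split: if_splits)
 also have "(\<Sum>x\<in>.... 1) = (if m = r then of_nat N else (0::rat))"
 proof -
  have "inj_on (%v. single v r) {1..N}"
  proof (rule inj_onI)
   fix v w :: nat assume "single v r = single w r"
   then have "keys (single v r) = keys (single w r)" by simp
   then show "v = w" using assms by simp
  qed
  then show ?thesis by (simp add: card_image)
 qed
 finally show "poly (if m = r then [:0, 1:] else 0) (of_nat N) = spec_sum (power_sum r) 0 m N" by simp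
next
 show "(if m = r then (- 1) ^ (r - 1) else 0) = (-1) ^ m * poly (if m = r then [:0, 1:] else 0) (-1 :: rat)"
  using assms by (cases r) auto
qed

lemma has_sspec_power_sum_part:
 assumes "0 \<notin> set g"
 shows "has_sspec (power_sum_partition g) 0 m
  (if m = sum_list g then (\<Prod>r\<leftarrow>g. (-1) ^ (r - 1)) else 0)"
 using assms
proof (induction g arbitrary: m)
 case Nil then show ?case using has_sspec_one[of m] unfolding power_sum_partition_def by (simp only: foldr.simps sum_list.Nil list.map prod_list.Nil id_apply)
next
 case (Cons r g)
 have "has_sspec (series_mult (power_sum r) (power_sum_partition g)) 0 m
   (\<Sum>i\<le>(0::nat). \<Sum>j\<le>m. (if j = r then (-1) ^ (r - 1) else 0) *
    (if m - j = sum_list g then (\<Prod>r\<leftarrow>g. (-1) ^ (r - 1)) else 0))"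
  by (rule has_sspec_mult[where u = "%i j. if j = r then (-1) ^ (r - 1) else 0"
     and w = "%i j. if j = sum_list g then (\<Prod>r\<leftarrow>g. (-1) ^ (r - 1)) else 0"])
   (use Cons has_sspec_power_sum[of r] in auto)
 moreover have "(\<Sum>i\<le>(0::nat). \<Sum>j\<le>m. (if j = r then (-1) ^ (r - 1) else 0) *
    (if m - j = sum_list g then (\<Prod>r\<leftarrow>g. (-1) ^ (r - 1)) else 0)) =
   (if m = sum_list (r # g) then (\<Prod>r\<leftarrow>r # g. (-1) ^ (r - 1)) else (0::rat))"
  by (auto simp: if_distrib[of "%z. z * _"] sum.delta cong: if_cong)
 ultimately show ?case by (simp only: power_sum_partition_def foldr.simps o_apply)
qed

section \<open>Chains of shapes as polynomial functions of their length\<close>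

lemma power_antidifference:
 "\<exists>R. \<forall>x. poly R (x + 1) - poly R x = (x :: rat) ^ k"
proof (induction k rule: less_induct)
 case (less k)
 then have "\<forall>i\<in>{..<k}. \<exists>R. \<forall>x. poly R (x + 1) - poly R x = (x :: rat) ^ i" by simp
 from bchoice[OF this] obtain R where "\<forall>i\<in>{..<k}. \<forall>x. poly (R i) (x + 1) - poly (R i) x = (x :: rat) ^ i" ..
 then have R: "poly (R i) (x + 1) - poly (R i) x = x ^ i" if "i < k" for i x using that by simp
 \<comment> \<open>In \<open>(x+1)^(k+1) - x^(k+1)\<close> the leading term is
   \<open>(k+1) x^k\<close>; the lower powers are removed by their own antidifferences.\<close>
 let ?T = "smult (1 / of_nat (Suc k)) (monom 1 (Suc k) - (\<Sum>i<k. smult (of_nat (Suc k choose i)) (R i)))"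
 have "poly ?T (x + 1) - poly ?T x = x ^ k" for x
 proof -
  have "(x + 1) ^ Suc k = (\<Sum>i\<le>Suc k. of_nat (Suc k choose i) * x ^ i)"
   unfolding binomial_ring by simp
  also have "... = (\<Sum>i<k. of_nat (Suc k choose i) * x ^ i) + of_nat (Suc k) * x ^ k + x ^ Suc k"
   unfolding lessThan_Suc_atMost[symmetric] sum.lessThan_Suc binomial_Suc_n binomial_n_n by simp
  finally have *: "(x + 1) ^ Suc k - x ^ Suc k - (\<Sum>i<k. of_nat (Suc k choose i) * x ^ i) = of_nat (Suc k) * x ^ k"
   by simp
  have T: "poly ?T y = 1 / of_nat (Suc k) * (y ^ Suc k - (\<Sum>i<k. of_nat (Suc k choose i) * poly (R i) y))" for y
   by (simp only: poly_smult poly_diff poly_monom poly_sum mult_1)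
  have "poly ?T (x + 1) - poly ?T x = 1 / of_nat (Suc k) * ((x + 1) ^ Suc k - x ^ Suc k
    - (\<Sum>i<k. of_nat (Suc k choose i) * (poly (R i) (x + 1) - poly (R i) x)))"
   unfolding T right_diff_distrib sum_subtractf by simp
  also have "... = 1 / of_nat (Suc k) * (of_nat (Suc k) * x ^ k)"
   unfolding *[symmetric] using R by simp
  finally show ?thesis by (simp del: of_nat_Suc)
 qed
 then show ?case by blast
qed

lemma poly_antidifference: "\<exists>R. \<forall>x :: rat. poly R (x + 1) - poly R x = poly Q x"
proof -
 obtain R where R: "!!k x. poly (R k) (x + 1) - poly (R k) x = (x :: rat) ^ k"
  using choice[of "%k R. \<forall>x. poly R (x + 1) - poly R x = (x :: rat) ^ k"] power_antidifference by blast
 have "poly (\<Sum>i\<le>degree Q. smult (coeff Q i) (R i)) (x + 1) - poly (\<Sum>i\<le>degree Q. smult (coeff Q i) (R i)) x = poly Q x" for x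
  by (simp add: poly_sum poly_altdef[of Q] R flip: sum_subtractf right_diff_distrib)
 then show ?thesis by blast
qed

text \<open>Tableaux in \<open>N + 1\<close> letters in which the letter 0 occurs \<open>a\<close>
  times and the other contents are free: the smallest shape of the chain is one row of length
  \<open>a\<close>. Without conditions on sizes the recursion is a pure difference equation in
  \<open>N\<close>.\<close>

fun row_chains :: "nat => nat => (nat => nat) => nat" where
 "row_chains a 0 la = (if la = (%i. if i = 0 then a else 0) then 1 else 0)"
| "row_chains a (Suc N) la = (\<Sum>ka | intl ka la. row_chains a N ka)"

lemma row_chains_size:
 assumes "1 \<le> L" shows "is_shape L la ==> row_chains a N la ~= 0 ==> a \<le> ssize L la"
proof (induction N arbitrary: la)
 case 0
 then have "la 0 = a" by (auto split: if_splits)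
 moreover have "la 0 \<le> (\<Sum>i<L. la i)" using assms by (intro member_le_sum) auto
 ultimately show ?case by (simp add: ssize_def)
next
 case (Suc N)
 then have "(\<Sum>ka | intl ka la. row_chains a N ka) ~= 0" by simp
 then obtain ka where "ka \<in> {ka. intl ka la}" "row_chains a N ka ~= 0"
  by (rule sum.not_neutral_contains_not_neutral)
 then show ?case using Suc.IH intl_is_shape[OF Suc.prems(1)] ssize_mono[of ka la L]
  by (metis le_trans mem_Collect_eq)
qed

lemma spec_mons_Suc:
 "(\<Sum>x\<in>spec_mons (Suc N) a m. f x) =
  (\<Sum>j\<le>m. \<Sum>x\<in>spec_mons N a (m - j). f (x + single (Suc N) j))"
proof -
 have z: "lookup x (Suc N) = 0" if "keys x \<subseteq> {..N}" for x :: monomial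
  using that by (meson atMost_iff in_keys_iff not_less_eq_eq order_refl subsetD)
 have rest: "x - single (Suc N) (lookup x (Suc N)) + single (Suc N) (lookup x (Suc N)) = x" for x :: monomial
  by (rule poly_mapping_eqI) (auto simp: lookup_add lookup_minus lookup_single when_def)
 have "(\<Sum>j\<le>m. \<Sum>x\<in>spec_mons N a (m - j). f (x + single (Suc N) j)) =
  (\<Sum>(j, x)\<in>(SIGMA j:{..m}. spec_mons N a (m - j)). f (x + single (Suc N) j))"
  by (subst sum.Sigma) auto
 also have "... = (\<Sum>x\<in>spec_mons (Suc N) a m. f x)"
 proof (rule sum.reindex_bij_witness[where
    j = "%(j, x). x + single (Suc N) j" and
    i = "%x. (lookup x (Suc N), x - single (Suc N) (lookup x (Suc N)))"], goal_cases)
  case (1 p) then show ?case by (auto simp: spec_mons_def lookup_add z)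
 next
  case (2 p) then show ?case
   by (auto simp: spec_mons_def keys_add_nat mon_degree_add lookup_add lookup_single
     split: if_splits intro: le_SucI)
 next
  case (3 x) then show ?case by (simp add: rest)
 next
  case (4 x)
  let ?j = "lookup x (Suc N)" and ?y = "x - single (Suc N) (lookup x (Suc N))"
  have deg: "mon_degree ?y + ?j = a + m" "lookup x 0 = a"
   using 4 mon_degree_add[of ?y "single (Suc N) ?j"] by (auto simp: spec_mons_def rest)
  have l0: "lookup ?y 0 = a" using deg by (simp add: lookup_minus lookup_single)
  then have "a \<le> mon_degree ?y" using lookup_le_mon_degree[of ?y 0] by simp
  moreover have "keys ?y \<subseteq> {..N}"
  proof
   fix v assume "v \<in> keys ?y"
   then have "v \<in> keys x" "v ~= Suc N"
    by (auto simp: in_keys_iff lookup_minus lookup_single when_def split: if_splits)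
   then show "v \<in> {..N}" using 4 by (auto simp: spec_mons_def le_Suc_eq)
  qed
  ultimately show ?case using deg l0 by (auto simp: spec_mons_def)
 next
  case (5 p) then show ?case by (auto simp: case_prod_beta)
 qed
 finally show ?thesis by simp
qed

text \<open>Summing over the exponent of the last variable frees its content: for each
  \<open>ka\<close> only the exponent \<open>j\<close> equal to the size of the strip contributes,
  and what remains is a condition on the total size.\<close>

lemma sum_gt_patterns:
 assumes L: "1 \<le> L"
 shows "is_shape L la ==> (\<Sum>x\<in>spec_mons N a m. gt_patterns L (Suc N) (lookup x) la) =
  (if ssize L la = a + m then row_chains a N la else 0)"
proof (induction N arbitrary: la m)
 case 0
 have U: "spec_mons 0 a m = (if m = 0 then {single 0 a} else {})"
 proof -
  have "spec_mons 0 a m \<subseteq> (if m = 0 then {single 0 a} else {})"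
  proof
   fix x assume x: "x \<in> spec_mons 0 a m"
   have k: "keys x \<subseteq> {0}" using x by (auto simp: spec_mons_def)
   have "lookup x v = lookup (single 0 a) v" for v
    using k x by (cases "v = 0") (auto simp: spec_mons_def lookup_single in_keys_iff)
   then have "x = single 0 a" by (rule poly_mapping_eqI)
   moreover from this have "m = 0" using x by (simp add: spec_mons_def)
   ultimately show "x \<in> (if m = 0 then {single 0 a} else {})" by simp
  qed
  moreover have "single 0 a \<in> spec_mons 0 a 0" by (auto simp: spec_mons_def)
  then have "(if m = 0 then {single 0 a} else {}) \<subseteq> spec_mons 0 a m" by simp
  ultimately show ?thesis by (rule equalityI)
 qed
 have fin: "finite {ka. intl ka la & ssize L ka + a = ssize L la}"
  by (rule finite_subset[OF _ finite_intl[OF 0]]) auto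
 have iff: "intl (%_. 0) la & ssize L la = a \<longleftrightarrow> la = (%i. if i = 0 then a else 0)"
 proof
  assume *: "intl (%_. 0) la & ssize L la = a"
  then have "la (Suc i) = 0" for i by (auto simp: intl_def)
  then have z: "la i = 0" if "i ~= 0" for i using that by (cases i) auto
  have "(\<Sum>i<L. la i) = (\<Sum>i<L. if i = 0 then la 0 else 0)" by (rule sum.cong) (auto simp: z)
  then have "ssize L la = la 0" using L by (simp add: ssize_def sum.delta)
  then have "la 0 = a" using * by simp
  with z show "la = (%i. if i = 0 then a else 0)" by (simp add: fun_eq_iff)
 next
  assume "la = (%i. if i = 0 then a else 0)"
  then show "intl (%_. 0) la & ssize L la = a"
   using L by (auto simp: intl_def ssize_def sum.delta)
 qed
 have "gt_patterns L (Suc 0) (lookup (single 0 a)) la =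
   (if intl (%_. 0) la & ssize L la = a then 1 else 0)"
  using fin by (simp add: sum.delta) (auto simp: ssize_def)
 then show ?case unfolding iff U using L by (auto simp: ssize_def sum.delta)
next
 case (Suc N)
 let ?I = "{ka. intl ka la}"
 have fI: "finite ?I" by (rule finite_intl[OF Suc.prems])
 have insert_last: "gt_patterns L (Suc (Suc N)) (lookup (x + single (Suc N) j)) la =
   (\<Sum>ka\<in>?I. if ssize L ka + j = ssize L la then gt_patterns L (Suc N) (lookup x) ka else 0)"
  if x: "x \<in> spec_mons N a (m - j)" for x j
 proof -
  let ?y = "lookup (x + single (Suc N) j)"
  have "lookup x (Suc N) = 0"
   using x by (auto simp: spec_mons_def in_keys_iff)
  then have "?y (Suc N) = j" by (simp add: lookup_add)
  moreover have "gt_patterns L (Suc N) ?y = gt_patterns L (Suc N) (lookup x)"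
   by (rule ext, rule gt_patterns_cong) (simp add: lookup_add lookup_single)
  ultimately show ?thesis
   using sum.inter_filter[OF fI, of "gt_patterns L (Suc N) (lookup x)" "%ka. ssize L ka + j = ssize L la"]
   by (simp only: gt_patterns.simps(2)[of L "Suc N"] mem_Collect_eq)
 qed
 have "(\<Sum>x\<in>spec_mons (Suc N) a m. gt_patterns L (Suc (Suc N)) (lookup x) la) =
  (\<Sum>j\<le>m. \<Sum>x\<in>spec_mons N a (m - j). \<Sum>ka\<in>?I. if ssize L ka + j = ssize L la then gt_patterns L (Suc N) (lookup x) ka else 0)"
  unfolding spec_mons_Suc by (intro sum.cong refl insert_last)
 also have "... = (\<Sum>j\<le>m. \<Sum>ka\<in>?I. \<Sum>x\<in>spec_mons N a (m - j). if ssize L ka + j = ssize L la then gt_patterns L (Suc N) (lookup x) ka else 0)"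
  by (intro sum.cong refl sum.swap)
 also have "... = (\<Sum>ka\<in>?I. \<Sum>j\<le>m. \<Sum>x\<in>spec_mons N a (m - j). if ssize L ka + j = ssize L la then gt_patterns L (Suc N) (lookup x) ka else 0)"
  by (rule sum.swap)
 also have "... = (\<Sum>ka\<in>?I. \<Sum>j\<le>m. if ssize L ka + j = ssize L la then
   (\<Sum>x\<in>spec_mons N a (m - j). gt_patterns L (Suc N) (lookup x) ka) else 0)"
  by (intro sum.cong refl) (simp del: gt_patterns.simps)
 also have "... = (\<Sum>ka\<in>?I. if ssize L la = a + m then row_chains a N ka else 0)"
 proof (rule sum.cong[OF refl])
  fix ka assume "ka \<in> ?I"
  then have sk: "is_shape L ka" and le: "ssize L ka \<le> ssize L la"
   using intl_is_shape[OF Suc.prems] ssize_mono by auto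
  have "(\<Sum>j\<le>m. if ssize L ka + j = ssize L la then
   (\<Sum>x\<in>spec_mons N a (m - j). gt_patterns L (Suc N) (lookup x) ka) else 0) =
   (\<Sum>j\<le>m. if j = ssize L la - ssize L ka then
     (if ssize L ka = a + (m - j) then row_chains a N ka else 0) else 0)"
  proof (intro sum.cong refl)
   fix j
   have "ssize L ka + j = ssize L la \<longleftrightarrow> j = ssize L la - ssize L ka" using le by auto
   then show "(if ssize L ka + j = ssize L la then
     (\<Sum>x\<in>spec_mons N a (m - j). gt_patterns L (Suc N) (lookup x) ka) else 0) =
    (if j = ssize L la - ssize L ka then (if ssize L ka = a + (m - j) then row_chains a N ka else 0) else 0)"
    by (simp only: Suc.IH[OF sk])
  qed
  also have "... = (if ssize L la - ssize L ka \<le> m & ssize L ka = a + (m - (ssize L la - ssize L ka))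
    then row_chains a N ka else 0)"
   by (simp add: sum.delta)
  also have "... = (if ssize L la = a + m then row_chains a N ka else 0)"
  proof (cases "row_chains a N ka = 0")
   case False
   \<comment> \<open>A chain that exists starts with \<open>a\<close> boxes, so the strip has at
     most \<open>m\<close> of them when the total size is \<open>a + m\<close>; without this the
     truncated differences would not match.\<close>
   then have "a \<le> ssize L ka" by (rule row_chains_size[OF L sk])
   then have "ssize L la - ssize L ka \<le> m & ssize L ka = a + (m - (ssize L la - ssize L ka))
     \<longleftrightarrow> ssize L la = a + m" using le by arith
   then show ?thesis by simp
  qed simp
  finally show "(\<Sum>j\<le>m. if ssize L ka + j = ssize L la then
   (\<Sum>x\<in>spec_mons N a (m - j). gt_patterns L (Suc N) (lookup x) ka) else 0) =
   (if ssize L la = a + m then row_chains a N ka else 0)" .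
 qed
 finally show ?case by simp
qed

text \<open>The skew shape \<open>ka / (a)\<close> is a vertical strip. It appears by reciprocity:
  at \<open>N = -1\<close> the chains of horizontal strips are replaced by a single vertical strip,
  with a sign.\<close>

definition row_plus_vert_strip :: "nat => (nat => nat) => bool" where
 "row_plus_vert_strip a ka \<longleftrightarrow> a \<le> ka 0 & ka 0 \<le> a + 1 & (\<forall>i\<ge>1. ka i \<le> 1)"

text \<open>All admissible \<open>\<kappa>\<close> cancel in pairs that differ by one box in the last nonzero row of \<open>\<lambda>\<close>.\<close>

lemma row_plus_vert_strip_sum:
 assumes L: "1 \<le> L" and s: "is_shape L la"
 shows "(\<Sum>ka | intl ka la. if row_plus_vert_strip a ka then (-1) ^ (a + ssize L ka) else 0) =
  (if la = (%i. if i = 0 then a else 0) then 1 else (0::rat))"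
proof -
 let ?w = "%ka. (-1 :: rat) ^ (a + ssize L ka)"
 define A where "A = {ka. intl ka la & row_plus_vert_strip a ka}"
 have sumA: "(\<Sum>ka | intl ka la. if row_plus_vert_strip a ka then ?w ka else 0) = (\<Sum>ka\<in>A. ?w ka)"
  using sum.inter_filter[OF finite_intl[OF s], of ?w "row_plus_vert_strip a"]
  unfolding A_def by simp
 have dec: "la j \<le> la i" if "i \<le> j" for i j using is_shape_antimono[OF s that] .
 \<comment> \<open>In row \<open>i\<close> only the lengths \<open>b\<close> and
   \<open>b + 1\<close> are possible, and \<open>la\<close> admits both; \<open>t\<close> exchanges
   them. This changes the size by one and therefore the sign.\<close>
 have toggle: "(\<Sum>ka\<in>A. ?w ka) = 0"
  if i: "i < L" and lo: "la (Suc i) \<le> b" and hi: "b + 1 \<le> la i"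
   and opt: "!!ka. row_plus_vert_strip a ka ==> ka i = b \<or> ka i = b + 1"
   and ok: "!!ka. row_plus_vert_strip a ka ==> row_plus_vert_strip a (ka(i := 2 * b + 1 - ka i))" for i b
 proof -
  define t where "t ka = ka(i := 2 * b + 1 - ka i)" for ka :: "nat => nat"
  have tA: "t ka \<in> A" "t (t ka) = ka" "?w (t ka) = - ?w ka" if "ka \<in> A" for ka
  proof -
   have il: "intl ka la" and v: "row_plus_vert_strip a ka" using that by (auto simp: A_def)
   note o = opt[OF v]
   show "t ka \<in> A" using il ok[OF v] o lo hi unfolding A_def t_def
    by (auto simp: intl_def)
   show "t (t ka) = ka" using o by (auto simp: t_def)
   have "ssize L (t ka) + ka i = ssize L ka + (2 * b + 1 - ka i)"
    using i unfolding ssize_def t_def by (simp add: sum.remove[of "{..<L}" i])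
   then have "ssize L (t ka) = ssize L ka + 1 \<or> ssize L ka = ssize L (t ka) + 1"
    using o by auto
   then show "?w (t ka) = - ?w ka" by auto
  qed
  have "(\<Sum>ka\<in>A. ?w ka) = (\<Sum>ka\<in>A. - ?w ka)"
   by (rule sum.reindex_bij_witness[where i = t and j = t]) (use tA in auto)
  then show ?thesis by (simp add: sum_negf)
 qed
 show ?thesis
 proof (cases "\<exists>i\<ge>1. la i ~= 0")
  case True
  define S where "S = {i. la i ~= 0}"
  have big: "la j = 0" if "L \<le> j" for j using s that by (simp add: is_shape_def)
  have "S \<subseteq> {..<L}"
  proof
   fix j assume "j \<in> S"
   then show "j \<in> {..<L}" using big[of j] by (cases "j < L") (auto simp: S_def)
  qed
  then have fS: "finite S" by (rule finite_subset) simp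
  define i where "i = Max S"
  obtain i1 where i1: "i1 \<ge> 1" "i1 \<in> S" using True by (auto simp: S_def)
  have "i \<in> S" unfolding i_def by (rule Max_in[OF fS]) (use i1 in blast)
  moreover have "i1 \<le> i" unfolding i_def by (rule Max_ge[OF fS i1(2)])
  ultimately have i: "i \<ge> 1" "la i ~= 0" using i1 by (auto simp: S_def)
  have "Suc i \<notin> S" using Max_ge[OF fS, of "Suc i"] unfolding i_def by (metis not_less_eq_eq order_refl)
  then have z: "la (Suc i) = 0" by (simp add: S_def)
  have "i < L" using i(2) big[of i] by (cases "i < L") auto
  then have "(\<Sum>ka\<in>A. ?w ka) = 0"
   by (rule toggle[of i 0]) (use i z in "auto simp: row_plus_vert_strip_def le_Suc_eq")
  moreover have "la ~= (%i. if i = 0 then a else 0)" using i by (auto dest: fun_cong[of _ _ i])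
  ultimately show ?thesis using sumA by simp
 next
  case False
  then have z: "la i = 0" if "i \<ge> 1" for i using that by blast
  show ?thesis
  proof (cases "la 0 \<ge> a + 1")
   case True
   have "(\<Sum>ka\<in>A. ?w ka) = 0"
    by (rule toggle[of 0 a]) (use L True z in "auto simp: row_plus_vert_strip_def")
   moreover have "la ~= (%i. if i = 0 then a else 0)" using True by (auto dest: fun_cong[of _ _ 0])
   ultimately show ?thesis using sumA by simp
  next
   case le: False
   show ?thesis
   proof (cases "la 0 = a")
    case True
    have "A = {%i. if i = 0 then a else 0}"
    proof (intro equalityI subsetI)
     fix ka assume "ka \<in> A"
     then have le: "ka i \<le> la i" and "a \<le> ka 0" for i
      by (auto simp: A_def row_plus_vert_strip_def intl_def)
     then have "ka i = (if i = 0 then a else 0)" for i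
      using z[of i] True le[of i] by (cases "i = 0") auto
     then show "ka \<in> {%i. if i = 0 then a else 0}" by auto
    qed (use z True in "auto simp: A_def row_plus_vert_strip_def intl_def")
    moreover have "ssize L (%i. if i = 0 then a else 0) = a"
     using L by (simp add: ssize_def sum.delta)
    moreover have "la = (%i. if i = 0 then a else 0)" using z True by (auto simp: fun_eq_iff)
    ultimately show ?thesis using sumA by (simp flip: power_add mult_2)
   next
    case False
    then have lt: "la 0 < a" using le by simp
    have "A = {}"
    proof (intro equals0I)
     fix ka assume "ka \<in> A"
     then have "ka 0 \<le> la 0" "a \<le> ka 0" by (auto simp: A_def row_plus_vert_strip_def intl_def)
     then show False using lt by simp
    qed
    moreover have "la ~= (%i. if i = 0 then a else 0)" using False by (auto dest: fun_cong[of _ _ 0])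
    ultimately show ?thesis using sumA by simp
   qed
  qed
 qed
qed

text \<open>In the recursion the summand \<open>ka = la\<close> is the function itself one step
  earlier, and the other summands belong to smaller shapes. So the polynomial \<open>T\<close>
  solves \<open>T (x+1) - T x = Q x\<close>. One step backwards from 0 gives
  \<open>T (-1) = T 0 - Q (-1)\<close>, which the cancellation of signs identifies.\<close>

lemma row_chains_polynomial:
 assumes L: "1 \<le> L"
 shows "is_shape L la ==> \<exists>P. (\<forall>N. poly P (of_nat N) = of_nat (row_chains a N la)) &
  poly P (-1) = (if row_plus_vert_strip a la then (-1) ^ (a + ssize L la) else (0::rat))"
proof (induction "ssize L la" arbitrary: la rule: less_induct)
 case (less la)
 note s = less.prems
 let ?I = "{ka. intl ka la}"
 have fI: "finite ?I" by (rule finite_intl[OF s])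
 have laI: "la \<in> ?I" using s by (auto simp: intl_def is_shape_def)
 let ?w = "%ka. if row_plus_vert_strip a ka then (-1) ^ (a + ssize L ka) else (0::rat)"
 have "\<exists>P. (\<forall>N. poly P (of_nat N) = of_nat (row_chains a N ka)) & poly P (-1) = ?w ka"
  if ka: "ka \<in> ?I - {la}" for ka
 proof (rule less.hyps)
  show sk: "is_shape L ka" using ka intl_is_shape[OF s] by auto
  have le: "ka i \<le> la i" for i using ka by (auto simp: intl_def)
  obtain i where i: "ka i ~= la i" using ka by auto
  then have "i < L" using s sk by (metis is_shape_def linorder_not_less)
  then show "ssize L ka < ssize L la" unfolding ssize_def
   using le i by (intro sum_strict_mono_ex1) (auto intro!: bexI[of _ i] simp: nat_less_le)
 qed
 then have "\<forall>ka\<in>?I - {la}. \<exists>P. (\<forall>N. poly P (of_nat N) = of_nat (row_chains a N ka)) & poly P (-1) = ?w ka"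
  by (intro ballI)
 from bchoice[OF this] obtain P where "\<forall>ka\<in>?I - {la}. (\<forall>N. poly (P ka) (of_nat N) = of_nat (row_chains a N ka))
   & poly (P ka) (-1) = ?w ka" ..
 then have P: "poly (P ka) (of_nat N) = of_nat (row_chains a N ka)" "poly (P ka) (-1) = ?w ka"
  if "ka \<in> ?I - {la}" for ka N using that by blast+
 define Q where "Q = (\<Sum>ka\<in>?I - {la}. P ka)"
 obtain R where R: "!!x. poly R (x + 1) - poly R x = poly Q x" using poly_antidifference[of Q] by blast
 define T where "T = R + [:of_nat (row_chains a 0 la) - poly R 0:]"
 have T: "poly T (x + 1) = poly T x + poly Q x" for x using R[of x] by (simp add: T_def algebra_simps)
 have "poly T (of_nat N) = of_nat (row_chains a N la)" for N
 proof (induction N)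
  case 0 then show ?case by (simp add: T_def)
 next
  case (Suc N)
  have "poly T (of_nat (Suc N)) = of_nat (row_chains a N la) + poly Q (of_nat N)"
   using T[of "of_nat N"] Suc by (simp add: add.commute)
  also have "poly Q (of_nat N) = of_nat (\<Sum>ka\<in>?I - {la}. row_chains a N ka)"
   using P(1) by (simp add: Q_def poly_sum)
  finally show ?case using sum.remove[OF fI laI, of "row_chains a N"] by simp
 qed
 moreover have "poly T (-1) = ?w la"
 proof -
  have "poly T 0 = poly T (-1) + poly Q (-1)" using T[of "-1"] by simp
  moreover have "poly T 0 = (if la = (%i. if i = 0 then a else 0) then 1 else 0)" by (simp add: T_def)
  moreover have "poly Q (-1) = (\<Sum>ka\<in>?I - {la}. ?w ka)" using P(2) by (simp add: Q_def poly_sum)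
  moreover have "(\<Sum>ka\<in>?I. ?w ka) = ?w la + (\<Sum>ka\<in>?I - {la}. ?w ka)" by (rule sum.remove[OF fI laI])
  ultimately show ?thesis using row_plus_vert_strip_sum[OF L s, of a] by simp
 qed
 ultimately show ?case by blast
qed

lemma has_sspec_schur_strip:
 assumes p: "is_partition v"
 shows "has_sspec (schur v) a m (of_bool (sum_list v = a + m & row_plus_vert_strip a (part v)))"
proof -
 define L where "L = Suc (length v)"
 have L: "1 \<le> L" "length v \<le> L" by (auto simp: L_def)
 note s = is_shape_part[OF p L(2)]
 obtain P where P: "!!N. poly P (of_nat N) = (of_nat (row_chains a N (part v)) :: rat)"
  "poly P (-1) = (if row_plus_vert_strip a (part v) then (-1) ^ (a + ssize L (part v)) else (0::rat))"
  using row_chains_polynomial[OF L(1) s, of a] by blast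
 have spec: "spec_sum (schur v) a m N = (if sum_list v = a + m then of_nat (row_chains a N (part v)) else 0)" for N
 proof -
  have "spec_sum (schur v) a m N = (\<Sum>x\<in>spec_mons N a m. of_nat (gt_patterns L (Suc N) (lookup x) (part v)))"
   unfolding spec_sum_def
   by (intro sum.cong refl schur_eq_gt_patterns[OF p L(2)]) (auto simp: spec_mons_def)
  then show ?thesis using sum_gt_patterns[OF L(1) s, of N a m] ssize_part[OF L(2)]
   by (simp flip: of_nat_sum del: gt_patterns.simps)
 qed
 show ?thesis
  by (rule has_sspecI[where P = "if sum_list v = a + m then P else 0"])
   (use P spec ssize_part[OF L(2)] in "auto simp: power_add mult_ac simp flip: power_mult_distrib")
qed

section \<open>Hooks and the pair sums of their coefficients\<close>

definition hook :: "nat => nat => nat list" where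
 "hook a m = a # replicate m 1"

lemma hook_partition: "1 \<le> a ==> is_partition (hook a m)"
proof -
 have "sorted_wrt (\<ge>) (replicate m (1 :: nat))" by (induction m) auto
 then show "1 \<le> a ==> is_partition (hook a m)" by (auto simp: hook_def is_partition_def)
qed

lemma hook_inject [simp]: "hook a m = hook b k \<longleftrightarrow> a = b & m = k"
 by (auto simp: hook_def dest: arg_cong[of _ _ length])

lemma hook_ne_Nil [simp]: "hook a m ~= []" "[] ~= hook a m" by (simp_all add: hook_def)

lemma is_hook_iff: "is_hook v \<longleftrightarrow> (\<exists>a m. 1 \<le> a & v = hook a m)"
 by (simp add: is_hook_def hook_def)

text \<open>A row with a vertical strip attached has all further rows of length at most 1, and the
  strip may or may not have a box in the first row. The two resulting hooks are the terms of the
  product of \<open>h_a\<close> and \<open>e_m\<close>; the last alternative is the empty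
  shape.\<close>

lemma strip_iff_hook:
 assumes p: "is_partition v"
 shows "sum_list v = a + m & row_plus_vert_strip a (part v) \<longleftrightarrow>
  1 \<le> a & v = hook a m \<or> 1 \<le> m & v = hook (Suc a) (m - 1) \<or> a = 0 & m = 0 & v = []"
proof (cases v)
 case Nil
 then show ?thesis by (auto simp: row_plus_vert_strip_def part_def)
next
 case (Cons b u)
 have pos: "x \<ge> 1" if "x \<in> set v" for x using p that by (cases x) (auto simp: is_partition_def)
 have part: "part v 0 = b" "part v (Suc i) = part u i" for i by (auto simp: part_def Cons)
 define k where "k = length u"
 have col: "(\<forall>i\<ge>1. part v i \<le> 1) \<longleftrightarrow> u = replicate k 1"
 proof
  assume *: "\<forall>i\<ge>1. part v i \<le> 1"
  have "u ! i = 1" if "i < length u" for i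
  proof -
   have "part v (Suc i) \<le> 1" using * by simp
   moreover have "u ! i \<ge> 1" using pos that Cons by auto
   ultimately show ?thesis using that by (simp add: part part_def[of u])
  qed
  then show "u = replicate k 1" by (intro nth_equalityI) (auto simp: k_def)
 next
  assume *: "u = replicate k 1"
  show "\<forall>i\<ge>1. part v i \<le> 1"
  proof (intro allI impI)
   fix i :: nat assume "i \<ge> 1"
   then obtain j where "i = Suc j" by (cases i) auto
   then have "part v i = part u j" by (simp add: part)
   also have "... \<le> 1" by (subst *) (simp add: part_def)
   finally show "part v i \<le> 1" .
  qed
 qed
 have b: "b \<ge> 1" using pos Cons by simp
 have rep: "u = replicate j 1 \<longleftrightarrow> j = k & u = replicate k 1" for j
  using arg_cong[of u "replicate j 1" length] by (auto simp: k_def)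
 show ?thesis
 proof (cases "u = replicate k 1")
  case True
  then have "sum_list v = b + k" by (simp add: Cons sum_list_replicate)
  then have "sum_list v = a + m & row_plus_vert_strip a (part v) \<longleftrightarrow> b + k = a + m & a \<le> b & b \<le> a + 1"
   unfolding row_plus_vert_strip_def col part(1) using True by simp
  also have "... \<longleftrightarrow> 1 \<le> a & b = a & m = k \<or> 1 \<le> m & b = Suc a & m - 1 = k" using b by arith
  finally show ?thesis using True unfolding hook_def Cons list.inject rep[of m] rep[of "m - 1"] by simp
 next
  case False
  then have "\<not> row_plus_vert_strip a (part v)" unfolding row_plus_vert_strip_def col by simp
  then show ?thesis using False unfolding hook_def Cons list.inject rep[of m] rep[of "m - 1"] by simp
 qed
qed

lemma has_sspec_schur:
 assumes "is_partition v"
 shows "has_sspec (schur v) a m (of_bool (1 \<le> a & v = hook a m \<or>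
  1 \<le> m & v = hook (Suc a) (m - 1) \<or> a = 0 & m = 0 & v = []))"
 using has_sspec_schur_strip[OF assms, of a m] unfolding strip_iff_hook[OF assms] .

text \<open>The Hall product with \<open>h_a e_m\<close> in terms of Schur coefficients. The guards
  exclude lists with first part 0 and the truncation in \<open>m - 1\<close>.\<close>

definition sspec_of :: "(nat list => rat) => nat => nat => rat" where
 "sspec_of c a m = (if 1 \<le> a then c (hook a m) else 0) +
   (if 1 \<le> m then c (hook (Suc a) (m - 1)) else 0) + (if a = 0 & m = 0 then c [] else 0)"

lemma has_sspec_expn:
 assumes "is_schur_expansion f c"
 shows "has_sspec f a m (sspec_of c a m)"
proof -
 let ?S = "{v. c v ~= 0}"
 have S: "finite ?S" "!!v. v \<in> ?S ==> is_partition v" and f: "f = (%x. \<Sum>v\<in>?S. c v * schur v x)"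
  using assms by (auto simp: is_schur_expansion_def schur_series_def)
 have "has_sspec f a m (\<Sum>v\<in>?S. c v * of_bool (1 \<le> a & v = hook a m \<or>
  1 \<le> m & v = hook (Suc a) (m - 1) \<or> a = 0 & m = 0 & v = []))"
  by (subst f) (intro has_sspec_lincomb S has_sspec_schur)
 also have "(\<Sum>v\<in>?S. c v * of_bool (1 \<le> a & v = hook a m \<or>
   1 \<le> m & v = hook (Suc a) (m - 1) \<or> a = 0 & m = 0 & v = [])) =
  (\<Sum>v\<in>?S. (if v = hook a m then (if 1 \<le> a then c (hook a m) else 0) else 0) +
    (if v = hook (Suc a) (m - 1) then (if 1 \<le> m then c (hook (Suc a) (m - 1)) else 0) else 0) +
    (if v = [] then (if a = 0 & m = 0 then c [] else 0) else 0))"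
  by (rule sum.cong) auto
 also have "... = sspec_of c a m"
  using S(1) by (auto simp: sum.distrib sum.delta sspec_of_def)
 finally show ?thesis .
qed

section \<open>The operator adjoint to multiplication by an elementary function\<close>

lemma has_sspec_sym:
 "f \<in> Sym ==> has_sspec f a m (sspec_of (schur_coeff f) a m)"
 by (rule has_sspec_expn[OF schur_coeff_expn])

lemma elem_eq_hook: "1 \<le> k ==> elementary k = schur (hook 1 (k - 1))"
 by (cases k) (auto simp: elementary_def hook_def)

lemma elem_sym: "1 \<le> k ==> elementary k \<in> Sym"
 by (simp add: elem_eq_hook schur_in_Sym hook_partition)

lemma has_sspec_elem:
 assumes "1 \<le> k"
 shows "has_sspec (elementary k) a m
  ((if a = 1 & m = k - 1 then 1 else 0) + (if a = 0 & m = k then 1 else 0))"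
proof -
 have "has_sspec (elementary k) a m (of_bool (1 \<le> a & hook 1 (k - 1) = hook a m \<or>
   1 \<le> m & hook 1 (k - 1) = hook (Suc a) (m - 1) \<or> a = 0 & m = 0 & hook 1 (k - 1) = []))"
  unfolding elem_eq_hook[OF assms] by (rule has_sspec_schur) (simp add: hook_partition)
 moreover have "of_bool (1 \<le> a & hook 1 (k - 1) = hook a m \<or>
   1 \<le> m & hook 1 (k - 1) = hook (Suc a) (m - 1) \<or> a = 0 & m = 0 & hook 1 (k - 1) = []) =
   (if a = 1 & m = k - 1 then 1 else 0) + (if a = 0 & m = k then 1 else (0 :: rat))"
  using assms by (auto split: if_splits)
 ultimately show ?thesis by simp
qed

lemma sspec_elem_mult:
 assumes k: "1 \<le> k" and h: "h \<in> Sym"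
 shows "sspec_of (schur_coeff (series_mult (elementary k) h)) a m =
  (if k \<le> m then sspec_of (schur_coeff h) a (m - k) else 0) +
  (if 1 \<le> a & k - 1 \<le> m then sspec_of (schur_coeff h) (a - 1) (m - (k - 1)) else 0)"
proof -
 let ?S = "sspec_of (schur_coeff h)"
 have "has_sspec (series_mult (elementary k) h) a m
   (\<Sum>i\<le>a. \<Sum>j\<le>m. ((if i = 1 & j = k - 1 then 1 else 0) + (if i = 0 & j = k then 1 else 0)) * ?S (a - i) (m - j))"
  by (rule has_sspec_mult[where w = ?S]) (intro has_sspec_elem k has_sspec_sym h)+
 moreover have "(\<Sum>i\<le>a. \<Sum>j\<le>m. ((if i = 1 & j = k - 1 then 1 else 0) + (if i = 0 & j = k then 1 else 0)) * ?S (a - i) (m - j))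
  = (\<Sum>i\<le>a. \<Sum>j\<le>m. (if i = 1 then if j = k - 1 then ?S (a - 1) (m - (k - 1)) else 0 else 0)
    + (if i = 0 then if j = k then ?S a (m - k) else 0 else 0))"
  by (intro sum.cong refl) auto
 moreover have "... = (\<Sum>i\<le>a. (if i = 1 then if k - 1 \<le> m then ?S (a - 1) (m - (k - 1)) else 0 else 0)
    + (if i = 0 then if k \<le> m then ?S a (m - k) else 0 else 0))"
  by (intro sum.cong refl) (simp add: sum.distrib sum.delta)
 moreover have "... = (if k \<le> m then ?S a (m - k) else 0) + (if 1 \<le> a & k - 1 \<le> m then ?S (a - 1) (m - (k - 1)) else 0)"
  by (simp add: sum.distrib sum.delta)
 moreover have "has_sspec (series_mult (elementary k) h) a m
   (sspec_of (schur_coeff (series_mult (elementary k) h)) a m)"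
  by (intro has_sspec_sym series_mult_sym elem_sym k h)
 ultimately show ?thesis using has_sspec_unique by metis
qed

text \<open>Only pair sums are known, but at \<open>m = 0\<close> the pair has one term. The
  coefficient of \<open>(a, 1^(m+1))\<close> is then the pair sum minus the coefficient of
  \<open>(a+1, 1^m)\<close>, which the induction hypothesis supplies; this requires the claim for
  all \<open>a\<close>. The last summand belongs to a column that is removed completely.\<close>

lemma pieri_hook:
 assumes k: "1 \<le> k" and h: "h \<in> Sym" and "1 \<le> a"
 shows "schur_coeff (series_mult (elementary k) h) (hook a m) =
  (if k \<le> m then schur_coeff h (hook a (m - k)) else 0) +
  (if k \<le> m + 1 & 2 \<le> a then schur_coeff h (hook (a - 1) (m + 1 - k)) else 0) +
  (if k = m + 1 & a = 1 then schur_coeff h [] else 0)"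
 using \<open>1 \<le> a\<close>
proof (induction m arbitrary: a)
 case 0
 then show ?case using sspec_elem_mult[OF k h, of a 0] k
  by (cases "k = 1"; cases "a = 1") (simp_all add: sspec_of_def)
next
 case (Suc m)
 have eq: "schur_coeff (series_mult (elementary k) h) (hook a (Suc m)) +
   schur_coeff (series_mult (elementary k) h) (hook (Suc a) m) =
  (if k \<le> Suc m then sspec_of (schur_coeff h) a (Suc m - k) else 0) +
  (if k - 1 \<le> Suc m then sspec_of (schur_coeff h) (a - 1) (Suc m - (k - 1)) else 0)"
  using sspec_elem_mult[OF k h, of a "Suc m"] Suc.prems
  by (simp add: sspec_of_def)
 have IH: "schur_coeff (series_mult (elementary k) h) (hook (Suc a) m) =
  (if k \<le> m then schur_coeff h (hook (Suc a) (m - k)) else 0) +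
  (if k \<le> m + 1 then schur_coeff h (hook a (m + 1 - k)) else 0)"
  using Suc.IH[of "Suc a"] Suc.prems by simp
 consider "m + 3 \<le> k" | "k = m + 2" | "k \<le> m + 1" by linarith
 then show ?case
 proof cases
  case 1 then show ?thesis using eq IH by (simp add: sspec_of_def)
 next
  case 2 then show ?thesis using eq IH Suc.prems by (cases "a = 1") (simp_all add: sspec_of_def)
 next
  case le: 3
  define j where "j = m + 1 - k"
  have 3: "m + 1 = k + j" using le by (simp add: j_def)
  then have *: "Suc m - k = j" "Suc m - (k - 1) = Suc j" "m + 1 - k = j" "Suc m + 1 - k = Suc j" "k \<le> Suc m" "k - 1 \<le> Suc m"
   using k by auto
  show ?thesis
  proof (cases j)
   case 0 then show ?thesis using eq IH Suc.prems * 3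
    by (cases "a = 1") (simp_all add: sspec_of_def)
  next
   case (Suc i)
   then have "k \<le> m" "m - k = i" using 3 by auto
   then show ?thesis using eq IH Suc.prems * Suc
    by (cases "a = 1") (simp_all add: sspec_of_def)
  qed
 qed
qed

lemma hall_eq_sum:
 assumes "finite S" "!!v. schur_coeff f v ~= 0 ==> v \<in> S"
 shows "hall f g = (\<Sum>v\<in>S. schur_coeff f v * schur_coeff g v)"
 unfolding hall_def by (rule sum.mono_neutral_left) (use assms in auto)

lemma hall_schur_left: "is_partition v ==> hall (schur v) g = schur_coeff g v"
proof -
 assume p: "is_partition v"
 have "hall (schur v) g = (\<Sum>u\<in>{v}. schur_coeff (schur v) u * schur_coeff g u)"
  by (rule hall_eq_sum) (auto simp: schur_coeff_schur[OF p] split: if_splits)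
 then show ?thesis by (simp add: schur_coeff_schur[OF p])
qed

lemma hall_lincomb_left:
 assumes "finite I" "!!i. i \<in> I ==> f i \<in> Sym"
 shows "hall (%x. \<Sum>i\<in>I. a i * f i x) g = (\<Sum>i\<in>I. a i * hall (f i) g)"
proof -
 let ?S = "\<Union>i\<in>I. {v. schur_coeff (f i) v ~= 0}"
 have exp: "is_schur_expansion (f i) (schur_coeff (f i))" if "i \<in> I" for i
  using assms(2)[OF that] by (rule schur_coeff_expn)
 have S: "finite ?S" using assms(1) exp by (auto simp: is_schur_expansion_def)
 have c: "schur_coeff (%x. \<Sum>i\<in>I. a i * f i x) = (%v. \<Sum>i\<in>I. a i * schur_coeff (f i) v)"
  by (intro schur_coeff_eqI schur_expn_lincomb assms(1) exp)
 have nz: "v \<in> ?S" if "(\<Sum>i\<in>I. a i * schur_coeff (f i) v) ~= 0" for v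
 proof (rule ccontr)
  assume "v \<notin> ?S"
  then have "(\<Sum>i\<in>I. a i * schur_coeff (f i) v) = 0" by (intro sum.neutral) auto
  with that show False by simp
 qed
 have "hall (%x. \<Sum>i\<in>I. a i * f i x) g = (\<Sum>v\<in>?S. (\<Sum>i\<in>I. a i * schur_coeff (f i) v) * schur_coeff g v)"
  by (rule hall_eq_sum[OF S, of "%x. \<Sum>i\<in>I. a i * f i x" g, unfolded c]) (rule nz)
 also have "... = (\<Sum>i\<in>I. a i * (\<Sum>v\<in>?S. schur_coeff (f i) v * schur_coeff g v))"
  by (simp add: sum_distrib_left sum_distrib_right mult.assoc sum.swap[of _ I])
 also have "... = (\<Sum>i\<in>I. a i * hall (f i) g)"
  by (intro sum.cong refl arg_cong2[where f = "(*)"] hall_eq_sum[OF S, symmetric]) blast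
 finally show ?thesis .
qed

lemma sym_function_eqI:
 assumes "f \<in> Sym" "g \<in> Sym"
  "!!v. is_partition v ==> schur_coeff f v = schur_coeff g v"
 shows "f = g"
proof -
 note e = schur_coeff_expn[OF assms(1)] schur_coeff_expn[OF assms(2)]
 have "schur_coeff f = schur_coeff g"
 proof
  fix v show "schur_coeff f v = schur_coeff g v"
   using e assms(3)[of v] unfolding is_schur_expansion_def by (cases "is_partition v") metis+
 qed
 then show ?thesis using e unfolding is_schur_expansion_def by metis
qed

text \<open>\<open>e_perp\<close> is a definite description. Testing adjointness against Schur
  functions fixes every Schur coefficient, which gives the uniqueness.\<close>

lemma e_perp_eqI:
 assumes g: "g \<in> Sym"
  and adj: "!!h. h \<in> Sym ==> hall g h = hall f (series_mult (elementary k) h)"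
 shows "e_perp k f = g"
 unfolding e_perp_def
proof (rule the_equality)
 show "g \<in> Sym & (\<forall>h\<in>symmetric_functions. hall g h = hall f (series_mult (elementary k) h))"
  using g adj by blast
next
 fix g' assume g': "g' \<in> Sym & (\<forall>h\<in>symmetric_functions. hall g' h = hall f (series_mult (elementary k) h))"
 show "g' = g"
 proof (rule sym_function_eqI)
  fix v assume p: "is_partition v"
  then have "hall g' (schur v) = hall g (schur v)"
   using g' adj schur_in_Sym by metis
  then show "schur_coeff g' v = schur_coeff g v" using g g' p by (simp add: hall_schur_right)
 qed (use g g' in auto)
qed

lemma sum_fun_apply': "(\<Sum>i\<in>I. f i) x = (\<Sum>i\<in>I. f i x)"
 by (induction I rule: infinite_finite_induct) auto

lemma Sym_add:
 assumes "f \<in> Sym" "g \<in> Sym" shows "f + g \<in> Sym"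
 using Sym_sum[of "{True, False}" "%b. if b then f else g" "%_. 1"] assms
 by (simp add: plus_fun_def)

lemma Sym_zero: "0 \<in> Sym"
 by (auto simp: symmetric_functions_def)

lemma Sym_Sum:
 assumes "finite I" "!!i. i \<in> I ==> f i \<in> Sym"
 shows "(\<Sum>i\<in>I. f i) \<in> Sym"
 using assms by (induction I rule: finite_induct) (auto simp: Sym_zero Sym_add)

lemma hall_Sum:
 assumes "finite I" "!!i. i \<in> I ==> f i \<in> Sym"
 shows "hall (\<Sum>i\<in>I. f i) g = (\<Sum>i\<in>I. hall (f i) g)"
proof -
 have "(\<Sum>i\<in>I. f i) = (%x. \<Sum>i\<in>I. 1 * f i x)" by (simp add: fun_eq_iff sum_fun_apply')
 then show ?thesis using hall_lincomb_left[OF assms, where a = "%_. 1" and g = g] by simp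
qed

lemma hall_add:
 assumes "f \<in> Sym" "g \<in> Sym"
 shows "hall (f + g) h = hall f h + hall g h"
 using hall_Sum[of "{True, False}" "%b. if b then f else g" h] assms by simp

lemma hall_zero: "hall 0 g = 0"
 using hall_Sum[of "{}" "%_. 0" g] by simp

text \<open>Pieri's rule read backwards. The condition on hooks with first part 1 excludes a column
  of height exactly \<open>k\<close>: it would leave the empty partition, whose Schur function does
  not occur on the right-hand side.\<close>

lemma e_perp_sum_hooks:
 assumes k: "1 \<le> k" and I: "finite I"
  and a: "!!i. i \<in> I ==> 1 \<le> a i" and m: "!!i. i \<in> I ==> a i = 1 ==> k \<le> m i"
 shows "e_perp k (\<Sum>i\<in>I. schur (hook (a i) (m i))) =
  (\<Sum>i\<in>I. (if k \<le> m i then schur (hook (a i) (m i - k)) else 0) +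
    (if k \<le> m i + 1 & 2 \<le> a i then schur (hook (a i - 1) (m i + 1 - k)) else 0))"
  (is "e_perp k ?f = (\<Sum>i\<in>I. ?p i + ?q i)")
proof (rule e_perp_eqI)
 have sym: "?p i \<in> Sym" "?q i \<in> Sym" if "i \<in> I" for i
  using a[OF that] by (auto intro!: schur_in_Sym hook_partition Sym_zero)
 then show "(\<Sum>i\<in>I. ?p i + ?q i) \<in> Sym"
  by (intro Sym_Sum I Sym_add)
 fix h assume h: "h \<in> Sym"
 have "hall (\<Sum>i\<in>I. ?p i + ?q i) h = (\<Sum>i\<in>I. hall (?p i) h + hall (?q i) h)"
  using sym I by (simp only: hall_Sum hall_add Sym_add cong: sum.cong)
 also have "... = (\<Sum>i\<in>I. hall (schur (hook (a i) (m i))) (series_mult (elementary k) h))"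
 proof (rule sum.cong[OF refl])
  fix i assume i: "i \<in> I"
  show "hall (?p i) h + hall (?q i) h = hall (schur (hook (a i) (m i))) (series_mult (elementary k) h)"
   using pieri_hook[OF k h a[OF i], of "m i"] a[OF i] m[OF i]
   by (auto simp: hall_schur_left hook_partition hall_zero)
 qed
 also have "... = hall ?f (series_mult (elementary k) h)"
  by (rule hall_Sum[symmetric]) (intro I schur_in_Sym hook_partition a)+
 finally show "hall (\<Sum>i\<in>I. ?p i + ?q i) h = hall ?f (series_mult (elementary k) h)" .
qed

section \<open>Polynomials: derivatives and substitutions\<close>

lemma Const_mult_lookup [simp]: "lookup (Const c * p) m = c * lookup p m"
proof -
 have "Const c * p = Poly_Mapping.map ((*) c) p" unfolding Const_def by (rule mult_map_scale_conv_mult[symmetric])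
 then show ?thesis by (simp add: map.rep_eq when_def)
qed

lemma Const_add: "Const (a + b) = Const a + Const b"
 and Const_mult: "Const (a * b) = Const a * Const b"
 and Const_0 [simp]: "Const 0 = 0"
 and Const_1 [simp]: "Const 1 = 1"
 and Const_minus: "Const (- a) = - Const a"
 by (simp_all add: Const_def single_add mult_single single_uminus)

lemma Const_of_nat: "Const (of_nat i) = of_nat i"
 by (induction i) (simp_all add: Const_add)

lemma Const_sum: "Const (\<Sum>i\<in>I. f i) = (\<Sum>i\<in>I. Const (f i))"
 by (induction I rule: infinite_finite_induct) (simp_all add: Const_add)

lemma lookup_sum: "lookup (\<Sum>i\<in>I. f i) m = (\<Sum>i\<in>I. lookup (f i) m)"
 by (induction I rule: infinite_finite_induct) (simp_all add: lookup_add)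

lemma mons_sum:
 assumes "finite S" "keys p \<subseteq> S"
 shows "(\<Sum>m\<in>S. single m (lookup p m)) = p"
proof (rule poly_mapping_eqI)
 fix m
 have "lookup (\<Sum>m\<in>S. single m (lookup p m)) m =
   (\<Sum>x\<in>S. if x = m then lookup p m else 0)"
  unfolding lookup_sum by (rule sum.cong) (auto simp: lookup_single when_def)
 also have "... = lookup p m"
  using assms by (auto simp: sum.delta in_keys_iff)
 finally show "lookup (\<Sum>m\<in>S. single m (lookup p m)) m = lookup p m" .
qed

text \<open>The definition subtracts exponents with truncation. Read coefficientwise no truncation
  is left, and linearity and commutation of derivatives become pointwise identities.\<close>

lemma lookup_pd:
 "lookup (pd v p) m =
   of_nat (lookup m v + 1) * lookup p (m + single v 1)"
proof -
 let ?e = "single v (1 :: nat)"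
 have "lookup (pd v p) m = (\<Sum>m'\<in>keys p.
   if m' = m + ?e then of_nat (lookup m v + 1) * lookup p (m + ?e) else 0)"
  unfolding partial_deriv_def lookup_sum
 proof (rule sum.cong[OF refl])
  fix m' assume "m' \<in> keys p"
  show "lookup (single (m' - ?e) (of_nat (lookup m' v) * lookup p m')) m =
   (if m' = m + ?e then of_nat (lookup m v + 1) * lookup p (m + ?e) else 0)"
  proof (cases "lookup m' v = 0")
   case True
   then have "m' ~= m + ?e" by (auto simp: lookup_add)
   then show ?thesis using True by simp
  next
   case False
   then have "m' - ?e + ?e = m'"
    by (intro poly_mapping_eqI) (auto simp: lookup_add lookup_minus lookup_single when_def)
   then have "m' - ?e = m \<longleftrightarrow> m' = m + ?e" by auto
   then show ?thesis by (auto simp: lookup_single when_def lookup_add)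
  qed
 qed
 also have "... = of_nat (lookup m v + 1) * lookup p (m + ?e)"
  by (auto simp: sum.delta in_keys_iff)
 finally show ?thesis .
qed

lemma pd_add: "pd v (p + q) = pd v p + pd v q"
 by (rule poly_mapping_eqI) (simp add: lookup_pd lookup_add algebra_simps)

lemma pd_zero [simp]: "pd v 0 = 0"
 by (simp add: partial_deriv_def)

lemma pd_sum: "pd v (\<Sum>i\<in>I. f i) = (\<Sum>i\<in>I. pd v (f i))"
 by (induction I rule: infinite_finite_induct) (simp_all add: pd_add)

lemma pd_scale: "pd v (Const c * p) = Const c * pd v p"
 by (rule poly_mapping_eqI) (simp add: lookup_pd)

lemma pd_commute: "pd v (pd w p) = pd w (pd v p)"
 by (rule poly_mapping_eqI)
  (simp add: lookup_pd lookup_add lookup_single when_def add_ac)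

lemma pd_single:
 "pd v (single m c) =
   single (m - single v 1) (of_nat (lookup m v) * c)"
 by (cases "c = 0") (simp_all add: partial_deriv_def)

lemma pd_mult: "pd v (p * q) = pd v p * q + p * pd v q"
proof -
 have single: "pd v (single a x * single b y) =
   pd v (single a x) * single b y +
   single a x * pd v (single b y)"
  for a b :: "nat \<times> nat \<Rightarrow>\<^sub>0 nat" and x y :: rat
 proof -
  let ?e = "single v (1 :: nat)"
  have 1: "single (a - ?e + b) (of_nat (lookup a v) * x * y) =
    single (a + b - ?e) (of_nat (lookup a v) * x * y)"
  proof (cases "lookup a v = 0")
   case False
   then have "a - ?e + b = a + b - ?e"
    by (intro poly_mapping_eqI) (auto simp: lookup_add lookup_minus lookup_single when_def)
   then show ?thesis by simp
  qed simp
  have 2: "single (a + (b - ?e)) (x * (of_nat (lookup b v) * y)) =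
    single (a + b - ?e) (x * (of_nat (lookup b v) * y))"
  proof (cases "lookup b v = 0")
   case False
   then have "a + (b - ?e) = a + b - ?e"
    by (intro poly_mapping_eqI) (auto simp: lookup_add lookup_minus lookup_single when_def)
   then show ?thesis by simp
  qed simp
  show ?thesis unfolding mult_single pd_single 1 2 single_add[symmetric]
   by (simp add: lookup_add algebra_simps)
 qed
 let ?P = "keys p" and ?Q = "keys q"
 let ?p = "%a. single a (lookup p a)" and ?q = "%b. single b (lookup q b)"
 have pq: "p = (\<Sum>a\<in>?P. ?p a)" "q = (\<Sum>b\<in>?Q. ?q b)" by (simp_all add: mons_sum)
 have "pd v ((\<Sum>a\<in>?P. ?p a) * (\<Sum>b\<in>?Q. ?q b)) =
  pd v (\<Sum>a\<in>?P. ?p a) * (\<Sum>b\<in>?Q. ?q b) + (\<Sum>a\<in>?P. ?p a) * pd v (\<Sum>b\<in>?Q. ?q b)"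
  unfolding sum_product pd_sum single sum.distrib ..
 then show ?thesis by (simp only: pq[symmetric])
qed

lemma pd_Const [simp]: "pd v (Const c) = 0"
 by (simp add: Const_def pd_single)

lemma pd_one [simp]: "pd v 1 = 0"
 using pd_Const[of v 1] by simp

lemma pd_Var: "pd v (Var w) = (if v = w then 1 else 0)"
proof (cases "v = w")
 case True
 have "single w (1::nat) - single w 1 = 0" by simp
 then show ?thesis using True by (simp add: Var_def pd_single flip: single_one)
next
 case False then show ?thesis by (simp add: Var_def pd_single lookup_single)
qed

lemma pd_uminus: "pd v (- p) = - pd v p"
 using pd_scale[of v "-1" p] by (simp add: Const_minus)

lemma pd_diff: "pd v (p - q) = pd v p - pd v q"
 using pd_add[of v p "-q"] by (simp add: pd_uminus)

section \<open>Substitution homomorphisms\<close>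

definition eval_mon :: "(nat \<times> nat => mpoly) => (nat \<times> nat \<Rightarrow>\<^sub>0 nat) => mpoly" where
 "eval_mon f m = (\<Prod>v\<in>keys m. f v ^ lookup m v)"

lemma eval_mon_superset:
 "finite S ==> keys m \<subseteq> S ==> eval_mon f m = (\<Prod>v\<in>S. f v ^ lookup m v)"
 unfolding eval_mon_def by (rule prod.mono_neutral_left) (auto simp: in_keys_iff)

lemma eval_mon_add: "eval_mon f (a + b) = eval_mon f a * eval_mon f b"
proof -
 let ?S = "keys a \<union> keys b"
 have "keys (a + b) \<subseteq> ?S" by (rule Poly_Mapping.keys_add)
 then show ?thesis
  by (simp add: eval_mon_superset[of ?S] lookup_add power_add prod.distrib)
qed

lemma eval_mon_single: "eval_mon f (single v i) = f v ^ i"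
 by (cases "i = 0") (simp_all add: eval_mon_def)

lemma sbst_superset:
 assumes "finite S" "keys p \<subseteq> S"
 shows "sbst f p = (\<Sum>m\<in>S. Const (lookup p m) * eval_mon f m)"
 unfolding substitute_def eval_mon_def
 by (rule sum.mono_neutral_left) (use assms in "auto simp: in_keys_iff")

lemma sbst_add: "sbst f (p + q) = sbst f p + sbst f q"
proof -
 let ?S = "keys p \<union> keys q"
 have "keys (p + q) \<subseteq> ?S" by (rule Poly_Mapping.keys_add)
 then show ?thesis
  by (simp add: sbst_superset[of ?S] lookup_add Const_add distrib_right sum.distrib)
qed

lemma sbst_zero [simp]: "sbst f 0 = 0"
 by (simp add: substitute_def)

lemma sbst_sum: "sbst f (\<Sum>i\<in>I. g i) = (\<Sum>i\<in>I. sbst f (g i))"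
 by (induction I rule: infinite_finite_induct) (simp_all add: sbst_add)

lemma sbst_single: "sbst f (single m c) = Const c * eval_mon f m"
 by (cases "c = 0") (simp_all add: substitute_def eval_mon_def)

lemma sbst_mult: "sbst f (p * q) = sbst f p * sbst f q"
proof -
 let ?P = "keys p" and ?Q = "keys q"
 let ?p = "%a. single a (lookup p a)" and ?q = "%b. single b (lookup q b)"
 have pq: "p = (\<Sum>a\<in>?P. ?p a)" "q = (\<Sum>b\<in>?Q. ?q b)" by (simp_all add: mons_sum)
 have "sbst f (?p a * ?q b) = sbst f (?p a) * sbst f (?q b)" for a b
  by (simp add: mult_single sbst_single eval_mon_add Const_mult)
 then have "sbst f ((\<Sum>a\<in>?P. ?p a) * (\<Sum>b\<in>?Q. ?q b)) =
  sbst f (\<Sum>a\<in>?P. ?p a) * sbst f (\<Sum>b\<in>?Q. ?q b)"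
  unfolding sum_product sbst_sum by simp
 then show ?thesis by (simp only: pq[symmetric])
qed

lemma sbst_Const [simp]: "sbst f (Const c) = Const c"
 by (simp add: Const_def[of c] sbst_single eval_mon_def) 

lemma sbst_one [simp]: "sbst f 1 = 1"
 using sbst_Const[of f 1] by simp

lemma sbst_Var [simp]: "sbst f (Var v) = f v"
 by (simp add: Var_def sbst_single eval_mon_single)

lemma sbst_scale: "sbst f (Const c * p) = Const c * sbst f p"
 by (simp add: sbst_mult)

lemma sbst_uminus: "sbst f (- p) = - sbst f p"
 using sbst_scale[of f "-1" p] by (simp add: Const_minus)

lemma sbst_diff: "sbst f (p - q) = sbst f p - sbst f q"
 using sbst_add[of f p "-q"] by (simp add: sbst_uminus)

lemma sbst_prod: "sbst f (\<Prod>i\<in>I. g i) = (\<Prod>i\<in>I. sbst f (g i))"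
 by (induction I rule: infinite_finite_induct) (simp_all add: sbst_mult)

lemma single_eq_Const_eval: "single m c = Const c * eval_mon Var m"
proof -
 have vp: "Var v ^ i = single (single v i) 1" for v i
  by (induction i) (simp_all add: Var_def mult_single single_add[symmetric] flip: single_one)
 have "finite S ==> (\<Prod>v\<in>S. Var v ^ lookup m v) =
   single (\<Sum>v\<in>S. single v (lookup m v)) 1" for S
  by (induction S rule: finite_induct) (simp_all add: vp mult_single flip: single_one)
 moreover have "(\<Sum>v\<in>keys m. single v (lookup m v)) = m"
 proof (rule poly_mapping_eqI)
  fix w
  have ls: "lookup (\<Sum>i\<in>I. f i) w = (\<Sum>i\<in>I. lookup (f i) w)"
   for I and f :: "nat \<times> nat => nat \<times> nat \<Rightarrow>\<^sub>0 nat"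
   by (induction I rule: infinite_finite_induct) (simp_all add: lookup_add)
  have "lookup (\<Sum>v\<in>keys m. single v (lookup m v)) w =
   (\<Sum>v\<in>keys m. if v = w then lookup m w else 0)"
   unfolding ls by (rule sum.cong) (auto simp: lookup_single when_def)
  then show "lookup (\<Sum>v\<in>keys m. single v (lookup m v)) w = lookup m w"
   by (auto simp: sum.delta in_keys_iff)
 qed
 ultimately have "eval_mon Var m = single m 1" by (simp add: eval_mon_def)
 then show ?thesis by (simp add: Const_def mult_single)
qed

definition polys_in :: "(nat \<times> nat) set => mpoly set" where
 "polys_in X = {p. \<forall>m\<in>keys p. keys m \<subseteq> X}"

lemma pring_eq: "poly_ring k n = polys_in ({..<k} \<times> {..<n})"
 by (simp add: poly_ring_def polys_in_def)

lemma polys_in_induct [consumes 1, case_names Const Var add mult]: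
 assumes p: "p \<in> polys_in X" and C: "!!c. P (Const c)" and V: "!!v. v \<in> X ==> P (Var v)"
  and A: "!!p q. P p ==> P q ==> P (p + q)" and M: "!!p q. P p ==> P q ==> P (p * q)"
 shows "P p"
proof -
 have one: "P 1" using C[of 1] by simp
 have pow: "P q ==> P (q ^ i)" for q i by (induction i) (auto intro: M one)
 have pr: "finite S ==> (!!v. v \<in> S ==> P (f v)) ==> P (\<Prod>v\<in>S. f v)" for S and f :: "nat \<times> nat => mpoly"
  by (induction S rule: finite_induct) (auto intro: M one)
 have sm: "finite S ==> (!!v. v \<in> S ==> P (f v)) ==> P (\<Sum>v\<in>S. f v)"
  for S and f :: "(nat \<times> nat \<Rightarrow>\<^sub>0 nat) => mpoly"
  by (induction S rule: finite_induct) (use C[of 0] in "auto intro: A")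
 have "P (\<Sum>m\<in>keys p. single m (lookup p m))"
 proof (rule sm)
  fix m assume m: "m \<in> keys p"
  show "P (single m (lookup p m))"
   unfolding single_eq_Const_eval eval_mon_def
   by (intro M C pr pow V) (use m p in "auto simp: polys_in_def")
 qed simp
 then show ?thesis by (simp add: mons_sum)
qed

lemma polys_in_UNIV [simp]: "p \<in> polys_in UNIV"
 by (simp add: polys_in_def)

lemma polys_in_iff: "p \<in> polys_in X \<longleftrightarrow> (\<forall>m. lookup p m ~= 0 --> keys m \<subseteq> X)"
 by (auto simp: polys_in_def in_keys_iff)

lemma polys_in_add: "p \<in> polys_in X ==> q \<in> polys_in X ==> p + q \<in> polys_in X"
 unfolding polys_in_iff lookup_add by (metis add.right_neutral)

lemma polys_in_zero [simp]: "0 \<in> polys_in X" by (simp add: polys_in_def)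

lemma polys_in_sum: "(!!i. i \<in> I ==> f i \<in> polys_in X) ==> (\<Sum>i\<in>I. f i) \<in> polys_in X"
 by (induction I rule: infinite_finite_induct) (auto intro: polys_in_add)

lemma polys_in_mult: assumes "p \<in> polys_in X" "q \<in> polys_in X" shows "p * q \<in> polys_in X"
proof -
 have "\<exists>a b. m = a + b & a \<in> keys p & b \<in> keys q" if "m \<in> keys (p * q)" for m
  using keys_mult[of p q] that by auto
 then show ?thesis using assms Poly_Mapping.keys_add unfolding polys_in_def by fastforce
qed

lemma polys_in_Const [simp]: "Const c \<in> polys_in X"
 by (auto simp: polys_in_iff Const_def lookup_single when_def)

lemma polys_in_Var: "v \<in> X ==> Var v \<in> polys_in X"
 by (auto simp: polys_in_iff Var_def lookup_single when_def)

lemma polys_in_diff: "p \<in> polys_in X ==> q \<in> polys_in X ==> p - q \<in> polys_in X"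
 unfolding polys_in_iff lookup_minus by (metis diff_0_right)

lemma polys_in_prod: "(!!i. i \<in> I ==> f i \<in> polys_in X) ==> (\<Prod>i\<in>I. f i) \<in> polys_in X"
 by (induction I rule: infinite_finite_induct) (use polys_in_Const[of 1] in "auto intro: polys_in_mult")

lemma polys_in_pd: "p \<in> polys_in X ==> pd v p \<in> polys_in X"
 unfolding polys_in_iff lookup_pd using keys_add_nat[of _ "single v 1"]
 by (metis Un_subset_iff mult_zero_right)

lemma polys_in_mono: "X \<subseteq> Y ==> polys_in X \<subseteq> polys_in Y" by (auto simp: polys_in_def)

lemma sbst_cong: "p \<in> polys_in X ==> (!!v. v \<in> X ==> f v = g v) ==> sbst f p = sbst g p"
 by (induction p rule: polys_in_induct) (auto simp: sbst_add sbst_mult)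

lemma sbst_sbst: "sbst f (sbst g p) = sbst (%v. sbst f (g v)) p"
 using polys_in_UNIV[of p] by (induction p rule: polys_in_induct) (auto simp: sbst_add sbst_mult)

lemma sbst_ident: "sbst Var p = p"
 using polys_in_UNIV[of p] by (induction p rule: polys_in_induct) (auto simp: sbst_add sbst_mult)

lemma chain_rule:
 assumes "p \<in> polys_in X" "finite X"
 shows "pd v (sbst f p) = (\<Sum>w\<in>X. pd v (f w) * sbst f (pd w p))"
 using assms(1)
proof (induction p rule: polys_in_induct)
 case (Var u)
 have "(\<Sum>w\<in>X. pd v (f w) * sbst f (pd w (Var u))) = (\<Sum>w\<in>X. if w = u then pd v (f u) else 0)"
  by (rule sum.cong) (auto simp: pd_Var)
 then show ?case using Var assms(2) by (simp add: sum.delta)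
next
 case (mult p q)
 have "(\<Sum>w\<in>X. pd v (f w) * sbst f (pd w (p * q))) =
   (\<Sum>w\<in>X. pd v (f w) * sbst f (pd w p)) * sbst f q +
   sbst f p * (\<Sum>w\<in>X. pd v (f w) * sbst f (pd w q))"
  by (simp add: pd_mult sbst_add sbst_mult distrib_left sum.distrib
    sum_distrib_left sum_distrib_right mult_ac)
 then show ?case by (simp add: sbst_mult pd_mult mult)
qed (simp_all add: sbst_add pd_add distrib_left sum.distrib)

lemma span_closed:
 assumes p: "p \<in> mpoly.span G" and W: "mpoly.subspace W"
  and add: "!!p q. F (p + q) = F p + F q" and scale: "!!c p. F (Const c * p) = Const c * F p"
  and gen: "!!g. g \<in> G ==> F g \<in> W"
 shows "F p \<in> W"
 using p
proof (induction p rule: mpoly.span_induct_alt)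
 case base
 have "F 0 = 0" using scale[of 0 0] by simp
 then show ?case using mpoly.subspace_0[OF W] by simp
next
 case (step c x y)
 then show ?case using W gen by (auto simp: add scale intro: mpoly.subspace_add mpoly.subspace_scale)
qed

section \<open>Degrees and alternating polynomials\<close>

definition rdeg :: "nat => nat => (nat \<times> nat \<Rightarrow>\<^sub>0 nat) => nat" where
 "rdeg n i m = (\<Sum>j<n. lookup m (i, j))"

definition homog :: "nat => monomial => mpoly => bool" where
 "homog n d p \<longleftrightarrow> (\<forall>m i. lookup p m ~= 0 --> rdeg n i m = lookup d i)"

lemma rdeg_add: "rdeg n i (a + b) = rdeg n i a + rdeg n i b"
 by (simp add: rdeg_def lookup_add sum.distrib)

lemma rdeg_single:
 "j < n ==> rdeg n i (single (r, j) e) = (if i = r then e else 0)"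
 by (cases "i = r") (simp_all add: rdeg_def lookup_single when_def sum.delta)

lemma homog_zero [simp]: "homog n d 0" by (simp add: homog_def)

lemma homog_add: "homog n d p ==> homog n d q ==> homog n d (p + q)"
 unfolding homog_def lookup_add by (metis add.right_neutral)

lemma homog_diff: "homog n d p ==> homog n d q ==> homog n d (p - q)"
 unfolding homog_def lookup_minus by (metis diff_0_right)

lemma homog_sum: "(!!i. i \<in> I ==> homog n d (f i)) ==> homog n d (\<Sum>i\<in>I. f i)"
 by (induction I rule: infinite_finite_induct) (auto intro: homog_add)

lemma homog_scale: "homog n d p ==> homog n d (Const c * p)"
 by (auto simp: homog_def)

lemma homog_mult:
 assumes "homog n d p" "homog n d' q" shows "homog n (d + d') (p * q)"
 unfolding homog_def
proof (intro allI impI)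
 fix m i assume "lookup (p * q) m ~= 0"
 then have "m \<in> keys (p * q)" by (simp add: in_keys_iff)
 then obtain a b where "m = a + b" "a \<in> keys p" "b \<in> keys q"
  using keys_mult[of p q] by auto
 then show "rdeg n i m = lookup (d + d') i"
  using assms by (simp add: homog_def in_keys_iff rdeg_add lookup_add)
qed

lemma homog_Var: "j < n ==> homog n (single r 1) (Var (r, j))"
 by (auto simp: homog_def Var_def lookup_single when_def rdeg_single[of j n])

text \<open>Multidegrees are subtracted with truncation. Therefore statements on derivatives come in
  two versions: the degree of the row is properly lowered, or it is exhausted and the result is
  zero.\<close>

lemma homog_pd:
 assumes "homog n d p" "j < n" "1 \<le> lookup d r"
 shows "homog n (d - single r 1) (pd (r, j) p)"
 unfolding homog_def lookup_pd
proof (intro allI impI)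
 fix m i
 assume "of_nat (lookup m (r, j) + 1) * lookup p (m + single (r, j) 1) ~= 0"
 then have "rdeg n i (m + single (r, j) 1) = lookup d i"
  using assms(1) by (auto simp: homog_def)
 then show "rdeg n i m = lookup (d - single r 1) i"
  using assms(2,3) by (auto simp: rdeg_add rdeg_single lookup_minus lookup_single when_def split: if_splits)
qed

lemma pd_degree_zero:
 assumes "homog n d p" "j < n" "lookup d r = 0"
 shows "pd (r, j) p = 0"
proof (rule poly_mapping_eqI)
 fix m
 have "lookup p (m + single (r, j) 1) = 0"
 proof (rule ccontr)
  assume "lookup p (m + single (r, j) 1) ~= 0"
  then have "rdeg n r (m + single (r, j) 1) = 0"
   using assms by (auto simp: homog_def)
  then show False using assms(2) by (simp add: rdeg_add rdeg_single)
 qed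
 then show "lookup (pd (r, j) p) m = lookup 0 m"
  by (simp add: lookup_pd)
qed

lemma homog_pd_funpow:
 assumes "homog n d p" "j < n"
 shows "e \<le> lookup d r ==> homog n (d - single r e) ((pd (r, j) ^^ e) p)"
proof (induction e)
 case 0
 have "d - single r 0 = d" by simp
 then show ?case using assms(1) by simp
next
 case (Suc e)
 have "homog n (d - single r e - single r 1) (pd (r, j) ((pd (r, j) ^^ e) p))"
  by (rule homog_pd) (use Suc assms in "auto simp: lookup_minus")
 moreover have "d - single r e - single r 1 = d - single r (Suc e)"
  by (rule poly_mapping_eqI) (auto simp: lookup_minus lookup_single when_def)
 ultimately show ?case by simp
qed

lemma pd_funpow_zero [simp]: "(pd v ^^ e) 0 = 0"
 by (induction e) auto

lemma pd_funpow_degree_zero: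
 assumes "homog n d p" "j < n" "lookup d r < e"
 shows "(pd (r, j) ^^ e) p = 0"
proof -
 let ?l = "lookup d r"
 have "homog n (d - single r ?l) ((pd (r, j) ^^ ?l) p)"
  by (rule homog_pd_funpow) (use assms in auto)
 then have z: "pd (r, j) ((pd (r, j) ^^ ?l) p) = 0"
  by (rule pd_degree_zero) (use assms in "auto simp: lookup_minus")
 have "e = (e - Suc ?l) + Suc ?l" using assms by simp
 then have "(pd (r, j) ^^ e) p = (pd (r, j) ^^ (e - Suc ?l)) ((pd (r, j) ^^ Suc ?l) p)"
  by (metis comp_apply funpow_add)
 then show ?thesis using z by simp
qed

lemma homog_pol:
 assumes "homog n d p" "e \<le> lookup d s"
 shows "homog n (d - single s e + single r 1) (pol n r s e p)"
 unfolding polarization_def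
proof (rule homog_sum)
 fix j assume "j \<in> {..<n}"
 then show "homog n (d - single s e + single r 1) (Var (r, j) * (pd (s, j) ^^ e) p)"
  using assms homog_mult[OF homog_Var homog_pd_funpow] by (simp add: add.commute)
qed

lemma pol_degree_zero:
 assumes "homog n d p" "lookup d s < e" shows "pol n r s e p = 0"
 unfolding polarization_def using pd_funpow_degree_zero[OF assms(1) _ assms(2)] by (simp add: sum.neutral)

text \<open>The degree of the Vandermonde determinant, in the form in which it is compared with sums
  of distinct exponents.\<close>

definition top_degree :: "nat => nat" where "top_degree n = (\<Sum>j<n. j)"

definition pairs :: "nat => (nat \<times> nat) set" where "pairs n = {(i, j). i < j & j < n}"

lemma finite_pairs [simp]: "finite (pairs n)"
 by (rule finite_subset[of _ "{..<n} \<times> {..<n}"]) (auto simp: pairs_def)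

lemma card_pairs: "card (pairs n) = top_degree n"
proof -
 have "bij_betw prod.swap (pairs n) (SIGMA j:{..<n}. {..<j})"
  by (rule bij_betw_byWitness[where f' = prod.swap]) (auto simp: pairs_def)
 then have "card (pairs n) = card (SIGMA j:{..<n}. {..<j})" by (rule bij_betw_same_card)
 then show ?thesis by (simp add: top_degree_def)
qed

lemma vdm_eq: "vdm n = (\<Prod>p\<in>pairs n. Var (0, fst p) - Var (0, snd p))"
 unfolding vandermonde_def pairs_def by (rule prod.cong) auto

lemma homog_vdm: "homog n (single 0 (top_degree n)) (vdm n)"
proof -
 have "finite S ==> S \<subseteq> pairs n ==> homog n (single 0 (card S)) (\<Prod>p\<in>S. Var (0, fst p) - Var (0, snd p))" for S
 proof (induction S rule: finite_induct)
  case empty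
  have "homog n 0 1" by (auto simp: homog_def lookup_one when_def rdeg_def)
  then show ?case by simp
 next
  case (insert x S)
  have "homog n (single 0 1) (Var (0, fst x) - Var (0, snd x))"
   using insert.prems by (intro homog_diff homog_Var) (auto simp: pairs_def)
  moreover have "single (0::nat) (card (insert x S)) = single 0 1 + single 0 (card S)"
   using insert.hyps by (simp flip: single_add)
  ultimately show ?case using insert homog_mult by simp
 qed
 from this[OF finite_pairs order_refl] show ?thesis by (simp add: vdm_eq card_pairs)
qed

lemma vdm_in_row: "vdm n \<in> polys_in ({0} \<times> {..<n})"
 unfolding vdm_eq by (intro polys_in_prod polys_in_diff polys_in_Var) (auto simp: pairs_def)

section \<open>Column permutations and the Vandermonde determinant\<close>

definition col_perm :: "(nat => nat) => mpoly => mpoly" where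
 "col_perm s = sbst (%(i, j). Var (i, s j))"

lemma col_perm_add: "col_perm s (p + q) = col_perm s p + col_perm s q"
 and col_perm_mult: "col_perm s (p * q) = col_perm s p * col_perm s q"
 and col_perm_Const: "col_perm s (Const c) = Const c"
 and col_perm_scale: "col_perm s (Const c * p) = Const c * col_perm s p"
 and col_perm_Var: "col_perm s (Var (i, j)) = Var (i, s j)"
 and col_perm_sum: "col_perm s (\<Sum>x\<in>I. f x) = (\<Sum>x\<in>I. col_perm s (f x))"
 and col_perm_diff: "col_perm s (p - q) = col_perm s p - col_perm s q"
 and col_perm_uminus: "col_perm s (- p) = - col_perm s p"
 and col_perm_zero: "col_perm s 0 = 0"
 by (simp_all add: col_perm_def sbst_add sbst_mult sbst_sum sbst_diff sbst_uminus)

lemma col_perm_comp: "col_perm (f o g) p = col_perm f (col_perm g p)"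
 unfolding col_perm_def sbst_sbst by (simp add: case_prod_beta')

lemma col_perm_id: "col_perm id p = p"
 using sbst_ident[of p] by (simp add: col_perm_def id_def)

lemma col_perm_pd:
 assumes "inj g" shows "col_perm g (pd (s, j) p) = pd (s, g j) (col_perm g p)"
 using polys_in_UNIV[of p]
proof (induction p rule: polys_in_induct)
 case (Const c) then show ?case by (simp add: col_perm_Const col_perm_zero)
next
 case (Var v)
 obtain i j' where "v = (i, j')" by force
 then show ?case using assms col_perm_Const[of g 1]
  by (auto simp: pd_Var col_perm_Var col_perm_zero inj_eq)
qed (simp_all add: pd_add pd_mult col_perm_add col_perm_mult)

lemma col_perm_pd_funpow:
 "inj g ==> col_perm g ((pd (s, j) ^^ e) p) = (pd (s, g j) ^^ e) (col_perm g p)"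
 by (induction e) (auto simp: col_perm_pd)

lemma col_perm_pol:
 assumes "g permutes {..<n}" shows "col_perm g (pol n r s e p) = pol n r s e (col_perm g p)"
proof -
 have "col_perm g (pol n r s e p) = (\<Sum>j<n. Var (r, g j) * (pd (s, g j) ^^ e) (col_perm g p))"
  by (simp add: polarization_def col_perm_sum col_perm_mult col_perm_Var col_perm_pd_funpow permutes_inj[OF assms])
 also have "... = pol n r s e (col_perm g p)"
  unfolding polarization_def
  by (rule sum.permute[OF assms, symmetric, unfolded o_def])
 finally show ?thesis .
qed

text \<open>An adjacent transposition preserves the order in every pair except
  \<open>(a, a+1)\<close>: it permutes the other factors and reverses this one.\<close>

lemma vdm_adjacent:
 assumes "Suc a < n" shows "col_perm (transpose a (Suc a)) (vdm n) = - vdm n"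
proof -
 let ?t = "transpose a (Suc a)"
 let ?P = "pairs n - {(a, Suc a)}"
 let ?f = "%p. Var (0, fst p) - Var (0, snd p)"
 have mem: "(a, Suc a) \<in> pairs n" using assms by (simp add: pairs_def)
 have "(?t i, ?t j) \<in> ?P" if "(i, j) \<in> ?P" for i j
  using that assms by (auto simp: pairs_def transpose_def split: if_splits)
 then have maps: "map_prod ?t ?t ` ?P \<subseteq> ?P" by force
 have "bij_betw (map_prod ?t ?t) ?P ?P"
  by (rule bij_betw_byWitness[where f' = "map_prod ?t ?t"]) (use maps in auto)
 from prod.reindex_bij_betw[OF this, of ?f]
 have eq: "(\<Prod>p\<in>?P. Var (0, ?t (fst p)) - Var (0, ?t (snd p))) = (\<Prod>p\<in>?P. ?f p)" by simp
 have "col_perm ?t (\<Prod>p\<in>pairs n. ?f p) = (\<Prod>p\<in>pairs n. Var (0, ?t (fst p)) - Var (0, ?t (snd p)))"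
  by (simp add: col_perm_def sbst_prod sbst_diff)
 also have "... = (Var (0, Suc a) - Var (0, a)) * (\<Prod>p\<in>?P. ?f p)"
  using prod.remove[OF finite_pairs mem, of "%p. Var (0, ?t (fst p)) - Var (0, ?t (snd p))"] eq by simp
 also have "... = - (\<Prod>p\<in>pairs n. ?f p)"
  using prod.remove[OF finite_pairs mem, of ?f] by (simp add: algebra_simps)
 finally show ?thesis by (simp add: vdm_eq)
qed

lemma vdm_transp:
 assumes "a < b" "b < n" shows "col_perm (transpose a b) (vdm n) = - vdm n"
proof -
 have "a + Suc d < n ==> col_perm (transpose a (a + Suc d)) (vdm n) = - vdm n" for d
 proof (induction d)
  case 0 then show ?case using vdm_adjacent by simp
 next
  case (Suc d)
  let ?c = "a + Suc d"
  have "transpose a (a + Suc (Suc d)) = (transpose ?c (Suc ?c) o transpose a ?c) o transpose ?c (Suc ?c)"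
   by (auto simp: fun_eq_iff transpose_def)
  then show ?case using Suc vdm_adjacent[of ?c n]
   by (simp add: col_perm_comp col_perm_uminus del: comp_apply o_apply)
 qed
 from this[of "b - a - 1"] show ?thesis using assms by simp
qed

lemma vdm_perm:
 assumes "s permutes {..<n}"
 shows "col_perm s (vdm n) = Const (of_int (sign s)) * vdm n"
 using assms finite_lessThan
proof (induction rule: permutes_induct)
 case id show ?case unfolding col_perm_id by (simp add: sign_id)
next
 case (swap a b p)
 have "col_perm (transpose a b) (vdm n) = - vdm n"
  using swap vdm_transp[of a b n] vdm_transp[of b a n]
  by (cases "a < b") (auto simp: transpose_commute)
 moreover have "sign (transpose a b o p) = - sign p"
  using swap by (simp add: sign_compose permutation_swap_id permutes_imp_permutation[of "{..<n}"] sign_swap_id)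
 ultimately show ?case using swap by (simp add: col_perm_comp col_perm_scale Const_minus del: comp_apply o_apply)
qed

definition rename :: "(nat \<times> nat => nat \<times> nat) => mpoly => mpoly" where
 "rename r = sbst (%v. Var (r v))"

text \<open>Bijectivity prevents different monomials from merging, so that a coefficient after
  renaming is a single coefficient before it, at the monomial pulled back by
  \<open>map_key\<close>.\<close>

lemma lookup_rename:
 assumes "bij r" shows "lookup (rename r p) m = lookup p (map_key r m)"
proof -
 have inj: "inj r" and surj: "surj r" using assms by (simp_all add: bij_def)
 have ev: "eval_mon (%v. Var (r v)) a = eval_mon Var b" if b: "map_key r b = a" for a b
 proof -
  have la: "lookup a v = lookup b (r v)" for v
   using b inj by (auto simp: map_key.rep_eq)
  have "bij_betw r (keys a) (keys b)"
  proof (rule bij_betw_imageI)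
   show "inj_on r (keys a)" using inj by (rule inj_on_subset) simp
   show "r ` keys a = keys b"
   proof (intro equalityI subsetI)
    fix w assume w: "w \<in> keys b"
    obtain v where "w = r v" using surj by (metis surjD)
    then show "w \<in> r ` keys a" using w by (auto simp: in_keys_iff la)
   qed (auto simp: in_keys_iff la)
  qed
  from prod.reindex_bij_betw[OF this, of "%w. Var w ^ lookup b w"]
  show ?thesis by (simp add: eval_mon_def la)
 qed
 have ex: "\<exists>b. map_key r b = a" for a
 proof -
  have "map_key r (map_key (inv_into UNIV r) a) = a"
   using inj bij_imp_bij_inv[OF assms] by (intro poly_mapping_eqI) (simp add: map_key.rep_eq bij_is_inj)
  then show ?thesis by blast
 qed
 have inj': "b = b'" if "map_key r b = map_key r b'" for b b' :: "nat \<times> nat \<Rightarrow>\<^sub>0 nat"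
 proof (rule poly_mapping_eqI)
  fix w
  obtain v where "w = r v" using surj by (metis surjD)
  then show "lookup b w = lookup b' w"
   using arg_cong[OF that, of "%x. lookup x v"] inj by (simp add: map_key.rep_eq)
 qed
 have "lookup (Const (lookup p a) * eval_mon (%v. Var (r v)) a) m =
   (if a = map_key r m then lookup p (map_key r m) else 0)" for a
 proof -
  obtain b where b: "map_key r b = a" using ex by blast
  have "eval_mon Var b = single b 1" using single_eq_Const_eval[of b 1] by simp
  then have "lookup (Const (lookup p a) * eval_mon (%v. Var (r v)) a) m =
   (if b = m then lookup p a else 0)"
   by (simp add: ev[OF b] lookup_single when_def)
  moreover have "b = m \<longleftrightarrow> a = map_key r m" using b inj' by auto
  ultimately show ?thesis by auto
 qed
 then have "lookup (rename r p) m = (\<Sum>a\<in>keys p.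
   if a = map_key r m then lookup p (map_key r m) else 0)"
  unfolding rename_def sbst_superset[OF finite_keys order_refl] lookup_sum by simp
 then show ?thesis by (auto simp: sum.delta in_keys_iff)
qed

lemma col_perm_rename: "col_perm s = rename (%(i, j). (i, s j))"
 by (simp add: col_perm_def rename_def case_prod_beta')

lemma bij_col_map: "bij s ==> bij (%(i :: nat, j). (i, s j))"
 by (auto simp: bij_def inj_on_def surj_def)

lemma sum_distinct_nat_ge: "finite S ==> (\<Sum>i<card S. i) \<le> \<Sum>(S :: nat set)"
proof (induction "card S" arbitrary: S)
 case (Suc k)
 have ne: "S ~= {}" using Suc.hyps(2) by auto
 let ?M = "Max S"
 have M: "?M \<in> S" using Suc.prems ne by simp
 have k: "k = card (S - {?M})" using Suc.hyps(2) M Suc.prems by simp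
 have "S \<subseteq> {..?M}" using Suc.prems by auto
 then have "card S \<le> Suc ?M" using card_mono[of "{..?M}" S] by simp
 then have "k \<le> ?M" using Suc.hyps(2) by simp
 moreover have "(\<Sum>i<k. i) \<le> \<Sum>(S - {?M})" using Suc.hyps(1)[OF k] Suc.prems k by simp
 ultimately show ?case using Suc.hyps(2) sum.remove[OF Suc.prems M, of "%x. x"]
  by (metis (no_types, lifting) add.commute add_mono sum.lessThan_Suc)
qed simp

text \<open>In an alternating polynomial a monomial with two equal exponents has a coefficient equal
  to its own negative. So the exponents in row 0 are \<open>n\<close> distinct numbers, and their
  sum is at least 0 + 1 + ... + (n-1).\<close>

lemma alt_low_degree_zero:
 assumes p: "p \<in> polys_in ({0} \<times> {..<n})"
  and alt: "!!a b. a < b ==> b < n ==> col_perm (transpose a b) p = - p"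
  and deg: "homog n d p" "lookup d 0 < top_degree n"
 shows "p = 0"
proof (rule poly_mapping_eqI)
 fix m
 show "lookup p m = lookup 0 m"
 proof (rule ccontr)
  assume "lookup p m ~= lookup 0 m"
  then have nz: "lookup p m ~= 0" by simp
  have keys: "keys m \<subseteq> {0} \<times> {..<n}" using nz p by (simp add: polys_in_iff)
  have ne: "lookup m (0, a) ~= lookup m (0, b)" if ab: "a < b" "b < n" for a b
  proof
   assume eq: "lookup m (0, a) = lookup m (0, b)"
   let ?r = "%(i :: nat, j). (i, transpose a b j)"
   have bij: "bij ?r" by (rule bij_col_map) simp
   have "map_key ?r m = m"
   proof (rule poly_mapping_eqI)
    fix v :: "nat \<times> nat"
    obtain i j where v: "v = (i, j)" by force
    have out: "lookup m (i, j) = 0" if "i ~= 0" for j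
     using keys that by (metis SigmaD1 in_keys_iff singletonD subsetD)
    show "lookup (map_key ?r m) v = lookup m v"
     using bij eq out by (cases "i = 0") (auto simp: map_key.rep_eq bij_is_inj v transpose_def)
   qed
   then have "lookup (col_perm (transpose a b) p) m = lookup p m"
    by (simp add: col_perm_rename lookup_rename[OF bij])
   then have "- lookup p m = lookup p m" using alt[OF ab] by simp
   then show False using nz by simp
  qed
  have inj: "inj_on (%j. lookup m (0, j)) {..<n}"
   using ne by (intro inj_onI) (metis lessThan_iff linorder_neqE_nat)
  have "top_degree n \<le> \<Sum>((%j. lookup m (0, j)) ` {..<n})"
   using sum_distinct_nat_ge[of "(%j. lookup m (0, j)) ` {..<n}"] inj
   by (simp add: card_image top_degree_def)
  also have "... = rdeg n 0 m" using inj by (simp add: sum.reindex rdeg_def)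
  also have "... = lookup d 0" using nz deg(1) by (simp add: homog_def)
  finally show False using deg(2) by simp
 qed
qed

lemma euler:
 assumes "p \<in> polys_in ({0} \<times> {..<n})" "homog n d p"
 shows "pol n 0 0 1 p = Const (of_nat (lookup d 0)) * p"
proof -
 define P where "P = pol n 0 0 1"
 have pol: "P p = (\<Sum>j<n. Var (0, j) * pd (0, j) p)" for p
  by (simp add: P_def polarization_def)
 have pol_mult: "P (p * q) = P p * q + p * P q" for p q
  by (simp add: pol pd_mult distrib_left sum.distrib sum_distrib_left sum_distrib_right mult_ac)
 have pol_Var: "P (Var (0, j)) = Var (0, j)" if "j < n" for j
 proof -
  have "P (Var (0, j)) = (\<Sum>i<n. if i = j then Var (0, j) else 0)"
   unfolding pol by (rule sum.cong) (auto simp: pd_Var)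
  then show ?thesis using that by (simp add: sum.delta)
 qed
 have pol_Const: "P (Const c) = 0" for c by (simp add: pol)
 have pow: "P (Var (0, j) ^ e) = Const (of_nat e) * Var (0, j) ^ e" if "j < n" for j e
  by (induction e) (use pol_Const[of 1] in "simp_all add: pol_mult pol_Var[OF that] Const_add algebra_simps")
 have prod: "finite S ==> S \<subseteq> {0} \<times> {..<n} ==>
   P (\<Prod>v\<in>S. Var v ^ f v) = Const (of_nat (\<Sum>v\<in>S. f v)) * (\<Prod>v\<in>S. Var v ^ f v)" for S f
 proof (induction S rule: finite_induct)
  case empty then show ?case using pol_Const[of 1] by simp
 next
  case (insert x S)
  obtain j where x: "x = (0, j)" "j < n" using insert.prems by auto
  show ?case using insert by (simp add: pol_mult pow[OF x(2)] x(1) Const_add algebra_simps)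
 qed
 have mono: "P (single m c) = Const (of_nat (rdeg n 0 m)) * single m c"
  if "keys m \<subseteq> {0} \<times> {..<n}" for m c
 proof -
  have "rdeg n 0 m = (\<Sum>v\<in>(%j. (0, j)) ` {..<n}. lookup m v)"
   by (subst sum.reindex) (auto simp: rdeg_def inj_on_def)
  also have "... = (\<Sum>v\<in>keys m. lookup m v)"
   by (rule sum.mono_neutral_right) (use that in "auto simp: in_keys_iff")
  finally show ?thesis
   by (simp add: single_eq_Const_eval eval_mon_def pol_mult pol_Const prod[OF _ that] mult.left_commute)
 qed
 have sum: "P (\<Sum>i\<in>I. f i) = (\<Sum>i\<in>I. P (f i))"
  for I and f :: "(nat \<times> nat \<Rightarrow>\<^sub>0 nat) => mpoly"
  unfolding pol pd_sum sum_distrib_left by (rule sum.swap)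
 let ?s = "\<Sum>m\<in>keys p. single m (lookup p m)"
 have "P ?s = (\<Sum>m\<in>keys p. Const (of_nat (lookup d 0)) * single m (lookup p m))"
  unfolding sum
 proof (rule sum.cong[OF refl])
  fix m assume m: "m \<in> keys p"
  then have "rdeg n 0 m = lookup d 0" using assms(2) by (simp add: homog_def in_keys_iff)
  then show "P (single m (lookup p m)) =
   Const (of_nat (lookup d 0)) * single m (lookup p m)"
   using mono[of m] assms(1) m by (auto simp: polys_in_def)
 qed
 then show ?thesis by (simp add: mons_sum P_def flip: sum_distrib_left)
qed

lemma polys_in_pd_funpow: "p \<in> polys_in X ==> (pd v ^^ e) p \<in> polys_in X"
 by (induction e) (auto intro: polys_in_pd)

lemma pol_uminus: "pol n r s e (- p) = - pol n r s e p"
proof -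
 have "(pd v ^^ e) (- p) = - (pd v ^^ e) p" for v
  by (induction e) (auto simp: pd_uminus)
 then show ?thesis by (simp add: polarization_def sum_negf)
qed

text \<open>For \<open>e = 1\<close> this is Euler's identity. For \<open>e > 1\<close> the result
  is still alternating, but its degree has dropped by \<open>e - 1\<close> below the least degree of
  a nonzero alternating polynomial.\<close>

lemma pol_row_zero_vdm:
 assumes "1 \<le> e" shows "\<exists>c. pol n 0 0 e (vdm n) = Const c * vdm n"
proof (cases "e = 1")
 case True
 then show ?thesis using euler[OF vdm_in_row homog_vdm] by blast
next
 case False
 let ?p = "pol n 0 0 e (vdm n)"
 have "?p = 0"
 proof (cases "e \<le> top_degree n")
  case le: True
  show ?thesis
  proof (rule alt_low_degree_zero)
   show "?p \<in> polys_in ({0} \<times> {..<n})" unfolding polarization_def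
    by (intro polys_in_sum polys_in_mult polys_in_Var polys_in_pd_funpow vdm_in_row) auto
   show "homog n (single 0 (top_degree n) - single 0 e + single 0 1) ?p"
    by (rule homog_pol[OF homog_vdm]) (use le in simp)
   show "lookup (single 0 (top_degree n) - single 0 e + single 0 1) 0 < top_degree n"
    using le False assms by (simp add: lookup_add lookup_minus)
   fix a b assume ab: "a < b" "b < n"
   have "transpose a b permutes {..<n}" using ab by (intro permutes_swap_id) auto
   then show "col_perm (transpose a b) ?p = - ?p"
    by (simp add: col_perm_pol vdm_transp[OF ab] pol_uminus)
  qed
 next
  case False
  then show ?thesis by (intro pol_degree_zero[OF homog_vdm]) simp
 qed
 then show ?thesis by (intro exI[of _ 0]) simp
qed

section \<open>The pol module\<close>

text \<open>A matrix acting on the rows turns a partial derivative into such a directional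
  derivative within the same kind of column, with a column of the inverse matrix as
  direction.\<close>

definition dir_deriv :: "nat => (nat => rat) => nat => mpoly => mpoly" where
 "dir_deriv k w j p = (\<Sum>a<k. Const (w a) * pd (a, j) p)"

lemma dir_deriv_add: "dir_deriv k w j (p + q) = dir_deriv k w j p + dir_deriv k w j q"
 by (simp add: dir_deriv_def pd_add distrib_left sum.distrib)

lemma dir_deriv_scale: "dir_deriv k w j (Const c * p) = Const c * dir_deriv k w j p"
 by (simp add: dir_deriv_def pd_scale sum_distrib_left mult.left_commute)

lemma dir_deriv_pd: "dir_deriv k w j (pd v p) = pd v (dir_deriv k w j p)"
 by (simp add: dir_deriv_def pd_sum pd_scale pd_commute)

lemma dir_deriv_Var_mult:
 "t < k ==> dir_deriv k w j (Var (t, i) * q) = Var (t, i) * dir_deriv k w j q + Const (if i = j then w t else 0) * q"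
proof -
 assume t: "t < k"
 have "dir_deriv k w j (Var (t, i) * q) =
   (\<Sum>a<k. Const (w a) * (pd (a, j) (Var (t, i)) * q)) + Var (t, i) * dir_deriv k w j q"
  by (simp add: dir_deriv_def pd_mult distrib_left sum.distrib sum_distrib_left mult.left_commute)
 also have "(\<Sum>a<k. Const (w a) * (pd (a, j) (Var (t, i)) * q)) =
   (\<Sum>a<k. if a = t then Const (if i = j then w t else 0) * q else 0)"
  by (rule sum.cong) (auto simp: pd_Var)
 finally show ?thesis using t by (simp add: sum.delta add.commute)
qed

lemma pd_Var_mult:
 "pd v (Var u * q) = Var u * pd v q + Const (if u = v then 1 else 0) * q"
 by (simp add: pd_mult pd_Var)

text \<open>The relation of the Weyl algebra: \<open>[D, x] = c\<close> for a scalar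
  \<open>c\<close> implies \<open>[D^d, x] = c d D^(d-1)\<close>. At \<open>d = 0\<close> the factor
  \<open>d\<close> makes the truncated exponent harmless.\<close>

lemma weyl_power:
 fixes D :: "mpoly => mpoly"
 assumes add: "!!p q. D (p + q) = D p + D q" and scale: "!!a p. D (Const a * p) = Const a * D p"
  and x: "!!q. D (x * q) = x * D q + Const c * q"
 shows "(D ^^ d) (x * q) = x * (D ^^ d) q + Const (c * of_nat d) * (D ^^ (d - 1)) q"
proof (induction d)
 case (Suc d)
 have "(D ^^ Suc d) (x * q) = x * (D ^^ Suc d) q + Const c * (D ^^ d) q + Const (c * of_nat d) * D ((D ^^ (d - 1)) q)"
  using Suc by (simp add: add scale x)
 also have "Const (c * of_nat d) * D ((D ^^ (d - 1)) q) = Const (c * of_nat d) * (D ^^ d) q"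
  by (cases d) simp_all
 finally have "(D ^^ Suc d) (x * q) = x * (D ^^ Suc d) q + (Const c + Const (c * of_nat d)) * (D ^^ d) q"
  by (simp only: distrib_right add.assoc)
 also have "Const c + Const (c * of_nat d) = Const (c * of_nat (Suc d))"
  by (simp add: Const_add[symmetric] distrib_left)
 finally show ?case by simp
qed simp

lemma funpow_linear:
 fixes D :: "mpoly => mpoly"
 assumes "!!p q. D (p + q) = D p + D q" "!!a p. D (Const a * p) = Const a * D p"
 shows "(D ^^ d) (p + q) = (D ^^ d) p + (D ^^ d) q" "(D ^^ d) (Const a * p) = Const a * (D ^^ d) p"
 by (induction d) (auto simp: assms)

lemma funpow_commute:
 fixes D :: "'a => 'a"
 assumes "!!p. D (F p) = F (D p)" shows "(D ^^ d) (F p) = F ((D ^^ d) p)"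
 by (induction d) (auto simp: assms)

lemmas pd_funpow_add = funpow_linear(1)[where D = "pd v" for v, OF pd_add pd_scale]
lemmas pd_funpow_scale = funpow_linear(2)[where D = "pd v" for v, OF pd_add pd_scale]
lemmas dir_deriv_funpow_add = funpow_linear(1)[where D = "dir_deriv k w j" for k w j, OF dir_deriv_add dir_deriv_scale]
lemmas dir_deriv_funpow_scale = funpow_linear(2)[where D = "dir_deriv k w j" for k w j, OF dir_deriv_add dir_deriv_scale]
lemmas dir_deriv_funpow_Var = weyl_power[where D = "dir_deriv k w j" for k w j, OF dir_deriv_add dir_deriv_scale dir_deriv_Var_mult]
lemmas pd_funpow_Var = weyl_power[where D = "pd v" for v, OF pd_add pd_scale pd_Var_mult]

lemma linear_sum:
 fixes F :: "mpoly => mpoly"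
 assumes "!!p q. F (p + q) = F p + F q" "!!a p. F (Const a * p) = Const a * F p"
 shows "F (\<Sum>i\<in>I. f i) = (\<Sum>i\<in>I. F (f i))"
proof -
 have "F 0 = 0" using assms(2)[of 0 0] by simp
 then show ?thesis by (induction I rule: infinite_finite_induct) (simp_all add: assms(1))
qed

lemmas dir_deriv_funpow_sum = linear_sum[where F = "dir_deriv k w j ^^ d" for k w j d, OF dir_deriv_funpow_add dir_deriv_funpow_scale]
lemmas pd_funpow_sum = linear_sum[where F = "pd v ^^ d" for v d, OF pd_funpow_add pd_funpow_scale]

lemma pol_add: "pol n r s e (p + q) = pol n r s e p + pol n r s e q"
 by (simp add: polarization_def pd_funpow_add distrib_left sum.distrib)

lemma pol_scale: "pol n r s e (Const c * p) = Const c * pol n r s e p"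
 by (simp add: polarization_def pd_funpow_scale sum_distrib_left mult.left_commute)

text \<open>The operators \<open>\<Sum>\<^sub>j x\<^sub>r\<^sub>j (\<Sum>\<^sub>a w\<^sub>a \<partial>\<^sub>a\<^sub>j)\<^sup>d \<partial>\<^sub>0\<^sub>j\<^sup>e\<close>; for fixed \<open>w\<close> this family is
  closed under commutators with the polarizations from row 0.\<close>

definition gen_pol :: "nat => nat => (nat => rat) => nat => nat => nat => mpoly => mpoly" where
 "gen_pol n k w r d e p =
   (\<Sum>j<n. Var (r, j) * (dir_deriv k w j ^^ d) ((pd (0, j) ^^ e) p))"

lemma gen_pol_add:
 "gen_pol n k w r d e (p + q) = gen_pol n k w r d e p + gen_pol n k w r d e q"
 by (simp add: gen_pol_def pd_funpow_add dir_deriv_funpow_add distrib_left sum.distrib)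

lemma gen_pol_scale:
 "gen_pol n k w r d e (Const c * p) = Const c * gen_pol n k w r d e p"
 by (simp add: gen_pol_def pd_funpow_scale dir_deriv_funpow_scale sum_distrib_left mult.left_commute)

lemma funpow_commute2:
 assumes "!!p. D (F p) = F (D p)" shows "(D ^^ d) ((F ^^ e) p) = (F ^^ e) ((D ^^ d) p)"
 using funpow_commute[of D "F ^^ e", OF funpow_commute[of F D e, OF assms[symmetric], symmetric]] .

lemma pd_funpow_commute:
 "(pd v ^^ d) ((pd w ^^ e) p) = (pd w ^^ e) ((pd v ^^ d) p)"
 by (rule funpow_commute2) (rule pd_commute)

lemma dir_deriv_pd_funpow:
 "(dir_deriv k w j ^^ d) ((pd v ^^ e) p) = (pd v ^^ e) ((dir_deriv k w j ^^ d) p)"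
 by (rule funpow_commute2) (rule dir_deriv_pd)

text \<open>The normally ordered products \<open>Q j i\<close> are the same for both orders of the
  operators and cancel. What remains are the terms in which a derivative hits a variable of its own
  column: the directional derivative hits row \<open>t\<close> with the factor \<open>w t\<close>,
  and derivatives in row 0 hit row \<open>r\<close> only for \<open>r = 0\<close>; as
  \<open>0 < t\<close>, they do not hit row \<open>t\<close>.\<close>

lemma gen_pol_comm:
 assumes t: "0 < t" "t < k"
 shows "gen_pol n k w r d e (pol n t 0 f p) =
  pol n t 0 f (gen_pol n k w r d e p)
  + Const (w t * of_nat d) * gen_pol n k w r (d - 1) (e + f) p
  - Const (if r = 0 then of_nat f else 0) * gen_pol n k w t d (e + f - 1) p"
proof -
 let ?D = "%j. dir_deriv k w j" and ?P = "%j. pd (0, j)"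
 define Q where "Q j i = Var (r, j) * (Var (t, i) * (?D j ^^ d) ((?P j ^^ e) ((?P i ^^ f) p)))" for j i
 have L: "Var (r, j) * (?D j ^^ d) ((?P j ^^ e) (Var (t, i) * (?P i ^^ f) p)) =
   Q j i + (if i = j then Var (r, j) * (Const (w t * of_nat d) * (?D j ^^ (d - 1)) ((?P j ^^ (e + f)) p)) else 0)" for j i
 proof -
  have "(?P j ^^ e) (Var (t, i) * (?P i ^^ f) p) = Var (t, i) * (?P j ^^ e) ((?P i ^^ f) p)"
   using t by (simp add: pd_funpow_Var)
  then show ?thesis using dir_deriv_funpow_Var[OF t(2), where w = w and j = j and d = d and i = i and q = "(?P j ^^ e) ((?P i ^^ f) p)"]
   by (simp add: Q_def distrib_left funpow_add)
 qed
 have R: "Var (t, i) * (?P i ^^ f) (Var (r, j) * (?D j ^^ d) ((?P j ^^ e) p)) =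
   Q j i + (if i = j then Var (t, i) * (Const (if r = 0 then of_nat f else 0) * (?D i ^^ d) ((?P i ^^ (e + f - 1)) p)) else 0)" for j i
 proof -
  have a: "(?P i ^^ f) (Var (r, j) * (?D j ^^ d) ((?P j ^^ e) p)) =
   Var (r, j) * (?P i ^^ f) ((?D j ^^ d) ((?P j ^^ e) p)) +
   Const ((if (r, j) = (0, i) then 1 else 0) * of_nat f) * (?P i ^^ (f - 1)) ((?D j ^^ d) ((?P j ^^ e) p))"
   by (rule pd_funpow_Var)
  have b: "(?P i ^^ f) ((?D j ^^ d) ((?P j ^^ e) p)) = (?D j ^^ d) ((?P j ^^ e) ((?P i ^^ f) p))"
   by (simp add: dir_deriv_pd_funpow pd_funpow_commute)
  have c: "(?P i ^^ (f - 1)) ((?D i ^^ d) ((?P i ^^ e) p)) = (?D i ^^ d) ((?P i ^^ (f - 1 + e)) p)"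
   by (simp add: dir_deriv_pd_funpow funpow_add)
  have d: "f ~= 0 ==> f - 1 + e = e + f - 1" by simp
  show ?thesis unfolding a b using c d
   by (cases "i = j"; cases "f = 0"; cases "r = 0") (simp_all add: Q_def distrib_left mult.left_commute)
 qed
 have "gen_pol n k w r d e (pol n t 0 f p) =
   (\<Sum>j<n. \<Sum>i<n. Var (r, j) * (?D j ^^ d) ((?P j ^^ e) (Var (t, i) * (?P i ^^ f) p)))"
  by (simp add: gen_pol_def polarization_def pd_funpow_sum dir_deriv_funpow_sum sum_distrib_left)
 also have "... = (\<Sum>j<n. \<Sum>i<n. Q j i) + (\<Sum>j<n. Var (r, j) * (Const (w t * of_nat d) * (?D j ^^ (d - 1)) ((?P j ^^ (e + f)) p)))"
  unfolding L sum.distrib by (simp add: sum.delta)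
 also have "(\<Sum>j<n. Var (r, j) * (Const (w t * of_nat d) * (?D j ^^ (d - 1)) ((?P j ^^ (e + f)) p))) =
   Const (w t * of_nat d) * gen_pol n k w r (d - 1) (e + f) p"
  by (simp add: gen_pol_def sum_distrib_left mult.left_commute)
 finally have 1: "gen_pol n k w r d e (pol n t 0 f p) =
   (\<Sum>j<n. \<Sum>i<n. Q j i) + Const (w t * of_nat d) * gen_pol n k w r (d - 1) (e + f) p" .
 have "pol n t 0 f (gen_pol n k w r d e p) =
   (\<Sum>i<n. \<Sum>j<n. Var (t, i) * (?P i ^^ f) (Var (r, j) * (?D j ^^ d) ((?P j ^^ e) p)))"
  by (simp add: gen_pol_def polarization_def pd_funpow_sum sum_distrib_left)
 also have "... = (\<Sum>i<n. \<Sum>j<n. Q j i) + (\<Sum>i<n. Var (t, i) * (Const (if r = 0 then of_nat f else 0) * (?D i ^^ d) ((?P i ^^ (e + f - 1)) p)))"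
  unfolding R sum.distrib by (simp add: sum.delta)
 also have "(\<Sum>i<n. \<Sum>j<n. Q j i) = (\<Sum>j<n. \<Sum>i<n. Q j i)" by (rule sum.swap)
 also have "(\<Sum>i<n. Var (t, i) * (Const (if r = 0 then of_nat f else 0) * (?D i ^^ d) ((?P i ^^ (e + f - 1)) p))) =
   Const (if r = 0 then of_nat f else 0) * gen_pol n k w t d (e + f - 1) p"
  by (simp add: gen_pol_def sum_distrib_left mult.left_commute)
 finally show ?thesis using 1 by simp
qed

lemma gen_pol_pd:
 assumes "i < n"
 shows "gen_pol n k w r d e (pd (0, i) p) =
  pd (0, i) (gen_pol n k w r d e p)
  - Const (if r = 0 then 1 else 0) * (dir_deriv k w i ^^ d) ((pd (0, i) ^^ e) p)"
proof -
 let ?y = "%j. (dir_deriv k w j ^^ d) ((pd (0, j) ^^ e) p)"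
 have y: "(dir_deriv k w j ^^ d) ((pd (0, j) ^^ e) (pd (0, i) p)) = pd (0, i) (?y j)" for j
 proof -
  have "(pd (0, j) ^^ e) (pd (0, i) p) = pd (0, i) ((pd (0, j) ^^ e) p)"
   by (rule funpow_commute) (rule pd_commute)
  then show ?thesis by (simp add: funpow_commute[where D = "dir_deriv k w j" and F = "pd (0, i)", OF dir_deriv_pd])
 qed
 have "pd (0, i) (gen_pol n k w r d e p) =
  gen_pol n k w r d e (pd (0, i) p) + (\<Sum>j<n. if j = i then Const (if r = 0 then 1 else 0) * ?y j else 0)"
  unfolding gen_pol_def y pd_sum pd_Var_mult sum.distrib
  by (intro arg_cong2[where f = plus] sum.cong refl) auto
 then show ?thesis using assms by (simp add: sum.delta)
qed

inductive_set words :: "nat => nat => mpoly set" for n k where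
 words_vdm: "vdm n \<in> words n k"
| words_pol: "p \<in> words n k ==> 0 < r ==> r < k ==> 0 < e ==> pol n r 0 e p \<in> words n k"
| words_pd: "p \<in> words n k ==> j < n ==> pd (0, j) p \<in> words n k"

abbreviation word_span :: "nat => nat => mpoly set" where
 "word_span n k \<equiv> mpoly.span (words n k)"

lemma span_Const_mult: "p \<in> mpoly.span S ==> Const c * p \<in> mpoly.span S"
 by (rule mpoly.span_scale)

lemmas span_closed' = span_closed[OF _ mpoly.subspace_span]

lemma word_span_pd0: "p \<in> word_span n k ==> j < n ==> pd (0, j) p \<in> word_span n k"
 by (rule span_closed'[where F = "pd (0, j)"])
  (auto simp: pd_add pd_scale intro: mpoly.span_base words.intros)

lemma word_span_pol0:
 "p \<in> word_span n k ==> 0 < r ==> r < k ==> 0 < e ==> pol n r 0 e p \<in> word_span n k"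
 by (rule span_closed'[where F = "pol n r 0 e"])
  (auto simp: pol_add pol_scale intro: mpoly.span_base words.intros)

lemma pd_not_in:
 assumes "p \<in> polys_in X" "v \<notin> X" shows "pd v p = 0"
 using assms(1)
proof (induction p rule: polys_in_induct)
 case (Var u) then show ?case using assms(2) by (auto simp: pd_Var)
qed (simp_all add: pd_add pd_mult)

lemma pd_pol:
 assumes "0 < s" "j < n"
 shows "pd (s, j) (pol n r 0 e p) =
  pol n r 0 e (pd (s, j) p) + (if r = s then (pd (0, j) ^^ e) p else 0)"
proof -
 have "pd (s, j) ((pd (0, i) ^^ e) p) = (pd (0, i) ^^ e) (pd (s, j) p)" for i
  by (rule funpow_commute[symmetric]) (rule pd_commute)
 then have "pd (s, j) (pol n r 0 e p) = pol n r 0 e (pd (s, j) p) +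
   (\<Sum>i<n. if i = j then (if r = s then (pd (0, j) ^^ e) p else 0) else 0)"
  unfolding polarization_def pd_sum pd_Var_mult sum.distrib
  by (intro arg_cong2[where f = plus] sum.cong refl) auto
 then show ?thesis using assms by (simp add: sum.delta)
qed

lemma word_span_pd_funpow0: "p \<in> word_span n k ==> j < n ==> (pd (0, j) ^^ e) p \<in> word_span n k"
 by (induction e) (auto intro: word_span_pd0)

text \<open>The determinant does not involve row \<open>s > 0\<close>. A derivative in this row
  passes a polarization up to the term in which it removes the new variable, and that term is an
  iterated derivative in row 0.\<close>

lemma word_span_pd:
 assumes "p \<in> word_span n k" "j < n" shows "pd (s, j) p \<in> word_span n k"
proof (cases "s = 0")
 case True then show ?thesis using word_span_pd0[OF assms] by simp
next
 case False
 show ?thesis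
 proof (rule span_closed'[where F = "pd (s, j)", OF assms(1) pd_add pd_scale])
  fix p assume "p \<in> words n k"
  then show "pd (s, j) p \<in> word_span n k"
  proof induction
   case words_vdm
   have "pd (s, j) (vdm n) = 0"
    by (rule pd_not_in[OF vdm_in_row]) (use False in auto)
   then show ?case by (simp add: mpoly.span_zero)
  next
   case (words_pol p r e)
   then have "pol n r 0 e (pd (s, j) p) \<in> word_span n k"
    by (intro word_span_pol0)
   moreover have "(if r = s then (pd (0, j) ^^ e) p else 0) \<in> word_span n k"
    using words_pol assms(2) by (simp add: word_span_pd_funpow0 mpoly.span_base mpoly.span_zero)
   ultimately show ?case using False assms(2) by (simp add: pd_pol mpoly.span_add)
  next
   case (words_pd p i)
   then show ?case by (subst pd_commute) (rule word_span_pd0)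
  qed
 qed
qed

lemma word_span_dir_deriv: "p \<in> word_span n k ==> j < n ==> (dir_deriv k w j ^^ d) p \<in> word_span n k"
 by (induction d) (auto simp: dir_deriv_def intro!: mpoly.span_sum span_Const_mult word_span_pd)

lemma dir_deriv_vdm:
 assumes "1 \<le> k"
 shows "(dir_deriv k w j ^^ d) ((pd (0, j) ^^ e) (vdm n)) =
  Const (w 0 ^ d) * (pd (0, j) ^^ (d + e)) (vdm n)"
proof (induction d)
 case (Suc d)
 let ?q = "(pd (0, j) ^^ (d + e)) (vdm n)"
 have q: "?q \<in> polys_in ({0} \<times> {..<n})" by (rule polys_in_pd_funpow[OF vdm_in_row])
 have "dir_deriv k w j ?q = (\<Sum>a<k. if a = 0 then Const (w 0) * pd (0, j) ?q else 0)"
  unfolding dir_deriv_def by (rule sum.cong) (auto simp: pd_not_in[OF q])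
 also have "... = Const (w 0) * pd (0, j) ?q" using assms by (simp add: sum.delta)
 finally have D: "dir_deriv k w j ?q = Const (w 0) * pd (0, j) ?q" .
 have "(dir_deriv k w j ^^ Suc d) ((pd (0, j) ^^ e) (vdm n)) = Const (w 0 ^ d) * (Const (w 0) * pd (0, j) ?q)"
  using Suc by (simp add: dir_deriv_scale D)
 also have "... = Const (w 0 ^ Suc d) * (pd (0, j) ^^ (Suc d + e)) (vdm n)"
  by (simp add: mult.assoc[symmetric] Const_mult[symmetric] mult.commute)
 finally show ?case .
qed simp

text \<open>The operator is moved to the right through the word. On the determinant it becomes a
  polarization from row 0, which gives a word or, for \<open>r = 0\<close>, a multiple of the
  determinant. The claim is proved for all \<open>r\<close>, \<open>d\<close>, \<open>e\<close> at
  once because commutators change them, while they keep the direction \<open>w\<close>.\<close>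

lemma word_span_gen_pol:
 assumes k: "1 \<le> k" and "p \<in> word_span n k" "r < k" "0 < d + e"
 shows "gen_pol n k w r d e p \<in> word_span n k"
proof (rule span_closed'[where F = "gen_pol n k w r d e", OF assms(2) gen_pol_add gen_pol_scale])
 fix p assume "p \<in> words n k"
 then have "\<forall>r (d :: nat) (e :: nat). r < k --> 0 < d + e --> gen_pol n k w r d e p \<in> word_span n k"
 proof induction
  case words_vdm
  show ?case
  proof (intro allI impI)
   fix r d e :: nat assume r: "r < k" and de: "0 < d + e"
   have "gen_pol n k w r d e (vdm n) = Const (w 0 ^ d) * pol n r 0 (d + e) (vdm n)"
    unfolding gen_pol_def polarization_def dir_deriv_vdm[OF k] sum_distrib_left
    by (simp add: mult.left_commute)
   moreover have "pol n r 0 (d + e) (vdm n) \<in> word_span n k"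
   proof (cases "r = 0")
    case True
    obtain c where "pol n 0 0 (d + e) (vdm n) = Const c * vdm n"
     using pol_row_zero_vdm[of "d + e" n] de by auto
    then show ?thesis using True by (simp add: span_Const_mult mpoly.span_base words.words_vdm)
   next
    case False
    then show ?thesis using r de by (intro mpoly.span_base words.words_pol words.words_vdm) auto
   qed
   ultimately show "gen_pol n k w r d e (vdm n) \<in> word_span n k"
    by (simp add: span_Const_mult)
  qed
 next
  case (words_pol p t f)
  show ?case
  proof (intro allI impI)
   fix r d e :: nat assume r: "r < k" and de: "0 < d + e"
   note IH = words_pol.IH[rule_format] and t = \<open>0 < t\<close> \<open>t < k\<close> and f = \<open>0 < f\<close>
   \<comment> \<open>The commutators do not reach the excluded total order 0, as both
     \<open>d + e\<close> and \<open>f\<close> are positive and at most one derivative is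
     lost.\<close>
   show "gen_pol n k w r d e (pol n t 0 f p) \<in> word_span n k"
    unfolding gen_pol_comm[OF t]
    by (intro mpoly.span_diff mpoly.span_add span_Const_mult word_span_pol0 IH r t f de)
     (use f de in linarith)+
  qed
 next
  case (words_pd p i)
  show ?case
  proof (intro allI impI)
   fix r d e :: nat assume r: "r < k" and de: "0 < d + e"
   note IH = words_pd.IH[rule_format] and i = \<open>i < n\<close> and p = mpoly.span_base[OF \<open>p \<in> words n k\<close>]
   show "gen_pol n k w r d e (pd (0, i) p) \<in> word_span n k"
    unfolding gen_pol_pd[OF i]
    by (intro mpoly.span_diff span_Const_mult word_span_pd word_span_dir_deriv
      word_span_pd_funpow0 p IH r i de)
  qed
 qed
 from this[rule_format, OF assms(3,4)] show "gen_pol n k w r d e p \<in> word_span n k" .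
qed

lemma pol_eq_gen:
 assumes "s < k" shows "pol n r s d p = gen_pol n k (%a. if a = s then 1 else 0) r d 0 p"
proof -
 have "dir_deriv k (%a. if a = s then 1 else 0) j = pd (s, j)" for j
 proof
  fix p
  have "dir_deriv k (%a. if a = s then 1 else 0) j p = (\<Sum>a<k. if a = s then pd (s, j) p else 0)"
   unfolding dir_deriv_def by (rule sum.cong) auto
  then show "dir_deriv k (%a. if a = s then 1 else 0) j p = pd (s, j) p"
   using assms by (simp add: sum.delta)
 qed
 then show ?thesis by (simp add: polarization_def gen_pol_def)
qed

lemma words_in_pring: "p \<in> words n k ==> 1 \<le> k ==> p \<in> poly_ring k n"
proof (induction rule: words.induct)
 case words_vdm
 then have "{0} \<times> {..<n} \<subseteq> {..<k} \<times> {..<n}" by auto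
 then show ?case unfolding pring_eq by (rule subsetD[OF polys_in_mono vdm_in_row])
next
 case (words_pol p r e)
 then have "p \<in> polys_in ({..<k} \<times> {..<n})" by (simp add: pring_eq)
 then show ?case unfolding pring_eq polarization_def
  by (intro polys_in_sum polys_in_mult polys_in_Var polys_in_pd_funpow)
   (use words_pol in auto)
next
 case (words_pd p j)
 then show ?case by (simp add: pring_eq polys_in_pd)
qed

lemma pring_subsp: "mpoly.subspace (poly_ring k n)"
 unfolding pring_eq by (intro mpoly.subspaceI) (simp_all add: polys_in_add polys_in_mult)

lemma word_span_pring: "1 \<le> k ==> word_span n k \<subseteq> poly_ring k n"
 by (intro mpoly.span_minimal pring_subsp subsetI words_in_pring)

text \<open>If \<open>D\<close> is a derivation with \<open>D l = m\<close> and
  \<open>D m = 0\<close>, then \<open>exp D\<close> replaces each factor \<open>l\<close> by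
  \<open>l + m\<close>, and the series is finite. The powers of \<open>t\<close> homogenize the
  formula, so that it covers \<open>t = 0\<close>, which occurs for matrices with vanishing corner
  entry. The vanishing of the next power of \<open>D\<close> is carried along because the induction
  step lengthens the sum by one term.\<close>

lemma taylor_product:
 fixes D :: "mpoly => mpoly"
 assumes "finite S" and add: "!!p q. D (p + q) = D p + D q" and scale: "!!a p. D (Const a * p) = Const a * D p"
  and mult: "!!p q. D (p * q) = D p * q + p * D q" and one: "D 1 = 0"
  and l: "!!x. x \<in> S ==> D (l x) = m x" and m: "!!x. x \<in> S ==> D (m x) = 0"
 shows "(D ^^ Suc (card S)) (\<Prod>x\<in>S. l x) = 0 &
  (\<Prod>x\<in>S. Const t * l x + m x) = (\<Sum>i\<le>card S. Const (t ^ (card S - i) / fact i) * (D ^^ i) (\<Prod>x\<in>S. l x))"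
 using assms(1) l m
proof (induction S rule: finite_induct)
 case empty then show ?case by (simp add: one)
next
 case (insert y S)
 let ?s = "card S" and ?g = "\<Prod>x\<in>S. l x"
 note lin = funpow_linear[of D, OF add scale]
 have IH: "(D ^^ Suc ?s) ?g = 0" "(\<Prod>x\<in>S. Const t * l x + m x) = (\<Sum>i\<le>?s. Const (t ^ (?s - i) / fact i) * (D ^^ i) ?g)"
  using insert by blast+
 have Dy: "D (l y) = m y" "D (m y) = 0" using insert by auto
 have Dm: "(D ^^ i) (m y * q) = m y * (D ^^ i) q" for i q by (induction i) (simp_all add: mult Dy)
 have comb: "a + b + c * a = b + (1 + c) * a" for a b c :: mpoly by (simp add: algebra_simps)
 have Dl: "(D ^^ Suc i) (l y * q) = l y * (D ^^ Suc i) q + Const (of_nat (Suc i)) * (m y * (D ^^ i) q)" for i q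
 proof (induction i)
  case 0 then show ?case by (simp add: mult Dy add.commute)
 next
  case (Suc i)
  have "(D ^^ Suc (Suc i)) (l y * q) = D (l y * (D ^^ Suc i) q + Const (of_nat (Suc i)) * (m y * (D ^^ i) q))"
   using Suc by simp
  also have "... = m y * (D ^^ Suc i) q + l y * (D ^^ Suc (Suc i)) q + Const (of_nat (Suc i)) * (m y * (D ^^ Suc i) q)"
   unfolding add scale by (simp add: mult Dy)
  also have "... = l y * (D ^^ Suc (Suc i)) q + (1 + Const (of_nat (Suc i))) * (m y * (D ^^ Suc i) q)"
   by (rule comb)
  also have "1 + Const (of_nat (Suc i)) = Const (of_nat (Suc (Suc i)))"
   by (simp only: of_nat_Suc[of "Suc i"] Const_add Const_1)
  finally show ?case .
 qed
 have z: "D 0 = 0" using scale[of 0 0] by simp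
 have zero: "(D ^^ Suc (Suc ?s)) (l y * ?g) = 0"
  unfolding Dl using IH(1) z by simp
 have "(\<Sum>i\<le>Suc ?s. Const (t ^ (Suc ?s - i) / fact i) * (D ^^ i) (l y * ?g)) =
   Const (t ^ Suc ?s) * (l y * ?g) + (\<Sum>i\<le>?s. Const (t ^ (?s - i) / fact (Suc i)) * (D ^^ Suc i) (l y * ?g))"
  by (subst sum.atMost_Suc_shift) simp
 also have "(\<Sum>i\<le>?s. Const (t ^ (?s - i) / fact (Suc i)) * (D ^^ Suc i) (l y * ?g)) =
   (\<Sum>i\<le>?s. Const (t ^ (?s - i) / fact (Suc i)) * (l y * (D ^^ Suc i) ?g)) +
   (\<Sum>i\<le>?s. Const (t ^ (?s - i) / fact i) * (m y * (D ^^ i) ?g))"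
 proof -
  have c: "Const (t ^ (?s - i) / fact (Suc i)) * (Const (of_nat (Suc i)) * q) = Const (t ^ (?s - i) / fact i) * q" for i q
  proof -
   have "t ^ (?s - i) / fact (Suc i) * of_nat (Suc i) = t ^ (?s - i) / fact i"
    by (simp add: field_simps del: of_nat_Suc)
   then show ?thesis by (metis Const_mult mult.assoc)
  qed
  show ?thesis unfolding Dl distrib_left sum.distrib c ..
 qed
 also have "Const (t ^ Suc ?s) * (l y * ?g) + ((\<Sum>i\<le>?s. Const (t ^ (?s - i) / fact (Suc i)) * (l y * (D ^^ Suc i) ?g)) +
   (\<Sum>i\<le>?s. Const (t ^ (?s - i) / fact i) * (m y * (D ^^ i) ?g))) =
   (\<Sum>i\<le>Suc ?s. Const (t ^ (Suc ?s - i) / fact i) * (l y * (D ^^ i) ?g)) + m y * (\<Prod>x\<in>S. Const t * l x + m x)"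
  unfolding IH(2) sum_distrib_left by (subst sum.atMost_Suc_shift) (simp add: mult.left_commute)
 also have "(\<Sum>i\<le>Suc ?s. Const (t ^ (Suc ?s - i) / fact i) * (l y * (D ^^ i) ?g)) = Const t * l y * (\<Prod>x\<in>S. Const t * l x + m x)"
 proof -
  have "(\<Sum>i\<le>Suc ?s. Const (t ^ (Suc ?s - i) / fact i) * (l y * (D ^^ i) ?g)) =
    (\<Sum>i\<le>?s. Const (t ^ (Suc ?s - i) / fact i) * (l y * (D ^^ i) ?g))"
   using IH(1) by simp
  also have "... = (\<Sum>i\<le>?s. Const t * l y * (Const (t ^ (?s - i) / fact i) * (D ^^ i) ?g))"
   by (intro sum.cong refl) (simp add: Suc_diff_le Const_mult mult_ac flip: times_divide_eq_right)
  finally show ?thesis unfolding IH(2) by (simp add: sum_distrib_left)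
 qed
 finally have "(\<Prod>x\<in>insert y S. Const t * l x + m x) =
   (\<Sum>i\<le>Suc ?s. Const (t ^ (Suc ?s - i) / fact i) * (D ^^ i) (l y * ?g))"
  using insert by (simp add: distrib_right)
 with zero show ?case using insert by simp
qed

text \<open>These are the images of the determinant under matrices, \<open>w\<close> being the first
  row of the matrix. The derivation \<open>D\<close> sends row 0 to the combination of the other
  rows and kills the latter, so the Taylor formula writes the product as a combination of iterated
  polarizations of the determinant.\<close>

lemma vdm_linear_forms:
 assumes k: "1 \<le> k"
 shows "(\<Prod>x\<in>pairs n. (\<Sum>a<k. Const (w a) * Var (a, fst x)) - (\<Sum>a<k. Const (w a) * Var (a, snd x))) \<in> word_span n k"
proof -
 define D where "D p = (\<Sum>a\<in>{1..<k}. Const (w a) * pol n a 0 1 p)" for p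
 define m where "m x = (\<Sum>a\<in>{1..<k}. Const (w a) * (Var (a, fst x) - Var (a, snd x)))" for x :: "nat \<times> nat"
 have pm: "pol n a 0 1 (p * q) = pol n a 0 1 p * q + p * pol n a 0 1 q" for a p q
  by (simp add: polarization_def pd_mult distrib_left sum.distrib sum_distrib_left sum_distrib_right mult_ac)
 have pv: "pol n a 0 1 (Var (b, j)) = (if b = 0 then Var (a, j) else 0)" if "j < n" for a b j
 proof -
  have "pol n a 0 1 (Var (b, j)) = (\<Sum>i<n. if i = j then (if b = 0 then Var (a, j) else 0) else 0)"
   unfolding polarization_def by (rule sum.cong) (auto simp: pd_Var)
  then show ?thesis using that by (simp add: sum.delta)
 qed
 have pdiff: "pol n a 0 1 (p - q) = pol n a 0 1 p - pol n a 0 1 q" for a p q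
  by (simp add: polarization_def pd_diff right_diff_distrib sum_subtractf)
 have add: "D (p + q) = D p + D q" for p q
  by (simp add: D_def pol_add distrib_left sum.distrib)
 have scale: "D (Const a * p) = Const a * D p" for a p
  by (simp add: D_def pol_scale sum_distrib_left mult.left_commute)
 have mult: "D (p * q) = D p * q + p * D q" for p q
  unfolding D_def pm by (simp add: distrib_left sum.distrib sum_distrib_left sum_distrib_right mult_ac)
 have one: "D 1 = 0" by (simp add: D_def polarization_def)
 have l: "D (Var (0, fst x) - Var (0, snd x)) = m x" if "x \<in> pairs n" for x
  using that by (auto simp: D_def m_def pairs_def pdiff[simplified] pv[simplified])
 have mm: "D (m x) = 0" if "x \<in> pairs n" for x
 proof -
  have "D (Const (w a) * (Var (a, fst x) - Var (a, snd x))) = 0" if "a \<in> {1..<k}" for a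
   using that \<open>x \<in> pairs n\<close> unfolding scale
   by (auto simp: D_def pairs_def pdiff[simplified] pv[simplified])
  then show ?thesis unfolding m_def by (subst linear_sum[of D, OF add scale]) simp
 qed
 have Dspan: "D p \<in> word_span n k" if "p \<in> word_span n k" for p
  unfolding D_def using that by (auto intro!: mpoly.span_sum span_Const_mult word_span_pol0)
 have Dpow: "(D ^^ i) (vdm n) \<in> word_span n k" for i
  by (induction i) (auto intro: Dspan mpoly.span_base words.intros)
 have split: "(\<Sum>a<k. f a) = f 0 + (\<Sum>a\<in>{1..<k}. f a)" for f :: "nat => mpoly"
 proof -
  have "{..<k} = insert 0 {1..<k}" using k by auto
  then show ?thesis by simp
 qed
 have "(\<Sum>a<k. Const (w a) * Var (a, fst x)) - (\<Sum>a<k. Const (w a) * Var (a, snd x)) =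
   Const (w 0) * (Var (0, fst x) - Var (0, snd x)) + m x" for x
  by (simp add: split m_def right_diff_distrib sum_subtractf)
 then have "(\<Prod>x\<in>pairs n. (\<Sum>a<k. Const (w a) * Var (a, fst x)) - (\<Sum>a<k. Const (w a) * Var (a, snd x))) =
  (\<Prod>x\<in>pairs n. Const (w 0) * (Var (0, fst x) - Var (0, snd x)) + m x)" by simp
 also have "... = (\<Sum>i\<le>card (pairs n). Const (w 0 ^ (card (pairs n) - i) / fact i) * (D ^^ i) (vdm n))"
  unfolding vdm_eq by (rule taylor_product[THEN conjunct2, OF finite_pairs add scale mult one l mm])
 also have "... \<in> word_span n k" by (intro mpoly.span_sum span_Const_mult Dpow)
 finally show ?thesis .
qed

lemma gl_sym_act_Var_deriv:
 assumes "inj s" "a < k"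
 shows "pd (a, s j) (\<Sum>b<k. Const (A $$ (i, b)) * Var (b, s j')) =
  (if j' = j then Const (A $$ (i, a)) else 0)"
proof -
 have "pd (a, s j) (\<Sum>b<k. Const (A $$ (i, b)) * Var (b, s j')) =
  (\<Sum>b<k. if b = a then (if j' = j then Const (A $$ (i, a)) else 0) else 0)"
  unfolding pd_sum pd_scale
  by (rule sum.cong) (use assms in "auto simp: pd_Var inj_eq")
 then show ?thesis using assms(2) by (simp add: sum.delta)
qed

lemma gl_sym_act_chain:
 assumes "p \<in> poly_ring k n" "inj s" "a < k" "j < n"
 shows "pd (a, s j) (gl_sym_act k A s p) =
  (\<Sum>i<k. Const (A $$ (i, a)) * gl_sym_act k A s (pd (i, j) p))"
proof -
 let ?f = "%(i, j). \<Sum>a<k. Const (A $$ (i, a)) * Var (a, s j)"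
 have "pd (a, s j) (gl_sym_act k A s p) =
  (\<Sum>w\<in>{..<k} \<times> {..<n}. pd (a, s j) (?f w) * gl_sym_act k A s (pd w p))"
  unfolding gl_sym_act_def by (rule chain_rule) (use assms in "auto simp: pring_eq")
 also have "... = (\<Sum>i<k. \<Sum>j'<n. pd (a, s j) (?f (i, j')) * gl_sym_act k A s (pd (i, j') p))"
  by (simp add: sum.cartesian_product case_prod_beta')
 also have "... = (\<Sum>i<k. \<Sum>j'<n. if j' = j then Const (A $$ (i, a)) * gl_sym_act k A s (pd (i, j) p) else 0)"
  by (intro sum.cong refl) (simp add: gl_sym_act_Var_deriv[OF assms(2,3)])
 finally show ?thesis using assms(4) by (simp add: sum.delta)
qed

lemma gl_sym_act_add: "gl_sym_act k A s (p + q) = gl_sym_act k A s p + gl_sym_act k A s q"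
 and gl_sym_act_scale: "gl_sym_act k A s (Const c * p) = Const c * gl_sym_act k A s p"
 by (simp_all add: gl_sym_act_def sbst_add sbst_scale)

text \<open>By the chain rule the derivatives of the transformed polynomial are combinations, with
  coefficients from \<open>A\<close>, of the transformed derivatives; the right inverse
  \<open>B\<close> solves this linear system.\<close>

lemma gl_sym_act_pd:
 assumes "p \<in> poly_ring k n" "inj s" "i0 < k" "j < n"
  and AB: "A \<in> carrier_mat k k" "B \<in> carrier_mat k k" "A * B = 1\<^sub>m k"
 shows "gl_sym_act k A s (pd (i0, j) p) =
  dir_deriv k (%a. B $$ (a, i0)) (s j) (gl_sym_act k A s p)"
proof -
 have "(\<Sum>a<k. A $$ (i, a) * B $$ (a, i0)) = (if i = i0 then 1 else 0)" if "i < k" for i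
 proof -
  have "(A * B) $$ (i, i0) = (\<Sum>a<k. A $$ (i, a) * B $$ (a, i0))"
   using AB(1,2) that assms(3) by (simp add: scalar_prod_def atLeast0LessThan)
  moreover have "(A * B) $$ (i, i0) = (if i = i0 then 1 else 0)"
   unfolding AB(3) using that assms(3) by simp
  ultimately show ?thesis by (rule trans[OF sym])
 qed
 then have C: "(\<Sum>a<k. Const (B $$ (a, i0)) * Const (A $$ (i, a))) = (if i = i0 then 1 else 0)" if "i < k" for i
  using that by (simp add: Const_mult[symmetric] Const_sum[symmetric] mult.commute)
 have "dir_deriv k (%a. B $$ (a, i0)) (s j) (gl_sym_act k A s p) =
  (\<Sum>a<k. \<Sum>i<k. (Const (B $$ (a, i0)) * Const (A $$ (i, a))) * gl_sym_act k A s (pd (i, j) p))"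
  unfolding dir_deriv_def
  by (intro sum.cong refl) (simp add: gl_sym_act_chain[OF assms(1,2) _ assms(4)] sum_distrib_left mult.assoc)
 also have "... = (\<Sum>i<k. (\<Sum>a<k. Const (B $$ (a, i0)) * Const (A $$ (i, a))) * gl_sym_act k A s (pd (i, j) p))"
  by (subst sum.swap) (simp add: sum_distrib_right)
 also have "... = (\<Sum>i<k. if i = i0 then gl_sym_act k A s (pd (i0, j) p) else 0)"
  by (rule sum.cong) (auto simp: C)
 finally show ?thesis using assms(3) by (simp add: sum.delta)
qed

lemma gl_sym_act_pd_funpow:
 assumes "p \<in> poly_ring k n" "inj s" "i0 < k" "j < n"
  and AB: "A \<in> carrier_mat k k" "B \<in> carrier_mat k k" "A * B = 1\<^sub>m k"
 shows "gl_sym_act k A s ((pd (i0, j) ^^ e) p) =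
  (dir_deriv k (%a. B $$ (a, i0)) (s j) ^^ e) (gl_sym_act k A s p)"
proof (induction e)
 case (Suc e)
 have "(pd (i0, j) ^^ e) p \<in> poly_ring k n"
  using assms(1) by (simp add: pring_eq polys_in_pd_funpow)
 from gl_sym_act_pd[OF this assms(2-)] Suc show ?case by simp
qed simp

lemma gl_sym_act_vdm:
 assumes k: "1 \<le> k" and s: "v permutes {..<n}"
 shows "gl_sym_act k A v (vdm n) \<in> word_span n k"
proof -
 let ?g = "%(i, j). \<Sum>a<k. Const (A $$ (i, a)) * Var (a, j)"
 have "gl_sym_act k A v (vdm n) = sbst ?g (col_perm v (vdm n))"
  unfolding gl_sym_act_def col_perm_def sbst_sbst by (simp add: case_prod_beta')
 also have "... = Const (of_int (sign v)) * sbst ?g (vdm n)"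
  by (simp add: vdm_perm[OF s] sbst_scale)
 also have "sbst ?g (vdm n) = (\<Prod>x\<in>pairs n.
   (\<Sum>a<k. Const (A $$ (0, a)) * Var (a, fst x)) - (\<Sum>a<k. Const (A $$ (0, a)) * Var (a, snd x)))"
  by (simp add: vdm_eq sbst_prod sbst_diff)
 also have "Const (of_int (sign v)) * ... \<in> word_span n k"
  by (intro span_Const_mult vdm_linear_forms k)
 finally show ?thesis .
qed

text \<open>Conjugated by a matrix, a polarization from row 0 becomes a combination of operators
  \<open>gen_pol\<close> whose direction is a column of the inverse matrix. This is the reason for
  admitting a general direction in \<open>gen_pol\<close>.\<close>

lemma gl_sym_act_word_span:
 assumes k: "1 \<le> k" and s: "g permutes {..<n}" and A: "A \<in> carrier_mat k k" "invertible_mat A"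
  and p: "p \<in> word_span n k"
 shows "gl_sym_act k A g p \<in> word_span n k"
proof (rule span_closed'[where F = "gl_sym_act k A g", OF p gl_sym_act_add gl_sym_act_scale])
 obtain B where AB: "A * B = 1\<^sub>m k" and BA: "B * A = 1\<^sub>m (dim_row B)"
  using A unfolding invertible_mat_def inverts_mat_def by auto
 have dB: "dim_col B = k" using arg_cong[OF AB, of dim_col] by simp
 have dB': "dim_row B = k" using arg_cong[OF BA, of dim_col] A(1) by simp
 have B: "B \<in> carrier_mat k k" using dB dB' by (intro carrier_matI)
 note inj = permutes_inj[OF s]
 have img: "g j < n" if "j < n" for j using permutes_in_image[OF s, of j] that by simp
 fix p assume "p \<in> words n k"
 then show "gl_sym_act k A g p \<in> word_span n k"
 proof induction
  case words_vdm then show ?case by (rule gl_sym_act_vdm[OF k s])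
 next
  case (words_pol p r e)
  note pr = words_in_pring[OF words_pol.hyps(1) k]
  have "gl_sym_act k A g (pol n r 0 e p) =
   (\<Sum>j<n. gl_sym_act k A g (Var (r, j)) * gl_sym_act k A g ((pd (0, j) ^^ e) p))"
   by (simp add: polarization_def gl_sym_act_def sbst_sum sbst_mult)
  also have "... = (\<Sum>j<n. (\<Sum>a<k. Const (A $$ (r, a)) * Var (a, g j)) *
    (dir_deriv k (%a. B $$ (a, 0)) (g j) ^^ e) (gl_sym_act k A g p))"
  proof (intro sum.cong refl arg_cong2[where f = "(*)"])
   fix j assume "j \<in> {..<n}"
   then show "gl_sym_act k A g ((pd (0, j) ^^ e) p) =
     (dir_deriv k (%a. B $$ (a, 0)) (g j) ^^ e) (gl_sym_act k A g p)"
    using k by (intro gl_sym_act_pd_funpow[OF pr inj _ _ A(1) B AB]) auto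
  qed (simp add: gl_sym_act_def)
  also have "... = (\<Sum>j<n. (\<Sum>a<k. Const (A $$ (r, a)) * Var (a, j)) *
    (dir_deriv k (%a. B $$ (a, 0)) j ^^ e) (gl_sym_act k A g p))"
   by (rule sum.permute[OF s, symmetric, unfolded o_def])
  also have "... = (\<Sum>a<k. Const (A $$ (r, a)) * gen_pol n k (%a. B $$ (a, 0)) a e 0 (gl_sym_act k A g p))"
   by (simp add: gen_pol_def sum_distrib_left sum_distrib_right mult.assoc sum.swap[of _ "{..<n}"])
  also have "... \<in> word_span n k"
  proof (intro mpoly.span_sum span_Const_mult word_span_gen_pol k)
   fix a assume "a \<in> {..<k}"
   then show "a < k" by simp
  qed (use words_pol in auto)
  finally show ?case .
 next
  case (words_pd p j)
  note pr = words_in_pring[OF words_pd.hyps(1) k]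
  have "gl_sym_act k A g (pd (0, j) p) = dir_deriv k (%a. B $$ (a, 0)) (g j) (gl_sym_act k A g p)"
   using k words_pd by (intro gl_sym_act_pd[OF pr inj _ _ A(1) B AB]) auto
  moreover have "(dir_deriv k (%a. B $$ (a, 0)) (g j) ^^ 1) (gl_sym_act k A g p) \<in> word_span n k"
   by (rule word_span_dir_deriv) (use words_pd img in auto)
  ultimately show ?case by simp
 qed
qed

lemma word_span_is_pol_module:
 assumes k: "1 \<le> k" shows "is_polarization_module k n (word_span n k)"
 unfolding is_polarization_module_def
proof (intro conjI allI impI ballI)
 show "word_span n k \<subseteq> poly_ring k n" by (rule word_span_pring[OF k])
 show "mpoly.subspace (word_span n k)" by (rule mpoly.subspace_span)
 show "vdm n \<in> word_span n k" by (rule mpoly.span_base[OF words_vdm])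
 show "gl_sym_act k A g p \<in> word_span n k"
  if "p \<in> word_span n k" "A \<in> carrier_mat k k & invertible_mat A & g permutes {..<n}" for A g p
  using that gl_sym_act_word_span[OF k] by blast
 show "pd (s, j) p \<in> word_span n k" if "j < n" "p \<in> word_span n k" for s j p
  using that by (intro word_span_pd)
 show "pol n r s d p \<in> word_span n k" if "r < k" "s < k" "1 \<le> d" "p \<in> word_span n k" for r s d p
  unfolding pol_eq_gen[OF that(2)] by (rule word_span_gen_pol[OF k that(4,1)]) (use that in simp)
qed

lemma E_module_eq: assumes k: "1 \<le> k" shows "E_module k n = word_span n k"
proof (rule equalityI)
 show "E_module k n \<subseteq> word_span n k" unfolding E_module_def
  using word_span_is_pol_module[OF k] by (intro Inter_lower CollectI)
 have "word_span n k \<subseteq> W" if W: "is_polarization_module k n W" for W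
 proof (rule mpoly.span_minimal)
  show "mpoly.subspace W" using W by (simp add: is_polarization_module_def)
  show "words n k \<subseteq> W"
  proof
   fix p assume "p \<in> words n k"
   then show "p \<in> W" by induction (use W k in "auto simp: is_polarization_module_def")
  qed
 qed
 then show "word_span n k \<subseteq> E_module k n" unfolding E_module_def by (intro Inter_greatest) simp
qed

text \<open>Words indexed by their multidegree; this does not involve the number of rows.\<close>

inductive gen :: "nat => monomial => mpoly => bool" for n where
 gen_vdm: "gen n (single 0 (top_degree n)) (vdm n)"
| gen_pol: "gen n d p ==> 0 < r ==> 0 < e ==> e \<le> lookup d 0 ==>
  gen n (d - single 0 e + single r 1) (pol n r 0 e p)"
| gen_pd: "gen n d p ==> j < n ==> 0 < lookup d 0 ==>
  gen n (d - single 0 1) (pd (0, j) p)"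

definition dpart :: "nat => monomial => mpoly set" where
 "dpart n d = mpoly.span {p. gen n d p}"

lemma gen_homog: "gen n d p ==> homog n d p"
proof (induction rule: gen.induct)
 case gen_vdm show ?case by (rule homog_vdm)
next
 case (gen_pol d p r e) then show ?case by (intro homog_pol)
next
 case (gen_pd d p j) then show ?case by (intro homog_pd) auto
qed

lemma keys_minus_subset: "keys (a - b :: monomial) \<subseteq> keys a"
 by (auto simp: in_keys_iff lookup_minus)

text \<open>A step that would lower the degree of row 0 below zero yields the zero polynomial, which
  carries no multidegree; hence the alternative \<open>p = 0\<close>.\<close>

lemma words_gen:
 assumes "1 \<le> k"
 shows "p \<in> words n k ==> p = 0 \<or> (\<exists>d. keys d \<subseteq> {..<k} & gen n d p)"
proof (induction rule: words.induct)
 case words_vdm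
 have "keys (single 0 (top_degree n)) \<subseteq> {..<k}" using assms by auto
 then show ?case using gen_vdm by blast
next
 case (words_pol p r e)
 show ?case
 proof (cases "p = 0")
  case True then show ?thesis by (simp add: polarization_def)
 next
  case False
  then obtain d where d: "keys d \<subseteq> {..<k}" "gen n d p" using words_pol by blast
  show ?thesis
  proof (cases "e \<le> lookup d 0")
   case True
   have "keys (d - single 0 e + single r 1) \<subseteq> {..<k}"
    using d(1) keys_minus_subset[of d "single 0 e"] words_pol
    by (auto simp: keys_add_nat)
   then show ?thesis using gen_pol[OF d(2) _ _ True] words_pol by blast
  next
   case False
   then show ?thesis using pol_degree_zero[OF gen_homog[OF d(2)]] by simp
  qed
 qed
next
 case (words_pd p j)
 show ?case
 proof (cases "p = 0")
  case False
  then obtain d where d: "keys d \<subseteq> {..<k}" "gen n d p" using words_pd by blast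
  show ?thesis
  proof (cases "lookup d 0 = 0")
   case True
   then show ?thesis using pd_degree_zero[OF gen_homog[OF d(2)] words_pd.hyps(2)] by simp
  next
   case False
   then have "gen n (d - single 0 1) (pd (0, j) p)"
    using d words_pd by (intro gen_pd) auto
   then show ?thesis using d(1) keys_minus_subset by blast
  qed
 qed simp
qed

text \<open>Rows other than 0 are never lowered, so every row into which a word polarizes leaves a
  trace in the multidegree. A multidegree supported on \<open>k\<close> rows therefore comes from
  polarizations into these rows.\<close>

lemma gen_words:
 assumes "1 \<le> k" shows "gen n d p ==> keys d \<subseteq> {..<k} ==> p \<in> words n k"
proof (induction rule: gen.induct)
 case gen_vdm show ?case by (rule words.words_vdm)
next
 case (gen_pol d p r e)
 have r: "r < k" using gen_pol.prems by (auto simp: keys_add_nat)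
 have "keys d \<subseteq> insert 0 (keys (d - single 0 e + single r 1))"
  by (auto simp: in_keys_iff lookup_add lookup_minus lookup_single when_def split: if_splits)
 then have "keys d \<subseteq> {..<k}" using gen_pol.prems assms by auto
 then show ?case using r gen_pol by (intro words.words_pol) auto
next
 case (gen_pd d p j)
 have "keys d \<subseteq> insert 0 (keys (d - single 0 1))"
  by (auto simp: in_keys_iff lookup_minus lookup_single when_def split: if_splits)
 then have "keys d \<subseteq> {..<k}" using gen_pd.prems assms by auto
 then show ?case using gen_pd by (intro words.words_pd) auto
qed

text \<open>A projection that, for the monomials of one multidegree, sends each word to itself or to
  0. So a multihomogeneous element of the span is a combination of words of its own
  multidegree.\<close>

definition restr_mons :: "((nat \<times> nat \<Rightarrow>\<^sub>0 nat) => bool) => mpoly => mpoly" where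
 "restr_mons P p = (\<Sum>m\<in>keys p. if P m then single m (lookup p m) else 0)"

lemma lookup_restr_mons:
 "lookup (restr_mons P p) m = (if P m then lookup p m else 0)"
proof -
 have "lookup (restr_mons P p) m =
  (\<Sum>x\<in>keys p. if x = m then (if P m then lookup p m else 0) else 0)"
  unfolding restr_mons_def lookup_sum by (rule sum.cong) (auto simp: lookup_single when_def)
 then show ?thesis by (auto simp: sum.delta in_keys_iff)
qed

lemma multidpart_E_module:
 assumes k: "1 \<le> k" and d: "keys d \<subseteq> {..<k}"
 shows "multidegree_part k n d (E_module k n) = dpart n d"
proof (rule equalityI)
 have hom: "lookup p m ~= 0 ==> rdeg n i m = lookup d i"
  if "p \<in> dpart n d" for p m i
  using that unfolding dpart_def
 proof (induction p arbitrary: m rule: mpoly.span_induct_alt)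
  case base then show ?case by simp
 next
  case (step c x y)
  then have "lookup x m ~= 0 \<or> lookup y m ~= 0" by (auto simp: lookup_add)
  then show ?case using step gen_homog[of n d x] by (auto simp: homog_def)
 qed
 have "dpart n d \<subseteq> word_span n k" unfolding dpart_def
  by (rule mpoly.span_mono) (use gen_words[OF k] d in auto)
 then show "dpart n d \<subseteq> multidegree_part k n d (E_module k n)"
  using hom by (auto simp: multidegree_part_def E_module_eq[OF k] in_keys_iff rdeg_def)
 define P where "P m \<longleftrightarrow> (\<forall>i<k. rdeg n i m = lookup d i)" for m
 let ?R = "restr_mons P"
 have add: "?R (p + q) = ?R p + ?R q" for p q
  by (rule poly_mapping_eqI) (simp add: lookup_restr_mons lookup_add)
 have scale: "?R (Const c * p) = Const c * ?R p" for c p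
  by (rule poly_mapping_eqI) (simp add: lookup_restr_mons)
 have R: "?R p \<in> dpart n d" if "p \<in> word_span n k" for p
  unfolding dpart_def
 proof (rule span_closed'[where F = ?R, OF that add scale])
  fix g assume "g \<in> words n k"
  from words_gen[OF k this] show "?R g \<in> mpoly.span {p. gen n d p}"
  proof
   assume "g = 0"
   then have "?R g = 0" by (simp add: restr_mons_def)
   then show ?thesis by (simp add: mpoly.span_zero)
  next
   assume "\<exists>d'. keys d' \<subseteq> {..<k} & gen n d' g"
   then obtain d' where d': "keys d' \<subseteq> {..<k}" "gen n d' g" by blast
   note h = gen_homog[OF d'(2)]
   show ?thesis
   proof (cases "d' = d")
    case True
    have "?R g = g"
     by (rule poly_mapping_eqI) (use h True in "auto simp: lookup_restr_mons P_def homog_def")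
    then show ?thesis using d' True by (simp add: mpoly.span_base)
   next
    case False
    then obtain i where i: "lookup d' i ~= lookup d i" by (metis poly_mapping_eqI)
    then have "i < k" using d d'(1) by (metis in_keys_iff lessThan_iff subsetD)
    then have "?R g = 0"
     by (intro poly_mapping_eqI) (use h i in "auto simp: lookup_restr_mons P_def homog_def")
    then show ?thesis by (simp add: mpoly.span_zero)
   qed
  qed
 qed
 show "multidegree_part k n d (E_module k n) \<subseteq> dpart n d"
 proof
  fix p assume p: "p \<in> multidegree_part k n d (E_module k n)"
  have "?R p = p"
   by (rule poly_mapping_eqI) (use p in "auto simp: lookup_restr_mons P_def multidegree_part_def in_keys_iff rdeg_def")
  then show "p \<in> dpart n d" using R[of p] p by (auto simp: multidegree_part_def E_module_eq[OF k])
 qed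
qed

lemma dpart_in_pring:
 assumes "1 \<le> k" "keys d \<subseteq> {..<k}" shows "dpart n d \<subseteq> poly_ring k n"
 unfolding dpart_def
 by (intro mpoly.span_minimal pring_subsp subsetI) (use gen_words[OF assms(1)] words_in_pring assms in auto)

section \<open>Traces and averaging over finite groups\<close>

definition linear_op :: "(mpoly => mpoly) => bool" where
 "linear_op f \<longleftrightarrow> (\<forall>p q. f (p + q) = f p + f q) & (\<forall>c p. f (Const c * p) = Const c * f p)"

definition finite_dim :: "mpoly set => bool" where
 "finite_dim V \<longleftrightarrow> mpoly.subspace V & (\<exists>S. finite S & V \<subseteq> mpoly.span S)"

lemma linear_op_sum: "linear_op f ==> f (\<Sum>i\<in>I. Const (c i) * g i) = (\<Sum>i\<in>I. Const (c i) * f (g i))"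
proof -
 assume f: "linear_op f"
 have "f (Const 0 * 0) = Const 0 * f 0" using f unfolding linear_op_def by blast
 then have "f 0 = 0" by simp
 then show ?thesis using f by (induction I rule: infinite_finite_induct) (simp_all add: linear_op_def)
qed

definition is_basis :: "mpoly set => mpoly set => bool" where
 "is_basis B V \<longleftrightarrow> finite B & mpoly.independent B & mpoly.span B = V"

lemma finite_dim_basis: assumes "finite_dim V" "mpoly.independent B" "mpoly.span B = V" shows "is_basis B V"
proof -
 obtain S where S: "finite S" "V \<subseteq> mpoly.span S" using assms(1) by (auto simp: finite_dim_def)
 have "B \<subseteq> V" using assms(3) mpoly.span_superset by blast
 then have "B \<subseteq> mpoly.span S" using S by blast
 then have "finite B" using mpoly.independent_span_bound[OF S(1) assms(2)] by blast
 then show ?thesis using assms by (simp add: is_basis_def)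
qed

lemma basis_extends:
 assumes "finite_dim V" "mpoly.independent C" "C \<subseteq> V"
 obtains B where "C \<subseteq> B" "is_basis B V"
proof -
 obtain B where B: "C \<subseteq> B" "B \<subseteq> V" "mpoly.independent B" "V \<subseteq> mpoly.span B"
  using mpoly.maximal_independent_subset_extend[OF assms(3,2)] .
 have "mpoly.span B \<subseteq> V" using B(2) assms(1) by (intro mpoly.span_minimal) (auto simp: finite_dim_def)
 then have "mpoly.span B = V" using B(4) by (rule equalityI)
 with that B(1) finite_dim_basis[OF assms(1) B(3)] show ?thesis by blast
qed

lemma basis_obtains: assumes "finite_dim V" obtains B where "is_basis B V"
 using basis_extends[OF assms mpoly.independent_empty empty_subsetI] .

lemma basis_expand:
 assumes "is_basis B V" "v \<in> V" shows "(\<Sum>b\<in>B. Const (mpoly.representation B v b) * b) = v"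
 using mpoly.sum_representation_eq[of B v B] assms by (simp add: is_basis_def)

lemma representation_sum':
 assumes "is_basis B V" "!!i. i \<in> I ==> v i \<in> V"
 shows "mpoly.representation B (\<Sum>i\<in>I. Const (c i) * v i) b = (\<Sum>i\<in>I. c i * mpoly.representation B (v i) b)"
proof -
 have B: "mpoly.independent B" "mpoly.span B = V" using assms(1) by (auto simp: is_basis_def)
 have "mpoly.representation B (\<Sum>i\<in>I. Const (c i) * v i) = (%b. \<Sum>i\<in>I. mpoly.representation B (Const (c i) * v i) b)"
  by (rule mpoly.representation_sum[OF B(1)]) (use B assms(2) mpoly.span_scale in auto)
 also have "... = (%b. \<Sum>i\<in>I. c i * mpoly.representation B (v i) b)"
  by (intro ext sum.cong refl) (use B assms(2) in "simp add: mpoly.representation_scale")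
 finally show ?thesis by simp
qed

text \<open>\<open>trace_on\<close> picks a basis by choice, so no trace can be computed before
  this. Expanding each basis in the other one produces the same double sum from both sides.\<close>

lemma trace_basis_indep:
 assumes B: "is_basis B V" and C: "is_basis C V" and f: "linear_op f" "!!v. v \<in> V ==> f v \<in> V"
 shows "(\<Sum>b\<in>B. mpoly.representation B (f b) b) = (\<Sum>c\<in>C. mpoly.representation C (f c) c)"
proof -
 have BV: "b \<in> V" if "b \<in> B" for b using that B mpoly.span_superset by (auto simp: is_basis_def)
 have CV: "c \<in> V" if "c \<in> C" for c using that C mpoly.span_superset by (auto simp: is_basis_def)
 have "mpoly.representation B (f b) b = (\<Sum>c\<in>C. mpoly.representation C b c * mpoly.representation B (f c) b)" if "b \<in> B" for b
 proof -
  have "f b = f (\<Sum>c\<in>C. Const (mpoly.representation C b c) * c)" by (simp add: basis_expand[OF C BV[OF that]])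
  also have "... = (\<Sum>c\<in>C. Const (mpoly.representation C b c) * f c)" by (rule linear_op_sum[OF f(1)])
  finally show ?thesis using representation_sum'[OF B, of C f] f(2) CV by simp
 qed
 then have "(\<Sum>b\<in>B. mpoly.representation B (f b) b) = (\<Sum>b\<in>B. \<Sum>c\<in>C. mpoly.representation C b c * mpoly.representation B (f c) b)"
  by simp
 also have "... = (\<Sum>c\<in>C. \<Sum>b\<in>B. mpoly.representation B (f c) b * mpoly.representation C b c)"
  by (subst sum.swap) (simp add: mult.commute)
 also have "... = (\<Sum>c\<in>C. mpoly.representation C (f c) c)"
 proof (rule sum.cong[OF refl])
  fix c assume "c \<in> C"
  then have "(\<Sum>b\<in>B. Const (mpoly.representation B (f c) b) * b) = f c" by (intro basis_expand[OF B] f(2) CV)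
  then show "(\<Sum>b\<in>B. mpoly.representation B (f c) b * mpoly.representation C b c) = mpoly.representation C (f c) c"
   using representation_sum'[OF C, of B "%b. b" "mpoly.representation B (f c)" c] BV by simp
 qed
 finally show ?thesis .
qed

lemma trace_on_basis:
 assumes V: "finite_dim V" and B: "is_basis B V" and f: "linear_op f" "!!v. v \<in> V ==> f v \<in> V"
 shows "trace_on V f = (\<Sum>b\<in>B. mpoly.representation B (f b) b)"
proof -
 define C where "C = (SOME B. mpoly.independent B & mpoly.span B = V)"
 have "mpoly.independent C & mpoly.span C = V"
  unfolding C_def by (rule someI[of _ B]) (use B in "auto simp: is_basis_def")
 then have "is_basis C V" using finite_dim_basis[OF V] by blast
 from trace_basis_indep[OF this B f] show ?thesis by (simp add: trace_on_def C_def)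
qed

text \<open>The identity matrix acts as \<open>col_perm\<close> only on polynomials in the first
  \<open>k\<close> rows, so agreement on \<open>V\<close> is what can be provided.\<close>

lemma trace_on_cong:
 assumes V: "finite_dim V" and "!!v. v \<in> V ==> f v = g v" shows "trace_on V f = trace_on V g"
proof -
 define C where "C = (SOME B. mpoly.independent B & mpoly.span B = V)"
 obtain B where B: "is_basis B V" using basis_obtains[OF V] .
 have "mpoly.independent C & mpoly.span C = V"
  unfolding C_def by (rule someI[of _ B]) (use B in "auto simp: is_basis_def")
 then have "C \<subseteq> V" using mpoly.span_superset by blast
 then show ?thesis using assms(2) by (auto simp: trace_on_def C_def[symmetric] Let_def intro!: sum.cong)
qed

lemma trace_on_lincomb:
 assumes V: "finite_dim V" and I: "finite I"
  and f: "!!i. i \<in> I ==> linear_op (f i)" "!!i v. i \<in> I ==> v \<in> V ==> f i v \<in> V"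
 shows "trace_on V (%p. \<Sum>i\<in>I. Const (c i) * f i p) = (\<Sum>i\<in>I. c i * trace_on V (f i))"
proof -
 obtain B where B: "is_basis B V" using basis_obtains[OF V] .
 have sub: "mpoly.subspace V" using V by (simp add: finite_dim_def)
 have BV: "b \<in> V" if "b \<in> B" for b using that B mpoly.span_superset by (auto simp: is_basis_def)
 let ?g = "%p. \<Sum>i\<in>I. Const (c i) * f i p"
 have lin: "linear_op ?g"
  unfolding linear_op_def
 proof (intro conjI allI)
  fix p q show "?g (p + q) = ?g p + ?g q"
   using f(1) by (simp add: linear_op_def distrib_left flip: sum.distrib)
 next
  fix a p
  show "?g (Const a * p) = Const a * ?g p" unfolding sum_distrib_left
   by (rule sum.cong) (use f(1) in "auto simp: linear_op_def mult.left_commute")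
 qed
 have maps: "?g v \<in> V" if "v \<in> V" for v
  by (intro mpoly.subspace_sum[OF sub] mpoly.subspace_scale[OF sub, simplified]) (use f(2) that in auto)
 have "trace_on V ?g = (\<Sum>b\<in>B. mpoly.representation B (?g b) b)"
  by (rule trace_on_basis[OF V B lin]) (rule maps)
 also have "... = (\<Sum>b\<in>B. \<Sum>i\<in>I. c i * mpoly.representation B (f i b) b)"
  by (intro sum.cong refl representation_sum'[OF B]) (use f(2) BV in auto)
 also have "... = (\<Sum>i\<in>I. c i * (\<Sum>b\<in>B. mpoly.representation B (f i b) b))"
  by (subst sum.swap) (simp add: sum_distrib_left)
 also have "... = (\<Sum>i\<in>I. c i * trace_on V (f i))"
  by (intro sum.cong refl) (simp add: trace_on_basis[OF V B f(1) f(2)])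
 finally show ?thesis .
qed

lemma finite_dim_subset: "finite_dim V ==> mpoly.subspace U ==> U \<subseteq> V ==> finite_dim U"
 unfolding finite_dim_def by blast

lemma dim_basis: "is_basis B V ==> mpoly.dim V = card B"
 unfolding is_basis_def by (metis mpoly.dim_eq_card_independent mpoly.dim_span)

lemma trace_on_projection:
 assumes V: "finite_dim V" and f: "linear_op f" "!!v. v \<in> V ==> f v \<in> U"
  and U: "mpoly.subspace U" "U \<subseteq> V" "!!u. u \<in> U ==> f u = u"
 shows "trace_on V f = of_nat (mpoly.dim U)"
proof -
 obtain C where C: "is_basis C U" using basis_obtains[OF finite_dim_subset[OF V U(1,2)]] .
 have CU: "C \<subseteq> U" using C mpoly.span_superset by (auto simp: is_basis_def)
 obtain B where B: "C \<subseteq> B" "is_basis B V"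
  using basis_extends[OF V, of C] C CU U(2) by (auto simp: is_basis_def)
 have BV: "b \<in> V" if "b \<in> B" for b using that B mpoly.span_superset by (auto simp: is_basis_def)
 have iB: "mpoly.independent B" "finite B" using B by (auto simp: is_basis_def)
 have "mpoly.representation B (f b) b = (if b \<in> C then 1 else 0)" if b: "b \<in> B" for b
 proof (cases "b \<in> C")
  case True
  then have "f b = b" using CU U(3) by blast
  then show ?thesis using mpoly.representation_basis[OF iB(1) b] True by simp
 next
  case False
  have fU: "f b \<in> U" using f(2) BV[OF b] by blast
  have "mpoly.representation B (f b) = mpoly.representation C (f b)"
   by (rule mpoly.representation_extend[OF iB(1)]) (use fU C B(1) in "auto simp: is_basis_def")
  moreover have "mpoly.representation C (f b) b = 0"
   using mpoly.representation_ne_zero[of C "f b" b] False by blast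
  ultimately show ?thesis using False by simp
 qed
 then have "(\<Sum>b\<in>B. mpoly.representation B (f b) b) = of_nat (card C)"
  using B(1) iB(2) by (simp add: sum.If_cases Int_absorb1)
 then show ?thesis using trace_on_basis[OF V B(2) f(1)] f(2) U(2) dim_basis[OF C] by auto
qed

lemma trace_on_transport:
 assumes V: "finite_dim V" and f: "linear_op f" "!!v. v \<in> V ==> f v \<in> V"
  and g: "linear_op g" "!!w. w \<in> W ==> g w \<in> W" and W: "finite_dim W"
  and R: "linear_op R" "bij_betw R V W" "!!v. v \<in> V ==> R (f v) = g (R v)"
 shows "trace_on V f = trace_on W g"
proof -
 obtain B where B: "is_basis B V" using basis_obtains[OF V] .
 have sub: "mpoly.subspace V" using V by (simp add: finite_dim_def)
 have BV: "b \<in> V" if "b \<in> B" for b using that B mpoly.span_superset by (auto simp: is_basis_def)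
 have fin: "finite B" using B by (simp add: is_basis_def)
 have inj: "inj_on R V" and img: "R ` V = W" using R(2) by (auto simp: bij_betw_def)
 have injB: "inj_on R B" using inj_on_subset[OF inj] BV by blast
 interpret R: Vector_Spaces.linear "%a p. Const a * p" "%a p. Const a * p" R
  by unfold_locales (use R(1) in "auto simp: linear_op_def")
 have "mpoly.span (R ` B) = W"
  using R.span_image[of B] B img by (simp add: is_basis_def)
 moreover have "mpoly.independent (R ` B)"
  by (rule R.independent_inj_on_image) (use B inj in "auto simp: is_basis_def")
 ultimately have RB: "is_basis (R ` B) W" using fin by (simp add: is_basis_def)
 have rep: "mpoly.representation (R ` B) (R v) (R b) = mpoly.representation B v b" if v: "v \<in> V" and b: "b \<in> B" for v b
 proof -
  have "R v = R (\<Sum>c\<in>B. Const (mpoly.representation B v c) * c)" by (simp add: basis_expand[OF B v])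
  also have "... = (\<Sum>c\<in>B. Const (mpoly.representation B v c) * R c)" by (rule linear_op_sum[OF R(1)])
  finally have "mpoly.representation (R ` B) (R v) (R b) =
   (\<Sum>c\<in>B. mpoly.representation B v c * mpoly.representation (R ` B) (R c) (R b))"
   using representation_sum'[OF RB, of B R] BV img by auto
  also have "... = (\<Sum>c\<in>B. if c = b then mpoly.representation B v b else 0)"
   using RB injB b by (intro sum.cong refl) (auto simp: is_basis_def mpoly.representation_basis inj_on_eq_iff)
  finally show ?thesis using b fin by (simp add: sum.delta)
 qed
 have "trace_on W g = (\<Sum>c\<in>R ` B. mpoly.representation (R ` B) (g c) c)"
  by (rule trace_on_basis[OF W RB g])
 also have "... = (\<Sum>b\<in>B. mpoly.representation (R ` B) (R (f b)) (R b))"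
  using injB R(3) BV by (simp add: sum.reindex)
 also have "... = (\<Sum>b\<in>B. mpoly.representation B (f b) b)"
  by (intro sum.cong refl rep f(2) BV)
 also have "... = trace_on V f" by (rule trace_on_basis[OF V B f, symmetric])
 finally show ?thesis ..
qed

text \<open>The operator \<open>e\<close> averages \<open>act g\<close> with weights
  \<open>\<chi> g\<close>. It projects onto the isotypic part of the character, so its trace is a
  dimension. As the values of \<open>\<chi>\<close> have square 1, the character is its own
  inverse.\<close>

lemma trace_char_sum:
 fixes act :: "('a => 'a) => mpoly => mpoly"
 assumes V: "finite_dim V" and G: "finite G" "G ~= {}"
  and lin: "!!g. g \<in> G ==> linear_op (act g)" "!!g v. g \<in> G ==> v \<in> V ==> act g v \<in> V"
  and hom: "!!g r v. g \<in> G ==> r \<in> G ==> act (g o r) v = act g (act r v)"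
  and bij: "!!g. g \<in> G ==> bij_betw (%r. g o r) G G"
  and chi: "!!g r. g \<in> G ==> r \<in> G ==> \<chi> (g o r) = \<chi> g * \<chi> r" "!!g. g \<in> G ==> \<chi> g * \<chi> g = (1 :: rat)"
 shows "(\<Sum>g\<in>G. \<chi> g * trace_on V (act g)) =
  of_nat (card G) * of_nat (mpoly.dim {p \<in> V. \<forall>g\<in>G. act g p = Const (\<chi> g) * p})"
proof -
 let ?N = "of_nat (card G) :: rat"
 have N: "?N ~= 0" using G by simp
 let ?U = "{p \<in> V. \<forall>g\<in>G. act g p = Const (\<chi> g) * p}"
 define e where "e p = (\<Sum>g\<in>G. Const (\<chi> g / ?N) * act g p)" for p
 have sub: "mpoly.subspace V" using V by (simp add: finite_dim_def)
 have "(\<Sum>g\<in>G. \<chi> g * trace_on V (act g)) = ?N * (\<Sum>g\<in>G. \<chi> g / ?N * trace_on V (act g))"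
  using N by (simp add: sum_distrib_left)
 also have "(\<Sum>g\<in>G. \<chi> g / ?N * trace_on V (act g)) = trace_on V e"
  unfolding e_def by (rule trace_on_lincomb[OF V G(1) lin, symmetric])
 also have "trace_on V e = of_nat (mpoly.dim ?U)"
 proof (rule trace_on_projection[OF V])
  show "linear_op e" unfolding linear_op_def
  proof (intro conjI allI)
   fix p q show "e (p + q) = e p + e q"
    using lin(1) by (simp add: e_def linear_op_def distrib_left flip: sum.distrib)
  next
   fix c p
   show "e (Const c * p) = Const c * e p" unfolding e_def sum_distrib_left
    by (rule sum.cong) (use lin(1) in "auto simp: linear_op_def mult.left_commute")
  qed
  show "e v \<in> ?U" if v: "v \<in> V" for v
  proof (intro CollectI conjI ballI)
   show "e v \<in> V" unfolding e_def
    by (intro mpoly.subspace_sum[OF sub] mpoly.subspace_scale[OF sub, simplified]) (use lin(2) v in auto)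
   fix r assume t: "r \<in> G"
   have "act r (e v) = (\<Sum>g\<in>G. Const (\<chi> g / ?N) * act (r o g) v)"
    unfolding e_def linear_op_sum[OF lin(1)[OF t]] by (intro sum.cong refl) (simp add: hom t)
   also have "... = (\<Sum>g\<in>G. Const (\<chi> r) * (Const (\<chi> (r o g) / ?N) * act (r o g) v))"
   proof (rule sum.cong[OF refl])
    fix g assume s: "g \<in> G"
    have "\<chi> r * (\<chi> (r o g) / ?N) = \<chi> r * \<chi> r * \<chi> g / ?N" using chi(1)[OF t s] by simp
    also have "... = \<chi> g / ?N" using chi(2)[OF t] by simp
    finally show "Const (\<chi> g / ?N) * act (r o g) v = Const (\<chi> r) * (Const (\<chi> (r o g) / ?N) * act (r o g) v)"
     by (simp only: Const_mult[symmetric] mult.assoc[symmetric])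
   qed
   also have "... = Const (\<chi> r) * e v"
    unfolding e_def sum_distrib_left by (rule sum.reindex_bij_betw[OF bij[OF t]])
   finally show "act r (e v) = Const (\<chi> r) * e v" .
  qed
  show "mpoly.subspace ?U"
  proof (rule mpoly.subspaceI)
   have "act g 0 = 0" if "g \<in> G" for g using linear_op_sum[OF lin(1)[OF that], of _ _ "{}"] by simp
   then show "0 \<in> ?U" using mpoly.subspace_0[OF sub] by simp
  next
   fix x y assume "x \<in> ?U" "y \<in> ?U"
   then show "x + y \<in> ?U" using lin(1) mpoly.subspace_add[OF sub] by (auto simp: linear_op_def distrib_left)
  next
   fix c x assume "x \<in> ?U"
   then show "Const c * x \<in> ?U"
    using lin(1) mpoly.subspace_scale[OF sub, of x c] by (auto simp: linear_op_def mult.left_commute)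
  qed
  show "e u = u" if "u \<in> ?U" for u
  proof -
   have "e u = (\<Sum>g\<in>G. Const (1 / ?N) * u)" unfolding e_def
   proof (rule sum.cong[OF refl])
    fix g assume s: "g \<in> G"
    then have "Const (\<chi> g / ?N) * act g u = Const (\<chi> g / ?N * \<chi> g) * u" using that by (simp add: Const_mult mult.assoc)
    moreover have "\<chi> g / ?N * \<chi> g = 1 / ?N" using chi(2)[OF s] by simp
    ultimately show "Const (\<chi> g / ?N) * act g u = Const (1 / ?N) * u" by simp
   qed
   also have "... = Const (\<Sum>g\<in>G. 1 / ?N) * u" by (simp only: Const_sum sum_distrib_right)
   also have "(\<Sum>g\<in>G. 1 / ?N) = 1" using N by simp
   finally show ?thesis by simp
  qed
 qed auto
 finally show ?thesis .
qed

section \<open>Orbits of permutations\<close>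

lemma orbit_eq_if_mem:
 assumes "permutation s" "v \<in> orbit s w" shows "orbit s v = orbit s w"
proof (rule equalityI)
 show "orbit s v \<subseteq> orbit s w" using orbit_trans[OF _ assms(2)] by blast
 have "w \<in> orbit s v" by (rule orbit_swap[OF permutation_self_in_orbit[OF assms(1)] assms(2)])
 then show "orbit s w \<subseteq> orbit s v" using orbit_trans by (metis subsetI)
qed

text \<open>Composing with the transposition of \<open>x\<close> and \<open>s x\<close> makes the
  permutation bypass \<open>x\<close>: the cycle of \<open>x\<close> loses this point and all other
  cycles stay.\<close>

lemma orbit_insert:
 assumes S: "finite S" "x \<notin> S" and s: "s permutes insert x S" and w: "w \<in> S"
  and t: "t = transpose x (s x) o s" and ne: "s x ~= x"
 shows "orbit s w - {x} = orbit t w"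
proof -
 have inj: "inj s" by (rule permutes_inj[OF s])
 have \<tau>S: "t permutes S" unfolding t by (rule permutes_insert_lemma[OF s])
 have \<tau>v: "t v = (if s v = x then s x else s v)" if "v ~= x" for v
  using that inj by (auto simp: t transpose_def inj_eq)
 have sub: "orbit t w \<subseteq> S" by (rule permutes_orbit_subset[OF \<tau>S w])
 have a: "v \<in> orbit s w" if "v \<in> orbit t w" for v
  using that
 proof induction
  case base
  have "w ~= x" using w S by auto
  then show ?case using \<tau>v[of w] orbit.base[of s w] orbit.step[of "s w" s w] by auto
 next
  case (step v)
  then have "v ~= x" using sub S by auto
  then show ?case using \<tau>v[of v] orbit.step[OF step.IH] orbit.step[OF orbit.step[OF step.IH]] by auto
 qed
 have b: "if v = x then s x \<in> orbit t w else v \<in> orbit t w" if "v \<in> orbit s w" for v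
  using that
 proof induction
  case base
  have "w ~= x" using w S by auto
  then show ?case using \<tau>v[of w] orbit.base[of t w] by auto
 next
  case (step v)
  show ?case
  proof (cases "v = x")
   case True then show ?thesis using step.IH ne by simp
  next
   case False then show ?thesis using step.IH \<tau>v[of v] orbit.step[of v t w] by auto
  qed
 qed
 show ?thesis
 proof (intro equalityI subsetI)
  fix v assume "v \<in> orbit s w - {x}"
  then show "v \<in> orbit t w" using b[of v] by simp
 next
  fix v assume "v \<in> orbit t w"
  then show "v \<in> orbit s w - {x}" using a[of v] sub S by auto
 qed
qed

text \<open>Remove a point. If it is fixed, one orbit disappears and the sign stays; otherwise the
  number of orbits stays, while the sign and the parity of the set both change.\<close>

lemma card_orbits_parity:
 "finite S ==> s permutes S ==> (-1) ^ card (orbit s ` S) = (-1) ^ card S * sign s"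
proof (induction S arbitrary: s rule: finite_induct)
 case empty then show ?case by simp
next
 case (insert x S)
 define t where "t = transpose x (s x) o s"
 have \<tau>S: "t permutes S" unfolding t_def by (rule permutes_insert_lemma[OF insert.prems])
 have perm: "permutation s" by (rule permutes_imp_permutation[OF _ insert.prems]) (use insert in auto)
 have permt: "permutation t" by (rule permutes_imp_permutation[OF insert.hyps(1) \<tau>S])
 note IH = insert.IH[OF \<tau>S]
 show ?case
 proof (cases "s x = x")
  case True
  then have "t = s" by (simp add: t_def)
  moreover have "orbit s x = {x}" using True by (simp add: orbit_eq_singleton_iff)
  moreover have "{x} \<notin> orbit s ` S"
  proof
   assume "{x} \<in> orbit s ` S"
   then obtain w where "w \<in> S" "orbit s w = {x}" by auto
   then show False using permutation_self_in_orbit[OF perm, of w] insert.hyps by auto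
  qed
  ultimately show ?thesis using IH insert.hyps by simp
 next
  case False
  have y: "s x \<in> S" using permutes_in_image[OF insert.prems, of x] False by simp
  have eq: "orbit s ` insert x S = orbit s ` S"
  proof -
   have "orbit s x = orbit s (s x)" using orbit_eq_if_mem[OF perm orbit.base[of s x]] by simp
   then have "orbit s x \<in> orbit s ` S" using y by (rule image_eqI)
   then show ?thesis by (simp add: insert_absorb)
  qed
  have del: "orbit s w - {x} = orbit t w" if "w \<in> S" for w
   by (rule orbit_insert[OF insert.hyps insert.prems that t_def False])
  have "inj_on (%B. B - {x}) (orbit s ` S)"
  proof (rule inj_onI)
   fix O1 O2 assume "O1 \<in> orbit s ` S" "O2 \<in> orbit s ` S" and e: "O1 - {x} = O2 - {x}"
   then obtain w1 w2 where w: "w1 \<in> S" "w2 \<in> S" "O1 = orbit s w1" "O2 = orbit s w2" by auto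
   have "w1 \<in> O1 - {x}" using permutation_self_in_orbit[OF perm, of w1] w insert.hyps by auto
   then have "w1 \<in> orbit s w2" using e w by auto
   then show "O1 = O2" using orbit_eq_if_mem[OF perm] w by simp
  qed
  moreover have "(%B. B - {x}) ` (orbit s ` S) = orbit t ` S" using del by (auto simp: image_image)
  ultimately have "card (orbit s ` S) = card (orbit t ` S)" using card_image by fastforce
  moreover have "sign t = - sign s"
   unfolding t_def using False by (subst sign_compose[OF permutation_swap_id perm]) (simp add: sign_swap_id)
  ultimately show ?thesis using IH eq insert.hyps by simp
 qed
qed

lemma orbits_part:
 assumes "finite S" "s permutes S"
 shows "(\<Sum>B\<in>orbit s ` S. card B) = card S" "!!B. B \<in> orbit s ` S ==> 1 \<le> card B"
proof -
 have perm: "permutation s" by (rule permutes_imp_permutation[OF assms])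
 have sub: "orbit s w \<subseteq> S" if "w \<in> S" for w by (rule permutes_orbit_subset[OF assms(2) that])
 have "\<Union>(orbit s ` S) = S" using sub permutation_self_in_orbit[OF perm] by blast
 moreover have "card (\<Union>(orbit s ` S)) = (\<Sum>B\<in>orbit s ` S. card B)"
 proof (rule card_Union_disjoint)
  show "pairwise disjnt (orbit s ` S)"
  proof (rule pairwiseI)
   fix O1 O2 assume B: "O1 \<in> orbit s ` S" "O2 \<in> orbit s ` S" "O1 ~= O2"
   show "disjnt O1 O2"
   proof (rule ccontr)
    assume "\<not> disjnt O1 O2"
    then obtain z where "z \<in> O1" "z \<in> O2" by (auto simp: disjnt_def)
    then have "O1 = orbit s z" "O2 = orbit s z" using B orbit_eq_if_mem[OF perm] by auto
    then show False using B by simp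
   qed
  qed
 qed (use finite_subset[OF sub assms(1)] in auto)
 ultimately show "(\<Sum>B\<in>orbit s ` S. card B) = card S" by simp
 fix B assume "B \<in> orbit s ` S"
 then obtain w where w: "w \<in> S" "B = orbit s w" by auto
 then have "finite B" "w \<in> B" using finite_subset[OF sub assms(1)] permutation_self_in_orbit[OF perm] by auto
 then have "card B ~= 0" by auto
 then show "1 \<le> card B" by simp
qed

text \<open>Invariant functions are those that are constant on orbits; \<open>?G\<close> reads such
  a function off at a chosen representative of each orbit.\<close>

lemma card_invariant_functions:
 assumes "finite S" "s permutes S"
 shows "card {f \<in> S \<rightarrow>\<^sub>E T. f o s = f} = card T ^ card (orbit s ` S)"
proof -
 have perm: "permutation s" by (rule permutes_imp_permutation[OF assms])
 have sub: "orbit s w \<subseteq> S" if "w \<in> S" for w by (rule permutes_orbit_subset[OF assms(2) that])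
 have self: "w \<in> orbit s w" for w by (rule permutation_self_in_orbit[OF perm])
 have fin: "finite (orbit s ` S)" using assms(1) by simp
 let ?F = "%g. %w. if w \<in> S then g (orbit s w) else undefined"
 let ?G = "%f. %B. if B \<in> orbit s ` S then f (SOME w. w \<in> B) else undefined"
 have const: "f v = f w" if "f o s = f" "v \<in> orbit s w" for f :: "'a => 'b" and v w
  using that(2) by induction (use that(1) in "auto simp: fun_eq_iff")
 have "bij_betw ?F (orbit s ` S \<rightarrow>\<^sub>E T) {f \<in> S \<rightarrow>\<^sub>E T. f o s = f}"
 proof (rule bij_betw_byWitness[where f' = ?G])
  show "\<forall>g\<in>orbit s ` S \<rightarrow>\<^sub>E T. ?G (?F g) = g"
  proof (intro ballI ext)
   fix g B assume g: "g \<in> orbit s ` S \<rightarrow>\<^sub>E T"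
   show "?G (?F g) B = g B"
   proof (cases "B \<in> orbit s ` S")
    case True
    then obtain w where w: "w \<in> S" "B = orbit s w" by auto
    have "(SOME w. w \<in> B) \<in> B" by (rule someI[of _ w]) (use w self in simp)
    then have "(SOME w. w \<in> B) \<in> S" "orbit s (SOME w. w \<in> B) = B" using w sub orbit_eq_if_mem[OF perm] by auto
    then show ?thesis using True by simp
   next
    case False
    then show ?thesis using PiE_arb[OF g False] by simp
   qed
  qed
  show "\<forall>f\<in>{f \<in> S \<rightarrow>\<^sub>E T. f o s = f}. ?F (?G f) = f"
  proof (intro ballI ext)
   fix f w assume f: "f \<in> {f \<in> S \<rightarrow>\<^sub>E T. f o s = f}"
   show "?F (?G f) w = f w"
   proof (cases "w \<in> S")
    case True
    have "(SOME v. v \<in> orbit s w) \<in> orbit s w" by (rule someI[of _ w]) (rule self)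
    then have "f (SOME v. v \<in> orbit s w) = f w" using const f by blast
    then show ?thesis using True by simp
   next
    case False
    have fE: "f \<in> S \<rightarrow>\<^sub>E T" using f by simp
    show ?thesis using PiE_arb[OF fE False] False by simp
   qed
  qed
  show "?F ` (orbit s ` S \<rightarrow>\<^sub>E T) \<subseteq> {f \<in> S \<rightarrow>\<^sub>E T. f o s = f}"
  proof (intro image_subsetI CollectI conjI)
   fix g assume g: "g \<in> orbit s ` S \<rightarrow>\<^sub>E T"
   show "?F g \<in> S \<rightarrow>\<^sub>E T" using g by (auto simp: PiE_iff extensional_def)
   show "?F g o s = ?F g"
   proof
    fix w show "(?F g o s) w = ?F g w"
     using permutes_in_image[OF assms(2), of w] orbit_eq_if_mem[OF perm orbit.base[of s w]] by simp
   qed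
  qed
  show "?G ` {f \<in> S \<rightarrow>\<^sub>E T. f o s = f} \<subseteq> orbit s ` S \<rightarrow>\<^sub>E T"
  proof (rule image_subsetI)
   fix f assume f: "f \<in> {f \<in> S \<rightarrow>\<^sub>E T. f o s = f}"
   have "(SOME v. v \<in> orbit s w) \<in> S" if "w \<in> S" for w
    using someI[of "%v. v \<in> orbit s w", OF self] sub[OF that] by blast
   then show "?G f \<in> orbit s ` S \<rightarrow>\<^sub>E T" using f by (auto simp: PiE_iff extensional_def)
  qed
 qed
 then have "card {f \<in> S \<rightarrow>\<^sub>E T. f o s = f} = card (orbit s ` S \<rightarrow>\<^sub>E T)"
  by (rule bij_betw_same_card[symmetric])
 then show ?thesis using fin by (simp add: card_PiE)
qed

text \<open>The third fact links the specialization of power sums with the sign character: a cycle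
  of length \<open>r\<close> contributes (-1)^(r-1).\<close>

lemma cycle_type_facts:
 assumes "s permutes {..<n}"
 shows "sum_list (cycle_type n s) = n" "0 \<notin> set (cycle_type n s)"
  "(\<Prod>r\<leftarrow>cycle_type n s. (-1) ^ (r - 1)) = (of_int (sign s) :: rat)"
proof -
 let ?B = "orbit s ` {..<n}"
 have fin: "finite ?B" by simp
 note part = orbits_part[OF finite_lessThan assms]
 have m: "mset (cycle_type n s) = image_mset card (mset_set ?B)" by (simp add: cycle_type_def)
 have "sum_list (cycle_type n s) = sum_mset (mset (cycle_type n s))" by (simp add: sum_mset_sum_list)
 also have "... = (\<Sum>B\<in>?B. card B)" unfolding m by (simp add: sum_unfold_sum_mset)
 finally show "sum_list (cycle_type n s) = n" using part(1) by simp
 have "set (cycle_type n s) = card ` ?B" using m fin by (metis finite_set_mset_mset_set set_image_mset set_mset_mset)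
 then show "0 \<notin> set (cycle_type n s)" using part(2) by force
 have "(\<Prod>r\<leftarrow>cycle_type n s. (-1) ^ (r - 1)) = prod_mset (image_mset (%r. (-1 :: rat) ^ (r - 1)) (mset (cycle_type n s)))"
  by (metis mset_map prod_mset_prod_list)
 also have "... = (\<Prod>B\<in>?B. (-1) ^ (card B - 1))"
  unfolding m by (simp add: prod_unfold_prod_mset image_mset.compositionality o_def)
 finally have e: "(\<Prod>r\<leftarrow>cycle_type n s. (-1) ^ (r - 1)) = (\<Prod>B\<in>?B. (-1 :: rat) ^ (card B - 1))" .
 have "(\<Prod>B\<in>?B. (-1 :: rat) ^ (card B - 1)) * (-1) ^ card ?B = (\<Prod>B\<in>?B. (-1) ^ (card B - 1) * (-1))"
  by (simp only: prod.distrib prod_constant)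
 also have "... = (\<Prod>B\<in>?B. (-1) ^ card B)"
 proof (rule prod.cong[OF refl])
  fix B assume "B \<in> ?B"
  then obtain c where "card B = Suc c" using part(2) by (metis Suc_le_D One_nat_def)
  then show "(-1 :: rat) ^ (card B - 1) * (-1) = (-1) ^ card B" by simp
 qed
 also have "... = (-1) ^ n" using part(1) by (simp add: power_sum[symmetric])
 finally have a: "(\<Prod>B\<in>?B. (-1 :: rat) ^ (card B - 1)) * (-1) ^ card ?B = (-1) ^ n" .
 have "(-1 :: int) ^ card ?B = (-1) ^ n * sign s"
  using card_orbits_parity[OF finite_lessThan assms] by simp
 then have "(-1 :: rat) ^ card ?B = (-1) ^ n * of_int (sign s)"
  by (metis of_int_1 of_int_minus of_int_mult of_int_power)
 then have "(\<Prod>B\<in>?B. (-1 :: rat) ^ (card B - 1)) * of_int (sign s) = 1"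
  using a by (simp add: mult.left_commute power_mult_distrib[symmetric])
 then have "(\<Prod>B\<in>?B. (-1 :: rat) ^ (card B - 1)) = of_int (sign s)"
  by (cases s rule: sign_cases) (auto simp: minus_equation_iff)
 then show "(\<Prod>r\<leftarrow>cycle_type n s. (-1) ^ (r - 1)) = (of_int (sign s) :: rat)" using e by simp
qed

section \<open>The character of the pol module\<close>

lemma linear_op_col_perm: "linear_op (col_perm s)"
 by (simp add: linear_op_def col_perm_add col_perm_scale)

lemma rows_bounded: obtains k where "1 \<le> k" "keys (d :: monomial) \<subseteq> {..<k}"
proof -
 obtain N where "keys d \<subseteq> {..<N}" by (rule keys_bounded)
 then show ?thesis by (intro that[of "Suc N"]) auto
qed

lemma dpart_homog: "p \<in> dpart n d ==> homog n d p"
 unfolding dpart_def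
proof (induction p rule: mpoly.span_induct_alt)
 case (step c x y) then show ?case by (auto intro: homog_add homog_scale gen_homog)
qed simp

lemma finite_dim_dpart: "finite_dim (dpart n d)"
proof -
 obtain k where k: "1 \<le> k" "keys d \<subseteq> {..<k}" by (rule rows_bounded)
 let ?X = "{..<k} \<times> {..<n}"
 let ?M = "{m :: nat \<times> nat \<Rightarrow>\<^sub>0 nat. \<forall>x. (x \<in> ?X --> lookup m x \<in> {..mon_degree d}) & (x \<notin> ?X --> lookup m x = 0)}"
 let ?F = "{f :: nat \<times> nat => nat. \<forall>x. (x \<in> ?X --> f x \<in> {..mon_degree d}) & (x \<notin> ?X --> f x = 0)}"
 have "finite ?F" by (rule finite_set_of_finite_funs) auto
 moreover have "lookup ` ?M \<subseteq> ?F" by (rule image_subsetI) simp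
 moreover have "inj_on lookup ?M" by (rule inj_onI) (auto intro: poly_mapping_eqI)
 ultimately have fin: "finite ?M" by (metis (no_types, lifting) finite_imageD finite_subset)
 have "p \<in> mpoly.span ((%m. single m 1) ` ?M)" if p: "p \<in> dpart n d" for p
 proof -
  have "p \<in> poly_ring k n" using dpart_in_pring[OF k] p by blast
  then have X: "keys m \<subseteq> ?X" if "m \<in> keys p" for m using that by (auto simp: poly_ring_def)
  have "m \<in> ?M" if m: "m \<in> keys p" for m
  proof (intro CollectI allI conjI impI)
   fix x assume "x \<in> ?X"
   then obtain i j where x: "x = (i, j)" "j < n" by auto
   have "lookup m (i, j) \<le> rdeg n i m"
    unfolding rdeg_def using x by (intro member_le_sum[of j "{..<n}" "%j. lookup m (i, j)"]) auto
   also have "... = lookup d i"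
    using dpart_homog[OF p] m by (simp add: homog_def in_keys_iff)
   also have "... \<le> mon_degree d" by (rule lookup_le_mon_degree)
   finally show "lookup m x \<in> {..mon_degree d}" using x by simp
  next
   fix x assume "x \<notin> ?X"
   then show "lookup m x = 0" using X[OF m] by (auto simp: in_keys_iff)
  qed
  then have s: "Const (lookup p m) * single m 1 \<in> mpoly.span ((%m. single m 1) ` ?M)"
   if "m \<in> keys p" for m
   using that by (intro span_Const_mult mpoly.span_base imageI)
  have "p = (\<Sum>m\<in>keys p. Const (lookup p m) * single m 1)"
   using mons_sum[of "keys p" p] by (simp add: Const_def mult_single)
  moreover have "... \<in> mpoly.span ((%m. single m 1) ` ?M)"
   by (rule mpoly.span_sum) (rule s)
  ultimately show ?thesis by simp
 qed
 then have "dpart n d \<subseteq> mpoly.span ((%m. single m 1) ` ?M)" by blast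
 moreover have "finite ((%m. single m (1 :: rat)) ` ?M)" using fin by (rule finite_imageI)
 ultimately show ?thesis unfolding finite_dim_def dpart_def
  using mpoly.subspace_span by blast
qed

lemma gl_sym_act_one_eq:
 assumes "p \<in> poly_ring k n" shows "gl_sym_act k (1\<^sub>m k) s p = col_perm s p"
 unfolding gl_sym_act_def col_perm_def
proof (rule sbst_cong[OF assms[unfolded pring_eq]])
 fix v assume "v \<in> {..<k} \<times> {..<n}"
 then obtain i j where v: "v = (i, j)" "i < k" by auto
 have "(\<Sum>a<k. Const (1\<^sub>m k $$ (i, a)) * Var (a, s j)) = (\<Sum>a<k. if a = i then Var (i, s j) else 0)"
  by (rule sum.cong) (use v in auto)
 then show "(case v of (i, j) => \<Sum>a<k. Const (1\<^sub>m k $$ (i, a)) * Var (a, s j)) = (case v of (i, j) => Var (i, s j))"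
  using v by (simp add: sum.delta)
qed

lemma col_perm_dpart:
 assumes "s permutes {..<n}" "p \<in> dpart n d" shows "col_perm s p \<in> dpart n d"
proof -
 obtain k where k: "1 \<le> k" "keys d \<subseteq> {..<k}" by (rule rows_bounded)
 have p: "p \<in> poly_ring k n" "p \<in> word_span n k"
  using assms(2) dpart_in_pring[OF k] multidpart_E_module[OF k, of n] E_module_eq[OF k(1), of n]
  by (auto simp: multidegree_part_def)
 have "gl_sym_act k (1\<^sub>m k) s p \<in> word_span n k"
  by (rule gl_sym_act_word_span[OF k(1) assms(1) _ _ p(2)]) (auto simp: invertible_mat_def inverts_mat_def square_mat.simps intro!: exI[of _ "1\<^sub>m k"])
 then have W: "col_perm s p \<in> word_span n k" by (simp add: gl_sym_act_one_eq[OF p(1)])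
 have bij: "bij (%(i :: nat, j). (i, s j))" by (rule bij_col_map[OF permutes_bij[OF assms(1)]])
 have "rdeg n i m = lookup d i" if "lookup (col_perm s p) m ~= 0" for m i
 proof -
  have "rdeg n i (map_key (%(i, j). (i, s j)) m) = lookup d i"
   using that dpart_homog[OF assms(2)] by (simp add: col_perm_rename lookup_rename[OF bij] homog_def)
  moreover have "rdeg n i (map_key (%(i, j). (i, s j)) m) = rdeg n i m"
   unfolding rdeg_def using sum.permute[OF assms(1), of "%j. lookup m (i, j)"] bij
   by (simp add: map_key.rep_eq bij_is_inj o_def)
  ultimately show ?thesis by simp
 qed
 then have "col_perm s p \<in> multidegree_part k n d (E_module k n)"
  using W by (auto simp: multidegree_part_def E_module_eq[OF k(1)] in_keys_iff rdeg_def)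
 then show ?thesis by (simp add: multidpart_E_module[OF k])
qed

text \<open>The Frobenius characteristic of one multidegree without reference to the number of rows.
  The factor 1/n! belongs to the coefficients, so that the series is visibly a linear combination of
  products of power sums.\<close>

definition frob_part :: "nat => monomial => series" where
 "frob_part n d = (%x. \<Sum>s | s permutes {..<n}.
   trace_on (dpart n d) (col_perm s) / fact n * power_sum_partition (cycle_type n s) x)"

lemma E_char_eq:
 assumes k: "1 \<le> k" "keys d \<subseteq> {..<k}" shows "E_character k n d x = frob_part n d x"
proof -
 have "trace_on (dpart n d) (gl_sym_act k (1\<^sub>m k) s) = trace_on (dpart n d) (col_perm s)" for s
  by (rule trace_on_cong[OF finite_dim_dpart gl_sym_act_one_eq])
   (use dpart_in_pring[OF k] in blast)
 then show ?thesis using k(2)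
  by (simp add: E_character_def Frob_def frob_part_def multidpart_E_module[OF k] sum_divide_distrib)
qed

lemma power_sum_sym: "power_sum r \<in> Sym"
proof -
 have "(\<exists>v. map_key p m = single v r) \<longleftrightarrow> (\<exists>v. m = single v r)"
  if "bij p" for p and m :: monomial
 proof -
  have key: "map_key p (single (p v) r) = single v r" for v
   using that by (intro poly_mapping_eqI) (auto simp: lookup_map_key bij_is_inj lookup_single when_def inj_eq)
  have inj: "a = b" if e: "map_key p a = map_key p b" for a b :: monomial
  proof (rule poly_mapping_eqI)
   fix w obtain v where "w = p v" using surjD[OF bij_is_surj[OF \<open>bij p\<close>], of w] by blast
   then show "lookup a w = lookup b w"
    using arg_cong[OF e, of "%z. lookup z v"] \<open>bij p\<close> by (simp add: lookup_map_key bij_is_inj)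
  qed
  show ?thesis
  proof
   assume "\<exists>v. map_key p m = single v r"
   then show "\<exists>v. m = single v r" using key inj by metis
  next
   assume "\<exists>v. m = single v r"
   then obtain w where "m = single w r" ..
   moreover obtain v where "w = p v" using surjD[OF bij_is_surj[OF \<open>bij p\<close>], of w] by blast
   ultimately show "\<exists>v. map_key p m = single v r" using key by auto
  qed
 qed
 moreover have "power_sum r m = 0" if "mon_degree m > r" for m using that by (auto simp: power_sum_def)
 ultimately show ?thesis unfolding symmetric_functions_def power_sum_def by auto
qed

lemma power_sum_part_sym: "power_sum_partition g \<in> Sym"
proof (induction g)
 case Nil
 have z: "(map_key p m = 0) = (m = 0)" if "bij p" for p and m :: monomial
 proof
  assume e: "map_key p m = 0"
  show "m = 0"
  proof (rule poly_mapping_eqI)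
   fix w obtain v where "w = p v" using surjD[OF bij_is_surj[OF \<open>bij p\<close>], of w] by blast
   then show "lookup m w = lookup 0 w"
    using arg_cong[OF e, of "%z. lookup z v"] that by (simp add: lookup_map_key bij_is_inj)
  qed
 next
  assume "m = 0" then show "map_key p m = 0"
   using that by (simp add: map_key_zero bij_is_inj)
 qed
 have "series_one (map_key p m) = series_one m" if "bij p" for p m
  by (simp add: series_one_def z[OF that])
 moreover have "\<exists>D. \<forall>m. D < mon_degree m --> series_one m = 0"
  by (rule exI[of _ 0]) (auto simp: series_one_def mon_degree_def)
 ultimately show ?case by (simp add: power_sum_partition_def symmetric_functions_def)
next
 case (Cons r g)
 then show ?case using series_mult_sym[OF power_sum_sym[of r]] by (simp add: power_sum_partition_def)
qed

lemma power_sum_part_degree: "power_sum_partition g x ~= 0 ==> mon_degree x = sum_list g"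
proof (induction g arbitrary: x)
 case Nil then show ?case by (auto simp: power_sum_partition_def series_one_def mon_degree_def split: if_splits)
next
 case (Cons r g)
 then have "(\<Sum>(a, b) | a + b = x. power_sum r a * power_sum_partition g b) ~= 0"
  by (simp add: power_sum_partition_def series_mult_def)
 then obtain ab where "ab \<in> {(a, b). a + b = x}" "(case ab of (a, b) => power_sum r a * power_sum_partition g b) ~= 0"
  by (rule sum.not_neutral_contains_not_neutral)
 then obtain a b where ab: "a + b = x" "power_sum r a ~= 0" "power_sum_partition g b ~= 0" by auto
 then have "mon_degree a = r" by (auto simp: power_sum_def split: if_splits)
 then show ?case using ab Cons.IH[OF ab(3)] by (simp add: mon_degree_add flip: ab(1))
qed

lemma finite_perms: "finite {s. s permutes {..<n :: nat}}"
 by (rule finite_permutations) simp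

lemma frob_part_sym: "frob_part n d \<in> Sym"
 unfolding frob_part_def
 by (intro Sym_sum finite_perms power_sum_part_sym)

lemma frob_part_degree:
 assumes "mon_degree x ~= n" shows "frob_part n d x = 0"
 unfolding frob_part_def
proof (rule sum.neutral, rule ballI)
 fix s assume "s \<in> {s. s permutes {..<n}}"
 then have "power_sum_partition (cycle_type n s) x = 0"
  using power_sum_part_degree[of "cycle_type n s" x] cycle_type_facts(1)[of s n] assms by auto
 then show "trace_on (dpart n d) (col_perm s) / fact n * power_sum_partition (cycle_type n s) x = 0" by simp
qed

lemma gen_degree: "gen n d p ==> mon_degree d \<le> top_degree n"
proof (induction rule: gen.induct)
 case (gen_pol d p r e)
 have "d - single 0 e + single 0 e = d"
  by (rule poly_mapping_eqI) (use gen_pol in "auto simp: lookup_add lookup_minus lookup_single when_def")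
 then have "mon_degree (d - single 0 e) + e = mon_degree d"
  by (metis mon_degree_add mon_degree_single)
 then show ?case using gen_pol by (simp add: mon_degree_add)
next
 case (gen_pd d p j)
 have "d - single 0 1 + single 0 1 = d"
  by (rule poly_mapping_eqI) (use gen_pd in "auto simp: lookup_add lookup_minus lookup_single when_def")
 then have "mon_degree (d - single 0 1) + 1 = mon_degree d"
  by (metis mon_degree_add mon_degree_single)
 then show ?case using gen_pd by simp
qed simp

lemma frob_part_large_degree:
 assumes "mon_degree d > top_degree n" shows "frob_part n d = 0"
proof -
 have "{p. gen n d p} = {}" using gen_degree[of n d] assms by fastforce
 then have V: "dpart n d = {0}" by (simp add: dpart_def)
 have "is_basis {} (dpart n d)" by (simp add: is_basis_def V mpoly.independent_empty)
 then have "trace_on (dpart n d) (col_perm s) = 0" if "s permutes {..<n}" for s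
  using trace_on_basis[OF finite_dim_dpart _ linear_op_col_perm, of "{}" n d s] col_perm_dpart[OF that] by simp
 then show ?thesis by (auto simp: frob_part_def fun_eq_iff intro!: sum.neutral)
qed

lemma rename_rename: "rename f (rename g p) = rename (f o g) p"
 by (simp add: rename_def sbst_sbst)

lemma linear_op_rename: "linear_op (rename r)"
 by (simp add: linear_op_def rename_def sbst_add sbst_scale)

text \<open>Exchanging two rows is the action of a permutation matrix, so the closure under GL_k
  maps one multidegree component to the other. This is the source of the symmetry of the character
  in \<open>Q\<close>.\<close>

lemma rename_rows_dpart:
 assumes "p \<in> dpart n d"
 shows "rename (%(i, j). (transpose a b i, j)) p \<in> dpart n (map_key (transpose a b) d)"
proof -
 let ?t = "transpose a b"
 obtain k0 where k0: "1 \<le> k0" "keys d \<subseteq> {..<k0}" by (rule rows_bounded)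
 define k where "k = max k0 (Suc (max a b))"
 have k: "1 \<le> k" "keys d \<subseteq> {..<k}" "a < k" "b < k" using k0 by (auto simp: k_def)
 have tk: "?t i < k \<longleftrightarrow> i < k" for i using k by (auto simp: transpose_def)
 define A where "A = mat k k (%(i, j). if j = ?t i then 1 else (0 :: rat))"
 have A: "A \<in> carrier_mat k k" by (simp add: A_def)
 have "A * A = 1\<^sub>m k"
 proof (rule eq_matI)
  fix i j assume ij: "i < dim_row (1\<^sub>m k :: rat mat)" "j < dim_col (1\<^sub>m k :: rat mat)"
  then have "(A * A) $$ (i, j) = (\<Sum>l = 0..<k. A $$ (i, l) * A $$ (l, j))" using A by (simp add: scalar_prod_def)
  also have "... = (\<Sum>l = 0..<k. if l = ?t i then if j = i then 1 else 0 else 0)"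
   by (rule sum.cong) (use ij in "auto simp: A_def")
  also have "... = (1\<^sub>m k :: rat mat) $$ (i, j)" using ij tk[of i] by (auto simp: sum.delta)
  finally show "(A * A) $$ (i, j) = (1\<^sub>m k :: rat mat) $$ (i, j)" .
 qed (auto simp: A_def)
 then have inv: "invertible_mat A" using A
  by (auto simp: invertible_mat_def inverts_mat_def square_mat.simps intro!: exI[of _ A])
 have p: "p \<in> poly_ring k n" "p \<in> word_span n k"
  using assms dpart_in_pring[OF k(1,2)] multidpart_E_module[OF k(1,2), of n] E_module_eq[OF k(1), of n]
  by (auto simp: multidegree_part_def)
 let ?R = "rename (%(i, j). (?t i, j))"
 have "gl_sym_act k A id p = ?R p"
  unfolding gl_sym_act_def rename_def
 proof (rule sbst_cong[OF p(1)[unfolded pring_eq]])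
  fix v assume "v \<in> {..<k} \<times> {..<n}"
  then obtain i j where v: "v = (i, j)" "i < k" by auto
  have "(\<Sum>l<k. Const (A $$ (i, l)) * Var (l, j)) = (\<Sum>l<k. if l = ?t i then Var (?t i, j) else 0)"
   by (rule sum.cong) (use v in "auto simp: A_def")
  then show "(case v of (i, j) => \<Sum>l<k. Const (A $$ (i, l)) * Var (l, id j)) = Var (case v of (i, j) => (?t i, j))"
   using v tk[of i] by (simp add: sum.delta)
 qed
 then have W: "?R p \<in> word_span n k"
  using gl_sym_act_word_span[OF k(1) permutes_id A inv p(2)] by simp
 have bij: "bij (%(i, j :: nat). (?t i, j))" by (rule involuntory_imp_bij) auto
 have keys: "keys (map_key ?t d) \<subseteq> {..<k}"
  using k(2) tk by (auto simp: keys_map_key)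
 have "rdeg n i m = lookup (map_key ?t d) i"
  if "lookup (?R p) m ~= 0" for m i
 proof -
  have "rdeg n (?t i) (map_key (%(i, j). (?t i, j)) m) = lookup d (?t i)"
   using that dpart_homog[OF assms] by (simp add: lookup_rename[OF bij] homog_def)
  moreover have "rdeg n (?t i) (map_key (%(i, j). (?t i, j)) m) = rdeg n i m"
   using bij by (simp add: rdeg_def map_key.rep_eq bij_is_inj)
  ultimately show ?thesis by (simp add: lookup_map_key)
 qed
 then have "?R p \<in> multidegree_part k n (map_key ?t d) (E_module k n)"
  using W by (auto simp: multidegree_part_def E_module_eq[OF k(1)] in_keys_iff rdeg_def)
 then show ?thesis by (simp add: multidpart_E_module[OF k(1) keys])
qed

lemma frob_part_transp: "frob_part n (map_key (transpose a b) d) = frob_part n d"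
proof -
 let ?t = "transpose a b"
 let ?R = "rename (%(i, j). (?t i, j))"
 let ?d = "map_key ?t d"
 have dd: "map_key ?t ?d = d"
  by (rule poly_mapping_eqI) (simp add: lookup_map_key)
 have RR: "?R (?R p) = p" for p
 proof -
  have "(%(i, j :: nat). (?t i, j)) o (%(i, j). (?t i, j)) = (%v. v)" by auto
  then have "?R (?R p) = rename (%v. v) p" by (simp only: rename_rename)
  then show ?thesis by (simp add: rename_def sbst_ident)
 qed
 have bij: "bij_betw ?R (dpart n d) (dpart n ?d)"
  by (rule bij_betw_byWitness[where f' = ?R])
   (use RR rename_rows_dpart[of _ n d a b] rename_rows_dpart[of _ n ?d a b] dd in auto)
 have "trace_on (dpart n ?d) (col_perm s) = trace_on (dpart n d) (col_perm s)" if s: "s permutes {..<n}" for s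
 proof (rule trace_on_transport[symmetric, OF finite_dim_dpart linear_op_col_perm _ linear_op_col_perm _
    finite_dim_dpart linear_op_rename bij])
  fix p
  have "(%(i, j). (?t i, j)) o (%(i, j). (i, s j)) = (%(i, j). (i, s j)) o (%(i, j). (?t i, j))" by auto
  then show "?R (col_perm s p) = col_perm s (?R p)" by (simp only: col_perm_rename rename_rename)
 qed (use col_perm_dpart[OF s] in auto)
 then show ?thesis unfolding frob_part_def by (intro ext sum.cong) auto
qed

lemma frob_part_bij: "bij p ==> frob_part n (map_key p d) = frob_part n d"
 by (rule sym_if_transpos[of "frob_part n", OF frob_part_transp])

text \<open>The multiplicity of a fixed Schur function in \<open>X\<close>, as a function of the
  multidegree, is itself a symmetric series in \<open>Q\<close>; its expansion completes the double
  expansion.\<close>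

definition cseries :: "nat => nat list => series" where
 "cseries n u = (%d. schur_coeff (frob_part n d) u)"

lemma frob_part_expn:
 "frob_part n d x = (\<Sum>u\<in>parts_upto n. cseries n u d * schur u x)"
 "u \<notin> parts_upto n ==> cseries n u d = 0"
proof -
 obtain c where c: "!!x. frob_part n d x = (\<Sum>u\<in>parts_upto n. c u * schur u x)"
  using schur_spanning[OF Sym_bij[OF frob_part_sym[of n d]], of n] frob_part_degree by (metis nat_less_le)
 have "is_schur_expansion (frob_part n d) (%u. if u \<in> parts_upto n then c u else 0)"
  by (rule is_schur_expn_sum[OF finite_parts_upto _ c]) (simp add: parts_upto_def)
 then have "cseries n u d = (if u \<in> parts_upto n then c u else 0)" for u
  by (simp add: cseries_def schur_coeff_eqI)
 then show "frob_part n d x = (\<Sum>u\<in>parts_upto n. cseries n u d * schur u x)"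
  "u \<notin> parts_upto n ==> cseries n u d = 0" using c by auto
qed

lemma schur_coeff_zero: "schur_coeff 0 = (%_. 0)"
 by (rule schur_coeff_eqI) (auto simp: is_schur_expansion_def schur_series_def fun_eq_iff)

lemma cseries_bij: "bij p ==> cseries n u (map_key p d) = cseries n u d"
 by (simp add: cseries_def frob_part_bij)

lemma cseries_degree: "mon_degree d > top_degree n ==> cseries n u d = 0"
 by (simp add: cseries_def frob_part_large_degree schur_coeff_zero)

lemma cseries_sym: "cseries n u \<in> Sym"
 unfolding symmetric_functions_def using cseries_bij cseries_degree by blast

lemma schur_series2_eq:
 assumes "finite S" "finite T" "!!v u. c v u ~= 0 ==> v \<in> S & u \<in> T"
 shows "schur_series2 c q x = (\<Sum>v\<in>S. \<Sum>u\<in>T. c v u * schur v q * schur u x)"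
proof -
 have "schur_series2 c q x = (\<Sum>(v, u)\<in>S \<times> T. c v u * schur v q * schur u x)"
  unfolding schur_series2_def by (rule sum.mono_neutral_left) (use assms in auto)
 then show ?thesis by (simp add: sum.cartesian_product)
qed

lemma schur_series2_unique:
 assumes c: "partition_supported2 c" and c': "partition_supported2 c'"
  and eq: "!!q x. schur_series2 c q x = schur_series2 c' q x"
 shows "c = c'"
proof (intro ext)
 let ?P = "{(v, u). c v u ~= 0} \<union> {(v, u). c' v u ~= 0}"
 have P: "finite ?P" "!!v u. (v, u) \<in> ?P ==> is_partition v & is_partition u"
  using c c' by (auto simp: partition_supported2_def)
 let ?S = "fst ` ?P" and ?T = "snd ` ?P"
 have S: "finite ?S" "!!v. v \<in> ?S ==> is_partition v" and T: "finite ?T" "!!u. u \<in> ?T ==> is_partition u"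
  using P by force+
 have supp: "c v u ~= 0 ==> v \<in> ?S & u \<in> ?T" "c' v u ~= 0 ==> v \<in> ?S & u \<in> ?T" for v u
  by (force simp: image_iff)+
 fix v u
 show "c v u = c' v u"
 proof (cases "v \<in> ?S & u \<in> ?T")
  case True
  have "(\<Sum>u\<in>?T. (\<Sum>v\<in>?S. (c v u - c' v u) * schur v q) * schur u x) = 0" for q x
  proof -
   have "(\<Sum>u\<in>?T. (\<Sum>v\<in>?S. (c v u - c' v u) * schur v q) * schur u x) =
    (\<Sum>v\<in>?S. \<Sum>u\<in>?T. c v u * schur v q * schur u x) - (\<Sum>v\<in>?S. \<Sum>u\<in>?T. c' v u * schur v q * schur u x)"
    unfolding sum_distrib_right by (subst sum.swap) (simp add: left_diff_distrib sum_subtractf)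
   then show ?thesis using eq[of q x] schur_series2_eq[OF S(1) T(1) supp(1)] schur_series2_eq[OF S(1) T(1) supp(2)]
    by simp
  qed
  then have "(\<Sum>v\<in>?S. (c v u - c' v u) * schur v q) = 0" for q
   using schur_indep[OF T(1) T(2), where c = "%u. \<Sum>v\<in>?S. (c v u - c' v u) * schur v q"] True by blast
  from schur_indep[OF S(1) S(2) this] True show ?thesis by simp
 next
  case False then show ?thesis using supp by metis
 qed
qed

text \<open>Existence: expand in \<open>X\<close>, then expand the coefficients in \<open>Q\<close>;
  bounded degrees in both alphabets make the support finite. Uniqueness: a monomial in
  \<open>Q\<close> involves finitely many variables, so it is seen by the character for some
  \<open>k\<close>.\<close>

lemma E_coeff_eq: "partition_supported2 (E_coeff n)" "E_coeff n = (%v u. schur_coeff (cseries n u) v)"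
proof -
 define c where "c = (%v u. schur_coeff (cseries n u) v)"
 let ?S = "parts_upto (top_degree n)" and ?T = "parts_upto n"
 have exp: "is_schur_expansion (cseries n u) (%v. c v u)" for u
  using schur_coeff_expn[OF cseries_sym] by (simp add: c_def)
 have suppS: "v \<in> ?S" if "c v u ~= 0" for v u
 proof -
  obtain b where b: "!!d. cseries n u d = (\<Sum>v\<in>?S. b v * schur v d)"
   using schur_spanning[where f = "cseries n u" and D = "top_degree n", OF cseries_bij cseries_degree] by blast
  have "is_schur_expansion (cseries n u) (%v. if v \<in> ?S then b v else 0)"
   by (rule is_schur_expn_sum[OF finite_parts_upto _ b]) (simp add: parts_upto_def)
  then have "c v u = (if v \<in> ?S then b v else 0)" by (simp add: c_def schur_coeff_eqI)
  then show ?thesis using that by (auto split: if_splits)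
 qed
 have suppT: "u \<in> ?T" if "c v u ~= 0" for v u
 proof (rule ccontr)
  assume "u \<notin> ?T"
  then have "cseries n u = 0" using frob_part_expn(2) by (auto simp: fun_eq_iff)
  then show False using that by (simp add: c_def schur_coeff_zero)
 qed
 have "{(v, u). c v u ~= 0} \<subseteq> ?S \<times> ?T" using suppS suppT by auto
 then have "finite {(v, u). c v u ~= 0}" by (rule finite_subset) (intro finite_cartesian_product finite_parts_upto)
 then have ps: "partition_supported2 c"
  using suppS suppT by (auto simp: partition_supported2_def parts_upto_def)
 have ser: "schur_series2 c d x = frob_part n d x" for d x
 proof -
  have "schur_series2 c d x = (\<Sum>u\<in>?T. \<Sum>v\<in>?S. c v u * schur v d * schur u x)"
   by (subst schur_series2_eq[of ?S ?T]) (use suppS suppT finite_parts_upto in "auto intro: sum.swap")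
  also have "... = (\<Sum>u\<in>?T. cseries n u d * schur u x)"
  proof (rule sum.cong[OF refl])
   fix u
   have "cseries n u d = schur_series (%v. c v u) d" using exp[of u] by (metis is_schur_expansion_def)
   also have "... = (\<Sum>v\<in>?S. c v u * schur v d)" by (rule schur_series_eq[OF finite_parts_upto suppS])
   finally show "(\<Sum>v\<in>?S. c v u * schur v d * schur u x) = cseries n u d * schur u x"
    by (simp add: sum_distrib_right)
  qed
  also have "... = frob_part n d x" by (rule frob_part_expn(1)[symmetric])
  finally show ?thesis .
 qed
 have "E_coeff n = c" unfolding E_coeff_def
 proof (rule the_equality)
  show "partition_supported2 c & (\<forall>k\<ge>1. \<forall>d x. keys d \<subseteq> {..<k} --> E_character k n d x = schur_series2 c d x)"
   using ps ser E_char_eq by simp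
 next
  fix c' assume c': "partition_supported2 c' & (\<forall>k\<ge>1. \<forall>d x. keys d \<subseteq> {..<k} --> E_character k n d x = schur_series2 c' d x)"
  show "c' = c"
  proof (rule schur_series2_unique)
   fix d x :: monomial
   obtain k where k: "1 \<le> k" "keys d \<subseteq> {..<k}" using rows_bounded[of d] by blast
   then have "E_character k n d x = schur_series2 c' d x" using c' by blast
   then show "schur_series2 c' d x = schur_series2 c d x" using E_char_eq[OF k] ser by simp
  qed (use c' ps in auto)
 qed
 then show "partition_supported2 (E_coeff n)" "E_coeff n = (%v u. schur_coeff (cseries n u) v)"
  using ps by (simp_all add: c_def)
qed

lemma pairing_E_function:
 assumes "1 \<le> n" shows "pairing (E_function n) (elementary n) = cseries n (hook 1 (n - 1))"
proof -
 have c: "schur_coeff2 (E_function n) = E_coeff n" unfolding schur_coeff2_def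
  by (rule the_equality) (use E_coeff_eq(1) schur_series2_unique in "auto simp: E_function_def")
 let ?e = "hook 1 (n - 1)"
 have part: "is_partition u" if "E_coeff n v u ~= 0" for v u
  using E_coeff_eq(1) that by (auto simp: partition_supported2_def)
 have "(\<Sum>u | E_coeff n v u ~= 0. E_coeff n v u * hall (schur u) (elementary n)) = E_coeff n v ?e" for v
 proof -
  have "finite {(v, u). E_coeff n v u ~= 0}" using E_coeff_eq(1) by (simp add: partition_supported2_def)
  then have fin: "finite {u. E_coeff n v u ~= 0}"
   by (rule finite_subset[rotated, OF finite_imageI[of _ snd]]) (force simp: image_iff)
  have "(\<Sum>u | E_coeff n v u ~= 0. E_coeff n v u * hall (schur u) (elementary n)) =
   (\<Sum>u | E_coeff n v u ~= 0. if u = ?e then E_coeff n v ?e else 0)"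
   by (rule sum.cong) (auto simp: hall_schur_left part elem_eq_hook[OF assms] schur_coeff_schur hook_partition)
  then show ?thesis using fin by (auto simp: sum.delta)
 qed
 then have "pairing (E_function n) (elementary n) = schur_series (%v. E_coeff n v ?e)"
  by (simp add: pairing_def c)
 also have "... = cseries n ?e"
  using schur_coeff_expn[OF cseries_sym[of n ?e]] unfolding E_coeff_eq(2) is_schur_expansion_def by simp
 finally show ?thesis .
qed

definition alts :: "nat => monomial => mpoly set" where
 "alts n d = {p \<in> dpart n d. \<forall>s\<in>{s. s permutes {..<n}}. col_perm s p = Const (of_int (sign s)) * p}"

lemma bij_comp_permutes:
 assumes "s permutes S" shows "bij_betw (%t. s o t) {t. t permutes S} {t. t permutes S}"
proof (rule bij_betw_byWitness[where f' = "%t. inv_into UNIV s o t"])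
 note inv = permutes_inv[OF assms]
 show "\<forall>t\<in>{t. t permutes S}. inv_into UNIV s o (s o t) = t"
  using permutes_inv_o(2)[OF assms] by (simp add: o_assoc)
 show "\<forall>t\<in>{t. t permutes S}. s o (inv_into UNIV s o t) = t"
  using permutes_inv_o(1)[OF assms] by (simp add: o_assoc)
qed (use assms permutes_inv[OF assms] permutes_compose in auto)

lemma sign_rat:
 assumes "finite S" "s permutes S" "t permutes S"
 shows "(of_int (sign (s o t)) :: rat) = of_int (sign s) * of_int (sign t)"
 by (simp add: sign_compose permutes_imp_permutation[OF assms(1)] assms)

text \<open>In degree \<open>(0, n)\<close> the specialization returns the coefficient of
  \<open>e_n\<close> alone. It turns products of power sums into signs, and the average of the
  traces weighted by signs is the dimension of the alternating part.\<close>

lemma cseries_hook_eq: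
 assumes "1 \<le> n" shows "cseries n (hook 1 (n - 1)) d = of_nat (mpoly.dim (alts n d))"
proof -
 let ?G = "{s. s permutes {..<n}}"
 have tr: "(\<Sum>s\<in>?G. of_int (sign s) * trace_on (dpart n d) (col_perm s)) =
  of_nat (card ?G) * of_nat (mpoly.dim (alts n d))"
  unfolding alts_def
 proof (rule trace_char_sum[OF finite_dim_dpart finite_perms _ linear_op_col_perm])
  show "?G ~= {}" using permutes_id by blast
  show "bij_betw ((o) s) ?G ?G" if "s \<in> ?G" for s using bij_comp_permutes that by blast
  show "of_int (sign (s o t)) = (of_int (sign s) * of_int (sign t) :: rat)" if "s \<in> ?G" "t \<in> ?G" for s t
   using that by (intro sign_rat) auto
  show "of_int (sign s) * of_int (sign s) = (1 :: rat)" for s :: "nat => nat"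
   by (simp flip: of_int_mult)
 qed (auto simp: col_perm_dpart col_perm_comp)
 have c: "card ?G = fact n" by (simp add: card_permutations[OF refl finite_lessThan])
 have "has_sspec (frob_part n d) 0 n (\<Sum>s\<in>?G. trace_on (dpart n d) (col_perm s) / fact n * of_int (sign s))"
  unfolding frob_part_def
 proof (rule has_sspec_lincomb[OF finite_perms])
  fix s assume "s \<in> ?G"
  then show "has_sspec (power_sum_partition (cycle_type n s)) 0 n (of_int (sign s))"
   using has_sspec_power_sum_part[of "cycle_type n s" n] cycle_type_facts[of s n] by simp
 qed
 also have "(\<Sum>s\<in>?G. trace_on (dpart n d) (col_perm s) / fact n * of_int (sign s)) =
  (\<Sum>s\<in>?G. of_int (sign s) * trace_on (dpart n d) (col_perm s)) / fact n"
  by (simp add: sum_divide_distrib mult.commute)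
 also have "... = of_nat (mpoly.dim (alts n d))" unfolding tr c by simp
 finally have "has_sspec (frob_part n d) 0 n (of_nat (mpoly.dim (alts n d)))" .
 moreover have "has_sspec (frob_part n d) 0 n (cseries n (hook 1 (n - 1)) d)"
  using has_sspec_sym[OF frob_part_sym[of n d], of 0 n] assms
  by (simp add: sspec_of_def cseries_def)
 ultimately show ?thesis using has_sspec_unique by blast
qed

section \<open>The alternating components\<close>

text \<open>The label \<open>(r, e)\<close> stands for the polarization \<open>\<Sum>\<^sub>j x\<^sub>r\<^sub>+\<^sub>1\<^sub>,\<^sub>j \<partial>\<^sub>0\<^sub>j\<^sup>e\<^sup>+\<^sup>1\<close>.
  These operators commute, so that words in them are indexed by multisets.\<close>

definition pol_op :: "nat => nat \<times> nat => mpoly => mpoly" where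
 "pol_op n x = pol n (Suc (fst x)) 0 (Suc (snd x))"

lemma pol_op_expand:
 "pol_op n x (pol_op n y p) = (\<Sum>i<n. \<Sum>j<n. Var (Suc (fst x), i) * (Var (Suc (fst y), j) *
   (pd (0, i) ^^ Suc (snd x)) ((pd (0, j) ^^ Suc (snd y)) p)))"
 unfolding pol_op_def polarization_def pd_funpow_sum sum_distrib_left pd_funpow_Var
 by simp

lemma pol_op_commute: "pol_op n x (pol_op n y p) = pol_op n y (pol_op n x p)"
proof -
 have "pol_op n y (pol_op n x p) = (\<Sum>j<n. \<Sum>i<n. Var (Suc (fst x), i) * (Var (Suc (fst y), j) *
   (pd (0, i) ^^ Suc (snd x)) ((pd (0, j) ^^ Suc (snd y)) p)))"
  unfolding pol_op_expand
 proof (intro sum.cong refl)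
  fix i j
  have "(pd (0, j) ^^ Suc (snd y)) ((pd (0, i) ^^ Suc (snd x)) p) =
   (pd (0, i) ^^ Suc (snd x)) ((pd (0, j) ^^ Suc (snd y)) p)"
   by (rule pd_funpow_commute)
  then show "Var (Suc (fst y), j) * (Var (Suc (fst x), i) * (pd (0, j) ^^ Suc (snd y)) ((pd (0, i) ^^ Suc (snd x)) p)) =
   Var (Suc (fst x), i) * (Var (Suc (fst y), j) * (pd (0, i) ^^ Suc (snd x)) ((pd (0, j) ^^ Suc (snd y)) p))"
   by (simp only: mult.left_commute)
 qed
 then show ?thesis unfolding pol_op_expand[of n x y p] by (subst sum.swap) simp
qed

lemma pol_op_add: "pol_op n x (p + q) = pol_op n x p + pol_op n x q"
 and pol_op_scale: "pol_op n x (Const c * p) = Const c * pol_op n x p"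
 by (simp_all add: pol_op_def pol_add pol_scale)

lemma pol_op_zero [simp]: "pol_op n x 0 = 0"
 using pol_op_scale[of n x 0 0] by simp

lemma pol_op_comp_fun_commute: "comp_fun_commute (pol_op n)"
 by unfold_locales (auto simp: pol_op_commute)

definition E_word :: "nat => (nat \<times> nat) multiset => mpoly" where
 "E_word n M = fold_mset (pol_op n) (vdm n) M"

lemma E_word_empty [simp]: "E_word n {#} = vdm n"
 and E_word_add [simp]: "E_word n (add_mset x M) = pol_op n x (E_word n M)"
 by (simp_all add: E_word_def comp_fun_commute.fold_mset_add_mset[OF pol_op_comp_fun_commute])

definition lowering :: "(nat \<times> nat) multiset => nat" where
 "lowering M = (\<Sum>x\<in>#M. Suc (snd x))"

definition row_mon :: "nat multiset => monomial" where
 "row_mon R = (\<Sum>r\<in>#R. single (Suc r) 1)"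

text \<open>Degree \<open>a\<close> in row 0, and in row \<open>r + 1\<close> the multiplicity of
  \<open>r\<close> in \<open>R\<close>. Every multidegree can be written in this way; the multiset
  matches the row labels of a word.\<close>

definition wdeg :: "nat => nat multiset => monomial" where
 "wdeg a R = single 0 a + row_mon R"

lemma lookup_row_mon:
 "lookup (row_mon R) i = (case i of 0 => 0 | Suc r => count R r)"
 by (induction R) (auto simp: row_mon_def lookup_add lookup_single when_def split: nat.splits)

lemma lookup_wdeg:
 "lookup (wdeg a R) i = (case i of 0 => a | Suc r => count R r)"
 by (auto simp: wdeg_def lookup_add lookup_row_mon lookup_single split: nat.split)

lemma wdeg_inject: "wdeg a R = wdeg b S \<longleftrightarrow> a = b & R = S"
proof
 assume e: "wdeg a R = wdeg b S"
 have "a = b" using arg_cong[OF e, of "%z. lookup z 0"] by (simp add: lookup_wdeg)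
 moreover have "count R r = count S r" for r
  using arg_cong[OF e, of "%z. lookup z (Suc r)"] by (simp add: lookup_wdeg)
 ultimately show "a = b & R = S" by (simp add: multiset_eqI)
qed simp

lemma wdeg_add:
 assumes "e \<le> a"
 shows "wdeg a R - single 0 e + single (Suc r) 1 = wdeg (a - e) (add_mset r R)"
proof (rule poly_mapping_eqI)
 fix i show "lookup (wdeg a R - single 0 e + single (Suc r) 1) i =
  lookup (wdeg (a - e) (add_mset r R)) i"
  by (cases i) (auto simp: lookup_add lookup_minus lookup_single lookup_wdeg when_def)
qed

lemma gen_E_word:
 "lowering M \<le> top_degree n ==> gen n (wdeg (top_degree n - lowering M) (image_mset fst M)) (E_word n M)"
proof (induction M)
 case empty
 have "wdeg (top_degree n) {#} = single 0 (top_degree n)" by (simp add: wdeg_def row_mon_def)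
 then show ?case using gen_vdm by (simp add: lowering_def)
next
 case (add x M)
 have low: "lowering (add_mset x M) = Suc (snd x) + lowering M" by (simp add: lowering_def)
 let ?d = "wdeg (top_degree n - lowering M) (image_mset fst M)"
 have "gen n (?d - single 0 (Suc (snd x)) + single (Suc (fst x)) 1)
   (pol n (Suc (fst x)) 0 (Suc (snd x)) (E_word n M))"
  by (rule gen_pol) (use add low in "auto simp: lookup_wdeg")
 moreover have "?d - single 0 (Suc (snd x)) + single (Suc (fst x)) 1 =
  wdeg (top_degree n - lowering M - Suc (snd x)) (add_mset (fst x) (image_mset fst M))"
  by (rule wdeg_add) (use add.prems low in simp)
 ultimately show ?case using low by (simp add: pol_op_def add.commute)
qed

abbreviation derivs :: "nat list => mpoly => mpoly" where
 "derivs js \<equiv> foldr (%j. pd (0, j)) js"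

lemma derivs_linear: "derivs js (p + q) = derivs js p + derivs js q" "derivs js (Const c * p) = Const c * derivs js p"
 by (induction js) (auto simp: pd_add pd_scale)

lemma pd0_pol_op: "pd (0, j) (pol_op n x p) = pol_op n x (pd (0, j) p)"
proof -
 have "pd (0, j) ((pd (0, i) ^^ e) p) = (pd (0, i) ^^ e) (pd (0, j) p)" for i e
  by (rule funpow_commute[symmetric]) (rule pd_commute)
 then show ?thesis
  unfolding pol_op_def polarization_def pd_sum pd_Var_mult
  by (simp del: funpow.simps)
qed

lemma derivs_pol_op: "derivs js (pol_op n x p) = pol_op n x (derivs js p)"
 by (induction js) (auto simp: pd0_pol_op)

text \<open>Derivatives in row 0 commute with polarizations into other rows, so they can be
  collected on the left. The multidegree is recorded only in their absence, since the other words
  disappear under antisymmetrization.\<close>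

lemma gen_normal_form:
 "gen n d p ==> \<exists>js M. set js \<subseteq> {..<n} & p = derivs js (E_word n M) &
   (js = [] --> lowering M \<le> top_degree n & d = wdeg (top_degree n - lowering M) (image_mset fst M))"
proof (induction rule: gen.induct)
 case gen_vdm
 have "wdeg (top_degree n) {#} = single 0 (top_degree n)" by (simp add: wdeg_def row_mon_def)
 then show ?case by (intro exI[of _ "[]"] exI[of _ "{#}"]) (simp add: lowering_def)
next
 case (gen_pol d p r e)
 then obtain js M where IH: "set js \<subseteq> {..<n}" "p = derivs js (E_word n M)"
  "js = [] ==> lowering M \<le> top_degree n & d = wdeg (top_degree n - lowering M) (image_mset fst M)" by blast
 obtain r' e' where re: "r = Suc r'" "e = Suc e'" using gen_pol.hyps by (metis gr0_implies_Suc)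
 let ?M = "add_mset (r', e') M"
 have "pol n r 0 e p = derivs js (E_word n ?M)"
 proof -
  have "pol n r 0 e q = pol_op n (r', e') q" for q by (simp add: pol_op_def re)
  then show ?thesis unfolding IH(2) by (simp add: derivs_pol_op)
 qed
 moreover have "lowering ?M \<le> top_degree n & d - single 0 e + single r 1 =
   wdeg (top_degree n - lowering ?M) (image_mset fst ?M)" if "js = []"
 proof -
  have d: "lowering M \<le> top_degree n" "d = wdeg (top_degree n - lowering M) (image_mset fst M)" using IH(3) that by auto
  then have le: "e \<le> top_degree n - lowering M" using gen_pol.hyps by (simp add: lookup_wdeg)
  have low: "lowering ?M = e + lowering M" by (simp add: lowering_def re)
  show ?thesis unfolding d(2) using wdeg_add[OF le, of "image_mset fst M" r'] d(1) le low
   by (simp add: re add.commute)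
 qed
 ultimately show ?case using IH(1) by blast
next
 case (gen_pd d p j)
 then obtain js M where IH: "set js \<subseteq> {..<n}" "p = derivs js (E_word n M)" by blast
 then show ?case using gen_pd.hyps by (intro exI[of _ "j # js"] exI[of _ M]) auto
qed

lemma col_perm_derivs: "inj s ==> col_perm s (derivs js p) = derivs (map s js) (col_perm s p)"
 by (induction js) (auto simp: col_perm_pd)

lemma col_perm_E_word:
 "s permutes {..<n} ==> col_perm s (E_word n M) = Const (of_int (sign s)) * E_word n M"
 by (induction M) (auto simp: vdm_perm pol_op_def col_perm_pol pol_scale)

lemma derivs_homog:
 assumes "homog n d p"
 shows "set js \<subseteq> {..<n} ==>
  (length js \<le> lookup d 0 --> homog n (d - single 0 (length js)) (derivs js p)) &
  (lookup d 0 < length js --> derivs js p = 0)"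
proof (induction js)
 case Nil
 have "d - single 0 0 = d" by simp
 then show ?case using assms by simp
next
 case (Cons j js)
 then have IH: "length js \<le> lookup d 0 ==> homog n (d - single 0 (length js)) (derivs js p)"
  "lookup d 0 < length js ==> derivs js p = 0" and j: "j < n" by auto
 have e: "d - single 0 (length js) - single 0 1 = d - single 0 (length (j # js))"
  by (rule poly_mapping_eqI) (auto simp: lookup_minus lookup_single when_def)
 consider "length (j # js) \<le> lookup d 0" | "length js = lookup d 0" | "lookup d 0 < length js"
  by fastforce
 then show ?case
 proof cases
  case 1
  then have "homog n (d - single 0 (length js) - single 0 1) (pd (0, j) (derivs js p))"
   using IH(1) j by (intro homog_pd) (auto simp: lookup_minus)
  then show ?thesis using 1 unfolding e by simp
 next
  case 2
  then have "pd (0, j) (derivs js p) = 0"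
   using IH(1) j by (intro pd_degree_zero[of n "d - single 0 (length js)"]) (auto simp: lookup_minus)
  then show ?thesis using 2 by simp
 next
  case 3 then show ?thesis using IH(2) by simp
 qed
qed

text \<open>Symmetric differential operators without constant term annihilate the Vandermonde determinant.\<close>

lemma symmetrized_derivs_vdm:
 assumes js: "set js \<subseteq> {..<n}" "js ~= []"
 shows "(\<Sum>s | s permutes {..<n}. derivs (map s js) (vdm n)) = 0" (is "?Z = 0")
proof -
 have img: "set (map s js) \<subseteq> {..<n}" if "s permutes {..<n}" for s
  using js(1) permutes_in_image[OF that] by auto
 note hom = derivs_homog[OF homog_vdm]
 show ?thesis
 proof (cases "length js \<le> top_degree n")
  case False
  have "derivs (map s js) (vdm n) = 0" if "s permutes {..<n}" for s
   using hom[OF img[OF that]] False by simp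
  then show ?thesis by (intro sum.neutral) auto
 next
  case True
  show ?thesis
  proof (rule alt_low_degree_zero)
   have "derivs js' (vdm n) \<in> polys_in ({0} \<times> {..<n})" for js'
    by (induction js') (auto intro: vdm_in_row polys_in_pd)
   then show "?Z \<in> polys_in ({0} \<times> {..<n})" by (intro polys_in_sum)
   show "homog n (single 0 (top_degree n) - single 0 (length js)) ?Z"
   proof (rule homog_sum)
    fix s assume "s \<in> {s. s permutes {..<n}}"
    then show "homog n (single 0 (top_degree n) - single 0 (length js)) (derivs (map s js) (vdm n))"
     using hom[OF img[of s]] True by simp
   qed
   show "lookup (single 0 (top_degree n) - single 0 (length js)) 0 < top_degree n"
    using True js(2) by (cases js) (auto simp: lookup_minus)
   fix a b assume ab: "a < b" "b < n"
   let ?t = "transpose a b"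
   have t: "?t permutes {..<n}" using ab by (intro permutes_swap_id) auto
   have "col_perm ?t ?Z = (\<Sum>s | s permutes {..<n}. derivs (map (?t o s) js) (- vdm n))"
    unfolding col_perm_sum
    by (intro sum.cong refl) (simp only: col_perm_derivs[OF permutes_inj[OF t]] map_map vdm_transp[OF ab])
   also have "... = (\<Sum>s | s permutes {..<n}. derivs (map s js) (- vdm n))"
    by (rule sum.reindex_bij_betw[OF bij_comp_permutes[OF t]])
   also have "... = (\<Sum>s | s permutes {..<n}. - derivs (map s js) (vdm n))"
    using derivs_linear(2)[of _ "-1" "vdm n"] by (simp add: Const_minus)
   finally show "col_perm ?t ?Z = - ?Z" by (simp add: sum_negf)
  qed
 qed
qed

definition alternator :: "nat => mpoly => mpoly" where
 "alternator n p = (\<Sum>s | s permutes {..<n}. Const (of_int (sign s)) * col_perm s p)"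

text \<open>As \<open>E_word n M\<close> is alternating, the two signs cancel and the
  antisymmetrization becomes a symmetrization of the derivatives alone. This commutes with the
  polarizations and so reaches the determinant.\<close>

lemma alternator_derivs:
 assumes js: "set js \<subseteq> {..<n}" "js ~= []" shows "alternator n (derivs js (E_word n M)) = 0"
proof -
 have "alternator n (derivs js (E_word n M)) = (\<Sum>g | g permutes {..<n}. derivs (map g js) (E_word n M))"
  unfolding alternator_def
 proof (intro sum.cong refl)
  fix g assume "g \<in> {g. g permutes {..<n}}"
  then have s: "g permutes {..<n}" by simp
  have "Const (of_int (sign g)) * col_perm g (derivs js (E_word n M)) =
   (Const (of_int (sign g)) * Const (of_int (sign g))) * derivs (map g js) (E_word n M)"
   by (simp add: col_perm_derivs[OF permutes_inj[OF s]] col_perm_E_word[OF s] derivs_linear mult.assoc)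
  then show "Const (of_int (sign g)) * col_perm g (derivs js (E_word n M)) = derivs (map g js) (E_word n M)"
   by (simp add: Const_mult[symmetric] flip: of_int_mult)
 qed
 also have "... = 0"
 proof (induction M)
  case empty then show ?case using symmetrized_derivs_vdm[OF js] by simp
 next
  case (add x M)
  have "(\<Sum>g | g permutes {..<n}. derivs (map g js) (E_word n (add_mset x M))) =
   (\<Sum>g | g permutes {..<n}. pol_op n x (derivs (map g js) (E_word n M)))"
   by (simp add: derivs_pol_op)
  also have "... = pol_op n x (\<Sum>g | g permutes {..<n}. derivs (map g js) (E_word n M))"
   by (rule linear_sum[OF pol_op_add pol_op_scale, symmetric])
  finally show ?case using add by simp
 qed
 finally show ?thesis .
qed

lemma alternator_alt:
 assumes "!!s. s permutes {..<n} ==> col_perm s p = Const (of_int (sign s)) * p"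
 shows "alternator n p = Const (fact n) * p"
proof -
 have "alternator n p = (\<Sum>s | s permutes {..<n}. p)" unfolding alternator_def
 proof (intro sum.cong refl)
  fix s assume "s \<in> {s. s permutes {..<n}}"
  then have "Const (of_int (sign s)) * col_perm s p = (Const (of_int (sign s)) * Const (of_int (sign s))) * p"
   using assms[of s] by (simp add: mult.assoc)
  then show "Const (of_int (sign s)) * col_perm s p = p"
   by (simp add: Const_mult[symmetric] flip: of_int_mult)
 qed
 moreover have "card {s. s permutes {..<n}} = fact n" by (simp add: card_permutations[OF refl finite_lessThan])
 moreover have "(of_nat (fact n) :: mpoly) = Const (fact n)" by (metis Const_of_nat of_nat_fact)
 ultimately show ?thesis by simp
qed

definition E_words :: "nat => nat => nat multiset => mpoly set" where
 "E_words n a R = E_word n ` {M. lowering M + a = top_degree n & image_mset fst M = R}"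

lemma alts_subsp: "mpoly.subspace (alts n d)"
proof (rule mpoly.subspaceI)
 show "0 \<in> alts n d" by (simp add: alts_def dpart_def mpoly.span_zero col_perm_zero)
next
 fix x y assume "x \<in> alts n d" "y \<in> alts n d"
 then show "x + y \<in> alts n d"
  by (auto simp: alts_def dpart_def mpoly.span_add col_perm_add distrib_left)
next
 fix c x assume "x \<in> alts n d"
 then show "Const c * x \<in> alts n d"
  by (auto simp: alts_def dpart_def span_Const_mult col_perm_scale mult.left_commute)
qed

text \<open>The antisymmetrizer multiplies alternating elements by \<open>n!\<close>, kills the
  words with derivatives and maps each word without derivatives to a multiple of itself.\<close>

lemma alts_eq_span: "alts n (wdeg a R) = mpoly.span (E_words n a R)"
proof (rule equalityI)
 have "E_words n a R \<subseteq> alts n (wdeg a R)"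
 proof
  fix p assume "p \<in> E_words n a R"
  then obtain M where M: "p = E_word n M" "lowering M + a = top_degree n" "image_mset fst M = R"
   by (auto simp: E_words_def)
  then have a: "a = top_degree n - lowering M" by simp
  have "gen n (wdeg a R) p" unfolding a M(1) M(3)[symmetric] by (rule gen_E_word) (use M(2) in simp)
  then have "p \<in> dpart n (wdeg a R)" by (simp add: dpart_def mpoly.span_base)
  then show "p \<in> alts n (wdeg a R)" using col_perm_E_word by (auto simp: alts_def M(1))
 qed
 then show "mpoly.span (E_words n a R) \<subseteq> alts n (wdeg a R)"
  by (rule mpoly.span_minimal[OF _ alts_subsp])
 show "alts n (wdeg a R) \<subseteq> mpoly.span (E_words n a R)"
 proof
  fix p assume p: "p \<in> alts n (wdeg a R)"
  have add: "alternator n (p + q) = alternator n p + alternator n q" for p q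
   by (simp add: alternator_def col_perm_add distrib_left sum.distrib)
  have scale: "alternator n (Const c * p) = Const c * alternator n p" for c p
   by (simp add: alternator_def col_perm_scale sum_distrib_left mult.left_commute)
  have "p \<in> mpoly.span {p. gen n (wdeg a R) p}" using p by (simp add: alts_def dpart_def)
  then have "alternator n p \<in> mpoly.span (E_words n a R)"
  proof (rule span_closed'[where F = "alternator n", OF _ add scale])
   fix g assume "g \<in> {p. gen n (wdeg a R) p}"
   then obtain js M where g: "set js \<subseteq> {..<n}" "g = derivs js (E_word n M)"
    "js = [] --> lowering M \<le> top_degree n & wdeg a R = wdeg (top_degree n - lowering M) (image_mset fst M)"
    using gen_normal_form[of n "wdeg a R" g] by auto
   show "alternator n g \<in> mpoly.span (E_words n a R)"
   proof (cases "js = []")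
    case True
    then have "g = E_word n M" "lowering M + a = top_degree n" "image_mset fst M = R"
     using g by (auto simp: wdeg_inject)
    moreover from this have "alternator n g = Const (fact n) * g"
     by (intro alternator_alt) (simp add: col_perm_E_word)
    moreover from calculation have "g \<in> E_words n a R" by (auto simp: E_words_def)
    ultimately show ?thesis by (simp only: span_Const_mult mpoly.span_base)
   next
    case False
    then show ?thesis using alternator_derivs[OF g(1) False] g(2) by (simp add: mpoly.span_zero)
   qed
  qed
  moreover have "alternator n p = Const (fact n) * p"
   by (rule alternator_alt) (use p in "auto simp: alts_def")
  ultimately have "Const (1 / fact n) * (Const (fact n) * p) \<in> mpoly.span (E_words n a R)"
   using span_Const_mult by metis
  moreover have "Const (1 / fact n) * (Const (fact n) * p) = Const (1 / fact n * fact n) * p"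
   by (simp only: Const_mult mult.assoc)
  ultimately show "p \<in> mpoly.span (E_words n a R)" by simp
 qed
qed

section \<open>Identification of rows and the multilinear part\<close>

definition lift_row :: "(nat => nat) => nat => nat" where
 "lift_row g i = (case i of 0 => 0 | Suc r => Suc (g r))"

lemma lift_row_simps [simp]: "lift_row g 0 = 0" "lift_row g (Suc r) = Suc (g r)" "lift_row g i = 0 \<longleftrightarrow> i = 0"
 by (auto simp: lift_row_def split: nat.splits)

text \<open>Restitution of multilinear forms: \<open>g\<close> may identify rows. Row 0 is kept
  fixed because all polarizations start from it.\<close>

definition row_sub :: "(nat => nat) => mpoly => mpoly" where
 "row_sub g = rename (%(i, j). (lift_row g i, j))"

lemma linear_op_row_sub: "linear_op (row_sub g)"
 unfolding row_sub_def by (rule linear_op_rename)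

lemma row_sub_linear: "row_sub g (p + q) = row_sub g p + row_sub g q" "row_sub g (Const c * p) = Const c * row_sub g p"
 using linear_op_row_sub[of g] by (auto simp: linear_op_def)

lemma row_sub_comp: "row_sub f (row_sub g p) = row_sub (f o g) p"
proof -
 have "(%(i, j :: nat). (lift_row f i, j)) o (%(i, j). (lift_row g i, j)) = (%(i, j). (lift_row (f o g) i, j))"
  by (auto simp: fun_eq_iff lift_row_def split: nat.split)
 then show ?thesis by (simp only: row_sub_def rename_rename)
qed

lemma row_sub_pd0: "row_sub g (pd (0, j) p) = pd (0, j) (row_sub g p)"
 using polys_in_UNIV[of p]
proof (induction p rule: polys_in_induct)
 case (Var v)
 obtain i j' where v: "v = (i, j')" by force
 have "sbst f (if b then 1 else 0) = (if b then 1 else 0)" for f b by simp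
 then show ?case by (simp add: row_sub_def rename_def pd_Var v eq_commute[of 0])
qed (simp_all add: row_sub_def rename_def sbst_add sbst_mult pd_add pd_mult)

lemma row_sub_pol_op: "row_sub g (pol_op n x p) = pol_op n (g (fst x), snd x) (row_sub g p)"
proof -
 have pw: "row_sub g ((pd (0, j) ^^ e) p) = (pd (0, j) ^^ e) (row_sub g p)" for j e
  by (induction e) (auto simp: row_sub_pd0)
 have "row_sub g (pol_op n x p) = (\<Sum>j<n. row_sub g (Var (Suc (fst x), j)) * row_sub g ((pd (0, j) ^^ Suc (snd x)) p))"
  by (simp only: pol_op_def polarization_def row_sub_def rename_def sbst_sum sbst_mult)
 also have "... = (\<Sum>j<n. Var (Suc (g (fst x)), j) * (pd (0, j) ^^ Suc (snd x)) (row_sub g p))"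
  unfolding pw by (simp add: row_sub_def rename_def)
 finally show ?thesis by (simp only: pol_op_def polarization_def fst_conv snd_conv)
qed

lemma row_sub_vdm: "row_sub g (vdm n) = vdm n"
proof -
 have "row_sub g (vdm n) = sbst Var (vdm n)"
  unfolding row_sub_def rename_def by (rule sbst_cong[OF vdm_in_row]) auto
 then show ?thesis by (simp add: sbst_ident)
qed

lemma row_sub_E_word: "row_sub g (E_word n M) = E_word n (image_mset (map_prod g id) M)"
 by (induction M) (auto simp: row_sub_vdm row_sub_pol_op map_prod_def split: prod.split)

lemma linear_op_span_image: "linear_op R ==> R ` mpoly.span S = mpoly.span (R ` S)"
proof -
 assume R: "linear_op R"
 interpret R: Vector_Spaces.linear "%a p. Const a * p" "%a p. Const a * p" R
  by unfold_locales (use R in "auto simp: linear_op_def")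
 show ?thesis by (rule R.span_image[symmetric])
qed

lemma multiset_labels:
 assumes "image_mset fst M = image_mset f (mset_set {..<m})"
 obtains d :: "nat => nat" where "M = image_mset (%i. (f i, d i)) (mset_set {..<m})"
proof -
 obtain xs where xs: "mset xs = M" using ex_mset by blast
 have "size M = m" using arg_cong[OF assms, of size] by simp
 then have len: "length xs = m" using xs by auto
 have Mx: "M = image_mset (nth xs) (mset_set {..<m})"
 proof -
  have "mset xs = mset (map (nth xs) [0..<m])" using len by (metis map_nth)
  then show ?thesis using xs by (simp add: mset_upt atLeast0LessThan)
 qed
 have e: "image_mset f (mset_set {..<m}) = image_mset (%i. fst (xs ! i)) (mset_set {..<m})"
  using assms Mx by (simp add: image_mset.compositionality o_def)
 obtain p where p: "p permutes {..<m}" "\<forall>i\<in>{..<m}. f i = fst (xs ! p i)"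
  by (rule image_mset_eq_implies_permutes[OF finite_lessThan e])
 have "M = image_mset (nth xs) (image_mset p (mset_set {..<m}))"
  using Mx p(1) by (simp add: permutes_image_mset)
 also have "... = image_mset (%i. (f i, snd (xs ! p i))) (mset_set {..<m})"
  unfolding image_mset.compositionality by (rule image_mset_cong) (use p(2) in auto)
 finally show ?thesis by (rule that)
qed

text \<open>A word depends only on the multiset of its labels. So each word of row type
  \<open>f\<close> arises from one with a single polarization into each of \<open>m\<close> separate
  rows, by renaming the rows along \<open>f\<close>; the orders of the derivatives are carried
  along.\<close>

lemma row_sub_alts:
 "row_sub f ` alts n (wdeg a (mset_set {..<m})) = alts n (wdeg a (image_mset f (mset_set {..<m})))"
proof -
 have "row_sub f ` E_words n a (mset_set {..<m}) = E_words n a (image_mset f (mset_set {..<m}))"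
 proof (intro equalityI subsetI)
  fix p assume "p \<in> row_sub f ` E_words n a (mset_set {..<m})"
  then obtain M where M: "p = E_word n (image_mset (map_prod f id) M)" "lowering M + a = top_degree n"
   "image_mset fst M = mset_set {..<m}"
   by (auto simp: E_words_def row_sub_E_word)
  have "lowering (image_mset (map_prod f id) M) = lowering M"
   by (simp add: lowering_def image_mset.compositionality o_def)
  moreover have "image_mset fst (image_mset (map_prod f id) M) = image_mset f (image_mset fst M)"
   by (simp add: image_mset.compositionality o_def)
  ultimately show "p \<in> E_words n a (image_mset f (mset_set {..<m}))" using M by (auto simp: E_words_def)
 next
  fix p assume "p \<in> E_words n a (image_mset f (mset_set {..<m}))"
  then obtain M where M: "p = E_word n M" "lowering M + a = top_degree n" "image_mset fst M = image_mset f (mset_set {..<m})"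
   by (auto simp: E_words_def)
  obtain g where d: "M = image_mset (%i. (f i, g i)) (mset_set {..<m})" using multiset_labels[OF M(3)] .
  define M' where "M' = image_mset (%i. (i, g i)) (mset_set {..<m})"
  have "M = image_mset (map_prod f id) M'" by (simp add: d M'_def image_mset.compositionality o_def)
  then have "p = row_sub f (E_word n M')" using M(1) by (simp add: row_sub_E_word)
  moreover have "lowering M' = lowering M" by (simp add: d M'_def lowering_def image_mset.compositionality o_def)
  moreover have "image_mset fst M' = mset_set {..<m}" by (simp add: M'_def image_mset.compositionality o_def)
  ultimately show "p \<in> row_sub f ` E_words n a (mset_set {..<m})" using M(2) by (auto simp: E_words_def)
 qed
 then show ?thesis unfolding alts_eq_span linear_op_span_image[OF linear_op_row_sub] by simp
qed

lemma dim_linear_image: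
 assumes U: "finite_dim U" and R: "linear_op R" "inj_on R U"
 shows "mpoly.dim (R ` U) = mpoly.dim U"
proof -
 obtain B where B: "is_basis B U" using basis_obtains[OF U] .
 have BU: "B \<subseteq> U" using B mpoly.span_superset by (auto simp: is_basis_def)
 interpret R: Vector_Spaces.linear "%a p. Const a * p" "%a p. Const a * p" R
  by unfold_locales (use R(1) in "auto simp: linear_op_def")
 have "mpoly.span (R ` B) = R ` U"
  using linear_op_span_image[OF R(1), of B] B by (simp add: is_basis_def)
 moreover have "mpoly.independent (R ` B)"
  by (rule R.independent_inj_on_image) (use B R(2) in "auto simp: is_basis_def")
 ultimately have "is_basis (R ` B) (R ` U)" using B by (simp add: is_basis_def)
 moreover have "card (R ` B) = card B" by (rule card_image[OF inj_on_subset[OF R(2) BU]])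
 ultimately show ?thesis using dim_basis[OF B] dim_basis by metis
qed

lemma alts_homog: "p \<in> alts n d ==> homog n d p"
 by (simp add: alts_def dpart_homog)

lemma alts_columns:
 assumes "p \<in> alts n d" "lookup p x ~= 0" "n \<le> j" shows "lookup x (i, j) = 0"
proof -
 obtain k where k: "1 \<le> k" "keys d \<subseteq> {..<k}" by (rule rows_bounded)
 have "p \<in> poly_ring k n" using assms(1) dpart_in_pring[OF k] by (auto simp: alts_def)
 then have "keys x \<subseteq> {..<k} \<times> {..<n}" using assms(2) by (simp add: pring_eq polys_in_iff)
 then show ?thesis using assms(3) by (auto simp: in_keys_iff)
qed

lemma finite_dim_alts: "finite_dim (alts n d)"
 by (rule finite_dim_subset[OF finite_dim_dpart alts_subsp]) (auto simp: alts_def)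

text \<open>A product of variables outside row 0, one for each \<open>i\<close>, at the place
  \<open>h i\<close>; the row index is shifted by one as in the labels of words.\<close>

definition box_mon :: "nat set => (nat => nat \<times> nat) => (nat \<times> nat \<Rightarrow>\<^sub>0 nat)" where
 "box_mon I h = (\<Sum>i\<in>I. single (Suc (fst (h i)), snd (h i)) 1)"

lemma lookup_box_mon:
 "finite I ==> lookup (box_mon I h) (i, j) =
   (case i of 0 => 0 | Suc r => count (image_mset h (mset_set I)) (r, j))"
proof (induction I rule: finite_induct)
 case empty then show ?case by (simp add: box_mon_def split: nat.split)
next
 case (insert x I)
 have "box_mon (insert x I) h = single (Suc (fst (h x)), snd (h x)) 1 + box_mon I h"
  using insert.hyps by (simp add: box_mon_def)
 then show ?case using insert by (cases "h x") (auto simp: lookup_add lookup_single when_def split: nat.splits)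
qed

lemma lookup_box_mon_rows:
 "lookup (box_mon {..<m} (%i. (i, c i))) (Suc r, j) = (if r < m & c r = j then 1 else 0)"
proof -
 have "count (image_mset (%i. (i, c i)) (mset_set {..<m})) (r, j) = card {i \<in> {..<m}. (i, c i) = (r, j)}"
  by (simp add: count_image_mset' sum.If_cases mset_set.infinite)
   (rule arg_cong[where f = card], auto)
 also have "{i \<in> {..<m}. (i, c i) = (r, j)} = (if r < m & c r = j then {r} else {})" by auto
 finally show ?thesis by (simp add: lookup_box_mon)
qed

lemma eval_mon_sum: "eval_mon g (\<Sum>i\<in>I. h i) = (\<Prod>i\<in>I. eval_mon g (h i))"
proof -
 have "eval_mon g 0 = 1" by (simp add: eval_mon_def)
 then show ?thesis by (induction I rule: infinite_finite_induct) (simp_all add: eval_mon_add)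
qed

lemma eval_mon_Var: "eval_mon Var x = single x 1"
 using single_eq_Const_eval[of x 1] by simp

lemma eval_box_mon:
 assumes b: "!!i j. lookup b (Suc i, j) = 0"
 shows "eval_mon (%v. Var ((%(i, j). (lift_row f i, j)) v)) (b + box_mon I (%i. (g i, c i))) =
  single (b + box_mon I (%i. (f (g i), c i))) 1"
proof -
 let ?e = "eval_mon (%v. Var ((%(i, j). (lift_row f i, j)) v))"
 have "?e b = eval_mon Var b" unfolding eval_mon_def
 proof (rule prod.cong[OF refl])
  fix v assume "v \<in> keys b"
  then obtain j where "v = (0, j)" using b by (cases v; cases "fst v") (auto simp: in_keys_iff)
  then show "Var ((%(i, j). (lift_row f i, j)) v) ^ lookup b v = Var v ^ lookup b v" by simp
 qed
 moreover have "?e (box_mon I (%i. (g i, c i))) = eval_mon Var (box_mon I (%i. (f (g i), c i)))"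
  by (simp add: box_mon_def eval_mon_sum eval_mon_single)
 ultimately show ?thesis by (simp add: eval_mon_add flip: eval_mon_Var)
qed

text \<open>Degree 1 in row \<open>r + 1\<close> leaves exactly one variable there, in column
  \<open>c r\<close>; the factor \<open>b\<close> contains the variables of row 0.\<close>

lemma mlin_mon:
 assumes p: "p \<in> alts n (wdeg a (mset_set {..<m}))" "lookup p x ~= 0"
 obtains b c where "x = b + box_mon {..<m} (%i. (i, c i))" "!!i j. lookup b (Suc i, j) = 0"
proof -
 have deg: "(\<Sum>j<n. lookup x (Suc r, j)) = (if r < m then 1 else 0)" for r
  using alts_homog[OF p(1)] p(2) by (auto simp: homog_def rdeg_def lookup_wdeg)
 have ge: "lookup x (i, j) = 0" if "n \<le> j" for i j by (rule alts_columns[OF p that])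
 have "\<exists>j0. \<forall>j. lookup x (Suc r, j) = (if j = j0 then 1 else 0)" if r: "r < m" for r
 proof -
  have "(\<Sum>j<n. lookup x (Suc r, j)) = 1" using deg r by simp
  then obtain j0 where j0: "j0 < n" "lookup x (Suc r, j0) = 1"
   "!!j. j < n ==> j0 ~= j ==> lookup x (Suc r, j) = 0"
   using sum_eq_1_iff[THEN iffD1, of "{..<n}" "%j. lookup x (Suc r, j)"] by auto
  have "lookup x (Suc r, j) = (if j = j0 then 1 else 0)" for j
   using j0 ge[of j "Suc r"] by (cases "j < n") auto
  then show ?thesis by blast
 qed
 then have "\<forall>r\<in>{..<m}. \<exists>j0. \<forall>j. lookup x (Suc r, j) = (if j = j0 then 1 else 0)" by simp
 from bchoice[OF this] obtain c where c: "\<forall>r\<in>{..<m}. \<forall>j. lookup x (Suc r, j) = (if j = c r then 1 else 0)" ..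
 have rows: "lookup x (Suc r, j) = (if r < m & c r = j then 1 else 0)" for r j
 proof (cases "r < m")
  case True then show ?thesis using c by auto
 next
  case False
  then have "(\<Sum>j<n. lookup x (Suc r, j)) = 0" using deg by simp
  then show ?thesis using ge[of j "Suc r"] False by (cases "j < n") auto
 qed
 let ?b = "x - box_mon {..<m} (%i. (i, c i))"
 have le: "lookup (box_mon {..<m} (%i. (i, c i))) (i, j) \<le> lookup x (i, j)" for i j
  by (cases i) (auto simp: lookup_box_mon lookup_box_mon_rows rows simp del: One_nat_def)
 have "x = ?b + box_mon {..<m} (%i. (i, c i))"
 proof (rule poly_mapping_eqI)
  fix v :: "nat \<times> nat" obtain i j where "v = (i, j)" by force
  then show "lookup x v = lookup (?b + box_mon {..<m} (%i. (i, c i))) v"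
   using le[of i j] by (simp add: lookup_add lookup_minus)
 qed
 moreover have "lookup ?b (Suc i, j) = 0" for i j
  by (simp add: lookup_minus rows lookup_box_mon_rows)
 ultimately show ?thesis by (rule that)
qed

definition row_stab :: "nat => (nat => nat) => (nat => nat) set" where
 "row_stab m f = {p. p permutes {..<m} & f o p = f}"

lemma bij_lift_row: "bij p ==> bij (%(i, j :: nat). (lift_row p i, j))"
proof -
 assume b: "bij p"
 have inj: "inj (lift_row p)"
 proof (rule injI)
  fix x y assume "lift_row p x = lift_row p y"
  then show "x = y" using injD[OF bij_is_inj[OF b]] by (cases x; cases y) (auto simp: lift_row_def)
 qed
 have su: "\<exists>x. i = lift_row p x" for i
 proof (cases i)
  case (Suc r)
  obtain s where "r = p s" using surjD[OF bij_is_surj[OF b]] by blast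
  then show ?thesis using Suc by (intro exI[of _ "Suc s"]) simp
 qed (intro exI[of _ 0], simp)
 show ?thesis
 proof (rule bijI)
  show "inj (%(i, j :: nat). (lift_row p i, j))" using injD[OF inj] by (intro injI) auto
  show "surj (%(i, j :: nat). (lift_row p i, j))"
   unfolding surj_def
  proof
   fix y :: "nat \<times> nat"
   obtain x where "fst y = lift_row p x" using su by blast
   then show "\<exists>x. y = (%(i, j). (lift_row p i, j)) x" by (intro exI[of _ "(x, snd y)"]) (cases y, simp)
  qed
 qed
qed

text \<open>On the vectors fixed by the stabilizer of \<open>f\<close>, all coefficients that are added up
  when the rows are identified along \<open>f\<close> are equal.\<close>

lemma row_sub_inj_on_invariants:
 assumes p: "p \<in> alts n (wdeg a (mset_set {..<m}))"
  and inv: "!!s. s \<in> row_stab m f ==> row_sub s p = p" and zero: "row_sub f p = 0"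
 shows "p = 0"
proof (rule ccontr)
 assume "p ~= 0"
 then obtain x0 where x0: "x0 \<in> keys p" by (metis all_not_in_conv keys_eq_empty)
 let ?g = "%v. Var ((%(i, j :: nat). (lift_row f i, j)) v)"
 have nz: "lookup p x ~= 0" if "x \<in> keys p" for x using that by (simp add: in_keys_iff)
 obtain b0 c0 where x0eq: "x0 = b0 + box_mon {..<m} (%i. (i, c0 i))" and b0: "!!i j. lookup b0 (Suc i, j) = 0"
  using mlin_mon[OF p nz[OF x0]] by metis
 let ?y = "b0 + box_mon {..<m} (%i. (f i, c0 i))"
 have key: "lookup (eval_mon ?g x) ?y = 0 \<or> lookup (eval_mon ?g x) ?y = 1 & lookup p x = lookup p x0"
  if x: "x \<in> keys p" for x
 proof -
  obtain b c where xeq: "x = b + box_mon {..<m} (%i. (i, c i))" and b: "!!i j. lookup b (Suc i, j) = 0"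
   using mlin_mon[OF p nz[OF x]] by metis
  have ev: "eval_mon ?g x = single (b + box_mon {..<m} (%i. (f i, c i))) 1"
   unfolding xeq by (rule eval_box_mon[OF b])
  show ?thesis
  proof (cases "b + box_mon {..<m} (%i. (f i, c i)) = ?y")
   case False then show ?thesis unfolding ev by (simp add: lookup_single)
  next
   case True
   have at: "lookup b v + lookup (box_mon {..<m} (%i. (f i, c i))) v =
    lookup b0 v + lookup (box_mon {..<m} (%i. (f i, c0 i))) v" for v
    using arg_cong[OF True, of "%z. lookup z v"] by (simp add: lookup_add)
   have bb: "lookup b (0, j) = lookup b0 (0, j)" for j
    using at[of "(0, j)"] by (simp add: lookup_box_mon)
   have "image_mset (%i. (f i, c i)) (mset_set {..<m}) = image_mset (%i. (f i, c0 i)) (mset_set {..<m})"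
   proof (rule multiset_eqI)
    fix z :: "nat \<times> nat" obtain r j where z: "z = (r, j)" by force
    show "count (image_mset (%i. (f i, c i)) (mset_set {..<m})) z = count (image_mset (%i. (f i, c0 i)) (mset_set {..<m})) z"
     using at[of "(Suc r, j)"] by (simp add: lookup_box_mon b b0 z)
   qed
   \<comment> \<open>Equal images mean equal multisets of pairs of an identified row and a column; a
     matching of the two multisets is a permutation of the rows that preserves
     \<open>f\<close>.\<close>
   from image_mset_eq_implies_permutes[OF finite_lessThan this]
   obtain s where pi: "s permutes {..<m}" "\<forall>i\<in>{..<m}. (f i, c i) = (f (s i), c0 (s i))" by blast
   have "f o s = f"
   proof
    fix i show "(f o s) i = f i" using pi permutes_not_in[OF pi(1), of i] by (cases "i < m") auto
   qed
   then have "row_sub s p = p" using inv pi(1) by (simp add: row_stab_def)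
   moreover have "map_key (%(i, j). (lift_row s i, j)) x0 = x"
   proof (rule poly_mapping_eqI)
    fix v :: "nat \<times> nat"
    obtain i j where v: "v = (i, j)" by force
    have bij: "bij (%(i, j :: nat). (lift_row s i, j))" by (rule bij_lift_row[OF permutes_bij[OF pi(1)]])
    show "lookup (map_key (%(i, j). (lift_row s i, j)) x0) v = lookup x v"
    proof (cases i)
     case 0
     then show ?thesis using bb[of j] bij
      by (simp add: v map_key.rep_eq bij_is_inj x0eq xeq lookup_add lookup_box_mon)
    next
     case (Suc r)
     have "s r < m \<longleftrightarrow> r < m" using permutes_in_image[OF pi(1), of r] by simp
     then show ?thesis using bij pi(2) Suc
      by (auto simp: v map_key.rep_eq bij_is_inj x0eq xeq lookup_add lookup_box_mon_rows b b0)
    qed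
   qed
   ultimately have "lookup p x = lookup p x0"
    using lookup_rename[OF bij_lift_row[OF permutes_bij[OF pi(1)]], of p x0] by (simp add: row_sub_def)
   then show ?thesis unfolding ev True by simp
  qed
 qed
 have one: "lookup (eval_mon ?g x0) ?y = 1"
  unfolding x0eq eval_box_mon[OF b0] by simp
 define K where "K = {x \<in> keys p. lookup (eval_mon ?g x) ?y = 1}"
 have fK: "finite K" "x0 \<in> K" using x0 one by (auto simp: K_def)
 have "0 = lookup (row_sub f p) ?y" by (simp add: zero)
 also have "... = (\<Sum>x\<in>keys p. lookup p x * lookup (eval_mon ?g x) ?y)"
  unfolding row_sub_def rename_def sbst_superset[OF finite_keys order_refl] lookup_sum by simp
 also have "... = (\<Sum>x\<in>keys p. if x \<in> K then lookup p x0 else 0)"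
 proof (rule sum.cong[OF refl])
  fix x assume "x \<in> keys p"
  then show "lookup p x * lookup (eval_mon ?g x) ?y = (if x \<in> K then lookup p x0 else 0)"
   using key[of x] by (auto simp: K_def)
 qed
 also have "... = (\<Sum>x\<in>K. lookup p x0)"
  using sum.inter_filter[of "keys p" "%_. lookup p x0" "%x. x \<in> K"]
  by (simp add: K_def)
 also have "... = of_nat (card K) * lookup p x0" by simp
 finally show False using fK nz[OF x0] by (auto simp: card_eq_0_iff)
qed

lemma row_stab_closed:
 assumes "g \<in> row_stab m f"
 shows "bij_betw (%t. g o t) (row_stab m f) (row_stab m f)"
proof (rule bij_betw_byWitness[where f' = "%t. inv_into UNIV g o t"])
 have s: "g permutes {..<m}" "f o g = f" using assms by (auto simp: row_stab_def)
 note inv = permutes_inv[OF s(1)] and io = permutes_inv_o[OF s(1)]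
 have fi: "f o inv_into UNIV g = f"
 proof -
  have "f o inv_into UNIV g = (f o g) o inv_into UNIV g" by (simp only: s(2))
  also have "... = f" by (simp only: comp_assoc io comp_id)
  finally show ?thesis .
 qed
 show "\<forall>t\<in>row_stab m f. inv_into UNIV g o (g o t) = t"
  by (intro ballI) (simp only: comp_assoc[symmetric] io id_comp)
 show "\<forall>t\<in>row_stab m f. g o (inv_into UNIV g o t) = t"
  by (intro ballI) (simp only: comp_assoc[symmetric] io id_comp)
 show "(%t. g o t) ` row_stab m f \<subseteq> row_stab m f"
  using s permutes_compose[OF _ s(1)] by (auto simp: row_stab_def simp flip: comp_assoc)
 show "(%t. inv_into UNIV g o t) ` row_stab m f \<subseteq> row_stab m f"
  using fi permutes_compose[OF _ inv] by (auto simp: row_stab_def simp flip: comp_assoc)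
qed

abbreviation mlin :: "nat => nat => nat => mpoly set" where
 "mlin n a m \<equiv> alts n (wdeg a (mset_set {..<m}))"

lemma row_sub_mlin: "p permutes {..<m} ==> row_sub p ` mlin n a m = mlin n a m"
 by (simp add: row_sub_alts permutes_image_mset)

lemma row_stab_finite: "finite (row_stab m f)" "id \<in> row_stab m f"
 by (auto simp: row_stab_def permutes_id intro: finite_subset[OF _ finite_perms[of m]])

text \<open>Renaming along \<open>f\<close> is a bijection from the invariants of the stabilizer in
  the multilinear part onto the component of row type \<open>f\<close>: it is onto because averaging
  over the stabilizer does not change the image. The dimension of the invariants is an average of
  traces.\<close>

lemma dim_alts_stab:
 "of_nat (mpoly.dim (alts n (wdeg a (image_mset f (mset_set {..<m}))))) * of_nat (card (row_stab m f)) =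
  (\<Sum>t\<in>row_stab m f. trace_on (mlin n a m) (row_sub t))"
proof -
 let ?B = "mlin n a m" and ?G = "row_stab m f"
 let ?U = "{p \<in> ?B. \<forall>t\<in>?G. row_sub t p = Const 1 * p}"
 have G: "t permutes {..<m}" "f o t = f" if "t \<in> ?G" for t using that by (auto simp: row_stab_def)
 have maps: "row_sub t p \<in> ?B" if "t \<in> ?G" "p \<in> ?B" for t p
  using row_sub_mlin[OF G(1)[OF that(1)]] that(2) by blast
 have "(\<Sum>t\<in>?G. 1 * trace_on ?B (row_sub t)) = of_nat (card ?G) * of_nat (mpoly.dim ?U)"
 proof (rule trace_char_sum[OF finite_dim_alts row_stab_finite(1) _ linear_op_row_sub maps])
  show "?G ~= {}" using row_stab_finite(2)[of m f] by blast
  show "bij_betw ((o) v) ?G ?G" if "v \<in> ?G" for v using row_stab_closed[OF that] .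
 qed (simp_all add: row_sub_comp)
 moreover have "mpoly.dim ?U = mpoly.dim (row_sub f ` ?U)"
 proof (rule dim_linear_image[symmetric, OF _ linear_op_row_sub])
  have sub: "mpoly.subspace ?B" by (rule alts_subsp)
  show "finite_dim ?U"
  proof (rule finite_dim_subset[OF finite_dim_alts])
   show "mpoly.subspace ?U"
   proof (rule mpoly.subspaceI)
    have "row_sub t 0 = 0" for t using row_sub_linear(2)[of t 0 0] by simp
    then show "0 \<in> ?U" using mpoly.subspace_0[OF sub] by simp
   next
    fix x y assume "x \<in> ?U" "y \<in> ?U"
    then show "x + y \<in> ?U" using mpoly.subspace_add[OF sub] by (auto simp: row_sub_linear)
   next
    fix c x assume "x \<in> ?U"
    then show "Const c * x \<in> ?U" using mpoly.subspace_scale[OF sub, of x c] by (auto simp: row_sub_linear)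
   qed
  qed auto
  show "inj_on (row_sub f) ?U"
  proof (rule inj_onI)
   fix p q assume pq: "p \<in> ?U" "q \<in> ?U" and e: "row_sub f p = row_sub f q"
   have diff: "row_sub g (p - q) = row_sub g p - row_sub g q" for g
    by (simp add: row_sub_def rename_def sbst_diff)
   have "p - q = 0"
   proof (rule row_sub_inj_on_invariants)
    show "p - q \<in> ?B" using pq mpoly.subspace_diff[OF sub] by simp
    show "row_sub t (p - q) = p - q" if "t \<in> ?G" for t using pq that by (simp add: diff)
    show "row_sub f (p - q) = 0" by (simp add: diff e)
   qed
   then show "p = q" by simp
  qed
 qed
 moreover have "row_sub f ` ?U = alts n (wdeg a (image_mset f (mset_set {..<m})))"
 proof (intro equalityI subsetI)
  fix q assume "q \<in> row_sub f ` ?U"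
  then show "q \<in> alts n (wdeg a (image_mset f (mset_set {..<m})))"
   unfolding row_sub_alts[symmetric] by blast
 next
  fix q assume "q \<in> alts n (wdeg a (image_mset f (mset_set {..<m})))"
  then obtain p where p: "p \<in> ?B" "q = row_sub f p" unfolding row_sub_alts[symmetric] by blast
  let ?N = "of_nat (card ?G) :: rat"
  have N: "?N ~= 0" using row_stab_finite[of m f] by auto
  define u where "u = (\<Sum>t\<in>?G. Const (1 / ?N) * row_sub t p)"
  have "u \<in> ?B" unfolding u_def using maps p(1)
   by (intro mpoly.subspace_sum[OF alts_subsp] mpoly.subspace_scale[OF alts_subsp, simplified])
  moreover have "row_sub v u = u" if s: "v \<in> ?G" for v
  proof -
   have "row_sub v u = (\<Sum>t\<in>?G. Const (1 / ?N) * row_sub (v o t) p)"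
    unfolding u_def linear_op_sum[OF linear_op_row_sub] by (simp only: row_sub_comp)
   also have "... = u" unfolding u_def by (rule sum.reindex_bij_betw[OF row_stab_closed[OF s]])
   finally show ?thesis .
  qed
  moreover have "row_sub f u = q"
  proof -
   have "row_sub f u = (\<Sum>t\<in>?G. Const (1 / ?N) * row_sub (f o t) p)"
    unfolding u_def linear_op_sum[OF linear_op_row_sub] by (simp only: row_sub_comp)
   also have "... = (\<Sum>t\<in>?G. Const (1 / ?N) * q)" by (rule sum.cong) (simp_all add: G(2) p(2))
   also have "... = Const (\<Sum>t\<in>?G. 1 / ?N) * q" by (simp only: Const_sum sum_distrib_right)
   also have "(\<Sum>t\<in>?G. 1 / ?N) = 1" using N by simp
   finally show ?thesis by simp
  qed
  ultimately show "q \<in> row_sub f ` ?U" by force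
 qed
 ultimately show ?thesis by (simp add: mult.commute)
qed

text \<open>Orbit-stabilizer: maps with the same multiset of values form one orbit of the symmetric
  group on the arguments.\<close>

lemma card_fibre_stab:
 assumes f: "f \<in> {..<m} \<rightarrow>\<^sub>E T"
 shows "card {f' \<in> {..<m} \<rightarrow>\<^sub>E T. image_mset f' (mset_set {..<m}) = image_mset f (mset_set {..<m})} * card (row_stab m f) = fact m"
proof -
 let ?P = "{g. g permutes {..<m}}"
 let ?F = "{f' \<in> {..<m} \<rightarrow>\<^sub>E T. image_mset f' (mset_set {..<m}) = image_mset f (mset_set {..<m})}"
 have fP: "finite ?P" by (rule finite_perms)
 have img: "f o g \<in> ?F" if "g \<in> ?P" for g
 proof -
  have p: "g permutes {..<m}" using that by simp
  have "(f o g) i \<in> T" if "i < m" for i using f permutes_in_image[OF p, of i] that by auto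
  moreover have "(f o g) i = undefined" if "\<not> i < m" for i
   using PiE_arb[OF f, of i] permutes_not_in[OF p, of i] that by simp
  ultimately have "f o g \<in> {..<m} \<rightarrow>\<^sub>E T" by (auto simp: PiE_iff extensional_def)
  moreover have "image_mset (f o g) (mset_set {..<m}) = image_mset f (mset_set {..<m})"
   using permutes_image_mset[OF p] by (metis image_mset.compositionality)
  ultimately show ?thesis by simp
 qed
 have fibre: "card {g \<in> ?P. f o g = f'} = card (row_stab m f)" if f': "f' \<in> ?F" for f'
 proof -
  have e: "image_mset f' (mset_set {..<m}) = image_mset f (mset_set {..<m})" and f'E: "f' \<in> {..<m} \<rightarrow>\<^sub>E T" using f' by auto
  obtain g where pi: "g permutes {..<m}" "\<forall>i\<in>{..<m}. f' i = f (g i)"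
   by (rule image_mset_eq_implies_permutes[OF finite_lessThan e])
  have fp: "f o g = f'"
  proof
   fix i show "(f o g) i = f' i"
    using pi permutes_not_in[OF pi(1), of i] PiE_arb[OF f, of i] PiE_arb[OF f'E, of i] by (cases "i < m") auto
  qed
  note inv = permutes_inv[OF pi(1)] and io = permutes_inv_o[OF pi(1)]
  have "{g \<in> ?P. f o g = f'} = (%s. s o g) ` row_stab m f"
  proof (intro equalityI subsetI)
   fix v assume r: "v \<in> {g \<in> ?P. f o g = f'}"
   have "f o (v o inv_into UNIV g) = f o g o inv_into UNIV g" using r fp by (simp add: comp_assoc[symmetric])
   also have "... = f" by (simp only: comp_assoc io comp_id)
   finally have "v o inv_into UNIV g \<in> row_stab m f"
    using r permutes_compose[OF inv] by (simp add: row_stab_def)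
   moreover have "v = (v o inv_into UNIV g) o g" by (simp only: comp_assoc io comp_id)
   ultimately show "v \<in> (%s. s o g) ` row_stab m f" by blast
  next
   fix v assume "v \<in> (%s. s o g) ` row_stab m f"
   then show "v \<in> {g \<in> ?P. f o g = f'}"
    using permutes_compose[OF pi(1)] fp by (auto simp: row_stab_def simp flip: comp_assoc)
  qed
  moreover have "inj_on (%s. s o g) (row_stab m f)"
  proof (rule inj_onI)
   fix s t assume "s o g = t o g"
   then have "s o g o inv_into UNIV g = t o g o inv_into UNIV g" by simp
   then show "s = t" by (simp only: comp_assoc io comp_id)
  qed
  ultimately show ?thesis by (simp add: card_image)
 qed
 have fin: "finite ?F"
 proof -
  have "?F = (%g. f o g) ` ?P"
  proof (intro equalityI subsetI)
   fix f' assume f': "f' \<in> ?F"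
   have "card (row_stab m f) ~= 0" using row_stab_finite[of m f] by auto
   then have "{g \<in> ?P. f o g = f'} ~= {}" using fibre[OF f'] by (metis card.empty)
   then show "f' \<in> (%g. f o g) ` ?P" by blast
  qed (use img in blast)
  then show ?thesis using fP by simp
 qed
 have "fact m = card ?P" by (simp add: card_permutations[OF refl finite_lessThan])
 also have "... = (\<Sum>g\<in>?P. 1)" by simp
 also have "... = (\<Sum>f'\<in>?F. \<Sum>g | g \<in> ?P & f o g = f'. 1)"
  by (rule sum.group[symmetric, OF fP fin]) (use img in blast)
 also have "... = (\<Sum>f'\<in>?F. card (row_stab m f))"
  by (rule sum.cong[OF refl]) (use fibre in simp)
 finally show ?thesis by simp
qed

lemma spec_mons_image:
 "spec_mons N a m = (%f. wdeg a (image_mset f (mset_set {..<m}))) ` ({..<m} \<rightarrow>\<^sub>E {..<N})"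
proof (intro equalityI subsetI)
 fix x assume x: "x \<in> spec_mons N a m"
 define R where "R = (\<Sum>r<N. replicate_mset (lookup x (Suc r)) r)"
 have cnt: "count R r = (if r < N then lookup x (Suc r) else 0)" for r
  by (auto simp: R_def count_sum sum.delta cong: if_cong)
 have keys: "keys x \<subseteq> {..<Suc N}" using x by (auto simp: spec_mons_def)
 have xR: "x = wdeg a R"
 proof (rule poly_mapping_eqI)
  fix i show "lookup x i = lookup (wdeg a R) i"
  proof (cases i)
   case 0 then show ?thesis using x by (simp add: lookup_wdeg spec_mons_def)
  next
   case (Suc r)
   have "lookup x (Suc r) = 0" if "\<not> r < N" using keys that by (auto simp: in_keys_iff)
   then show ?thesis by (auto simp: Suc lookup_wdeg cnt)
  qed
 qed
 have "a + m = (\<Sum>v<Suc N. lookup x v)"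
  using x mon_degree_eq[OF keys] by (simp add: spec_mons_def)
 also have "... = a + (\<Sum>r<N. lookup x (Suc r))"
  using x by (subst sum.lessThan_Suc_shift) (simp add: spec_mons_def)
 finally have "size R = m" by (simp add: R_def size_multiset_sum)
 obtain xs where xs: "mset xs = R" using ex_mset by blast
 then have len: "length xs = m" using \<open>size R = m\<close> by auto
 define f where "f i = (if i < m then xs ! i else undefined)" for i
 have "image_mset f (mset_set {..<m}) = image_mset (nth xs) (mset_set {..<m})"
  by (rule image_mset_cong) (simp add: f_def)
 also have "... = mset (map (nth xs) [0..<m])" by (simp add: mset_upt atLeast0LessThan)
 also have "... = R" using len xs by (metis map_nth)
 finally have fR: "image_mset f (mset_set {..<m}) = R" .
 have "xs ! i < N" if "i < m" for i
 proof -
  have "xs ! i \<in># R" using that len xs by auto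
  then have "count R (xs ! i) ~= 0" by simp
  then show ?thesis using cnt[of "xs ! i"] by (auto split: if_splits)
 qed
 then have "f \<in> {..<m} \<rightarrow>\<^sub>E {..<N}" by (auto simp: f_def PiE_iff extensional_def)
 then show "x \<in> (%f. wdeg a (image_mset f (mset_set {..<m}))) ` ({..<m} \<rightarrow>\<^sub>E {..<N})"
  using xR fR by blast
next
 fix x assume "x \<in> (%f. wdeg a (image_mset f (mset_set {..<m}))) ` ({..<m} \<rightarrow>\<^sub>E {..<N})"
 then obtain f where f: "x = wdeg a (image_mset f (mset_set {..<m}))" "f \<in> {..<m} \<rightarrow>\<^sub>E {..<N}" by (rule imageE)
 have deg: "mon_degree (wdeg a R) = a + size R" for R
 proof (induction R)
  case empty then show ?case by (simp add: wdeg_def row_mon_def)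
 next
  case (add r R)
  have "wdeg a (add_mset r R) = wdeg a R + single (Suc r) 1"
   by (simp add: wdeg_def row_mon_def add.commute add.left_commute)
  then show ?case using add by (simp add: mon_degree_add)
 qed
 have "keys x \<subseteq> {..N}"
 proof
  fix v assume v: "v \<in> keys x"
  show "v \<in> {..N}"
  proof (cases v)
   case (Suc r)
   then have "r \<in># image_mset f (mset_set {..<m})" using v by (simp add: f(1) in_keys_iff lookup_wdeg)
   then obtain i where "i < m" "r = f i" by auto
   then show ?thesis using PiE_mem[OF f(2), of i] Suc by simp
  qed simp
 qed
 then show "x \<in> spec_mons N a m" by (simp add: spec_mons_def f(1) deg lookup_wdeg)
qed

definition sign_part :: "nat => nat => nat => mpoly set" where
 "sign_part n a m = {p \<in> mlin n a m.
   \<forall>s\<in>{s. s permutes {..<m}}. row_sub s p = Const (of_int (sign s)) * p}"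

text \<open>The sum over multidegrees becomes a sum over maps \<open>f\<close>, each weighted by its
  stabilizer. Exchanging it with the sum over permutations, as in Burnside's lemma, leaves the
  number of maps fixed by a permutation, a power of \<open>N\<close>. This is why the count is a
  polynomial in \<open>N\<close>.\<close>

lemma spec_sum_alts:
 "spec_sum (%d. of_nat (mpoly.dim (alts n d))) a m N =
  (\<Sum>p | p permutes {..<m}. trace_on (mlin n a m) (row_sub p) / fact m * of_nat N ^ card (orbit p ` {..<m}))"
proof -
 define F where "F = {..<m} \<rightarrow>\<^sub>E {..<N}"
 let ?P = "{p. p permutes {..<m}}"
 let ?R = "%f. image_mset f (mset_set {..<m})"
 let ?H = "%d. of_nat (mpoly.dim (alts n d)) :: rat"
 let ?t = "%p. trace_on (mlin n a m) (row_sub p)"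
 have finF: "finite F" unfolding F_def by (intro finite_PiE) auto
 have img: "spec_mons N a m = (%f. wdeg a (?R f)) ` F" unfolding F_def by (rule spec_mons_image)
 have fib: "card {f' \<in> F. ?R f' = ?R f} * card (row_stab m f) = fact m" if "f \<in> F" for f
  using that unfolding F_def by (rule card_fibre_stab)
 have invc: "card {f \<in> F. f o p = f} = N ^ card (orbit p ` {..<m})" if "p permutes {..<m}" for p
  unfolding F_def using card_invariant_functions[of "{..<m}" p "{..<N}"] that by simp
 have "(\<Sum>f\<in>F. ?H (wdeg a (?R f)) * of_nat (card (row_stab m f)) / fact m) =
  (\<Sum>x\<in>spec_mons N a m. \<Sum>f | f \<in> F & wdeg a (?R f) = x. ?H (wdeg a (?R f)) * of_nat (card (row_stab m f)) / fact m)"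
  by (rule sum.group[symmetric, OF finF finite_spec_mons]) (simp add: img)
 also have "... = (\<Sum>x\<in>spec_mons N a m. ?H x)"
 proof (rule sum.cong[OF refl])
  fix x assume x: "x \<in> spec_mons N a m"
  obtain f0 where f0: "x = wdeg a (?R f0)" "f0 \<in> F" by (rule imageE[OF x[unfolded img]])
  let ?Fx = "{f. f \<in> F & wdeg a (?R f) = x}"
  have Fx: "?Fx = {f' \<in> F. ?R f' = ?R f}" if "f \<in> ?Fx" for f
  proof -
   from CollectD[OF that] have e: "wdeg a (?R f) = x" ..
   show ?thesis by (simp only: e[symmetric] wdeg_inject simp_thms)
  qed
  have f0x: "f0 \<in> ?Fx" using f0 by (intro CollectI conjI) simp_all
  have "finite ?Fx" by (rule finite_subset[OF _ finF]) blast
  define N' :: rat where "N' = of_nat (card ?Fx)"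
  from \<open>finite ?Fx\<close> have c: "N' ~= 0" unfolding N'_def using f0x by auto
  have "?H (wdeg a (?R f)) * of_nat (card (row_stab m f)) / fact m = ?H x / N'" if f: "f \<in> ?Fx" for f
  proof -
   from CollectD[OF f] have fF: "f \<in> F" and fx: "wdeg a (?R f) = x" by blast+
   have "card ?Fx * card (row_stab m f) = fact m"
    unfolding Fx[OF f] by (rule fib[OF fF])
   then have "N' * of_nat (card (row_stab m f)) = fact m"
    unfolding N'_def by (simp only: of_nat_mult[symmetric] of_nat_fact)
   then show ?thesis using c unfolding fx by (simp add: field_simps)
  qed
  then have "(\<Sum>f\<in>?Fx. ?H (wdeg a (?R f)) * of_nat (card (row_stab m f)) / fact m) = (\<Sum>f\<in>?Fx. ?H x / N')"
   by (rule sum.cong[OF refl])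
  also have "... = ?H x" using c by (simp only: sum_constant N'_def[symmetric]) simp
  finally show "(\<Sum>f | f \<in> F & wdeg a (?R f) = x. ?H (wdeg a (?R f)) * of_nat (card (row_stab m f)) / fact m) = ?H x" .
 qed
 finally have "spec_sum ?H a m N = (\<Sum>f\<in>F. (\<Sum>p\<in>row_stab m f. ?t p) / fact m)"
  by (simp add: spec_sum_def dim_alts_stab)
 also have "... = (\<Sum>f\<in>F. \<Sum>p\<in>?P. if f o p = f then ?t p / fact m else 0)"
 proof (rule sum.cong[OF refl])
  fix f
  have "row_stab m f = {p \<in> ?P. f o p = f}" by (auto simp: row_stab_def)
  then show "(\<Sum>p\<in>row_stab m f. ?t p) / fact m = (\<Sum>p\<in>?P. if f o p = f then ?t p / fact m else 0)"
   using sum.inter_filter[OF finite_perms[of m], of "%p. ?t p / fact m" "%p. f o p = f"]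
   by (simp only: sum_divide_distrib)
 qed
 also have "... = (\<Sum>p\<in>?P. \<Sum>f\<in>F. if f o p = f then ?t p / fact m else 0)" by (rule sum.swap)
 also have "... = (\<Sum>p\<in>?P. ?t p / fact m * of_nat N ^ card (orbit p ` {..<m}))"
 proof (rule sum.cong[OF refl])
  fix p assume "p \<in> ?P"
  then have "of_nat (card {f \<in> F. f o p = f}) = (of_nat N ^ card (orbit p ` {..<m}) :: rat)"
   by (simp add: invc)
  then show "(\<Sum>f\<in>F. if f o p = f then ?t p / fact m else 0) = ?t p / fact m * of_nat N ^ card (orbit p ` {..<m})"
   using sum.inter_filter[OF finF, of "%_. ?t p / fact m" "%f. f o p = f"] by (simp add: mult.commute)
 qed
 finally show ?thesis .
qed

text \<open>At \<open>N = -1\<close> the power of \<open>N\<close> is (-1)^m times the sign of the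
  permutation, by the parity of the number of cycles. So the average of the traces selects the part
  of the multilinear component that is antisymmetric in the rows.\<close>

lemma has_sspec_alts:
 "has_sspec (%d. of_nat (mpoly.dim (alts n d))) a m (of_nat (mpoly.dim (sign_part n a m)))"
proof (rule has_sspecI[where P = "\<Sum>p | p permutes {..<m}.
   monom (trace_on (mlin n a m) (row_sub p) / fact m) (card (orbit p ` {..<m}))"])
 fix N
 show "poly (\<Sum>p | p permutes {..<m}. monom (trace_on (mlin n a m) (row_sub p) / fact m) (card (orbit p ` {..<m}))) (of_nat N) =
  spec_sum (%d. of_nat (mpoly.dim (alts n d))) a m N"
  unfolding spec_sum_alts by (simp add: poly_sum poly_monom)
next
 let ?P = "{p. p permutes {..<m}}" and ?t = "%p. trace_on (mlin n a m) (row_sub p)"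
 have c: "card ?P = fact m" by (simp add: card_permutations[OF refl finite_lessThan])
 have "(\<Sum>s\<in>?P. of_int (sign s) * ?t s) = of_nat (card ?P) * of_nat (mpoly.dim (sign_part n a m))"
  unfolding sign_part_def
 proof (rule trace_char_sum[OF finite_dim_alts finite_perms _ linear_op_row_sub])
  show "?P ~= {}" using permutes_id by blast
  show "row_sub s v \<in> mlin n a m" if "s \<in> ?P" "v \<in> mlin n a m" for s v
   using row_sub_mlin[of s m n a] that by blast
  show "bij_betw ((o) s) ?P ?P" if "s \<in> ?P" for s using bij_comp_permutes that by blast
  show "of_int (sign (s o g)) = (of_int (sign s) * of_int (sign g) :: rat)" if "s \<in> ?P" "g \<in> ?P" for s g
   using that by (intro sign_rat) auto
  show "of_int (sign s) * of_int (sign s) = (1 :: rat)" for s :: "nat => nat"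
   by (simp flip: of_int_mult)
 qed (simp add: row_sub_comp)
 then have d: "of_nat (mpoly.dim (sign_part n a m)) = (\<Sum>s\<in>?P. of_int (sign s) * ?t s) / fact m"
  by (simp add: c)
 have "(-1) ^ m * (?t p / fact m * (-1) ^ card (orbit p ` {..<m})) = of_int (sign p) * ?t p / fact m" if "p \<in> ?P" for p
 proof -
  have "(-1 :: int) ^ card (orbit p ` {..<m}) = (-1) ^ m * sign p"
   using card_orbits_parity[of "{..<m}" p] that by simp
  then have "(-1 :: rat) ^ card (orbit p ` {..<m}) = (-1) ^ m * of_int (sign p)"
   by (metis of_int_1 of_int_minus of_int_mult of_int_power)
  moreover have "(-1 :: rat) ^ m * (-1) ^ m = 1" by (simp flip: power_mult_distrib)
  ultimately show ?thesis by (simp add: mult.left_commute mult.assoc[symmetric])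
 qed
 note e = this
 have "(-1) ^ m * poly (\<Sum>p | p permutes {..<m}. monom (?t p / fact m) (card (orbit p ` {..<m}))) (-1) =
  (\<Sum>p\<in>?P. (-1) ^ m * (?t p / fact m * (-1) ^ card (orbit p ` {..<m})))"
  by (simp only: poly_sum poly_monom sum_distrib_left)
 also have "... = (\<Sum>p\<in>?P. of_int (sign p) * ?t p / fact m)" by (rule sum.cong[OF refl e])
 finally show "of_nat (mpoly.dim (sign_part n a m)) = (-1) ^ m *
   poly (\<Sum>p | p permutes {..<m}. monom (?t p / fact m) (card (orbit p ` {..<m}))) (-1)"
  unfolding d by (simp only: sum_divide_distrib)
qed

section \<open>A basis of the row-antisymmetric alts\<close>

definition row0_mon :: "nat => (nat => nat) => (nat \<times> nat \<Rightarrow>\<^sub>0 nat)" where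
 "row0_mon n w = (\<Sum>j<n. single (0, j) (w j))"

lemma lookup_row0_mon: "lookup (row0_mon n w) (i, j) = (if i = 0 & j < n then w j else 0)"
 by (cases "i = 0") (simp_all add: row0_mon_def lookup_sum lookup_single when_def)

lemma row0_mon_eqI:
 assumes "!!j. j < n ==> lookup x (0, j) = w j" "!!i j. i ~= 0 \<or> n \<le> j ==> lookup x (i, j) = 0"
 shows "x = row0_mon n w"
proof (rule poly_mapping_eqI)
 fix v :: "nat \<times> nat" obtain i j where v: "v = (i, j)" by force
 show "lookup x v = lookup (row0_mon n w) v"
  using assms(1)[of j] assms(2)[of i j] by (cases "i = 0"; cases "j < n") (simp_all add: v lookup_row0_mon)
qed

definition vdm_coeff :: "nat => (nat => nat) => rat" where
 "vdm_coeff n w = lookup (vdm n) (row0_mon n w)"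

lemma vdm_coeff_cong: "(!!j. j < n ==> w j = w' j) ==> vdm_coeff n w = vdm_coeff n w'"
 by (simp add: vdm_coeff_def row0_mon_def)

lemma vdm_coeff_perm:
 assumes "s permutes {..<n}"
 shows "vdm_coeff n (w o s) = of_int (sign s) * vdm_coeff n w"
proof -
 let ?r = "%(i :: nat, j). (i, s j)"
 have bij: "bij ?r" by (rule bij_col_map[OF permutes_bij[OF assms]])
 have "map_key ?r (row0_mon n w) = row0_mon n (w o s)"
 proof (rule row0_mon_eqI)
  have l: "lookup (map_key ?r (row0_mon n w)) (i, j) =
    (if i = 0 & j < n then w (s j) else 0)" for i j
   using permutes_in_image[OF assms, of j] by (simp add: map_key.rep_eq[OF bij_is_inj[OF bij]] lookup_row0_mon)
  show "lookup (map_key ?r (row0_mon n w)) (0, j) = (w o s) j" if "j < n" for j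
   unfolding l using that by simp
  show "lookup (map_key ?r (row0_mon n w)) (i, j) = 0" if "i ~= 0 \<or> n \<le> j" for i j
   unfolding l using that by auto
 qed
 then have "vdm_coeff n (w o s) = lookup (col_perm s (vdm n)) (row0_mon n w)"
  by (simp add: vdm_coeff_def col_perm_rename lookup_rename[OF bij])
 then show ?thesis by (simp add: vdm_perm[OF assms] vdm_coeff_def)
qed

lemma vdm_mon:
 assumes "lookup (vdm n) x ~= 0"
 shows "x = row0_mon n (%j. lookup x (0, j))"
proof (rule row0_mon_eqI)
 have "keys x \<subseteq> {0} \<times> {..<n}"
  using vdm_in_row[of n] assms by (simp add: polys_in_iff)
 then show "lookup x (i, j) = 0" if "i ~= 0 \<or> n \<le> j" for i j
  using that by (auto simp: in_keys_iff)
qed simp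

lemma sum_distinct_nat_eq:
 assumes "finite (S :: nat set)" "\<Sum>S = (\<Sum>i<card S. i)"
 shows "S = {..<card S}"
proof (rule card_subset_eq)
 show "S \<subseteq> {..<card S}"
 proof
  fix x assume x: "x \<in> S"
  then obtain c where c: "card S = Suc c" using assms(1) by (cases "card S") auto
  have "(\<Sum>i<card (S - {x}). i) \<le> \<Sum>(S - {x})" using assms(1) by (intro sum_distinct_nat_ge) simp
  moreover have "\<Sum>S = x + \<Sum>(S - {x})" using assms(1) x by (rule sum.remove)
  moreover have "card (S - {x}) = c" using x assms(1) c by simp
  ultimately show "x \<in> {..<card S}" using assms(2) c by simp
 qed
qed simp_all

text \<open>Antisymmetry forces distinct exponents, and the total degree is the least sum of
  \<open>n\<close> distinct numbers, so the exponents are 0, ..., n-1. Together with the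
  nonvanishing of these coefficients this takes the place of the Leibniz formula.\<close>

lemma vdm_coeff_bij:
 assumes nz: "vdm_coeff n w ~= 0" shows "bij_betw w {..<n} {..<n}"
proof -
 have inj: "inj_on w {..<n}"
 proof (rule inj_onI, rule ccontr)
  fix a b assume ab: "a \<in> {..<n}" "b \<in> {..<n}" "w a = w b" "a ~= b"
  have "transpose a b permutes {..<n}" using ab by (intro permutes_swap_id) auto
  then have "vdm_coeff n (w o transpose a b) = - vdm_coeff n w"
   using ab(4) by (simp add: vdm_coeff_perm sign_swap_id)
  moreover have "w o transpose a b = w" using ab(3) by (auto simp: fun_eq_iff transpose_def)
  ultimately show False using nz by simp
 qed
 have "rdeg n 0 (row0_mon n w) = top_degree n"
  using homog_vdm nz by (fastforce simp: homog_def vdm_coeff_def)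
 then have "(\<Sum>j<n. w j) = (\<Sum>j<n. j)" by (simp add: rdeg_def lookup_row0_mon top_degree_def)
 then have "\<Sum>(w ` {..<n}) = (\<Sum>i<card (w ` {..<n}). i)" using inj by (simp add: sum.reindex card_image)
 then have "w ` {..<n} = {..<card (w ` {..<n})}" by (intro sum_distinct_nat_eq) auto
 then show ?thesis using inj by (simp add: bij_betw_def card_image)
qed

lemma Const_prod: "Const (\<Prod>i\<in>I. f i) = (\<Prod>i\<in>I. Const (f i))"
 by (induction I rule: infinite_finite_induct) (simp_all add: Const_mult)

lemma Const_diff: "Const (a - b) = Const a - Const b"
 using Const_add[of a "- b"] by (simp add: Const_minus)

lemma vdm_nonzero: "vdm n ~= 0"
proof
 assume "vdm n = 0"
 \<comment> \<open>Evaluating column \<open>j\<close> at the number \<open>j\<close> leaves a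
   product of nonzero differences.\<close>
 then have "0 = sbst (%v. Const (of_nat (snd v))) (vdm n)" by simp
 also have "... = Const (\<Prod>p\<in>pairs n. of_nat (fst p) - of_nat (snd p))"
  by (simp add: vdm_eq sbst_prod sbst_diff Const_prod Const_diff)
 finally have "lookup (Const (\<Prod>p\<in>pairs n. of_nat (fst p) - of_nat (snd p))) 0 = 0"
  by (metis lookup_zero)
 then have "(\<Prod>p\<in>pairs n. of_nat (fst p) - of_nat (snd p) :: rat) = 0" by (simp add: Const_def)
 then have "\<exists>p\<in>pairs n. (of_nat (fst p) :: rat) = of_nat (snd p)" by simp
 then show False by (auto simp: pairs_def)
qed

text \<open>Some coefficient is nonzero, and a permutation of the columns leads from its exponents
  to any other bijection at the cost of a sign.\<close>

lemma vdm_coeff_nonzero: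
 assumes w: "bij_betw w {..<n} {..<n}" shows "vdm_coeff n w ~= 0"
proof -
 obtain x where x: "lookup (vdm n) x ~= 0"
  using vdm_nonzero[of n] by (metis poly_mapping_eqI lookup_zero)
 define w0 where "w0 j = lookup x (0, j)" for j
 have nz: "vdm_coeff n w0 ~= 0"
  using x vdm_mon[OF x] unfolding vdm_coeff_def w0_def by simp
 have b0: "bij_betw w0 {..<n} {..<n}" by (rule vdm_coeff_bij[OF nz])
 define s where "s j = (if j < n then inv_into {..<n} w0 (w j) else j)" for j
 have "bij_betw (inv_into {..<n} w0 o w) {..<n} {..<n}"
  by (rule bij_betw_trans[OF w bij_betw_inv_into[OF b0]])
 then have "bij_betw s {..<n} {..<n}" by (subst bij_betw_cong[of _ _ "inv_into {..<n} w0 o w"]) (auto simp: s_def)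
 then have p: "s permutes {..<n}" by (rule bij_imp_permutes) (simp add: s_def)
 have "vdm_coeff n w = vdm_coeff n (w0 o s)"
 proof (rule vdm_coeff_cong)
  fix j assume j: "j < n"
  then have "w j \<in> w0 ` {..<n}" using w b0 by (auto simp: bij_betw_def)
  then show "w j = (w0 o s) j" using j by (simp add: s_def f_inv_into_f)
 qed
 also have "... = of_int (sign s) * vdm_coeff n w0" by (rule vdm_coeff_perm[OF p])
 finally show ?thesis using nz by (simp add: sign_def)
qed

text \<open>The factorial on the left replaces the falling factorial of an iterated derivative and
  avoids a quotient.\<close>

lemma lookup_pd_funpow:
 "lookup ((pd v ^^ e) p) x * fact (lookup x v) =
   fact (lookup x v + e) * lookup p (x + single v e)"
proof (induction e arbitrary: x)
 case (Suc e)
 have "lookup ((pd v ^^ Suc e) p) x * fact (lookup x v) =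
   lookup ((pd v ^^ e) p) (x + single v 1) * fact (lookup (x + single v 1) v)"
  by (simp add: lookup_pd lookup_add)
 also have "... = fact (lookup x v + Suc e) * lookup p (x + single v 1 + single v e)"
  unfolding Suc.IH by (simp add: lookup_add)
 also have "x + single v 1 + single v e = x + single v (Suc e)"
  by (simp add: add.assoc flip: single_add)
 finally show ?case .
qed simp

lemma lookup_Var_mult:
 "lookup (Var v * q) x =
  (if lookup x v = 0 then 0 else lookup q (x - single v 1))"
proof -
 have "Var v * q = Var v * (\<Sum>m\<in>keys q. single m (lookup q m))"
  by (simp add: mons_sum)
 also have "... = (\<Sum>m\<in>keys q. single (single v 1 + m) (lookup q m))"
  by (simp add: Var_def sum_distrib_left mult_single)
 finally have e: "lookup (Var v * q) x =
   (\<Sum>m\<in>keys q. if single v 1 + m = x then lookup q m else 0)"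
  by (simp add: lookup_sum lookup_single when_def)
 show ?thesis
 proof (cases "lookup x v = 0")
  case True
  then have "single v 1 + m ~= x" for m by (auto simp: lookup_add)
  then show ?thesis using True by (simp add: e)
 next
  case False
  have "single v 1 + m = x \<longleftrightarrow> m = x - single v 1" for m
  proof
   assume m: "m = x - single v 1"
   show "single v 1 + m = x"
    by (rule poly_mapping_eqI) (use False in "auto simp: m lookup_add lookup_minus lookup_single when_def")
  qed auto
  then show ?thesis using False by (simp add: e in_keys_iff)
 qed
qed

definition row_word :: "nat => nat => (nat => nat) => mpoly" where
 "row_word n m d = E_word n (image_mset (%i. (i, d i)) (mset_set {..<m}))"

lemma row_word_0 [simp]: "row_word n 0 d = vdm n"
 and row_word_Suc: "row_word n (Suc m) d = pol_op n (m, d m) (row_word n m d)"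
 by (simp_all add: row_word_def lessThan_Suc)

lemma row_word_cong: "(!!r. r < m ==> d r = d' r) ==> row_word n m d = row_word n m d'"
 unfolding row_word_def by (rule arg_cong[where f = "E_word n"], rule image_mset_cong) simp

abbreviation diag_boxes :: "nat => (nat \<times> nat \<Rightarrow>\<^sub>0 nat)" where
 "diag_boxes m \<equiv> box_mon {..<m} (%i. (i, i))"

text \<open>The monomial places the variable of row \<open>r + 1\<close> in column \<open>r\<close>,
  where row 0 has exponent 0. So a single term of each polarization contributes, and the determinant
  must have had exponent \<open>d r + 1\<close> in that column, all of which is differentiated away;
  this gives the factorials.\<close>

lemma lookup_row_word:
 assumes "m \<le> n" "!!r. r < m ==> lookup b (0, r) = 0" "!!i j. lookup b (Suc i, j) = 0"
 shows "lookup (row_word n m d) (b + diag_boxes m) =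
  (\<Prod>r<m. fact (Suc (d r))) * lookup (vdm n) (b + row0_mon m (%r. Suc (d r)))"
 using assms
proof (induction m arbitrary: b)
 case 0 then show ?case by (simp add: box_mon_def row0_mon_def)
next
 case (Suc m)
 let ?p = "row_word n m d" and ?e = "Suc (d m)"
 define x where "x = b + diag_boxes (Suc m)"
 have x: "x = single (Suc m, m) 1 + (b + diag_boxes m)"
  by (simp add: x_def box_mon_def lessThan_Suc add_ac)
 have lx: "lookup x (Suc m, j) = (if j = m then 1 else 0)" for j
  by (auto simp: x_def lookup_add Suc.prems(3) lookup_box_mon_rows)
 have "lookup (row_word n (Suc m) d) x =
   (\<Sum>j<n. if j = m then lookup ((pd (0, m) ^^ ?e) ?p) (x - single (Suc m, m) 1) else 0)"
  unfolding row_word_Suc pol_op_def polarization_def lookup_sum lookup_Var_mult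
  by (rule sum.cong[OF refl]) (simp add: lx del: funpow.simps)
 also have "... = lookup ((pd (0, m) ^^ ?e) ?p) (b + diag_boxes m)"
  using Suc.prems(1) by (simp add: x del: funpow.simps)
 also have "... = fact ?e * lookup ?p (b + diag_boxes m + single (0, m) ?e)"
 proof -
  have "lookup (b + diag_boxes m) (0, m) = 0"
   using Suc.prems(2)[of m] by (simp add: lookup_add lookup_box_mon)
  then show ?thesis
   using lookup_pd_funpow[where v = "(0, m)" and e = ?e and p = ?p and x = "b + diag_boxes m"] by (simp del: funpow.simps fact_Suc)
 qed
 also have "b + diag_boxes m + single (0, m) ?e = (b + single (0, m) ?e) + diag_boxes m"
  by (simp add: add_ac)
 also have "lookup ?p ... = (\<Prod>r<m. fact (Suc (d r))) *
   lookup (vdm n) (b + single (0, m) ?e + row0_mon m (%r. Suc (d r)))"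
  by (rule Suc.IH) (use Suc.prems in "auto simp: lookup_add lookup_single when_def")
 also have "b + single (0, m) ?e + row0_mon m (%r. Suc (d r)) = b + row0_mon (Suc m) (%r. Suc (d r))"
  by (simp add: row0_mon_def add_ac)
 finally show ?case by (simp add: x_def mult_ac del: fact_Suc)
qed

definition row_altr :: "nat => nat => (nat => nat) => mpoly" where
 "row_altr n m d = (\<Sum>p | p permutes {..<m}. Const (of_int (sign p)) * row_word n m (d o p))"

lemma sign_perm_lessThan:
 assumes "s permutes {..<m :: nat}" "t permutes {..<m}"
 shows "sign (s o t) = sign s * sign t"
 by (rule sign_compose) (use assms permutes_imp_permutation in blast)+

lemma Const_sign_square: "Const (of_int (sign t)) * (Const (of_int (sign t)) * p) = p"
 by (simp add: mult.assoc[symmetric] flip: Const_mult of_int_mult)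

lemma row_altr_comp:
 assumes t: "s permutes {..<m}"
 shows "row_altr n m (d o s) = Const (of_int (sign s)) * row_altr n m d"
proof -
 let ?g = "%r. Const (of_int (sign s)) * (Const (of_int (sign r)) * row_word n m (d o r))"
 have "Const (of_int (sign s)) * row_altr n m d = (\<Sum>r | r permutes {..<m}. ?g r)"
  by (simp add: row_altr_def sum_distrib_left)
 also have "... = (\<Sum>p | p permutes {..<m}. ?g (s o p))" by (rule setum_permutations_compose_left[OF t])
 also have "... = row_altr n m (d o s)" unfolding row_altr_def
 proof (rule sum.cong[OF refl])
  fix p assume "p \<in> {p. p permutes {..<m}}"
  then have "sign (s o p) = sign s * sign p" using t by (simp add: sign_perm_lessThan)
  then show "?g (s o p) = Const (of_int (sign p)) * row_word n m (d o s o p)"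
   by (simp only: of_int_mult Const_mult mult.assoc Const_sign_square comp_assoc)
 qed
 finally show ?thesis by simp
qed

lemma row_altr_cong:
 assumes "!!r. r < m ==> d r = d' r" shows "row_altr n m d = row_altr n m d'"
 unfolding row_altr_def
proof (intro sum.cong refl arg_cong[where f = "%p. _ * p"] row_word_cong)
 fix g r assume "g \<in> {g. g permutes {..<m}}" "r < m"
 then show "(d o g) r = (d' o g) r" using assms permutes_in_image[of g "{..<m}" r] by simp
qed

lemma row_sub_row_word:
 assumes p: "g permutes {..<m}"
 shows "row_sub g (row_word n m d) = row_word n m (d o inv_into UNIV g)"
proof -
 have "image_mset (%i. (i, (d o inv_into UNIV g) i)) (mset_set {..<m}) =
   image_mset (%i. (i, (d o inv_into UNIV g) i)) (image_mset g (mset_set {..<m}))"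
  by (simp only: permutes_image_mset[OF p])
 also have "... = image_mset (map_prod g id) (image_mset (%i. (i, d i)) (mset_set {..<m}))"
  by (simp add: image_mset.compositionality o_def permutes_inverses(2)[OF p])
 finally show ?thesis by (simp add: row_word_def row_sub_E_word)
qed

lemma row_sub_row_altr:
 assumes t: "g permutes {..<m}"
 shows "row_sub g (row_altr n m d) = Const (of_int (sign g)) * row_altr n m d"
proof -
 let ?f = "%p. Const (of_int (sign p)) * row_word n m (d o p o inv_into UNIV g)"
 have "row_sub g (row_altr n m d) = (\<Sum>p | p permutes {..<m}. ?f p)"
  unfolding row_altr_def linear_op_sum[OF linear_op_row_sub] by (simp only: row_sub_row_word[OF t])
 also have "... = (\<Sum>p | p permutes {..<m}. ?f (p o g))" by (rule sum_permutations_compose_right[OF t])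
 also have "... = (\<Sum>p | p permutes {..<m}. Const (of_int (sign g)) * (Const (of_int (sign p)) * row_word n m (d o p)))"
 proof (rule sum.cong[OF refl])
  fix p assume "p \<in> {p. p permutes {..<m}}"
  then have "sign (p o g) = sign g * sign p" using t by (simp add: sign_perm_lessThan)
  moreover have "d o (p o g) o inv_into UNIV g = d o p" by (simp only: comp_assoc permutes_inv_o(1)[OF t] comp_id)
  ultimately show "?f (p o g) = Const (of_int (sign g)) * (Const (of_int (sign p)) * row_word n m (d o p))"
   by (simp only: of_int_mult Const_mult mult.assoc)
 qed
 finally show ?thesis by (simp add: row_altr_def sum_distrib_left)
qed

lemma row_altr_not_inj:
 assumes "\<not> inj_on d {..<m}" shows "row_altr n m d = 0"
proof -
 obtain i j where ij: "i < m" "j < m" "i ~= j" "d i = d j" using assms by (auto simp: inj_on_def)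
 have "transpose i j permutes {..<m}" using ij by (intro permutes_swap_id) auto
 then have "row_altr n m (d o transpose i j) = Const (-1) * row_altr n m d"
  using ij(3) by (simp add: row_altr_comp sign_swap_id)
 moreover have "d o transpose i j = d" using ij(4) by (auto simp: fun_eq_iff transpose_def)
 ultimately have e: "row_altr n m d = Const (-1) * row_altr n m d" by simp
 show ?thesis
  by (rule poly_mapping_eqI) (use arg_cong[OF e, of lookup] in "auto simp: fun_eq_iff")
qed

lemma pol_op_vdm_zero: assumes "n \<le> Suc d" shows "pol_op n (r, d) (vdm n) = 0"
proof -
 have "(pd (0, j) ^^ Suc d) (vdm n) = 0" if j: "j < n" for j
 proof (rule poly_mapping_eqI)
  fix x :: "nat \<times> nat \<Rightarrow>\<^sub>0 nat"
  let ?y = "x + single (0, j) (Suc d)"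
  have "lookup (vdm n) ?y = 0"
  proof (rule ccontr)
   assume nz: "lookup (vdm n) ?y ~= 0"
   let ?w = "%j. lookup ?y (0, j)"
   have "vdm_coeff n ?w ~= 0"
    unfolding vdm_coeff_def using nz vdm_mon[OF nz] by metis
   from vdm_coeff_bij[OF this] have "?w ` {..<n} = {..<n}" by (simp add: bij_betw_def)
   then have "?w j < n" using j by blast
   then show False using assms by (simp add: lookup_add)
  qed
  then show "lookup ((pd (0, j) ^^ Suc d) (vdm n)) x = lookup 0 x"
   using lookup_pd_funpow[where v = "(0, j)" and e = "Suc d" and p = "vdm n" and x = x] by (simp del: funpow.simps)
 qed
 then show ?thesis by (simp add: pol_op_def polarization_def del: funpow.simps)
qed

lemma E_word_zero:
 assumes "n \<le> Suc d" shows "(r, d) \<in># M ==> E_word n M = 0"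
proof (induction M)
 case (add y M)
 have "pol_op n (r, d) (E_word n M) = 0"
  by (induction M) (simp_all add: pol_op_vdm_zero[OF assms] pol_op_commute[of n "(r, d)"])
 then show ?case using add by auto
qed simp

lemma row_altr_large:
 assumes "r < m" "n \<le> Suc (d r)" shows "row_altr n m d = 0"
 unfolding row_altr_def
proof (rule sum.neutral, rule ballI)
 fix g assume "g \<in> {g. g permutes {..<m}}"
 then have p: "g permutes {..<m}" by simp
 define s where "s = inv_into UNIV g r"
 have s: "g s = r" "s < m"
  using permutes_inverses(1)[OF p, of r] permutes_in_image[OF p, of s] assms(1) by (auto simp: s_def)
 then have "(s, d r) \<in># image_mset (%i. (i, (d o g) i)) (mset_set {..<m})" by auto
 then have "row_word n m (d o g) = 0" unfolding row_word_def by (rule E_word_zero[OF assms(2)])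
 then show "Const (of_int (sign g)) * row_word n m (d o g) = 0" by simp
qed

lemma row_word_in_E_words:
 "(\<Sum>r<m. Suc (d r)) + a = top_degree n ==> row_word n m d \<in> E_words n a (mset_set {..<m})"
 unfolding row_word_def E_words_def
 by (intro imageI CollectI) (simp add: lowering_def image_mset.compositionality o_def sum_unfold_sum_mset)

lemma E_words_row_words:
 assumes "p \<in> E_words n a (mset_set {..<m})"
 obtains d where "p = row_word n m d" "(\<Sum>r<m. Suc (d r)) + a = top_degree n"
proof -
 obtain M where M: "p = E_word n M" "lowering M + a = top_degree n" "image_mset fst M = image_mset id (mset_set {..<m})"
  using assms by (auto simp: E_words_def)
 obtain d where "M = image_mset (%i. (id i, d i)) (mset_set {..<m})" using multiset_labels[OF M(3)] .
 then show ?thesis using that[of d] M(1,2)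
  by (simp add: row_word_def lowering_def image_mset.compositionality o_def sum_unfold_sum_mset)
qed

lemma row_altr_in_sign_part:
 assumes d: "(\<Sum>r<m. Suc (s r)) + a = top_degree n"
 shows "row_altr n m s \<in> sign_part n a m"
proof -
 have "row_word n m (s o g) \<in> mlin n a m" if p: "g permutes {..<m}" for g
 proof -
  have "(\<Sum>r<m. Suc ((s o g) r)) = (\<Sum>r<m. Suc (s r))"
   using sum.permute[OF p, of "%r. Suc (s r)"] by (simp add: o_def)
  then show ?thesis
   unfolding alts_eq_span using d by (intro mpoly.span_base row_word_in_E_words) simp
 qed
 then have "row_altr n m s \<in> mlin n a m"
  unfolding row_altr_def
  by (intro mpoly.subspace_sum[OF alts_subsp] mpoly.subspace_scale[OF alts_subsp, simplified]) simp
 then show ?thesis by (simp add: sign_part_def row_sub_row_altr)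
qed

text \<open>\<open>AL\<close> antisymmetrizes the rows: it multiplies the elements of the sign part
  by \<open>m!\<close> and sends every word to its \<open>row_altr\<close>.\<close>

lemma sign_part_spanned:
 assumes p: "p \<in> sign_part n a m"
 shows "p \<in> mpoly.span {row_altr n m d | d. (\<Sum>r<m. Suc (d r)) + a = top_degree n}" (is "_ \<in> mpoly.span ?T")
proof -
 define AL where "AL q = (\<Sum>g | g permutes {..<m}. Const (of_int (sign g)) * row_sub g q)" for q
 have lin: "linear_op AL"
  by (simp add: linear_op_def AL_def row_sub_linear distrib_left sum.distrib sum_distrib_left mult.left_commute)
 have word: "AL (row_word n m d) = row_altr n m d" for d
 proof -
  have "AL (row_word n m d) = (\<Sum>g | g permutes {..<m}. Const (of_int (sign (inv_into UNIV g))) * row_word n m (d o inv_into UNIV g))"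
   unfolding AL_def
  proof (rule sum.cong[OF refl])
   fix g assume "g \<in> {g. g permutes {..<m}}"
   then have "g permutes {..<m}" by simp
   then show "Const (of_int (sign g)) * row_sub g (row_word n m d) =
     Const (of_int (sign (inv_into UNIV g))) * row_word n m (d o inv_into UNIV g)"
    by (simp only: row_sub_row_word sign_inverse permutes_imp_permutation[OF finite_lessThan])
  qed
  also have "... = row_altr n m d" unfolding row_altr_def by (rule sum_permutations_inverse[symmetric])
  finally show ?thesis .
 qed
 have AL: "AL p = Const (fact m) * p"
 proof -
  have "AL p = (\<Sum>g | g permutes {..<m}. p)" unfolding AL_def
  proof (rule sum.cong[OF refl])
   fix g assume "g \<in> {g. g permutes {..<m}}"
   then have e: "row_sub g p = Const (of_int (sign g)) * p" using p by (simp add: sign_part_def)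
   show "Const (of_int (sign g)) * row_sub g p = p" unfolding e by (rule Const_sign_square)
  qed
  also have "... = Const (of_nat (card {g. g permutes {..<m}})) * p" by (simp add: Const_of_nat)
  finally show ?thesis by (simp add: card_permutations[OF refl finite_lessThan])
 qed
 have "AL p \<in> AL ` mpoly.span (E_words n a (mset_set {..<m}))"
  using p by (auto simp: sign_part_def alts_eq_span)
 also have "... = mpoly.span (AL ` E_words n a (mset_set {..<m}))" by (rule linear_op_span_image[OF lin])
 also have "... \<subseteq> mpoly.span ?T"
 proof (rule mpoly.span_mono, rule subsetI)
  fix q assume "q \<in> AL ` E_words n a (mset_set {..<m})"
  then obtain p' where p': "q = AL p'" "p' \<in> E_words n a (mset_set {..<m})" by (rule imageE)
  obtain d where "p' = row_word n m d" "(\<Sum>r<m. Suc (d r)) + a = top_degree n" using E_words_row_words[OF p'(2)] .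
  then show "q \<in> ?T" using p'(1) word by blast
 qed
 finally have "Const (1 / fact m) * AL p \<in> mpoly.span ?T" by (rule span_Const_mult)
 then show ?thesis by (simp add: AL mult.assoc[symmetric] flip: Const_mult)
qed

text \<open>Sets of derivative orders: equal orders cancel under antisymmetrization, and orders of
  \<open>n\<close> or more kill the determinant. Their sum is the degree that row 0 has
  lost.\<close>

definition exponent_sets :: "nat => nat => nat => nat set set" where
 "exponent_sets n a m = {I. I \<subseteq> {1..<n} & card I = m & \<Sum>I + a = top_degree n}"

text \<open>Any enumeration will do, since another one changes the resulting vector only by the sign
  of a permutation.\<close>

definition enum_set :: "nat set => nat => nat" where
 "enum_set I = (SOME h. bij_betw h {..<card I} I)"

lemma enum_set: "finite I ==> bij_betw (enum_set I) {..<card I} I"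
 using someI_ex[of "%h. bij_betw h {..<card I} I"] ex_bij_betw_nat_finite[of I]
 by (simp add: enum_set_def atLeast0LessThan)

text \<open>The label of a polarization is its order minus one, hence the subtraction.\<close>

definition sign_vector :: "nat => nat set => mpoly" where
 "sign_vector n I = row_altr n (card I) (%r. enum_set I r - 1)"

lemma Suc_enum_set:
 assumes "I \<subseteq> {1..<n}" "r < card I" shows "Suc (enum_set I r - 1) = enum_set I r"
proof -
 have "finite I" using assms(1) finite_subset by blast
 then have "enum_set I r \<in> I" using bij_betwE[OF enum_set] assms(2) by blast
 then show ?thesis using assms(1) by force
qed

lemma sign_vector_in:
 assumes "I \<in> exponent_sets n a m" shows "sign_vector n I \<in> sign_part n a m"
proof -
 have I: "I \<subseteq> {1..<n}" "card I = m" "\<Sum>I + a = top_degree n" using assms by (auto simp: exponent_sets_def)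
 have fin: "finite I" using I(1) finite_subset by blast
 have "(\<Sum>r<m. Suc (enum_set I r - 1)) = (\<Sum>r<m. enum_set I r)"
  by (rule sum.cong[OF refl]) (use Suc_enum_set[OF I(1)] I(2) in simp)
 also have "... = \<Sum>I" using sum.reindex_bij_betw[OF enum_set[OF fin], of "%x. x"] I(2) by simp
 finally show ?thesis unfolding sign_vector_def I(2) by (intro row_altr_in_sign_part) (simp add: I(3))
qed

lemma row_altr_in_span:
 assumes d: "(\<Sum>r<m. Suc (s r)) + a = top_degree n"
 shows "row_altr n m s \<in> mpoly.span (sign_vector n ` exponent_sets n a m)"
proof (cases "inj_on s {..<m} & (\<forall>r<m. Suc (s r) < n)")
 case False
 then have "row_altr n m s = 0" using row_altr_not_inj row_altr_large by (metis not_less)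
 then show ?thesis by (simp add: mpoly.span_zero)
next
 case True
 let ?f = "%r. Suc (s r)"
 define I where "I = ?f ` {..<m}"
 have inj: "inj_on ?f {..<m}" using True by (auto simp: inj_on_def)
 have bij: "bij_betw ?f {..<m} I" using inj by (simp add: bij_betw_def I_def)
 have sub: "I \<subseteq> {1..<n}" using True by (auto simp: I_def)
 have cI: "card I = m" using inj by (simp add: I_def card_image)
 have "\<Sum>I = (\<Sum>r<m. ?f r)" using inj by (simp add: I_def sum.reindex)
 then have I: "I \<in> exponent_sets n a m" using sub cI d by (simp add: exponent_sets_def)
 have fin: "finite I" by (simp add: I_def)
 have h: "bij_betw (enum_set I) {..<m} I" using enum_set[OF fin] by (simp add: cI)
 define g where "g r = (if r < m then inv_into {..<m} (enum_set I) (?f r) else r)" for r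
 have "bij_betw (inv_into {..<m} (enum_set I) o ?f) {..<m} {..<m}"
  by (rule bij_betw_trans[OF bij bij_betw_inv_into[OF h]])
 then have "bij_betw g {..<m} {..<m}" by (subst bij_betw_cong[of _ _ "inv_into {..<m} (enum_set I) o ?f"]) (auto simp: g_def)
 then have p: "g permutes {..<m}" by (rule bij_imp_permutes) (simp add: g_def)
 have "row_altr n m s = row_altr n m ((%r. enum_set I r - 1) o g)"
 proof (rule row_altr_cong)
  fix r assume r: "r < m"
  then have "?f r \<in> enum_set I ` {..<m}" using bij h by (auto simp: bij_betw_def)
  then show "s r = ((%r. enum_set I r - 1) o g) r" using r by (simp add: g_def f_inv_into_f)
 qed
 also have "... = Const (of_int (sign g)) * sign_vector n I"
  unfolding sign_vector_def cI by (rule row_altr_comp[OF p])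
 finally show ?thesis using I by (simp add: span_Const_mult mpoly.span_base)
qed

lemma sign_part_subsp: "mpoly.subspace (sign_part n a m)"
proof (rule mpoly.subspaceI)
 have "row_sub p 0 = 0" for p using row_sub_linear(2)[of p 0 0] by simp
 then show "0 \<in> sign_part n a m" by (simp add: sign_part_def mpoly.subspace_0[OF alts_subsp])
next
 fix x y assume "x \<in> sign_part n a m" "y \<in> sign_part n a m"
 then show "x + y \<in> sign_part n a m"
  by (simp add: sign_part_def mpoly.subspace_add[OF alts_subsp] row_sub_linear distrib_left)
next
 fix c x assume "x \<in> sign_part n a m"
 then show "Const c * x \<in> sign_part n a m"
  using mpoly.subspace_scale[OF alts_subsp, of x n _ c]
  by (simp add: sign_part_def row_sub_linear mult.left_commute)
qed

lemma span_sign_vectors: "mpoly.span (sign_vector n ` exponent_sets n a m) = sign_part n a m"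
proof (rule equalityI)
 show "mpoly.span (sign_vector n ` exponent_sets n a m) \<subseteq> sign_part n a m"
  by (rule mpoly.span_minimal[OF _ sign_part_subsp]) (use sign_vector_in in blast)
 show "sign_part n a m \<subseteq> mpoly.span (sign_vector n ` exponent_sets n a m)"
 proof
  fix p assume "p \<in> sign_part n a m"
  then have "p \<in> mpoly.span {row_altr n m d | d. (\<Sum>r<m. Suc (d r)) + a = top_degree n}" by (rule sign_part_spanned)
  also have "... \<subseteq> mpoly.span (sign_vector n ` exponent_sets n a m)"
   by (rule mpoly.span_minimal[OF _ mpoly.subspace_span]) (use row_altr_in_span in blast)
  finally show "p \<in> mpoly.span (sign_vector n ` exponent_sets n a m)" .
 qed
qed

text \<open>Permuting the orders permutes the exponents required of the determinant, whose
  coefficient then contributes the sign of the permutation a second time. So all \<open>m!\<close>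
  summands are equal and nothing cancels.\<close>

lemma lookup_row_altr:
 assumes m: "m \<le> n"
 shows "lookup (row_altr n m d) (row0_mon n (%j. if j < m then 0 else v j) + diag_boxes m) =
  fact m * (\<Prod>r<m. fact (Suc (d r))) * vdm_coeff n (%j. if j < m then Suc (d j) else v j)"
  (is "lookup _ (?b + _) = _ * ?F * vdm_coeff n ?w")
proof -
 have term_eq: "of_int (sign g) * lookup (row_word n m (d o g)) (?b + diag_boxes m) = ?F * vdm_coeff n ?w"
  if p: "g permutes {..<m}" for g
 proof -
  have pn: "g permutes {..<n}" by (rule permutes_subset[OF p]) (use m in auto)
  have eq: "?b + row0_mon m (%r. Suc ((d o g) r)) = row0_mon n (?w o g)"
  proof (rule row0_mon_eqI)
   fix j assume "j < n"
   then show "lookup (?b + row0_mon m (%r. Suc ((d o g) r))) (0, j) = (?w o g) j"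
    using permutes_in_image[OF p, of j] permutes_not_in[OF p, of j]
    by (cases "j < m") (simp_all add: lookup_add lookup_row0_mon)
  next
   fix i j :: nat assume "i ~= 0 \<or> n \<le> j"
   then show "lookup (?b + row0_mon m (%r. Suc ((d o g) r))) (i, j) = 0"
    using m by (auto simp: lookup_add lookup_row0_mon)
  qed
  have l: "lookup (row_word n m (d o g)) (?b + diag_boxes m) =
    (\<Prod>r<m. fact (Suc ((d o g) r))) * vdm_coeff n (?w o g)"
   unfolding vdm_coeff_def eq[symmetric]
   by (rule lookup_row_word) (use m in "simp_all add: lookup_row0_mon")
  have f: "(\<Prod>r<m. fact (Suc ((d o g) r)) :: rat) = ?F"
   using prod.permute[OF p, of "%r. fact (Suc (d r)) :: rat"] by (simp only: o_def)
  have "of_int (sign g) * (of_int (sign g) :: rat) = 1" by (simp flip: of_int_mult)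
  moreover have "s * (x * (s * y)) = (s * s) * (x * y)" for s x y :: rat by (simp only: mult_ac)
  ultimately show ?thesis unfolding l f vdm_coeff_perm[OF pn] by (simp only: mult_1_left)
 qed
 have "lookup (row_altr n m d) (?b + diag_boxes m) =
   (\<Sum>g | g permutes {..<m}. of_int (sign g) * lookup (row_word n m (d o g)) (?b + diag_boxes m))"
  by (simp add: row_altr_def lookup_sum)
 also have "... = (\<Sum>g | g permutes {..<m}. ?F * vdm_coeff n ?w)"
  by (rule sum.cong[OF refl]) (use term_eq in simp)
 finally show ?thesis by (simp add: card_permutations[OF refl finite_lessThan] del: fact_Suc)
qed

text \<open>A monomial that occurs in exactly one of the vectors \<open>sign_vector n I'\<close> with \<open>|I'| = |I|\<close>:
  the columns \<open>j \<ge> |I|\<close> carry the exponents missing in \<open>I\<close>.\<close>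

lemma sign_vector_detector:
 assumes I: "I \<subseteq> {1..<n}"
 obtains x where "!!I'. I' \<subseteq> {1..<n} ==> card I' = card I ==> lookup (sign_vector n I') x ~= 0 \<longleftrightarrow> I' = I"
proof -
 let ?m = "card I"
 have fin: "finite I" using I finite_subset by blast
 have sub: "I \<subseteq> {..<n}" using I by auto
 have m: "?m \<le> n" using card_mono[OF _ sub] by simp
 have "card {?m..<n} = card ({..<n} - I)" using card_Diff_subset[OF fin sub] by simp
 then obtain g where b: "bij_betw g {?m..<n} ({..<n} - I)"
  using finite_same_card_bij[of "{?m..<n}" "{..<n} - I"] by auto
 let ?x = "row0_mon n (%j. if j < ?m then 0 else g j) + diag_boxes ?m"
 have "lookup (sign_vector n I') ?x ~= 0 \<longleftrightarrow> I' = I" if I': "I' \<subseteq> {1..<n}" "card I' = ?m" for I'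
 proof -
  let ?w = "%j. if j < ?m then Suc (enum_set I' j - 1) else g j"
  have fin': "finite I'" using I' finite_subset by blast
  have e: "bij_betw (enum_set I') {..<?m} I'" using enum_set[OF fin'] I'(2) by simp
  have w1: "bij_betw ?w {..<?m} I'"
   by (subst bij_betw_cong[of _ _ "enum_set I'"]) (use e Suc_enum_set[OF I'(1)] I'(2) in auto)
  have w2: "bij_betw ?w {?m..<n} ({..<n} - I)"
   by (subst bij_betw_cong[of _ _ g]) (use b in auto)
  have un: "{..<?m} \<union> {?m..<n} = {..<n}" using m by auto
  have nz: "(\<Prod>r<?m. fact (Suc (enum_set I' r - 1)) :: rat) ~= 0" by (simp del: fact_Suc)
  have "lookup (sign_vector n I') ?x ~= 0 \<longleftrightarrow> vdm_coeff n ?w ~= 0"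
   unfolding sign_vector_def I'(2) lookup_row_altr[OF m] using nz by simp
  also have "... \<longleftrightarrow> I' = I"
  proof
   assume "vdm_coeff n ?w ~= 0"
   then have w: "bij_betw ?w {..<n} {..<n}" by (rule vdm_coeff_bij)
   have "{..<?m} = {..<n} - {?m..<n}" using m by auto
   then have "I' = ?w ` ({..<n} - {?m..<n})" using w1 by (simp add: bij_betw_def)
   also have "... = ?w ` {..<n} - ?w ` {?m..<n}"
    by (rule inj_on_image_set_diff[OF bij_betw_imp_inj_on[OF w]]) auto
   also have "... = {..<n} - ({..<n} - I)"
    by (simp only: bij_betw_imp_surj_on[OF w] bij_betw_imp_surj_on[OF w2])
   finally show "I' = I" using sub by blast
  next
   assume "I' = I"
   then have "bij_betw ?w ({..<?m} \<union> {?m..<n}) (I \<union> ({..<n} - I))"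
    using bij_betw_combine[OF w1 w2] by blast
   then have "bij_betw ?w {..<n} {..<n}" unfolding un using sub by (simp add: Un_absorb1)
   then show "vdm_coeff n ?w ~= 0" by (rule vdm_coeff_nonzero)
  qed
  finally show ?thesis .
 qed
 then show ?thesis by (rule that)
qed

lemma dim_sign_part: "mpoly.dim (sign_part n a m) = card (exponent_sets n a m)"
proof -
 let ?S = "exponent_sets n a m"
 have fin: "finite ?S" by (rule finite_subset[of _ "Pow {1..<n}"]) (auto simp: exponent_sets_def)
 have S: "I \<subseteq> {1..<n}" "card I = m" if "I \<in> ?S" for I using that by (auto simp: exponent_sets_def)
 have "\<forall>I\<in>?S. \<exists>x. \<forall>I'\<in>?S. lookup (sign_vector n I') x ~= 0 \<longleftrightarrow> I' = I"
 proof
  fix I assume I: "I \<in> ?S"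
  obtain x where "!!I'. I' \<subseteq> {1..<n} ==> card I' = card I ==> lookup (sign_vector n I') x ~= 0 \<longleftrightarrow> I' = I"
   using sign_vector_detector[OF S(1)[OF I]] by metis
  then show "\<exists>x. \<forall>I'\<in>?S. lookup (sign_vector n I') x ~= 0 \<longleftrightarrow> I' = I"
   using S S(2)[OF I] by (intro exI[of _ x]) simp
 qed
 from bchoice[OF this] obtain g where k: "\<forall>I\<in>?S. \<forall>I'\<in>?S. lookup (sign_vector n I') (g I) ~= 0 \<longleftrightarrow> I' = I" ..
 note g = bspec[OF bspec[OF k]]
 have inj: "inj_on (sign_vector n) ?S"
 proof (rule inj_onI)
  fix I I' assume I: "I \<in> ?S" "I' \<in> ?S" and e: "sign_vector n I = sign_vector n I'"
  have "lookup (sign_vector n I) (g I') ~= 0" unfolding e using g[of I' I'] I by simp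
  then show "I = I'" using g[of I' I] I by simp
 qed
 have "mpoly.independent (sign_vector n ` ?S)"
 proof (rule mpoly.independent_if_scalars_zero)
  fix f x assume z: "(\<Sum>x\<in>sign_vector n ` ?S. Const (f x) * x) = 0" and "x \<in> sign_vector n ` ?S"
  then obtain I where I: "I \<in> ?S" "x = sign_vector n I" by blast
  have "0 = lookup (\<Sum>x\<in>sign_vector n ` ?S. Const (f x) * x) (g I)" by (simp add: z)
  also have "... = (\<Sum>I'\<in>?S. f (sign_vector n I') * lookup (sign_vector n I') (g I))"
   by (simp add: sum.reindex[OF inj] lookup_sum)
  also have "... = (\<Sum>I'\<in>?S. if I' = I then f x * lookup x (g I) else 0)"
   by (rule sum.cong[OF refl]) (use g[OF I(1)] I(2) in auto)
  also have "... = f x * lookup x (g I)" using I(1) fin by simp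
  finally show "f x = 0" using g[OF I(1) I(1)] I(2) by simp
 qed (simp add: fin)
 then have "is_basis (sign_vector n ` ?S) (sign_part n a m)" by (simp add: is_basis_def fin span_sign_vectors)
 then show ?thesis using dim_basis card_image[OF inj] by metis
qed

section \<open>The hook part of the alternating component\<close>

definition hook_sets :: "nat => nat => nat => nat set set" where
 "hook_sets n a m = {J. J \<subseteq> {2..<n} & card J = m & \<Sum>J + a = top_degree n}"

lemma finite_hook_sets: "finite (hook_sets n a m)"
 by (rule finite_subset[of _ "Pow {2..<n}"]) (auto simp: hook_sets_def)

text \<open>Deleting the element 1 lowers the cardinality by one and raises \<open>a\<close> by one.
  Sets without and with 1 thus correspond to the two hooks in the product of \<open>h_a\<close> and
  \<open>e_m\<close>.\<close>

lemma card_exponent_sets: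
 assumes n: "2 \<le> n"
 shows "card (exponent_sets n a m) = card (hook_sets n a m) + (if 1 \<le> m then card (hook_sets n (Suc a) (m - 1)) else 0)"
proof -
 have ins: "{1..<n} = insert 1 {2..<n}" using n by auto
 have not1: "1 \<notin> J" and finJ: "finite J" if "J \<subseteq> {2..<n}" for J using that finite_subset by auto
 let ?K = "if 1 \<le> m then insert 1 ` hook_sets n (Suc a) (m - 1) else {}"
 have "exponent_sets n a m = hook_sets n a m \<union> ?K"
 proof (intro equalityI subsetI)
  fix I assume "I \<in> exponent_sets n a m"
  then have I: "I \<subseteq> insert 1 {2..<n}" "card I = m" "\<Sum>I + a = top_degree n" by (auto simp: exponent_sets_def ins)
  have fin: "finite I" using I(1) finite_subset by blast
  show "I \<in> hook_sets n a m \<union> ?K"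
  proof (cases "1 \<in> I")
   case False
   then show ?thesis using I by (auto simp: hook_sets_def)
  next
   case True
   have "card (I - {1}) = m - 1" "\<Sum>I = 1 + \<Sum>(I - {1})" "1 \<le> m"
    using True fin I(2) card_gt_0_iff[of I] by (auto simp: sum.remove[of I 1 "%x. x"])
   then have "I - {1} \<in> hook_sets n (Suc a) (m - 1)" using I by (auto simp: hook_sets_def)
   moreover have "I = insert 1 (I - {1})" using True by blast
   ultimately have "I \<in> insert 1 ` hook_sets n (Suc a) (m - 1)" by (rule rev_image_eqI)
   then show ?thesis using \<open>1 \<le> m\<close> by simp
  qed
 next
  fix I assume I: "I \<in> hook_sets n a m \<union> ?K"
  show "I \<in> exponent_sets n a m"
  proof (cases "I \<in> hook_sets n a m")
   case True then show ?thesis by (auto simp: hook_sets_def exponent_sets_def)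
  next
   case False
   then obtain J where J: "1 \<le> m" "I = insert 1 J" "J \<in> hook_sets n (Suc a) (m - 1)" using I by (auto split: if_splits)
   then have "J \<subseteq> {2..<n}" by (simp add: hook_sets_def)
   then show ?thesis using J not1[of J] finJ[of J] n by (auto simp: hook_sets_def exponent_sets_def)
  qed
 qed
 moreover have "hook_sets n a m \<inter> ?K = {}" using not1 by (auto simp: hook_sets_def)
 moreover have "card ?K = (if 1 \<le> m then card (hook_sets n (Suc a) (m - 1)) else 0)"
 proof -
  have "inj_on (insert 1) (hook_sets n (Suc a) (m - 1))"
   by (rule inj_onI) (metis (no_types, lifting) hook_sets_def insert_ident mem_Collect_eq not1)
  then show ?thesis by (simp add: card_image)
 qed
 ultimately show ?thesis using finite_hook_sets by (simp add: card_Un_disjoint)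
qed

lemma sspec_coeffs_alts:
 assumes n: "2 \<le> n"
 shows "sspec_of (schur_coeff (cseries n (hook 1 (n - 1)))) a m = of_nat (card (exponent_sets n a m))"
proof -
 let ?f = "cseries n (hook 1 (n - 1))"
 have f: "?f = (%d. of_nat (mpoly.dim (alts n d)))" using n by (intro ext cseries_hook_eq) simp
 have "has_sspec ?f a m (of_nat (card (exponent_sets n a m)))"
  unfolding f dim_sign_part[symmetric] by (rule has_sspec_alts)
 then show ?thesis using has_sspec_sym[OF cseries_sym] has_sspec_unique by blast
qed

text \<open>Coefficients and cardinalities obey the same two-term recursion, with the same start at
  \<open>m = 0\<close>; the induction on the leg needs all first parts \<open>a\<close> at
  once.\<close>

lemma schur_coeff_hook:
 assumes n: "2 \<le> n"
 shows "1 \<le> a ==> schur_coeff (cseries n (hook 1 (n - 1))) (hook a m) = of_nat (card (hook_sets n a m))"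
proof (induction m arbitrary: a)
 case (0 a)
 then show ?case using sspec_coeffs_alts[OF n, of a 0] card_exponent_sets[OF n, of a 0] by (simp add: sspec_of_def)
next
 case (Suc m a)
 then show ?case using sspec_coeffs_alts[OF n, of a "Suc m"] card_exponent_sets[OF n, of a "Suc m"] Suc.IH[of "Suc a"]
  by (simp add: sspec_of_def)
qed

lemma schur_series_count:
 assumes "finite F"
 shows "schur_series (%v. of_nat (card {J \<in> F. h J = v})) = (\<Sum>J\<in>F. schur (h J))"
proof
 fix x
 have nz: "{v. (of_nat (card {J \<in> F. h J = v}) :: rat) ~= 0} = h ` F" using assms by auto
 have "(\<Sum>J\<in>F. schur (h J)) x = (\<Sum>v\<in>h ` F. \<Sum>J | J \<in> F & h J = v. schur (h J) x)"
  unfolding sum_fun_apply' by (rule sum.image_gen[OF assms])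
 also have "... = (\<Sum>v\<in>h ` F. of_nat (card {J \<in> F. h J = v}) * schur v x)"
  by (rule sum.cong[OF refl]) simp
 finally show "schur_series (%v. of_nat (card {J \<in> F. h J = v})) x = (\<Sum>J\<in>F. schur (h J)) x"
  by (simp only: schur_series_def nz)
qed

lemma top_degree_eq: "2 \<le> n ==> top_degree n = 1 + \<Sum>{2..<n}"
proof -
 assume n: "2 \<le> n"
 have "{..<n} = {0, 1} \<union> {2..<n}" using n by auto
 then have "top_degree n = \<Sum>({0, 1} \<union> {2..<n})" by (simp add: top_degree_def)
 also have "... = 1 + \<Sum>{2..<n}" by (subst sum.union_disjoint) auto
 finally show ?thesis .
qed

lemma hook_part_pairing:
 assumes n: "2 \<le> n"
 shows "hook_part (pairing (E_function n) (elementary n)) = (\<Sum>J\<in>Pow {2..<n}. schur (hook (top_degree n - \<Sum>J) (card J)))"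
proof -
 let ?c = "schur_coeff (cseries n (hook 1 (n - 1)))" and ?h = "%J. hook (top_degree n - \<Sum>J) (card J)"
 \<comment> \<open>The inequality is strict because 1 counts in \<open>top_degree n\<close> but lies
   outside \<open>{2..<n}\<close>; it makes the first part of every hook positive.\<close>
 have J: "\<Sum>J < top_degree n" if "J \<subseteq> {2..<n}" for J
  using sum_mono2[OF _ that, of "%x. x"] by (simp add: top_degree_eq[OF n])
 have "(if is_hook v then ?c v else 0) = of_nat (card {J \<in> Pow {2..<n}. ?h J = v})" for v
 proof (cases "is_hook v")
  case True
  then obtain a m where am: "1 \<le> a" "v = hook a m" by (auto simp: is_hook_iff)
  have iff: "J \<in> hook_sets n a m \<longleftrightarrow> J \<in> Pow {2..<n} & ?h J = v" for J
  proof (cases "J \<subseteq> {2..<n}")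
   case True
   then have "\<Sum>J + a = top_degree n \<longleftrightarrow> top_degree n - \<Sum>J = a" using J[OF True] by arith
   then show ?thesis using True am(2) by (auto simp: hook_sets_def)
  qed (simp add: hook_sets_def)
  have "hook_sets n a m = {J \<in> Pow {2..<n}. ?h J = v}"
  proof (rule Set.set_eqI)
   fix J show "J \<in> hook_sets n a m \<longleftrightarrow> J \<in> {J \<in> Pow {2..<n}. ?h J = v}"
    unfolding mem_Collect_eq by (rule iff)
  qed
  then show ?thesis using True am schur_coeff_hook[OF n am(1)] by simp
 next
  case False
  have "?h J ~= v" if "J \<in> Pow {2..<n}" for J
  proof
   assume "?h J = v"
   moreover have "1 \<le> top_degree n - \<Sum>J" using J[of J] that by simp
   ultimately show False using False unfolding is_hook_iff by blast
  qed
  then have "{J \<in> Pow {2..<n}. ?h J = v} = {}" by blast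
  then show ?thesis using False by (simp only: if_False card.empty of_nat_0)
 qed
 note coeffs = this
 have pairing: "pairing (E_function n) (elementary n) = cseries n (hook 1 (n - 1))"
  by (rule pairing_E_function) (use n in simp)
 show ?thesis unfolding hook_part_def pairing coeffs by (rule schur_series_count) simp
qed

section \<open>Lattice paths\<close>

lemma count_steps: "count_list g East + count_list g North = length g"
proof (induction g)
 case (Cons a g) then show ?case by (cases a) auto
qed simp

lemma paths_eq: "paths n s = {g. length g + s = n - 2}"
proof (rule Set.set_eqI)
 fix g show "g \<in> paths n s \<longleftrightarrow> g \<in> {g. length g + s = n - 2}"
  using count_steps[of g] by (auto simp: paths_def path_point_def)
qed

lemma finite_paths: "finite (paths n s)"
proof -
 have "(UNIV :: step set) \<subseteq> {North, East}" using step.exhaust by blast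
 then have "finite (UNIV :: step set)" using finite_subset by blast
 from finite_lists_length_le[OF this, of "n - 2"] show ?thesis
  by (rule rev_finite_subset) (auto simp: paths_eq)
qed

lemma height_eq: "height s g = s + count_list g North"
 by (simp add: height_def path_point_def)

text \<open>\<open>weight (n - 1) \<gamma>\<close> is \<open>area \<gamma> + ht \<gamma>\<close> for a path from the origin.\<close>

fun weight :: "nat => path => nat" where
 "weight c [] = 0"
| "weight c (a # g) = (if a = North then c else 0) + weight (c - 1) g"

lemma sum_pos_Cons:
 "(\<Sum>i | i < length (a # g) & (a # g) ! i = b. f i) =
  (if a = b then f 0 else 0) + (\<Sum>i | i < length g & g ! i = b. f (Suc i))"
proof -
 have "{i. i < length (a # g) & (a # g) ! i = b} =
  (if a = b then {0} else {}) \<union> Suc ` {i. i < length g & g ! i = b}" (is "?L = ?R")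
 proof (rule Set.set_eqI)
  fix i show "i \<in> ?L \<longleftrightarrow> i \<in> ?R" by (cases i) auto
 qed
 moreover have "(\<Sum>i\<in>?R. f i) = (if a = b then f 0 else 0) + (\<Sum>i | i < length g & g ! i = b. f (Suc i))"
  by (subst sum.union_disjoint) (auto simp: sum.reindex)
 ultimately show ?thesis by simp
qed

lemma sum_north_weight:
 "length g \<le> c ==> (\<Sum>i | i < length g & g ! i = North. c - i) + count_list g North = weight (Suc c) g"
proof (induction g arbitrary: c)
 case (Cons a g)
 then obtain c' where c': "c = Suc c'" by (cases c) auto
 have "(\<Sum>i | i < length g & g ! i = North. Suc c' - Suc i) + count_list g North = weight (Suc c') g"
  using Cons.IH[of c'] Cons.prems by (simp add: c')
 then show ?case unfolding sum_pos_Cons c' by (cases a) simp_all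
qed simp

text \<open>A north step from \<open>(x, y)\<close> adds \<open>n - 2 - y - x\<close> to the area
  and 1 to the height. As \<open>x + y\<close> depends only on the position of the step, both
  combine to a weight that drops by one per step. The rows below the starting height are treated in
  the same way.\<close>

lemma area_height:
 assumes "g \<in> paths n s" shows "area n s g + height s g = (\<Sum>j<s. n - 1 - j) + weight (n - 1 - s) g"
proof -
 have len: "length g = n - 2 - s" "s \<le> n - 2" using assms by (auto simp: paths_eq)
 have "(case path_point s g i of (x, y) => n - 2 - y - x) = length g - i" if "i < length g" for i
  using count_steps[of "take i g"] that len by (simp add: path_point_def)
 then have "(\<Sum>i | i < length g & g ! i = North. case path_point s g i of (x, y) => n - 2 - y - x) =
   (\<Sum>i | i < length g & g ! i = North. length g - i)"
  by (intro sum.cong) auto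
 moreover have "(\<Sum>j<s. n - 2 - j) + s = (\<Sum>j<s. n - 1 - j)"
 proof -
  have "(\<Sum>j<s. n - 1 - j) = (\<Sum>j<s. (n - 2 - j) + 1)" by (rule sum.cong) (use len(2) in auto)
  then show ?thesis by (simp only: sum.distrib) simp
 qed
 moreover have "weight (Suc (length g)) g = weight (n - 1 - s) g"
 proof (cases "n \<le> 1 + s")
  case True then show ?thesis using len by simp
 next
  case False then have "Suc (length g) = n - 1 - s" using len by simp
  then show ?thesis by simp
 qed
 ultimately show ?thesis using sum_north_weight[of g "length g"] by (simp add: area_def height_eq)
qed

lemma weight_pos: "North \<in> set g ==> length g \<le> c ==> 0 < weight c g"
 by (induction g arbitrary: c) auto

lemma weight_zero: "North \<notin> set g ==> weight c g = 0"
 by (induction g arbitrary: c) auto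

lemma no_north: "North \<notin> set g \<longleftrightarrow> g = replicate (length g) East"
proof
 assume "North \<notin> set g"
 then have "\<forall>a\<in>set g. a = East" using step.exhaust by metis
 then show "g = replicate (length g) East" by (simp add: replicate_eqI)
next
 assume e: "g = replicate (length g) East"
 have "set g \<subseteq> {East}" by (subst e) auto
 then show "North \<notin> set g" by auto
qed

section \<open>Deletion of steps from a path\<close>

lemma delete_first_0 [simp]: "delete_first a 0 g = g"
 and delete_first_Suc: "delete_first a (Suc k) g = delete_first a k (remove1 a g)"
 by (simp_all add: delete_first_def funpow_swap1)

lemma delete_first_East [simp]: "delete_first East (Suc k) (East # g) = delete_first East k g"
 by (simp add: delete_first_Suc)

lemma delete_first_North [simp]: "delete_first East k (North # g) = North # delete_first East k g"
 by (induction k arbitrary: g) (simp_all add: delete_first_Suc)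

abbreviation east_pos :: "path => nat list" where
 "east_pos g \<equiv> filter (%j. g ! j = East) [0..<length g]"

lemma east_pos_Cons: "east_pos (a # g) = (if a = East then [0] else []) @ map Suc (east_pos g)"
proof -
 have "[0..<length (a # g)] = 0 # map Suc [0..<length g]"
  by (simp add: upt_conv_Cons map_Suc_upt del: upt_Suc)
 then show ?thesis by (simp add: filter_map o_def)
qed

lemma length_east_pos: "length (east_pos g) = count_list g East"
proof (induction g)
 case (Cons a g) then show ?case unfolding east_pos_Cons by simp
qed simp

lemma norths_Cons:
 assumes "1 \<le> i" "i \<le> count_list (a # g) East"
 shows "norths_before (a # g) i =
  (if a = North then Suc (norths_before g i) else if i = 1 then 0 else norths_before g (i - 1))"
proof (cases a)
 case North
 then show ?thesis unfolding norths_before_def east_pos_Cons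
  using assms length_east_pos[of g] by (simp add: nth_map)
next
 case East
 show ?thesis
 proof (cases "i = 1")
  case True then show ?thesis unfolding norths_before_def east_pos_Cons using East by simp
 next
  case False
  then obtain j where j: "i = Suc (Suc j)" using assms(1) by (cases i; cases "i - 1") auto
  then show ?thesis unfolding norths_before_def east_pos_Cons
   using assms length_east_pos[of g] East by (simp add: nth_map)
 qed
qed

lemma norths_North [simp]:
 "1 \<le> i ==> i \<le> count_list g East ==> norths_before (North # g) i = Suc (norths_before g i)"
 by (simp add: norths_Cons)

lemma norths_East_1 [simp]: "norths_before (East # g) (Suc 0) = 0"
 by (simp add: norths_Cons)

lemma norths_East_Suc [simp]:
 "1 \<le> i ==> i \<le> count_list g East ==> norths_before (East # g) (Suc i) = norths_before g i"
 by (simp add: norths_Cons)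

lemma norths_bound: "1 \<le> i ==> i \<le> count_list g East ==> i + norths_before g i \<le> length g"
proof (induction g arbitrary: i)
 case (Cons a g)
 show ?case
 proof (cases a)
  case North then show ?thesis using Cons.IH[of i] Cons.prems by simp
 next
  case East
  then obtain i' where i': "i = Suc i'" "i' \<le> count_list g East" using Cons.prems by (cases i) auto
  show ?thesis using East i' Cons.IH[of i'] Cons.prems by (cases "i' = 0") simp_all
 qed
qed simp

lemma norths_mono:
 "1 \<le> i ==> Suc i \<le> count_list g East ==> norths_before g i \<le> norths_before g (Suc i)"
proof (induction g arbitrary: i)
 case (Cons a g)
 show ?case
 proof (cases a)
  case North then show ?thesis using Cons.IH[of i] Cons.prems by simp
 next
  case East
  then obtain i' where i': "i = Suc i'" "i' \<le> count_list g East" using Cons.prems by (cases i) auto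
  show ?thesis using East i' Cons.IH[of i'] Cons.prems by (cases "i' = 0") simp_all
 qed
qed simp

lemma count_delete_East: "k \<le> count_list g East ==> count_list (delete_first East k g) North = count_list g North"
proof (induction g arbitrary: k)
 case Nil then show ?case by simp
next
 case (Cons a g)
 show ?case
 proof (cases a)
  case North then show ?thesis using Cons.IH[of k] Cons.prems by simp
 next
  case East then show ?thesis using Cons.IH[of "k - 1"] Cons.prems by (cases k) simp_all
 qed
qed

lemma length_delete_East: "k \<le> count_list g East ==> length (delete_first East k g) + k = length g"
proof (induction g arbitrary: k)
 case Nil then show ?case by simp
next
 case (Cons a g)
 show ?case
 proof (cases a)
  case North then show ?thesis using Cons.IH[of k] Cons.prems by simp
 next
  case East then show ?thesis using Cons.IH[of "k - 1"] Cons.prems by (cases k) simp_all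
 qed
qed

text \<open>A north step loses as much weight as there are deleted east steps after it: the initial
  weight drops by \<open>k\<close>, and the deleted steps before it move it to the left. Counted
  from the east steps, this is the sum of \<open>norths_before\<close>.\<close>

lemma weight_delete_East:
 "k \<le> count_list g East ==> length g \<le> c ==>
  weight c g = weight (c - k) (delete_first East k g) + (\<Sum>i=1..k. norths_before g i)"
proof (induction g arbitrary: k c)
 case Nil then show ?case by simp
next
 case (Cons a g)
 show ?case
 proof (cases a)
  case North
  have k: "k \<le> count_list g East" using Cons.prems North by simp
  have "(\<Sum>i=1..k. norths_before (North # g) i) = (\<Sum>i=1..k. norths_before g i + 1)"
   by (rule sum.cong) (use k in auto)
  also have "... = (\<Sum>i=1..k. norths_before g i) + k" by (simp only: sum.distrib) simp
  finally have s: "(\<Sum>i=1..k. norths_before (North # g) i) = (\<Sum>i=1..k. norths_before g i) + k" .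
  have "k \<le> c" using k count_steps[of g] Cons.prems by simp
  moreover have "weight (c - 1) g = weight (c - 1 - k) (delete_first East k g) + (\<Sum>i=1..k. norths_before g i)"
   using Cons.IH[OF k, of "c - 1"] Cons.prems by simp
  moreover have "c - 1 - k = c - k - 1" by simp
  ultimately show ?thesis unfolding North s by simp
 next
  case East
  show ?thesis
  proof (cases k)
   case 0 then show ?thesis by simp
  next
   case (Suc k')
   have k: "k' \<le> count_list g East" using Cons.prems East Suc by simp
   have "(\<Sum>i=1..Suc k'. norths_before (East # g) i) = (\<Sum>i=1..k'. norths_before (East # g) (Suc i))"
    by (subst sum.atLeast_Suc_atMost) (simp_all add: sum.shift_bounds_cl_Suc_ivl del: sum.cl_ivl_Suc)
   also have "... = (\<Sum>i=1..k'. norths_before g i)" by (rule sum.cong) (use k in auto)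
   finally show ?thesis using Cons.IH[OF k, of "c - 1"] Cons.prems unfolding East Suc by simp
  qed
 qed
qed

abbreviation lead :: "step => path => nat" where
 "lead b g \<equiv> length (takeWhile (%a. a = b) g)"

text \<open>Before the first north step there are only east steps, which have no weight; the later
  steps move one place to the left, which compensates the smaller initial weight.\<close>

lemma weight_remove_North:
 "North \<in> set g ==> length g \<le> c ==> weight c g = (c - lead East g) + weight (c - 1) (remove1 North g)"
proof (induction g arbitrary: c)
 case (Cons a g)
 show ?case
 proof (cases a)
  case North then show ?thesis by simp
 next
  case East then show ?thesis using Cons.IH[of "c - 1"] Cons.prems by simp
 qed
qed simp

lemma lead_East_delete: "k \<le> count_list g East ==> lead East (delete_first East k g) = lead East g - k"
proof (induction g arbitrary: k)
 case Nil then show ?case by simp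
next
 case (Cons a g)
 show ?case
 proof (cases a)
  case North then show ?thesis by simp
 next
  case East then show ?thesis using Cons.IH[of "k - 1"] Cons.prems by (cases k) simp_all
 qed
qed

text \<open>If north steps precede the \<open>k\<close>-th east step, then the remaining path begins
  with a north step and its leading east run is empty. So at least one of the two quantities is
  zero.\<close>

lemma lead_East_bound:
 "1 \<le> k ==> k \<le> count_list g East ==> lead East (delete_first East k g) + k + norths_before g k \<le> length g"
proof (induction g arbitrary: k)
 case (Cons a g)
 show ?case
 proof (cases a)
  case North then show ?thesis using norths_bound[of k g] Cons.prems by simp
 next
  case East
  then obtain k' where k: "k = Suc k'" "k' \<le> count_list g East" using Cons.prems by (cases k) auto
  show ?thesis
  proof (cases "k' = 0")
   case True then show ?thesis using East k length_takeWhile_le[of _ g] by simp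
  next
   case False then show ?thesis using East k Cons.IH[of k'] by simp
  qed
 qed
qed simp

lemma lead_North_delete:
 "1 \<le> k ==> k \<le> count_list g East ==> norths_before g k \<le> lead North (delete_first East k g) \<or>
  norths_before g k = 0"
proof (induction g arbitrary: k)
 case (Cons a g)
 show ?case
 proof (cases a)
  case North then show ?thesis using Cons.IH[of k] Cons.prems by auto
 next
  case East
  then obtain i' where i': "k = Suc i'" "i' \<le> count_list g East" using Cons.prems by (cases k) auto
  show ?thesis using East i' Cons.IH[of i'] Cons.prems by (cases "i' = 0") simp_all
 qed
qed simp

lemma lead_East_remove: "lead East g \<le> lead East (remove1 North g)"
 by (induction g) auto

lemma lead_disjoint: "lead East g = 0 \<or> lead North g = 0"
 by (cases g) (auto intro: step.exhaust)

text \<open>The numbers of north steps before the deleted steps tell where to insert them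
  again.\<close>

lemma delete_East_inj:
 "k \<le> count_list s East ==> k \<le> count_list s' East ==> delete_first East k s = delete_first East k s' ==>
  (!!i. 1 \<le> i ==> i \<le> k ==> norths_before s i = norths_before s' i) ==> s = s'"
proof (induction s arbitrary: s' k)
 case Nil then show ?case by simp
next
 case (Cons a s)
 show ?case
 proof (cases "k = 0")
  case True then show ?thesis using Cons.prems by simp
 next
  case False
  then obtain b r where g: "s' = b # r" using Cons.prems(2) by (cases s') auto
  have nb: "norths_before (a # s) i = norths_before (b # r) i" if "1 \<le> i" "i \<le> k" for i
   using Cons.prems(4)[OF that] g by simp
  have one: "1 \<le> k" using False by simp
  consider "a = North" "b = North" | "a = East" "b = East" | "a = North" "b = East" | "a = East" "b = North"
   by (metis step.exhaust)
  then show ?thesis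
  proof cases
   case 1
   have "s = r"
   proof (rule Cons.IH[of k])
    fix i assume "1 \<le> i" "i \<le> k"
    then show "norths_before s i = norths_before r i" using nb[of i] 1 Cons.prems g by simp
   qed (use Cons.prems g 1 in auto)
   then show ?thesis using 1 g by simp
  next
   case 2
   obtain k' where k': "k = Suc k'" using one by (cases k) auto
   have "s = r"
   proof (rule Cons.IH[of k'])
    fix i assume "1 \<le> i" "i \<le> k'"
    then show "norths_before s i = norths_before r i" using nb[of "Suc i"] 2 Cons.prems g k' by simp
   qed (use Cons.prems g 2 k' in auto)
   then show ?thesis using 2 g by simp
  next
   case 3 then show ?thesis using nb[of 1] one Cons.prems(1) by simp
  next
   case 4 then show ?thesis using nb[of 1] one Cons.prems(2) g by simp
  qed
 qed
qed

lemma remove_North_inj: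
 "North \<in> set s ==> North \<in> set s' ==> lead East s = lead East s' ==>
  remove1 North s = remove1 North s' ==> s = s'"
proof (induction s arbitrary: s')
 case (Cons a s)
 then obtain b r where g: "s' = b # r" by (cases s') auto
 show ?case
 proof (cases a)
  case North
  then have "b = North" using Cons.prems(3) g by (cases b) simp_all
  then show ?thesis using North Cons.prems(4) g by simp
 next
  case East
  then have "b = East" using Cons.prems(3) g by (cases b) simp_all
  then show ?thesis using East Cons.prems g Cons.IH[of r] by simp
 qed
qed simp

text \<open>The index of a value is its rank in the set of values. This recovers a sequence from a
  descent set, which carries no order of its own.\<close>

lemma strict_decr_image_unique:
 fixes f g :: "nat => nat"
 assumes f: "!!i j. 1 \<le> i ==> i < j ==> j \<le> k ==> f j < f i"
  and g: "!!i j. 1 \<le> i ==> i < j ==> j \<le> k ==> g j < g i"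
  and eq: "f ` {1..k} = g ` {1..k}" and i: "1 \<le> i" "i \<le> k"
 shows "f i = g i"
proof -
 have rank: "card {d \<in> h ` {1..k}. h i \<le> d} = i"
  if h: "!!i j. 1 \<le> i ==> i < j ==> j \<le> k ==> h j < h i" and i: "1 \<le> i" "i \<le> k" for h :: "nat => nat" and i
 proof -
  have "{d \<in> h ` {1..k}. h i \<le> d} = h ` {1..i}"
  proof (intro equalityI subsetI)
   fix d assume "d \<in> {d \<in> h ` {1..k}. h i \<le> d}"
   then obtain j where j: "1 \<le> j" "j \<le> k" "d = h j" "h i \<le> h j" by auto
   have "j \<le> i" using h[of i j] i(1) j by (meson not_le)
   then show "d \<in> h ` {1..i}" using j by auto
  next
   fix d assume "d \<in> h ` {1..i}"
   then obtain j where j: "1 \<le> j" "j \<le> i" "d = h j" by auto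
   then have "h i \<le> h j" using h[of j i] i(2) by (cases "j = i") auto
   then show "d \<in> {d \<in> h ` {1..k}. h i \<le> d}" using j i(2) by auto
  qed
  moreover have "inj_on h {1..i}"
  proof (rule inj_onI)
   fix x y assume "x \<in> {1..i}" "y \<in> {1..i}" "h x = h y"
   then show "x = y" using h[of x y] h[of y x] i(2) by (cases x y rule: linorder_cases) auto
  qed
  ultimately show ?thesis by (simp add: card_image)
 qed
 obtain j where j: "1 \<le> j" "j \<le> k" "f i = g j"
 proof -
  have "f i \<in> g ` {1..k}" using i eq by auto
  then show ?thesis using that by auto
 qed
 have "card {d \<in> f ` {1..k}. f i \<le> d} = i" by (rule rank[OF f i])
 moreover have "card {d \<in> g ` {1..k}. g j \<le> d} = j" by (rule rank[OF g j(1,2)])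
 ultimately have "i = j" unfolding eq j(3) by (rule trans[OF sym])
 then show ?thesis using j(3) by simp
qed

lemma strict_increasing_image_unique:
 fixes f g :: "nat => nat"
 assumes f: "!!i j. i < j ==> j < m ==> f i < f j" and g: "!!i j. i < j ==> j < m ==> g i < g j"
  and eq: "f ` {..<m} = g ` {..<m}" and i: "i < m"
 shows "f i = g i"
proof -
 have refl_image: "(%i. m - i) ` {1..m} = {..<m}"
 proof (intro equalityI subsetI)
  fix x assume "x \<in> {..<m}"
  then show "x \<in> (%i. m - i) ` {1..m}" by (intro image_eqI[of _ _ "m - x"]) auto
 qed auto
 have im: "(%i. h (m - i)) ` {1..m} = h ` {..<m}" for h :: "nat => nat"
  unfolding refl_image[symmetric] image_image ..
 have e: "(%i. f (m - i)) ` {1..m} = (%i. g (m - i)) ` {1..m}" unfolding im by (rule eq)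
 have "f (m - (m - i)) = g (m - (m - i))"
  by (rule strict_decr_image_unique[OF _ _ e]) (use f g i in simp_all)
 then show ?thesis using i by simp
qed

section \<open>Hook-shaped standard tableaux\<close>

lemma hook_diagram:
 assumes "k < n" shows "diagram (hook_shape n k) = {0} \<times> {1..k} \<union> {..<n - k} \<times> {0}"
proof (rule Set.set_eqI)
 fix x :: "nat \<times> nat" obtain r c where x: "x = (r, c)" by force
 have len: "length (hook_shape n k) = n - k" using assms by (simp add: hook_shape_def)
 show "x \<in> diagram (hook_shape n k) \<longleftrightarrow> x \<in> {0} \<times> {1..k} \<union> {..<n - k} \<times> {0}"
 proof (cases r)
  case 0 then show ?thesis using assms by (auto simp: x diagram_def hook_shape_def)
 next
  case (Suc r')
  have "hook_shape n k ! r = 1" if "r < n - k" using that Suc by (simp add: hook_shape_def)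
  then show ?thesis using Suc by (auto simp: x diagram_def len)
 qed
qed

lemma sum_list_hook_shape: "k < n ==> sum_list (hook_shape n k) = n"
 by (simp add: hook_shape_def sum_list_replicate)

lemma arm_cells: "{0 :: nat} \<times> {1..k} = (%c. (0, Suc c)) ` {..<k}"
proof (intro equalityI subsetI)
 fix x assume "x \<in> {0 :: nat} \<times> {1..k}"
 then show "x \<in> (%c. (0, Suc c)) ` {..<k}" by (intro image_eqI[of _ _ "snd x - 1"]) auto
qed auto

context
 fixes n k :: nat
 assumes kn: "k < n"
begin

lemma SYT_hook_iff:
 "t \<in> SYT (hook_shape n k) \<longleftrightarrow>
  (\<forall>x. x \<notin> {0} \<times> {1..k} \<union> {..<n - k} \<times> {0} --> t x = 0) &
  bij_betw t ({0} \<times> {1..k} \<union> {..<n - k} \<times> {0}) {1..n} &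
  (\<forall>c c'. c < c' & c' \<le> k --> t (0, c) < t (0, c')) &
  (\<forall>r r'. r < r' & r' < n - k --> t (r, 0) < t (r', 0))"
proof -
 have rows: "(\<forall>r c c'. c < c' & (r, c') \<in> {0} \<times> {1..k} \<union> {..<n - k} \<times> {0} --> t (r, c) < t (r, c')) \<longleftrightarrow>
  (\<forall>c c'. c < c' & c' \<le> k --> t (0, c) < t (0, c'))" by auto
 have cols: "(\<forall>r r' c. r < r' & (r', c) \<in> {0} \<times> {1..k} \<union> {..<n - k} \<times> {0} --> t (r, c) < t (r', c)) \<longleftrightarrow>
  (\<forall>r r'. r < r' & r' < n - k --> t (r, 0) < t (r', 0))" by auto
 show ?thesis unfolding SYT_def mem_Collect_eq hook_diagram[OF kn] sum_list_hook_shape[OF kn] rows cols ..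
qed

lemma SYT_hook:
 assumes "t \<in> SYT (hook_shape n k)"
 shows "x \<notin> {0} \<times> {1..k} \<union> {..<n - k} \<times> {0} ==> t x = 0"
  and "bij_betw t ({0} \<times> {1..k} \<union> {..<n - k} \<times> {0}) {1..n}"
  and "c < c' ==> c' \<le> k ==> t (0, c) < t (0, c')"
  and "r < r' ==> r' < n - k ==> t (r, 0) < t (r', 0)"
 using assms unfolding SYT_hook_iff by blast+

lemma SYT_hook_corner:
 assumes t: "g \<in> SYT (hook_shape n k)" shows "g (0, 0) = 1"
proof -
 note b = SYT_hook(2)[OF t]
 have "1 \<in> g ` ({0} \<times> {1..k} \<union> {..<n - k} \<times> {0})" using b kn by (simp add: bij_betw_def)
 then obtain x where x2: "1 = g x" and x1: "x \<in> {0} \<times> {1..k} \<union> {..<n - k} \<times> {0}" by (rule imageE)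
 note x = x1 x2[symmetric]
 have "g (0, 0) \<in> {1..n}" by (rule bij_betwE[OF b, rule_format]) (use kn in simp)
 moreover have "g (0, 0) \<le> g x"
 proof -
  obtain r c where rc: "x = (r, c)" by force
  show ?thesis
  proof (cases "r = 0")
   case True then show ?thesis using SYT_hook(3)[OF t, of 0 c] x(1) rc by (cases "c = 0") auto
  next
   case False
   then have "c = 0" "r < n - k" using x(1) rc by auto
   then show ?thesis using SYT_hook(4)[OF t, of 0 r] rc False by simp
  qed
 qed
 ultimately show ?thesis using x(2) by simp
qed

lemma arm_ge_2:
 assumes "t \<in> SYT (hook_shape n k)" "c \<in> {1..k}" shows "2 \<le> t (0, c)" "t (0, c) \<le> n"
proof -
 show "2 \<le> t (0, c)" using SYT_hook(3)[OF assms(1), of 0 c] SYT_hook_corner[OF assms(1)] assms(2) by simp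
 have "t (0, c) \<in> {1..n}" by (rule bij_betwE[OF SYT_hook(2)[OF assms(1)], rule_format]) (use assms(2) in simp)
 then show "t (0, c) \<le> n" by simp
qed

text \<open>After transposition \<open>i\<close> is a descent if \<open>i + 1\<close> lies in a
  column strictly to the right of that of \<open>i\<close>; then \<open>i + 1\<close> is in the arm.
  Conversely all entries smaller than an arm entry lie further left, in the leg or earlier in the
  arm.\<close>

lemma Des_transp_hook:
 assumes t: "s \<in> SYT (hook_shape n k)"
 shows "Des (tab_transpose s) = (%c. s (0, c) - 1) ` {1..k}"
proof (intro equalityI subsetI)
 fix i assume "i \<in> Des (tab_transpose s)"
 then obtain r c r' c' where i: "1 \<le> i" "s (c, r) = i" "s (c', r') = i + 1" "r < r'"
  by (auto simp: Des_def tab_transpose_def)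
 then have "(c', r') \<in> {0} \<times> {1..k} \<union> {..<n - k} \<times> {0}" using SYT_hook(1)[OF t, of "(c', r')"] by (cases "(c', r') \<in> {0} \<times> {1..k} \<union> {..<n - k} \<times> {0}") simp_all
 then have "c' = 0" "r' \<in> {1..k}" using i(4) by auto
 then show "i \<in> (%c. s (0, c) - 1) ` {1..k}" using i(3) by (intro image_eqI[of _ _ r']) simp_all
next
 fix i assume "i \<in> (%c. s (0, c) - 1) ` {1..k}"
 then obtain c where c2: "i = s (0, c) - 1" and c1: "c \<in> {1..k}" by (rule imageE)
 note c = c1 c2
 note g = arm_ge_2[OF t c(1)]
 have "i \<in> {1..n}" using g c(2) by auto
 then have "i \<in> s ` ({0} \<times> {1..k} \<union> {..<n - k} \<times> {0})"
  by (simp only: bij_betw_imp_surj_on[OF SYT_hook(2)[OF t]])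
 then obtain x where x2: "i = s x" and x1: "x \<in> {0} \<times> {1..k} \<union> {..<n - k} \<times> {0}" by (rule imageE)
 note x = x1 x2
 obtain r d where rd: "x = (r, d)" by force
 have "d < c"
 proof (cases "r = 0 & 1 \<le> d")
  case True
  show ?thesis
  proof (rule ccontr)
   assume "\<not> d < c"
   then have "s (0, c) \<le> s (0, d)" using SYT_hook(3)[OF t, of c d] x(1) rd True by (cases "c = d") auto
   then show False using x(2) c(2) g rd True by simp
  qed
 next
  case False then show ?thesis using x(1) rd c(1) by auto
 qed
 moreover have "tab_transpose s (d, r) = i" "tab_transpose s (c, 0) = i + 1"
  using x(2) rd c(2) g by (simp_all add: tab_transpose_def)
 moreover have "1 \<le> i" using g c(2) by simp
 ultimately show "i \<in> Des (tab_transpose s)" unfolding Des_def by blast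
qed

lemma Des_hook_card:
 assumes t: "g \<in> SYT (hook_shape n k)"
 shows "Des (tab_transpose g) \<subseteq> {1..<n}" "des (tab_transpose g) = k"
proof -
 show "Des (tab_transpose g) \<subseteq> {1..<n}"
  unfolding Des_transp_hook[OF t] using arm_ge_2[OF t] by fastforce
 have "inj_on (%c. g (0, c) - 1) {1..k}"
 proof (rule inj_onI)
  fix c d assume cd: "c \<in> {1..k}" "d \<in> {1..k}" "g (0, c) - 1 = g (0, d) - 1"
  then have e: "g (0, c) = g (0, d)" using arm_ge_2(1)[OF t cd(1)] arm_ge_2(1)[OF t cd(2)] by simp
  show "c = d" using SYT_hook(3)[OF t, of c d] SYT_hook(3)[OF t, of d c] e cd by (cases c d rule: linorder_cases) auto
 qed
 then show "des (tab_transpose g) = k" by (simp add: des_def Des_transp_hook[OF t] card_image)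
qed

lemma arm_image:
 assumes t: "g \<in> SYT (hook_shape n k)"
 shows "g ` ({0} \<times> {1..k}) = Suc ` Des (tab_transpose g)"
proof -
 have "Suc ` Des (tab_transpose g) = (%c. g (0, c)) ` {1..k}"
  unfolding Des_transp_hook[OF t] image_image by (rule image_cong[OF refl]) (use arm_ge_2[OF t] in fastforce)
 then show ?thesis by (auto simp: image_iff)
qed

lemma leg_image:
 assumes t: "g \<in> SYT (hook_shape n k)"
 shows "g ` ({..<n - k} \<times> {0}) = {1..n} - Suc ` Des (tab_transpose g)"
proof -
 let ?A = "{0} \<times> {1..k}" and ?L = "{..<n - k} \<times> {0 :: nat}"
 have "?L = (?A \<union> ?L) - ?A" by auto
 then have "g ` ?L = g ` ((?A \<union> ?L) - ?A)" by (rule arg_cong)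
 also have "... = g ` (?A \<union> ?L) - g ` ?A"
  by (rule inj_on_image_set_diff[OF bij_betw_imp_inj_on[OF SYT_hook(2)[OF t]]]) auto
 finally show ?thesis by (simp only: arm_image[OF t] bij_betw_imp_surj_on[OF SYT_hook(2)[OF t]])
qed

lemma SYT_hook_unique:
 assumes t: "u \<in> SYT (hook_shape n k)" and s: "v \<in> SYT (hook_shape n k)"
  and D: "Des (tab_transpose u) = Des (tab_transpose v)"
 shows "u = v"
proof
 fix x :: "nat \<times> nat"
 have arm: "u (0, Suc c) = v (0, Suc c)" if "c < k" for c
 proof (rule strict_increasing_image_unique[where f = "%c. u (0, Suc c)" and g = "%c. v (0, Suc c)" and m = k])
  have "(%c. p (0, Suc c)) ` {..<k} = p ` ({0} \<times> {1..k})" for p :: tableau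
   unfolding arm_cells image_image ..
  then show "(%c. u (0, Suc c)) ` {..<k} = (%c. v (0, Suc c)) ` {..<k}"
   by (simp only: arm_image[OF t] arm_image[OF s] D)
 qed (use SYT_hook(3)[OF t] SYT_hook(3)[OF s] that in simp_all)
 have leg: "u (r, 0) = v (r, 0)" if "r < n - k" for r
 proof (rule strict_increasing_image_unique[where f = "%r. u (r, 0)" and g = "%r. v (r, 0)" and m = "n - k"])
  have "{..<n - k} \<times> {0 :: nat} = (%r. (r, 0)) ` {..<n - k}" by auto
  then have "(%r. p (r, 0)) ` {..<n - k} = p ` ({..<n - k} \<times> {0})" for p :: tableau
   by (simp only: image_image)
  then show "(%r. u (r, 0)) ` {..<n - k} = (%r. v (r, 0)) ` {..<n - k}"
   by (simp only: leg_image[OF t] leg_image[OF s] D)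
 qed (use SYT_hook(4)[OF t] SYT_hook(4)[OF s] that in simp_all)
 show "u x = v x"
 proof (cases "x \<in> {0} \<times> {1..k} \<union> {..<n - k} \<times> {0}")
  case False then show ?thesis using SYT_hook(1)[OF t] SYT_hook(1)[OF s] by simp
 next
  case True
  then consider c where "x = (0, Suc c)" "c < k" | r where "x = (r, 0)" "r < n - k"
   by (cases x; cases "snd x") auto
  then show ?thesis using arm leg by cases auto
 qed
qed

text \<open>The arm receives the successors of the elements of \<open>D\<close> in increasing order
  and the leg the remaining numbers. As 1 is not such a successor, it is the least entry of the leg
  and falls to the corner.\<close>

lemma SYT_hook_exists:
 assumes D: "D \<subseteq> {1..<n}" "card D = k"
 shows "\<exists>t\<in>SYT (hook_shape n k). Des (tab_transpose t) = D"
proof -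
 define S where "S = Suc ` D"
 define rs where "rs = sorted_list_of_set S"
 define cs where "cs = sorted_list_of_set ({1..n} - S)"
 have finD: "finite D" using D(1) finite_subset by blast
 have S: "finite S" "card S = k" "S \<subseteq> {2..n}" using D finD by (auto simp: S_def card_image)
 have rs: "set rs = S" "length rs = k" "sorted_wrt (<) rs" using S by (simp_all add: rs_def)
 have "card ({1..n} - S) = n - k" using S by (subst card_Diff_subset) auto
 then have cs: "set cs = {1..n} - S" "length cs = n - k" "sorted_wrt (<) cs" by (simp_all add: cs_def)
 have cs0: "cs ! 0 = 1"
 proof -
  have "1 \<in> set cs" using cs(1) S(3) kn by auto
  then obtain j where j: "j < length cs" "cs ! j = 1" by (metis in_set_conv_nth)
  show ?thesis
  proof (cases "j = 0")
   case False
   then have "cs ! 0 < cs ! j" using sorted_wrt_nth_less[OF cs(3), of 0 j] j(1) by simp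
   moreover have "cs ! 0 \<in> {1..n}" using nth_mem[of 0 cs] cs(1) j(1) by (metis DiffD1 gr_implies_not0 neq0_conv)
   ultimately show ?thesis using j(2) by simp
  qed (use j in simp)
 qed
 define t :: tableau where "t = (%(r, c). if r = 0 & 1 \<le> c & c \<le> k then rs ! (c - 1)
  else if c = 0 & r < n - k then cs ! r else 0)"
 let ?A = "{0 :: nat} \<times> {1..k}" and ?L = "{..<n - k} \<times> {0 :: nat}"
 have arm: "t (0, Suc c) = rs ! c" if "c < k" for c using that by (simp add: t_def)
 have leg: "t (r, 0) = cs ! r" if "r < n - k" for r using that by (simp add: t_def)
 have iA: "t ` ?A = S"
 proof -
  have "t ` ?A = (%c. rs ! c) ` {..<k}" unfolding arm_cells image_image by (rule image_cong[OF refl]) (simp add: arm)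
  also have "... = set rs" using rs(2) by (auto simp: set_conv_nth)
  finally show ?thesis using rs(1) by simp
 qed
 have iL: "t ` ?L = {1..n} - S"
 proof -
  have "?L = (%r. (r, 0)) ` {..<n - k}" by auto
  then have "t ` ?L = (%r. cs ! r) ` {..<n - k}" by (simp add: image_image leg)
  also have "... = set cs" using cs(2) by (auto simp: set_conv_nth)
  finally show ?thesis using cs(1) by simp
 qed
 have im: "t ` (?A \<union> ?L) = {1..n}" unfolding image_Un iA iL using S(3) by auto
 have "card (?A \<union> ?L) = card ?A + card ?L" by (rule card_Un_disjoint) auto
 then have "card (t ` (?A \<union> ?L)) = card (?A \<union> ?L)" using kn by (simp only: im) (simp add: card_cartesian_product)
 then have bij: "bij_betw t (?A \<union> ?L) {1..n}" using im by (simp add: bij_betw_def eq_card_imp_inj_on)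
 have "t \<in> SYT (hook_shape n k)" unfolding SYT_hook_iff
 proof (intro conjI allI impI)
  show "t x = 0" if "x \<notin> ?A \<union> ?L" for x using that by (cases x) (auto simp: t_def)
  show "bij_betw t (?A \<union> ?L) {1..n}" by (rule bij)
  show "t (0, c) < t (0, c')" if cc: "c < c' & c' \<le> k" for c c'
  proof (cases c)
   case 0
   obtain d where d: "c' = Suc d" "d < k" using cc by (cases c') auto
   have "rs ! d \<in> S" using rs(1,2) d(2) nth_mem[of d rs] by simp
   then have "2 \<le> rs ! d" using S(3) by auto
   then show ?thesis using 0 d arm[of d] leg[of 0] cs0 kn by simp
  next
   case (Suc b)
   obtain d where d: "c' = Suc d" "d < k" using cc by (cases c') auto
   then show ?thesis using Suc cc sorted_wrt_nth_less[OF rs(3), of b d] rs(2) arm[of b] arm[of d] by simp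
  qed
  show "t (r, 0) < t (r', 0)" if "r < r' & r' < n - k" for r r'
   using that sorted_wrt_nth_less[OF cs(3), of r r'] cs(2) leg[of r] leg[of r'] by simp
 qed
 moreover from this have "Des (tab_transpose t) = D"
  using arm_image iA by (simp add: S_def inj_image_eq_iff)
 ultimately show ?thesis by blast
qed

lemma hook_tableau:
 assumes "D \<subseteq> {1..<n}" "card D = k"
 shows "hook_tableau n k D \<in> SYT (hook_shape n k)" "Des (tab_transpose (hook_tableau n k D)) = D"
proof -
 obtain g where t: "g \<in> SYT (hook_shape n k)" "Des (tab_transpose g) = D" using SYT_hook_exists[OF assms] by blast
 have "hook_tableau n k D = g" unfolding hook_tableau_def
  by (rule the_equality) (use t SYT_hook_unique in auto)
 then show "hook_tableau n k D \<in> SYT (hook_shape n k)" "Des (tab_transpose (hook_tableau n k D)) = D"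
  using t by simp_all
qed

lemma finite_SYT_hook: "finite (SYT (hook_shape n k))"
proof (rule inj_on_finite)
 show "inj_on (%t. Des (tab_transpose t)) (SYT (hook_shape n k))"
  by (rule inj_onI) (rule SYT_hook_unique)
 show "(%t. Des (tab_transpose t)) ` SYT (hook_shape n k) \<subseteq> Pow {1..<n}" using Des_hook_card(1) by blast
qed simp

end

text \<open>The bijection between paths and subsets: the steps get the labels n-1, ..., 2 in order,
  and the east steps select the subset. The labels of the north steps are then their
  weights.\<close>

fun east_set :: "path => nat set" where
 "east_set [] = {}"
| "east_set (a # g) = (if a = East then insert (length g + 2) (east_set g) else east_set g)"

lemma east_set_subset: "east_set g \<subseteq> {2..Suc (length g)}"
proof (induction g)
 case (Cons a g)
 then have "east_set g \<subseteq> {2..Suc (length (a # g))}" by auto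
 then show ?case by simp
qed simp

lemma east_set_new: "length g + 2 \<notin> east_set g"
 using east_set_subset[of g] by auto

lemma finite_east_set: "finite (east_set g)"
 by (induction g) auto

lemma card_east_set: "card (east_set g) = count_list g East"
 by (induction g) (auto simp: finite_east_set east_set_new[simplified])

lemma sum_east_set: "\<Sum>(east_set g) + weight (Suc (length g)) g = \<Sum>{2..Suc (length g)}"
proof (induction g)
 case (Cons a g)
 have "\<Sum>{2..Suc (length (a # g))} = \<Sum>{2..Suc (length g)} + (length g + 2)" by simp
 then show ?case using Cons east_set_new[of g] by (cases a) (simp_all add: finite_east_set)
qed simp

lemma east_set_inj: "length g = length g' ==> east_set g = east_set g' ==> g = g'"
proof (induction g g' rule: list_induct2)
 case (Cons a g b g')
 have mem: "length r + 2 \<in> east_set (c # r) \<longleftrightarrow> c = East" for c r using east_set_new[of r] by simp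
 have del: "east_set r = east_set (c # r) - {length r + 2}" for c r using east_set_new[of r] by simp
 have "a = East \<longleftrightarrow> b = East" using mem[of g a] mem[of g' b] Cons.prems Cons.hyps by simp
 then have "a = b" by (cases a; cases b) auto
 moreover have "east_set g = east_set g'" using del[of g a] del[of g' b] Cons.prems Cons.hyps by simp
 ultimately show ?case using Cons.IH by simp
qed simp

lemma east_set_surj: "J \<subseteq> {2..Suc l} ==> \<exists>s. length s = l & east_set s = J"
proof (induction l arbitrary: J)
 case 0 then show ?case by (intro exI[of _ "[]"]) auto
next
 case (Suc l)
 have "J - {l + 2} \<subseteq> {2..Suc l}" using Suc.prems by auto
 from Suc.IH[OF this] obtain s where g: "length s = l" "east_set s = J - {l + 2}" by blast
 show ?case
 proof (cases "l + 2 \<in> J")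
  case True then show ?thesis using g by (intro exI[of _ "East # s"]) auto
 next
  case False then show ?thesis using g by (intro exI[of _ "North # s"]) auto
 qed
qed

text \<open>All labels together with 1 sum to \<open>top_degree n\<close>, so subtracting the labels
  of the east steps leaves 1 plus the labels of the north steps.\<close>

lemma sum_over_paths:
 fixes F :: "nat => nat => 'a :: comm_monoid_add"
 assumes n: "2 \<le> n"
 shows "(\<Sum>J\<in>Pow {2..<n}. F (top_degree n - \<Sum>J) (card J)) = (\<Sum>g\<in>paths n 0. F (weight (n - 1) g + 1) (count_list g East))"
proof -
 have P: "Pow {2..<n} = Pow {2..Suc (n - 2)}" using n by (intro arg_cong[where f = Pow]) auto
 have "bij_betw east_set (paths n 0) (Pow {2..<n})" unfolding P
 proof (rule bij_betw_imageI)
  show "inj_on east_set (paths n 0)" by (rule inj_onI) (rule east_set_inj, simp_all add: paths_eq)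
  show "east_set ` paths n 0 = Pow {2..Suc (n - 2)}"
  proof (intro equalityI subsetI)
   fix J assume "J \<in> east_set ` paths n 0"
   then show "J \<in> Pow {2..Suc (n - 2)}" using east_set_subset by (force simp: paths_eq)
  next
   fix J assume "J \<in> Pow {2..Suc (n - 2)}"
   then obtain g where "length g = n - 2" "east_set g = J" using east_set_surj[of J "n - 2"] by blast
   then show "J \<in> east_set ` paths n 0" by (auto simp: paths_eq)
  qed
 qed
 then have "(\<Sum>J\<in>Pow {2..<n}. F (top_degree n - \<Sum>J) (card J)) =
   (\<Sum>g\<in>paths n 0. F (top_degree n - \<Sum>(east_set g)) (card (east_set g)))"
  by (rule sum.reindex_bij_betw[symmetric])
 also have "... = (\<Sum>g\<in>paths n 0. F (weight (n - 1) g + 1) (count_list g East))"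
 proof (rule sum.cong[OF refl])
  fix g assume "g \<in> paths n 0"
  then have len: "Suc (length g) = n - 1" using n by (simp add: paths_eq)
  have "{2..n - 1} = {2..<n}" using n by auto
  then have "top_degree n - \<Sum>(east_set g) = weight (n - 1) g + 1"
   using sum_east_set[of g] top_degree_eq[OF n] unfolding len by simp
  then show "F (top_degree n - \<Sum>(east_set g)) (card (east_set g)) = F (weight (n - 1) g + 1) (count_list g East)"
   by (simp only: card_east_set)
 qed
 finally show ?thesis .
qed

lemma paths_with_east_eq: "paths_with_east n m = {g. length g = n - 2 & m \<le> count_list g East}"
proof (rule Set.set_eqI)
 fix g show "g \<in> paths_with_east n m \<longleftrightarrow> g \<in> {g. length g = n - 2 & m \<le> count_list g East}"
  using count_steps[of g] by (auto simp: paths_with_east_def paths_eq height_eq)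
qed

lemma norths_le:
 assumes "1 \<le> i" "i \<le> j" "j \<le> count_list g East"
 shows "norths_before g i \<le> norths_before g j"
 using assms(2,3,1)
proof (induction rule: dec_induct)
 case (step j) then show ?case using norths_mono[of j g] by simp
qed simp

lemma decr_seq_image:
 fixes f :: "nat => nat"
 assumes "!!i j. 1 \<le> i ==> i < j ==> j \<le> k ==> f j < f i"
 shows "card (f ` {1..k}) = k" "\<Sum>(f ` {1..k}) = (\<Sum>i=1..k. f i)"
proof -
 have "inj_on f {1..k}"
 proof (rule inj_onI)
  fix i j assume "i \<in> {1..k}" "j \<in> {1..k}" "f i = f j"
  then show "i = j" using assms[of i j] assms[of j i] by (cases i j rule: linorder_cases) auto
 qed
 then show "card (f ` {1..k}) = k" "\<Sum>(f ` {1..k}) = (\<Sum>i=1..k. f i)" by (simp_all add: card_image sum.reindex)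
qed

lemma path_hook_eq:
 assumes k: "k < n" and t: "v \<in> SYT (hook_shape n k)" and g: "s \<in> paths n k"
 shows "path_hook n v s = hook ((\<Sum>i=1..k. n - i) + weight (n - 1 - k) s + 1 - \<Sum>(Des (tab_transpose v)))
  (n - 2 - (k + count_list s North))"
proof -
 have "(\<Sum>j<k. n - 1 - j) = (\<Sum>i=1..k. n - i)" by (simp add: sum.atLeast1_atMost_eq)
 then show ?thesis using area_height[OF g]
  by (simp add: path_hook_def Des_hook_card(2)[OF k t] maj_def hook_def height_eq)
qed

text \<open>Reflecting the elements of \<open>D\<close> reduces this to the lower bound for sums of
  distinct natural numbers. It keeps the first part of \<open>path_hook\<close> positive in spite of
  the truncated subtraction.\<close>

lemma sum_le_top:
 assumes D: "D \<subseteq> {1..<n}" "card D = k" and k: "k < n" shows "\<Sum>D \<le> (\<Sum>i=1..k. n - i)"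
proof -
 have fin: "finite D" using D(1) finite_subset by blast
 have inj: "inj_on (%d. n - 1 - d) D"
 proof (rule inj_onI)
  fix x y assume "x \<in> D" "y \<in> D" "n - 1 - x = n - 1 - y"
  moreover from this D(1) have "x < n" "y < n" by auto
  ultimately show "x = y" by simp
 qed
 have "(\<Sum>i<k. i) \<le> \<Sum>((%d. n - 1 - d) ` D)"
  using sum_distinct_nat_ge[of "(%d. n - 1 - d) ` D"] fin inj D(2) by (simp add: card_image)
 then have le: "(\<Sum>i<k. i) \<le> (\<Sum>d\<in>D. n - 1 - d)" using inj by (simp add: sum.reindex)
 have "(\<Sum>d\<in>D. n - 1 - d) + \<Sum>D = (\<Sum>d\<in>D. n - 1)"
  unfolding sum.distrib[symmetric] by (rule sum.cong[OF refl]) (use D(1) in force)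
 moreover have "(\<Sum>i=1..k. n - i) + (\<Sum>i<k. i) = (\<Sum>i<k. n - 1)"
 proof -
  have "(\<Sum>i=1..k. n - i) = (\<Sum>i<k. n - Suc i)" by (simp add: sum.atLeast1_atMost_eq)
  also have "... + (\<Sum>i<k. i) = (\<Sum>i<k. n - 1)"
   unfolding sum.distrib[symmetric] by (rule sum.cong[OF refl]) (use k in auto)
  finally show ?thesis .
 qed
 ultimately show ?thesis using le D(2) by simp
qed

lemma path_hook_part:
 assumes "k < n" "t \<in> SYT (hook_shape n k)" "g \<in> paths n k"
 shows "is_partition (path_hook n t g)"
proof -
 have "card (Des (tab_transpose t)) = k" using Des_hook_card(2)[OF assms(1,2)] by (simp add: des_def)
 then have "\<Sum>(Des (tab_transpose t)) \<le> (\<Sum>i=1..k. n - i)"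
  by (rule sum_le_top[OF Des_hook_card(1)[OF assms(1,2)] _ assms(1)])
 then show ?thesis unfolding path_hook_eq[OF assms] by (intro hook_partition) simp
qed

section \<open>Descents and hooks of the values of the two maps\<close>

definition plus_seq :: "nat => path => nat => nat" where
 "plus_seq n g i = n - i - norths_before g i"

text \<open>The descents in decreasing order. The last one is expressed by the east run that remains
  after deleting \<open>k - 1\<close> east steps; the length of this run is the truncated difference
  of \<open>h\<close> and \<open>k - 1\<close>, so adding 1 gives
  \<open>max 1 (h + 2 - k)\<close>.\<close>

definition minus_seq :: "nat => nat => path => nat => nat" where
 "minus_seq n k g i = (if i = k then lead East (delete_first East (k - 1) g) + 1 else plus_seq n g i)"

lemma plus_seq_decr:
 assumes "length g = n - 2" "1 \<le> i" "i < j" "j \<le> count_list g East"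
 shows "plus_seq n g j < plus_seq n g i"
 using norths_le[of i j g] norths_bound[of j g] assms by (simp add: plus_seq_def)

context
 fixes n k :: nat
 assumes n: "3 \<le> n" and k1: "1 \<le> k" and k2: "k \<le> n - 2"
begin

lemma kn: "k < n" using n k2 by simp

text \<open>The descents sum to (n-1) + ... + (n-k) minus the north steps before the deleted east
  steps. In \<open>path_hook\<close> these north steps come back and are exactly the weight lost by
  the deletion, so the first part is unchanged and only the leg shrinks, by
  \<open>k\<close>.\<close>

lemma e_perp_plus_cases:
 assumes g: "s \<in> paths_with_east n k"
 obtains t where "e_perp_plus n k s = Some (t, delete_first East k s)" "t \<in> SYT (hook_shape n k)"
  "delete_first East k s \<in> paths n k" "Des (tab_transpose t) = plus_seq n s ` {1..k}"
  "path_hook n t (delete_first East k s) = hook (weight (n - 1) s + 1) (count_list s East - k)"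
proof -
 have len: "length s = n - 2" and ke: "k \<le> count_list s East" using g by (auto simp: paths_with_east_eq)
 let ?D = "plus_seq n s ` {1..k}" and ?g = "delete_first East k s"
 have bound: "i + norths_before s i \<le> n - 2" if "i \<in> {1..k}" for i
  using norths_bound[of i s] that len ke by simp
 have D1: "?D \<subseteq> {1..<n}" using bound n by (fastforce simp: plus_seq_def)
 have dec: "plus_seq n s j < plus_seq n s i" if "1 \<le> i" "i < j" "j \<le> k" for i j
  using plus_seq_decr[OF len that(1,2)] that(3) ke by simp
 have cardD: "card ?D = k" and sumD: "\<Sum>?D = (\<Sum>i=1..k. plus_seq n s i)"
  by (rule decr_seq_image, rule dec, assumption+)+
 note D = D1 cardD
 note tab = hook_tableau[OF kn D]
 have len': "length ?g + k = n - 2" using length_delete_East[OF ke] len by simp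
 have gp: "?g \<in> paths n k" using len' by (simp add: paths_eq)
 have "e_perp_plus n k s = Some (hook_tableau n k ?D, ?g)"
  using g by (simp add: e_perp_plus_def plus_seq_def)
 moreover have "path_hook n (hook_tableau n k ?D) ?g = hook (weight (n - 1) s + 1) (count_list s East - k)"
 proof -
  have "(\<Sum>i=1..k. n - i) = (\<Sum>i=1..k. plus_seq n s i + norths_before s i)"
   by (rule sum.cong[OF refl]) (use bound in "force simp: plus_seq_def")
  then have "(\<Sum>i=1..k. n - i) = \<Sum>?D + (\<Sum>i=1..k. norths_before s i)"
   by (simp only: sum.distrib sumD)
  moreover have "weight (n - 1) s = weight (n - 1 - k) ?g + (\<Sum>i=1..k. norths_before s i)"
   by (rule weight_delete_East[OF ke]) (use len in simp)
  moreover have "n - 2 - (k + count_list ?g North) = count_list s East - k"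
   using count_delete_East[OF ke] count_steps[of s] len by simp
  moreover have "path_hook n (hook_tableau n k ?D) ?g =
    hook ((\<Sum>i=1..k. n - i) + weight (n - 1 - k) ?g + 1 - \<Sum>?D) (n - 2 - (k + count_list ?g North))"
   using path_hook_eq[OF kn tab(1) gp] unfolding tab(2) .
  ultimately show ?thesis by simp
 qed
 ultimately show ?thesis using that[of "hook_tableau n k ?D"] tab gp by blast
qed

lemma minus_domain:
 assumes "g \<in> paths_with_east n (k - 1) - {replicate (n - 2) East}"
 shows "length g = n - 2" "k - 1 \<le> count_list g East" "North \<in> set g" "North \<in> set (delete_first East (k - 1) g)"
  "length (delete_first East (k - 1) g) = n - 1 - k"
proof -
 show len: "length g = n - 2" and ke: "k - 1 \<le> count_list g East" using assms by (auto simp: paths_with_east_eq)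
 show N: "North \<in> set g" using assms len no_north[of g] by auto
 have "count_list g North ~= 0" using N by (simp add: count_list_0_iff)
 then have "count_list (delete_first East (k - 1) g) North ~= 0" unfolding count_delete_East[OF ke] .
 then show "North \<in> set (delete_first East (k - 1) g)" by (simp add: count_list_0_iff)
 show "length (delete_first East (k - 1) g) = n - 1 - k" using length_delete_East[OF ke] len k1 k2 n by simp
qed

lemma minus_seq_decr:
 assumes g: "s \<in> paths_with_east n (k - 1) - {replicate (n - 2) East}" and ij: "1 \<le> i" "i < j" "j \<le> k"
 shows "minus_seq n k s j < minus_seq n k s i"
proof -
 note d = minus_domain[OF g]
 show ?thesis
 proof (cases "j = k")
  case False
  then show ?thesis using plus_seq_decr[OF d(1) ij(1,2)] d(2) ij by (simp add: minus_seq_def)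
 next
  case True
  have "plus_seq n s (k - 1) \<le> plus_seq n s i"
   using plus_seq_decr[OF d(1) ij(1), of "k - 1"] d(2) ij True by (cases "i = k - 1") (simp, linarith)
  \<comment> \<open>The additional descent is smaller than all the others, so there are exactly
    \<open>k\<close> descents and it is the one of index \<open>k\<close>.\<close>
  moreover have "lead East (delete_first East (k - 1) s) + 1 < plus_seq n s (k - 1)"
  proof -
   have "1 \<le> k - 1" using ij True by simp
   from lead_East_bound[OF this d(2)] show ?thesis unfolding plus_seq_def using d(1) n by arith
  qed
  ultimately show ?thesis using True ij by (simp add: minus_seq_def)
 qed
qed

text \<open>Let \<open>h\<close> be the east run left after deleting \<open>k - 1\<close> east
  steps. The removed north step takes the weight \<open>n - k - h\<close> away, while the descent
  \<open>h + 1\<close> is subtracted where the starting height contributes \<open>n - k\<close>.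
  Together the first part drops by one, and the leg shrinks by \<open>k - 1\<close> only.\<close>

lemma e_perp_minus_cases:
 assumes g: "s \<in> paths_with_east n (k - 1) - {replicate (n - 2) East}"
 obtains t where "e_perp_minus n k s = Some (t, remove1 North (delete_first East (k - 1) s))" "t \<in> SYT (hook_shape n k)"
  "remove1 North (delete_first East (k - 1) s) \<in> paths n k" "Des (tab_transpose t) = minus_seq n k s ` {1..k}"
  "path_hook n t (remove1 North (delete_first East (k - 1) s)) = hook (weight (n - 1) s) (count_list s East + 1 - k)"
proof -
 note d = minus_domain[OF g]
 let ?D = "minus_seq n k s ` {1..k}" and ?d = "delete_first East (k - 1) s"
 let ?g = "remove1 North ?d" and ?h = "lead East ?d"
 have h: "?h \<le> n - 1 - k" using length_takeWhile_le[of _ ?d] d(5) by metis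
 have bound: "i + norths_before s i \<le> n - 2" if "i \<in> {1..k - 1}" for i
  using norths_bound[of i s] that d(1,2) by simp
 have K: "{1..k} = insert k {1..k - 1}" using k1 by auto
 have D1: "?D \<subseteq> {1..<n}"
 proof
  fix x assume "x \<in> ?D"
  then obtain i where i: "i \<in> {1..k}" "x = minus_seq n k s i" by blast
  show "x \<in> {1..<n}"
  proof (cases "i = k")
   case True then show ?thesis using i h n k1 k2 by (simp add: minus_seq_def)
  next
   case False
   then have "i \<in> {1..k - 1}" using i by auto
   then have "i + norths_before s i \<le> n - 2" by (rule bound)
   then show ?thesis using i False n by (simp add: minus_seq_def plus_seq_def)
  qed
 qed
 note dec = minus_seq_decr[OF g]
 have cardD: "card ?D = k" and sumD: "\<Sum>?D = (\<Sum>i=1..k. minus_seq n k s i)"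
  by (rule decr_seq_image, rule dec, assumption+)+
 note D = D1 cardD
 note tab = hook_tableau[OF kn D]
 have gp: "?g \<in> paths n k" using d(4,5) n k1 k2 by (simp add: paths_eq length_remove1)
 have "e_perp_minus n k s = Some (hook_tableau n k ?D, ?g)"
 proof -
  have "minus_seq n k s k = lead East s - (k - 1) + 1"
   unfolding minus_seq_def lead_East_delete[OF d(2)] by simp
  then have "max 1 (lead East s + 2 - k) = minus_seq n k s k"
   using k1 by arith
  moreover have "(%i. n - i - norths_before s i) ` {1..k - 1} = minus_seq n k s ` {1..k - 1}"
   by (rule image_cong[OF refl]) (use k1 in "auto simp: minus_seq_def plus_seq_def")
  ultimately have "(%i. n - i - norths_before s i) ` {1..k - 1} \<union> {max 1 (lead East s + 2 - k)} = ?D"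
   unfolding K by simp
  moreover have "delete_first North 1 ?d = ?g" by (simp add: delete_first_def)
  ultimately show ?thesis using g unfolding e_perp_minus_def Let_def by simp
 qed
 moreover have "path_hook n (hook_tableau n k ?D) ?g = hook (weight (n - 1) s) (count_list s East + 1 - k)"
 proof -
  have "(\<Sum>i=1..k - 1. n - i) = (\<Sum>i=1..k - 1. minus_seq n k s i + norths_before s i)"
  proof (rule sum.cong[OF refl])
   fix i assume i: "i \<in> {1..k - 1}"
   then have "i ~= k" using k1 by auto
   then show "n - i = minus_seq n k s i + norths_before s i" using bound[OF i] by (simp add: minus_seq_def plus_seq_def)
  qed
  then have "(\<Sum>i=1..k - 1. n - i) = (\<Sum>i=1..k - 1. minus_seq n k s i) + (\<Sum>i=1..k - 1. norths_before s i)"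
   by (simp only: sum.distrib)
  moreover have "(\<Sum>i=1..k. f i) = f k + (\<Sum>i=1..k - 1. f i)" for f :: "nat => nat"
   unfolding K using k1 by simp
  moreover have "minus_seq n k s k = ?h + 1" by (simp add: minus_seq_def)
  ultimately have S: "(\<Sum>i=1..k. n - i) + ?h + 1 = (n - k) + \<Sum>?D + (\<Sum>i=1..k - 1. norths_before s i)"
   by (simp only: sumD)
  have w1: "weight (n - 1) s = weight (n - 1 - (k - 1)) ?d + (\<Sum>i=1..k - 1. norths_before s i)"
   by (rule weight_delete_East[OF d(2)]) (use d(1) in simp)
  have w2: "weight (n - k) ?d = (n - k - ?h) + weight (n - k - 1) ?g"
   by (rule weight_remove_North[OF d(4)]) (use d(5) in simp)
  have e: "n - 1 - (k - 1) = n - k" "n - k - 1 = n - 1 - k" using k1 n by simp_all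
  have "n - k - ?h + ?h = n - k" using h kn by linarith
  then have W: "weight (n - 1) s + ?h = (n - k) + weight (n - 1 - k) ?g + (\<Sum>i=1..k - 1. norths_before s i)"
   unfolding w1 e(1) w2 e(2) by linarith
  have "count_list ?g North + 1 = count_list s North"
  proof -
   have "count_list (remove1 North xs) North + 1 = count_list xs North" if "North \<in> set xs" for xs
    using that by (induction xs) auto
   then show ?thesis using d(4) count_delete_East[OF d(2)] by metis
  qed
  then have "n - 2 - (k + count_list ?g North) = count_list s East + 1 - k"
   using count_steps[of s] d(1) by simp
  moreover have "path_hook n (hook_tableau n k ?D) ?g =
    hook ((\<Sum>i=1..k. n - i) + weight (n - 1 - k) ?g + 1 - \<Sum>?D) (n - 2 - (k + count_list ?g North))"
   using path_hook_eq[OF kn tab(1) gp] unfolding tab(2) .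
  moreover have "(\<Sum>i=1..k. n - i) + weight (n - 1 - k) ?g + 1 - \<Sum>?D = weight (n - 1) s" using S W by arith
  ultimately show ?thesis by (simp only:)
 qed
 ultimately show ?thesis using that[of "hook_tableau n k ?D"] tab gp by blast
qed

text \<open>The descent set determines the decreasing sequence \<open>plus_seq\<close>, and with it
  the north steps before each deleted east step.\<close>

lemma e_perp_plus_inj: "inj_on (e_perp_plus n k) (paths_with_east n k)"
proof (rule inj_onI)
 fix u w assume g: "u \<in> paths_with_east n k" and r: "w \<in> paths_with_east n k"
  and e: "e_perp_plus n k u = e_perp_plus n k w"
 obtain p where t: "e_perp_plus n k u = Some (p, delete_first East k u)" "Des (tab_transpose p) = plus_seq n u ` {1..k}"
  by (rule e_perp_plus_cases[OF g])
 obtain v where s: "e_perp_plus n k w = Some (v, delete_first East k w)" "Des (tab_transpose v) = plus_seq n w ` {1..k}"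
  by (rule e_perp_plus_cases[OF r])
 have eq: "p = v" "delete_first East k u = delete_first East k w" using e t(1) s(1) by auto
 have im: "plus_seq n u ` {1..k} = plus_seq n w ` {1..k}" using t(2) s(2) eq(1) by simp
 have G: "length u = n - 2" "k \<le> count_list u East" and R: "length w = n - 2" "k \<le> count_list w East"
  using g r by (auto simp: paths_with_east_eq)
 show "u = w"
 proof (rule delete_East_inj[OF G(2) R(2) eq(2)])
  fix i assume i: "1 \<le> i" "i \<le> k"
  have "plus_seq n u i = plus_seq n w i"
   by (rule strict_decr_image_unique[OF _ _ im i]) (use plus_seq_decr G R in auto)
  moreover have "i + norths_before u i \<le> n - 2" "i + norths_before w i \<le> n - 2"
   using norths_bound[of i u] norths_bound[of i w] G R i by simp_all
  ultimately show "norths_before u i = norths_before w i" by (simp add: plus_seq_def)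
 qed
qed

text \<open>The smallest descent gives the east run in front of the removed north step and so
  restores this step; the other descents then restore the east steps.\<close>

lemma e_perp_minus_inj: "inj_on (e_perp_minus n k) (paths_with_east n (k - 1) - {replicate (n - 2) East})"
proof (rule inj_onI)
 fix u w assume g: "u \<in> paths_with_east n (k - 1) - {replicate (n - 2) East}"
  and r: "w \<in> paths_with_east n (k - 1) - {replicate (n - 2) East}" and e: "e_perp_minus n k u = e_perp_minus n k w"
 let ?d = "%u. delete_first East (k - 1) u"
 obtain p where t: "e_perp_minus n k u = Some (p, remove1 North (?d u))" "Des (tab_transpose p) = minus_seq n k u ` {1..k}"
  by (rule e_perp_minus_cases[OF g])
 obtain v where s: "e_perp_minus n k w = Some (v, remove1 North (?d w))" "Des (tab_transpose v) = minus_seq n k w ` {1..k}"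
  by (rule e_perp_minus_cases[OF r])
 have eq: "p = v" "remove1 North (?d u) = remove1 North (?d w)" using e t(1) s(1) by auto
 have im: "minus_seq n k u ` {1..k} = minus_seq n k w ` {1..k}" using t(2) s(2) eq(1) by simp
 have seq: "minus_seq n k u i = minus_seq n k w i" if "1 \<le> i" "i \<le> k" for i
  by (rule strict_decr_image_unique[OF minus_seq_decr[OF g] minus_seq_decr[OF r] im that])
 note G = minus_domain[OF g] and R = minus_domain[OF r]
 have "lead East (?d u) = lead East (?d w)" using seq[of k] k1 by (simp add: minus_seq_def)
 then have d: "?d u = ?d w" by (rule remove_North_inj[OF G(4) R(4) _ eq(2)])
 show "u = w"
 proof (rule delete_East_inj[OF G(2) R(2) d])
  fix i assume i: "1 \<le> i" "i \<le> k - 1"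
  then have "i ~= k" "i \<le> k" using k1 by auto
  then have "plus_seq n u i = plus_seq n w i" using seq[OF i(1)] by (simp add: minus_seq_def)
  moreover have "i + norths_before u i \<le> n - 2" "i + norths_before w i \<le> n - 2"
   using norths_bound[of i u] norths_bound[of i w] G R i by simp_all
  ultimately show "norths_before u i = norths_before w i" by (simp add: plus_seq_def)
 qed
qed

text \<open>If both maps had a common value \<open>(\<tau>, \<gamma>')\<close>, then comparing the smallest descents would give
  \<open>p + h = |\<gamma>'| + 1\<close>, while \<open>\<gamma>'\<close> starts with \<open>p\<close> north steps and with \<open>h\<close> east steps.\<close>

lemma e_perp_plus_minus_disjoint:
 assumes g: "u \<in> paths_with_east n k" and r: "w \<in> paths_with_east n (k - 1) - {replicate (n - 2) East}"
 shows "e_perp_plus n k u ~= e_perp_minus n k w"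
proof
 assume e: "e_perp_plus n k u = e_perp_minus n k w"
 let ?d = "delete_first East (k - 1) w" and ?g = "delete_first East k u"
 obtain p where t: "e_perp_plus n k u = Some (p, ?g)" "Des (tab_transpose p) = plus_seq n u ` {1..k}"
  by (rule e_perp_plus_cases[OF g])
 obtain v where s: "e_perp_minus n k w = Some (v, remove1 North ?d)" "Des (tab_transpose v) = minus_seq n k w ` {1..k}"
  by (rule e_perp_minus_cases[OF r])
 have eq: "p = v" "?g = remove1 North ?d" using e t(1) s(1) by auto
 have im: "plus_seq n u ` {1..k} = minus_seq n k w ` {1..k}" using t(2) s(2) eq(1) by simp
 have G: "length u = n - 2" "k \<le> count_list u East" using g by (auto simp: paths_with_east_eq)
 have dec: "plus_seq n u j < plus_seq n u i" if "1 \<le> i" "i < j" "j \<le> k" for i j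
  using plus_seq_decr[OF G(1) that(1,2)] that(3) G(2) by simp
 have "plus_seq n u k = minus_seq n k w k"
  by (rule strict_decr_image_unique[OF dec minus_seq_decr[OF r] im k1 order_refl])
 then have sum: "k + norths_before u k + lead East ?d + 1 = n"
  using norths_bound[of k u] G k1 n by (simp add: minus_seq_def plus_seq_def)
 have len: "length ?g + k = n - 2" using length_delete_East[OF G(2)] G(1) by simp
 have "lead East ?d \<le> lead East ?g" unfolding eq(2) by (rule lead_East_remove)
 moreover have "norths_before u k \<le> lead North ?g" using lead_North_delete[OF k1 G(2)] by auto
 moreover have "lead East ?g + lead North ?g \<le> length ?g"
  using lead_disjoint[of ?g] length_takeWhile_le[of "%a. a = East" ?g] length_takeWhile_le[of "%a. a = North" ?g] by auto
 ultimately show False using sum len n by simp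
qed

end

lemma schur_positive_sum:
 assumes F: "finite F" and p: "!!z. z \<in> F ==> is_partition (h z)"
 shows "schur_positive (\<Sum>z\<in>F. schur (h z))"
proof -
 let ?c = "%v. card {z \<in> F. h z = v}"
 have "v \<in> h ` F" if "(of_nat (?c v) :: rat) ~= 0" for v
 proof (rule ccontr)
  assume "v \<notin> h ` F"
  then have "{z \<in> F. h z = v} = {}" by blast
  then show False using that by (simp only: card.empty of_nat_0)
 qed
 then have sub: "{v. (of_nat (?c v) :: rat) ~= 0} \<subseteq> h ` F" by blast
 have "is_schur_expansion (\<Sum>z\<in>F. schur (h z)) (%v. of_nat (?c v))"
  unfolding is_schur_expansion_def
 proof (intro conjI allI impI)
  show "finite {v. (of_nat (?c v) :: rat) ~= 0}" by (rule finite_subset[OF sub]) (simp add: F)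
  show "is_partition v" if "(of_nat (?c v) :: rat) ~= 0" for v
  proof -
   have "v \<in> h ` F" using sub that by blast
   then show ?thesis using p by blast
  qed
  show "(\<Sum>z\<in>F. schur (h z)) = schur_series (%v. of_nat (?c v))" by (rule schur_series_count[OF F, symmetric])
 qed
 then show ?thesis unfolding schur_positive_def by (intro exI[of _ ?c])
qed

theorem proposition5:
  fixes n k :: nat
  assumes "n \<ge> 3" and "1 \<le> k" and "k \<le> n - 2"
  shows "e_perp k (hook_part (pairing (E_function n) (elementary n))) =
      (\<Sum>\<gamma>\<in>paths n 0. hook_schur n (e_perp_plus n k \<gamma>) + hook_schur n (e_perp_minus n k \<gamma>))
    \<and> schur_positive
      ((\<Sum>\<tau>\<in>SYT (hook_shape n k). \<Sum>\<gamma>\<in>paths n (des (tab_transpose \<tau>)). schur (path_hook n \<tau> \<gamma>))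
        - e_perp k (hook_part (pairing (E_function n) (schur (replicate n 1)))))"
proof
 let ?T = "paths n 0" and ?A = "paths_with_east n k" and ?B = "paths_with_east n (k - 1) - {replicate (n - 2) East}"
 let ?E = "e_perp k (hook_part (pairing (E_function n) (elementary n)))"
 let ?f = "%s. the (e_perp_plus n k s)" and ?g = "%s. the (e_perp_minus n k s)"
 let ?H = "%z. path_hook n (fst z) (snd z)"
 let ?P = "SYT (hook_shape n k) \<times> paths n k"
 note kn = kn[OF assms]
 have n2: "2 \<le> n" using assms(1) by simp
 have len: "length s = n - 2" if "s \<in> ?T" for s using that by (simp add: paths_eq)
 have A: "s \<in> ?A \<longleftrightarrow> k \<le> count_list s East" if "s \<in> ?T" for s
  using len[OF that] by (simp add: paths_with_east_eq)
 \<comment> \<open>The second Pieri term requires a first part of at least 2, that is, a north step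
   in the path; this is the domain of the second map.\<close>
 have B: "s \<in> ?B \<longleftrightarrow> k \<le> count_list s East + 1 & 2 \<le> weight (n - 1) s + 1" if "s \<in> ?T" for s
 proof -
  have "s ~= replicate (n - 2) East \<longleftrightarrow> 0 < weight (n - 1) s"
   using no_north[of s] weight_pos[of s "n - 1"] weight_zero[of s "n - 1"] len[OF that] by auto
  moreover have "k - 1 \<le> count_list s East \<longleftrightarrow> k \<le> count_list s East + 1" by arith
  moreover have "0 < weight (n - 1) s \<longleftrightarrow> 2 \<le> weight (n - 1) s + 1" by arith
  ultimately show ?thesis using len[OF that] by (simp only: paths_with_east_eq Diff_iff mem_Collect_eq singleton_iff simp_thms)
 qed
 have sub: "?A \<subseteq> ?T" "?B \<subseteq> ?T" by (auto simp: paths_with_east_def)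
 have plus: "hook_schur n (e_perp_plus n k s) =
   (if s \<in> ?A then schur (hook (weight (n - 1) s + 1) (count_list s East - k)) else 0)" for s
 proof (cases "s \<in> ?A")
  case True
  show ?thesis by (rule e_perp_plus_cases[OF assms True]) (simp add: hook_schur_def True)
 qed (simp add: e_perp_plus_def hook_schur_def)
 have minus: "hook_schur n (e_perp_minus n k s) =
   (if s \<in> ?B then schur (hook (weight (n - 1) s) (count_list s East + 1 - k)) else 0)" for s
 proof (cases "s \<in> ?B")
  case True
  show ?thesis by (rule e_perp_minus_cases[OF assms True]) (simp only: hook_schur_def True option.case prod.case if_True)
 next
  case False
  then show ?thesis by (simp only: e_perp_minus_def hook_schur_def if_False option.case)
 qed
 have "hook_part (pairing (E_function n) (elementary n)) =
   (\<Sum>s\<in>?T. schur (hook (weight (n - 1) s + 1) (count_list s East)))"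
  unfolding hook_part_pairing[OF n2] by (rule sum_over_paths[OF n2])
 then have "?E = (\<Sum>s\<in>?T.
   (if k \<le> count_list s East then schur (hook (weight (n - 1) s + 1) (count_list s East - k)) else 0) +
   (if k \<le> count_list s East + 1 & 2 \<le> weight (n - 1) s + 1
    then schur (hook (weight (n - 1) s + 1 - 1) (count_list s East + 1 - k)) else 0))"
 proof (simp only:, intro e_perp_sum_hooks[OF assms(2) finite_paths])
  \<comment> \<open>First part 1 occurs only for the path without north steps, whose leg
    \<open>n - 2\<close> is at least \<open>k\<close>; so no column is removed completely.\<close>
  fix s assume g: "s \<in> ?T" and w: "weight (n - 1) s + 1 = 1"
  have "length s \<le> n - 1" using len[OF g] by simp
  then have "North \<notin> set s" using weight_pos[of s "n - 1"] w by auto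
  then have "count_list s East = n - 2" using count_steps[of s] len[OF g] by (simp add: count_list_0_iff)
  then show "k \<le> count_list s East" using assms(3) by simp
 qed simp
 also have "... = (\<Sum>s\<in>?T. hook_schur n (e_perp_plus n k s) + hook_schur n (e_perp_minus n k s))"
 proof (rule sum.cong[OF refl])
  fix s assume g: "s \<in> ?T"
  show "(if k \<le> count_list s East then schur (hook (weight (n - 1) s + 1) (count_list s East - k)) else 0) +
    (if k \<le> count_list s East + 1 & 2 \<le> weight (n - 1) s + 1
     then schur (hook (weight (n - 1) s + 1 - 1) (count_list s East + 1 - k)) else 0) =
   hook_schur n (e_perp_plus n k s) + hook_schur n (e_perp_minus n k s)"
   unfolding plus minus A[OF g] B[OF g] by (simp only: add_diff_cancel_right')
 qed
 finally show E: "?E = (\<Sum>s\<in>?T. hook_schur n (e_perp_plus n k s) + hook_schur n (e_perp_minus n k s))" .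

 have finP: "finite ?P" using finite_SYT_hook[OF kn] finite_paths by blast
 have fin: "finite ?A" "finite ?B" using sub finite_paths finite_subset by blast+
 have f: "?f s \<in> ?P & hook_schur n (e_perp_plus n k s) = schur (?H (?f s)) & e_perp_plus n k s = Some (?f s)"
  if "s \<in> ?A" for s
  by (rule e_perp_plus_cases[OF assms that]) (simp add: hook_schur_def)
 have g: "?g s \<in> ?P & hook_schur n (e_perp_minus n k s) = schur (?H (?g s)) & e_perp_minus n k s = Some (?g s)"
  if "s \<in> ?B" for s
  by (rule e_perp_minus_cases[OF assms that]) (simp add: hook_schur_def)
 have injf: "inj_on ?f ?A"
 proof (rule inj_onI)
  fix s r assume "s \<in> ?A" "r \<in> ?A" "?f s = ?f r"
  then show "s = r" using f inj_onD[OF e_perp_plus_inj[OF assms]] by metis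
 qed
 have injg: "inj_on ?g ?B"
 proof (rule inj_onI)
  fix s r assume "s \<in> ?B" "r \<in> ?B" "?g s = ?g r"
  then show "s = r" using g inj_onD[OF e_perp_minus_inj[OF assms]] by metis
 qed
 have disj: "?f ` ?A \<inter> ?g ` ?B = {}"
 proof (rule equals0I)
  fix z assume "z \<in> ?f ` ?A \<inter> ?g ` ?B"
  then obtain s r where z: "s \<in> ?A" "z = ?f s" "r \<in> ?B" "z = ?g r" by blast
  then have "e_perp_plus n k s = e_perp_minus n k r" using f[OF z(1)] g[OF z(3)] by metis
  then show False using e_perp_plus_minus_disjoint[OF assms z(1,3)] by blast
 qed
 \<comment> \<open>The pairs of a tableau and a path that are values of one of the maps. By
   injectivity and disjointness the sum over this set is \<open>?E\<close>, so the difference is the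
   sum over the complementary pairs.\<close>
 let ?I = "?f ` ?A \<union> ?g ` ?B"
 have IP: "?I \<subseteq> ?P" using f g by blast
 have sumA: "(\<Sum>s\<in>?T. hook_schur n (e_perp_plus n k s)) = (\<Sum>z\<in>?f ` ?A. schur (?H z))"
 proof -
  have "(\<Sum>s\<in>?T. hook_schur n (e_perp_plus n k s)) = (\<Sum>s\<in>?A. schur (?H (?f s)))"
   by (rule sum.mono_neutral_cong_right[OF finite_paths sub(1)]) (use f plus in auto)
  then show ?thesis by (simp only: sum.reindex[OF injf] o_def)
 qed
 have sumB: "(\<Sum>s\<in>?T. hook_schur n (e_perp_minus n k s)) = (\<Sum>z\<in>?g ` ?B. schur (?H z))"
 proof -
  have "(\<Sum>s\<in>?T. hook_schur n (e_perp_minus n k s)) = (\<Sum>s\<in>?B. schur (?H (?g s)))"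
  proof (rule sum.mono_neutral_cong_right[OF finite_paths sub(2)])
   show "\<forall>s\<in>?T - ?B. hook_schur n (e_perp_minus n k s) = 0"
   proof
    fix s assume "s \<in> ?T - ?B"
    then have "s \<notin> ?B" by blast
    then show "hook_schur n (e_perp_minus n k s) = 0" unfolding minus by (rule if_not_P)
   qed
   show "hook_schur n (e_perp_minus n k s) = schur (?H (?g s))" if "s \<in> ?B" for s
    by (rule g[OF that, THEN conjunct2, THEN conjunct1])
  qed
  then show ?thesis by (simp only: sum.reindex[OF injg] o_def)
 qed
 have EI: "?E = (\<Sum>z\<in>?I. schur (?H z))"
  unfolding E sum.distrib sumA sumB using fin disj by (intro sum.union_disjoint[symmetric]) simp_all
 have "(\<Sum>t\<in>SYT (hook_shape n k). \<Sum>s\<in>paths n (des (tab_transpose t)). schur (path_hook n t s)) =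
   (\<Sum>t\<in>SYT (hook_shape n k). \<Sum>s\<in>paths n k. schur (path_hook n t s))"
  by (rule sum.cong[OF refl]) (simp only: Des_hook_card(2)[OF kn])
 also have "... = (\<Sum>z\<in>?P. schur (?H z))" by (simp only: sum.cartesian_product case_prod_unfold)
 also have "... = (\<Sum>z\<in>?P - ?I. schur (?H z)) + (\<Sum>z\<in>?I. schur (?H z))" by (rule sum.subset_diff[OF IP finP])
 finally have "(\<Sum>t\<in>SYT (hook_shape n k). \<Sum>s\<in>paths n (des (tab_transpose t)). schur (path_hook n t s)) - ?E =
   (\<Sum>z\<in>?P - ?I. schur (?H z))" by (simp only: EI add_diff_cancel_right')
 moreover have "schur_positive (\<Sum>z\<in>?P - ?I. schur (?H z))"
  by (rule schur_positive_sum) (use finP path_hook_part[OF kn] in auto)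
 ultimately show "schur_positive
   ((\<Sum>t\<in>SYT (hook_shape n k). \<Sum>s\<in>paths n (des (tab_transpose t)). schur (path_hook n t s))
    - e_perp k (hook_part (pairing (E_function n) (schur (replicate n 1)))))"
  by (simp only: elementary_def)
qed

end
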